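(* Let $R$ be a (left and right) hereditary ring and let $\mathsf{E}$ be a well-placed subcategory of $\mathsf{fpmod}(R)$ all of whose nonzero modules have homological dimension $1$. Let $M$ be a finitely presented $R$-module. Then the kernel of the canonical map $M\to M\otimes_R R_{\mathsf{E}}$ is finitely generated. Moreover, if this map is injective, then as an $R$-module $M\otimes_R R_{\mathsf{E}}$ is a directed union of $R$-submodules $M_t\supset M$ such that $M_t/M\in\mathsf{E}$.
   Context: Modules are right modules; $\mathsf{fpmod}(R)$ is the category of finitely presented right $R$-modules. A well-placed subcategory of $\mathsf{fpmod}(R)$ is a full additive subcategory (closed under isomorphism) closed under images, kernels and cokernels of its maps (computed as modules) and under extensions. For a well-placed subcategory $\mathsf{E}$, $R\to R_{\mathsf{E}}$ denotes the universal localisation of $R$ inverting the maps $P\to Q$ in presentations $0\to P\to Q\to E\to 0$ ($P,Q$ finitely generated projective) of the modules $E\in\mathsf{E}$, i.e. the universal ring homomorphism making these maps invertible after applying $\otimes_R R_{\mathsf{E}}$. *)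

theory Defs
  imports "HOL-Algebra.AbelCoset" "HOL-Algebra.Generated_Groups" "HOL-Algebra.Free_Abelian_Groups"
begin

section \<open>Right modules over a not necessarily commutative ring\<close>

text \<open>
  As for the record \<open>module\<close> of HOL-Algebra, the fields \<open>mult\<close> and \<open>one\<close> inherited from
  \<open>ring\<close> carry no information. HOL-Algebra's own \<open>module\<close> locale requires a commutative
  base ring, so right modules are introduced here.
\<close>

record ('r, 'm) rmod = "'m ring" +
  ract :: "['m, 'r] \<Rightarrow> 'm" (infixl "\<star>\<index>" 70)

locale right_module = R?: ring R + M?: abelian_group M
  for R :: "('r, 'k) ring_scheme" (structure) and M :: "('r, 'm, 'z) rmod_scheme" (structure) +
  assumes ract_closed:
      "\<lbrakk>x \<in> carrier M; a \<in> carrier R\<rbrakk> \<Longrightarrow> x \<star>\<^bsub>M\<^esub> a \<in> carrier M"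
    and ract_add_left:
      "\<lbrakk>x \<in> carrier M; y \<in> carrier M; a \<in> carrier R\<rbrakk>
       \<Longrightarrow> (x \<oplus>\<^bsub>M\<^esub> y) \<star>\<^bsub>M\<^esub> a = x \<star>\<^bsub>M\<^esub> a \<oplus>\<^bsub>M\<^esub> y \<star>\<^bsub>M\<^esub> a"
    and ract_add_right:
      "\<lbrakk>x \<in> carrier M; a \<in> carrier R; b \<in> carrier R\<rbrakk>
       \<Longrightarrow> x \<star>\<^bsub>M\<^esub> (a \<oplus>\<^bsub>R\<^esub> b) = x \<star>\<^bsub>M\<^esub> a \<oplus>\<^bsub>M\<^esub> x \<star>\<^bsub>M\<^esub> b"
    and ract_assoc:
      "\<lbrakk>x \<in> carrier M; a \<in> carrier R; b \<in> carrier R\<rbrakk>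
       \<Longrightarrow> x \<star>\<^bsub>M\<^esub> (a \<otimes>\<^bsub>R\<^esub> b) = (x \<star>\<^bsub>M\<^esub> a) \<star>\<^bsub>M\<^esub> b"
    and ract_one:
      "x \<in> carrier M \<Longrightarrow> x \<star>\<^bsub>M\<^esub> \<one>\<^bsub>R\<^esub> = x"

definition rmod_hom ::
    "('r, 'k) ring_scheme \<Rightarrow> ('r, 'm, 'z) rmod_scheme \<Rightarrow> ('r, 'n, 'y) rmod_scheme \<Rightarrow> ('m \<Rightarrow> 'n) set"
  where "rmod_hom R M N =
    {f \<in> carrier M \<rightarrow> carrier N.
      (\<forall>x\<in>carrier M. \<forall>y\<in>carrier M. f (x \<oplus>\<^bsub>M\<^esub> y) = f x \<oplus>\<^bsub>N\<^esub> f y) \<and>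
      (\<forall>x\<in>carrier M. \<forall>a\<in>carrier R. f (x \<star>\<^bsub>M\<^esub> a) = f x \<star>\<^bsub>N\<^esub> a)}"

definition rmod_iso ::
    "('r, 'k) ring_scheme \<Rightarrow> ('r, 'm, 'z) rmod_scheme \<Rightarrow> ('r, 'n, 'y) rmod_scheme \<Rightarrow> bool"
  where "rmod_iso R M N \<longleftrightarrow> (\<exists>f\<in>rmod_hom R M N. bij_betw f (carrier M) (carrier N))"

definition short_exact ::
    "('r, 'k) ring_scheme \<Rightarrow> ('r, 'm, 'z) rmod_scheme \<Rightarrow> ('m \<Rightarrow> 'n) \<Rightarrow> ('r, 'n, 'y) rmod_scheme
      \<Rightarrow> ('n \<Rightarrow> 'l) \<Rightarrow> ('r, 'l, 'x) rmod_scheme \<Rightarrow> bool"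
  where "short_exact R A f B g C \<longleftrightarrow>
    f \<in> rmod_hom R A B \<and> g \<in> rmod_hom R B C \<and> inj_on f (carrier A) \<and>
    f ` carrier A = a_kernel B C g \<and> g ` carrier B = carrier C"

definition rsubmodule :: "('r, 'k) ring_scheme \<Rightarrow> ('r, 'm, 'z) rmod_scheme \<Rightarrow> 'm set \<Rightarrow> bool"
  where "rsubmodule R M N \<longleftrightarrow>
    additive_subgroup N M \<and> (\<forall>x\<in>N. \<forall>a\<in>carrier R. x \<star>\<^bsub>M\<^esub> a \<in> N)"

definition rspan :: "('r, 'k) ring_scheme \<Rightarrow> ('r, 'm, 'z) rmod_scheme \<Rightarrow> 'm set \<Rightarrow> 'm set"
  where "rspan R M X = \<Inter> {N. rsubmodule R M N \<and> X \<subseteq> N}"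

definition fin_gen :: "('r, 'k) ring_scheme \<Rightarrow> ('r, 'm, 'z) rmod_scheme \<Rightarrow> 'm set \<Rightarrow> bool"
  where "fin_gen R M N \<longleftrightarrow> (\<exists>X. finite X \<and> X \<subseteq> carrier M \<and> N = rspan R M X)"

text \<open>The quotient by a submodule \<open>N\<close>, with cosets as elements; the union is the single coset of
  the \<open>x \<star> a\<close>.\<close>

definition rquot :: "('r, 'm, 'z) rmod_scheme \<Rightarrow> 'm set \<Rightarrow> ('r, 'm set) rmod"
  where "rquot M N =
    \<lparr>carrier = a_rcosets\<^bsub>M\<^esub> N, monoid.mult = (\<lambda>_ _. undefined), one = undefined,
     ring.zero = N, add = set_add M,
     ract = (\<lambda>X a. \<Union>x\<in>X. a_r_coset M N (x \<star>\<^bsub>M\<^esub> a))\<rparr>"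

definition rmod_prod ::
    "('r, 'm, 'z) rmod_scheme \<Rightarrow> ('r, 'n, 'y) rmod_scheme \<Rightarrow> ('r, 'm \<times> 'n) rmod"
  where "rmod_prod M N =
    \<lparr>carrier = carrier M \<times> carrier N, monoid.mult = (\<lambda>_ _. undefined), one = undefined,
     ring.zero = (\<zero>\<^bsub>M\<^esub>, \<zero>\<^bsub>N\<^esub>),
     add = (\<lambda>(x, y) (x', y'). (x \<oplus>\<^bsub>M\<^esub> x', y \<oplus>\<^bsub>N\<^esub> y')),
     ract = (\<lambda>(x, y) a. (x \<star>\<^bsub>M\<^esub> a, y \<star>\<^bsub>N\<^esub> a))\<rparr>"

definition regular_rmod :: "('r, 'k) ring_scheme \<Rightarrow> ('r, 'r) rmod"
  where "regular_rmod R =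
    \<lparr>carrier = carrier R, monoid.mult = (\<lambda>_ _. undefined), one = undefined,
     ring.zero = \<zero>\<^bsub>R\<^esub>, add = add R, ract = monoid.mult R\<rparr>"

text \<open>The free right module on a basis indexed by \<open>X\<close>: finitely supported functions, vanishing
  outside \<open>X\<close>.\<close>

definition free_rmod :: "('r, 'k) ring_scheme \<Rightarrow> 'x set \<Rightarrow> ('r, 'x \<Rightarrow> 'r) rmod"
  where "free_rmod R X =
    \<lparr>carrier = {f. (\<forall>x. f x \<in> carrier R) \<and> finite {x. f x \<noteq> \<zero>\<^bsub>R\<^esub>} \<and> (\<forall>x. x \<notin> X \<longrightarrow> f x = \<zero>\<^bsub>R\<^esub>)},
     monoid.mult = (\<lambda>_ _. undefined), one = undefined,
     ring.zero = (\<lambda>_. \<zero>\<^bsub>R\<^esub>), add = (\<lambda>f g x. f x \<oplus>\<^bsub>R\<^esub> g x), ract = (\<lambda>f a x. f x \<otimes>\<^bsub>R\<^esub> a)\<rparr>"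

text \<open>Projective: a direct summand of a free module. A projective module \<open>P\<close> is a summand of the
  free module on its own elements, so index sets in the type of \<open>P\<close> suffice.\<close>

definition projective_rmod :: "('r, 'k) ring_scheme \<Rightarrow> ('r, 'm, 'z) rmod_scheme \<Rightarrow> bool"
  where "projective_rmod R P \<longleftrightarrow> right_module R P \<and>
    (\<exists>(X :: 'm set) i p. i \<in> rmod_hom R P (free_rmod R X) \<and> p \<in> rmod_hom R (free_rmod R X) P \<and>
      (\<forall>x\<in>carrier P. p (i x) = x))"

definition fg_projective_rmod :: "('r, 'k) ring_scheme \<Rightarrow> ('r, 'm, 'z) rmod_scheme \<Rightarrow> bool"
  where "fg_projective_rmod R P \<longleftrightarrow> projective_rmod R P \<and> fin_gen R P (carrier P)"

definition fin_presented :: "('r, 'k) ring_scheme \<Rightarrow> ('r, 'm, 'z) rmod_scheme \<Rightarrow> bool"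
  where "fin_presented R M \<longleftrightarrow> right_module R M \<and>
    (\<exists>(n :: nat) p. p \<in> rmod_hom R (free_rmod R {..<n}) M \<and>
      p ` carrier (free_rmod R {..<n}) = carrier M \<and>
      fin_gen R (free_rmod R {..<n}) (a_kernel (free_rmod R {..<n}) M p))"

text \<open>Projective dimension exactly one. If a projective resolution of length one exists then the
  free module on the elements of \<open>M\<close> and the kernel of its map to \<open>M\<close> form one (Schanuel), so
  the type chosen for \<open>P\<close> and \<open>Q\<close> is no restriction.\<close>

definition hom_dim_one :: "('r, 'k) ring_scheme \<Rightarrow> ('r, 'm, 'z) rmod_scheme \<Rightarrow> bool"
  where "hom_dim_one R M \<longleftrightarrow> \<not> projective_rmod R M \<and>
    (\<exists>(P :: ('r, 'm \<Rightarrow> 'r) rmod) (Q :: ('r, 'm \<Rightarrow> 'r) rmod) f g.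
      projective_rmod R P \<and> projective_rmod R Q \<and> short_exact R P f Q g M)"


section \<open>Hereditary rings\<close>

definition opposite_ring :: "('r, 'k) ring_scheme \<Rightarrow> ('r, 'k) ring_scheme"
  where "opposite_ring R = R\<lparr>monoid.mult := (\<lambda>x y. y \<otimes>\<^bsub>R\<^esub> x)\<rparr>"

definition right_hereditary :: "('r, 'k) ring_scheme \<Rightarrow> bool"
  where "right_hereditary R \<longleftrightarrow> ring R \<and>
    (\<forall>I. rsubmodule R (regular_rmod R) I \<longrightarrow>
      projective_rmod R ((regular_rmod R)\<lparr>carrier := I\<rparr>))"

text \<open>Left modules over \<open>R\<close> are right modules over the opposite ring.\<close>

definition hereditary_ring :: "('r, 'k) ring_scheme \<Rightarrow> bool"
  where "hereditary_ring R \<longleftrightarrow> right_hereditary R \<and> right_hereditary (opposite_ring R)"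


section \<open>Well-placed subcategories\<close>

text \<open>
  Every finitely presented \<open>R\<close>-module, whatever the type of its elements, is isomorphic to
  \<open>rquot (free_rmod R {..<n}) N\<close> for some \<open>n\<close> and \<open>N\<close>, whose elements are sets of functions
  \<open>nat \<Rightarrow> 'r\<close>. So the finitely presented modules with elements in the following type
  form a category equivalent to that of all finitely presented modules. A full subcategory
  is given by its set of objects.
\<close>

type_synonym 'r univ = "(nat \<Rightarrow> 'r) set"

definition fpmod :: "('r, 'k) ring_scheme \<Rightarrow> ('r, 'r univ) rmod set"
  where "fpmod R = {M. fin_presented R M}"

text \<open>Membership of a module with elements in an arbitrary type, up to isomorphism.\<close>

definition belongs_to ::
    "('r, 'k) ring_scheme \<Rightarrow> ('r, 'r univ) rmod set \<Rightarrow> ('r, 'm, 'z) rmod_scheme \<Rightarrow> bool"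
  where "belongs_to R E M \<longleftrightarrow> (\<exists>A\<in>E. rmod_iso R A M)"

locale well_placed =
  fixes R :: "('r, 'k) ring_scheme" and E :: "('r, 'r univ) rmod set"
  assumes objects: "E \<subseteq> fpmod R"
    and iso_closed: "\<lbrakk>A \<in> E; B \<in> fpmod R; rmod_iso R A B\<rbrakk> \<Longrightarrow> B \<in> E"
    and zero_object: "\<lbrakk>Z \<in> fpmod R; carrier Z = {\<zero>\<^bsub>Z\<^esub>}\<rbrakk> \<Longrightarrow> Z \<in> E"
    and direct_sums: "\<lbrakk>A \<in> E; B \<in> E\<rbrakk> \<Longrightarrow> belongs_to R E (rmod_prod A B)"
    and images: "\<lbrakk>A \<in> E; B \<in> E; f \<in> rmod_hom R A B\<rbrakk>
      \<Longrightarrow> belongs_to R E (B\<lparr>carrier := f ` carrier A\<rparr>)"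
    and kernels: "\<lbrakk>A \<in> E; B \<in> E; f \<in> rmod_hom R A B\<rbrakk>
      \<Longrightarrow> belongs_to R E (A\<lparr>carrier := a_kernel A B f\<rparr>)"
    and cokernels: "\<lbrakk>A \<in> E; B \<in> E; f \<in> rmod_hom R A B\<rbrakk>
      \<Longrightarrow> belongs_to R E (rquot B (f ` carrier A))"
    and extensions: "\<lbrakk>A \<in> E; C \<in> E; B \<in> fpmod R; short_exact R A f B g C\<rbrakk> \<Longrightarrow> B \<in> E"


section \<open>Extension of scalars\<close>

text \<open>
  For a ring homomorphism \<open>\<phi> : R \<rightarrow> S\<close>, the tensor product \<open>M \<otimes>\<^sub>R S\<close> is the free abelian group on
  \<open>M \<times> S\<close> modulo the usual relations.
\<close>

definition tensor_relators ::
    "('r, 'k) ring_scheme \<Rightarrow> ('r, 'm, 'z) rmod_scheme \<Rightarrow> ('s, 'l) ring_scheme \<Rightarrow> ('r \<Rightarrow> 's)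
      \<Rightarrow> ('m \<times> 's \<Rightarrow>\<^sub>0 int) set"
  where "tensor_relators R M S \<phi> =
    {frag_of (x \<oplus>\<^bsub>M\<^esub> y, s) - frag_of (x, s) - frag_of (y, s) | x y s.
        x \<in> carrier M \<and> y \<in> carrier M \<and> s \<in> carrier S} \<union>
    {frag_of (x, s \<oplus>\<^bsub>S\<^esub> t) - frag_of (x, s) - frag_of (x, t) | x s t.
        x \<in> carrier M \<and> s \<in> carrier S \<and> t \<in> carrier S} \<union>
    {frag_of (x \<star>\<^bsub>M\<^esub> a, s) - frag_of (x, \<phi> a \<otimes>\<^bsub>S\<^esub> s) | x a s.
        x \<in> carrier M \<and> a \<in> carrier R \<and> s \<in> carrier S}"

definition tensor_coset ::
    "('r, 'k) ring_scheme \<Rightarrow> ('r, 'm, 'z) rmod_scheme \<Rightarrow> ('s, 'l) ring_scheme \<Rightarrow> ('r \<Rightarrow> 's)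
      \<Rightarrow> ('m \<times> 's \<Rightarrow>\<^sub>0 int) \<Rightarrow> ('m \<times> 's \<Rightarrow>\<^sub>0 int) set"
  where "tensor_coset R M S \<phi> c =
    (let F = free_Abelian_group (carrier M \<times> carrier S)
     in generate F (tensor_relators R M S \<phi>) #>\<^bsub>F\<^esub> c)"

definition tensor ::
    "('r, 'k) ring_scheme \<Rightarrow> ('r, 'm, 'z) rmod_scheme \<Rightarrow> ('s, 'l) ring_scheme \<Rightarrow> ('r \<Rightarrow> 's)
      \<Rightarrow> ('s, ('m \<times> 's \<Rightarrow>\<^sub>0 int) set) rmod"
  where "tensor R M S \<phi> =
    (let F = free_Abelian_group (carrier M \<times> carrier S);
         N = generate F (tensor_relators R M S \<phi>)
     in \<lparr>carrier = rcosets\<^bsub>F\<^esub> N, monoid.mult = (\<lambda>_ _. undefined), one = undefined,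
         ring.zero = N, add = set_mult F,
         ract = (\<lambda>X b. \<Union>c\<in>X. tensor_coset R M S \<phi> (frag_extend (\<lambda>(x, s). frag_of (x, s \<otimes>\<^bsub>S\<^esub> b)) c))\<rparr>)"

definition tensor_map ::
    "('r, 'k) ring_scheme \<Rightarrow> ('r, 'n, 'y) rmod_scheme \<Rightarrow> ('s, 'l) ring_scheme \<Rightarrow> ('r \<Rightarrow> 's)
      \<Rightarrow> ('m \<Rightarrow> 'n) \<Rightarrow> ('m \<times> 's \<Rightarrow>\<^sub>0 int) set \<Rightarrow> ('n \<times> 's \<Rightarrow>\<^sub>0 int) set"
  \<comment> \<open>\<open>f \<otimes> S\<close> for \<open>f : M \<rightarrow> N\<close>; only the target \<open>N\<close> is needed as an argument\<close>
  where "tensor_map R N S \<phi> f X =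
    (\<Union>c\<in>X. tensor_coset R N S \<phi> (frag_extend (\<lambda>(x, s). frag_of (f x, s)) c))"

definition restrict_scalars :: "('r \<Rightarrow> 's) \<Rightarrow> ('s, 'm, 'z) rmod_scheme \<Rightarrow> ('r, 'm) rmod"
  where "restrict_scalars \<phi> M =
    \<lparr>carrier = carrier M, monoid.mult = monoid.mult M, one = \<one>\<^bsub>M\<^esub>, ring.zero = \<zero>\<^bsub>M\<^esub>, add = add M,
     ract = (\<lambda>x a. x \<star>\<^bsub>M\<^esub> \<phi> a)\<rparr>"

definition canonical_map ::
    "('r, 'k) ring_scheme \<Rightarrow> ('r, 'm, 'z) rmod_scheme \<Rightarrow> ('s, 'l) ring_scheme \<Rightarrow> ('r \<Rightarrow> 's)
      \<Rightarrow> 'm \<Rightarrow> ('m \<times> 's \<Rightarrow>\<^sub>0 int) set"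
  where "canonical_map R M S \<phi> x = tensor_coset R M S \<phi> (frag_of (x, \<one>\<^bsub>S\<^esub>))"


section \<open>Universal localisation\<close>

definition inverts ::
    "('r, 'k) ring_scheme \<Rightarrow> ('r, 'r univ) rmod set \<Rightarrow> ('s, 'l) ring_scheme \<Rightarrow> ('r \<Rightarrow> 's) \<Rightarrow> bool"
  where "inverts R E S \<phi> \<longleftrightarrow>
    (\<forall>A\<in>E. \<forall>(P :: ('r, 'r univ) rmod) (Q :: ('r, 'r univ) rmod) f g.
      fg_projective_rmod R P \<and> fg_projective_rmod R Q \<and> short_exact R P f Q g A \<longrightarrow>
      bij_betw (tensor_map R Q S \<phi> f) (carrier (tensor R P S \<phi>)) (carrier (tensor R Q S \<phi>)))"

text \<open>
  Test rings \<open>T\<close> have elements in \<open>'s + 'r univ\<close>. This type contains a copy of \<open>S\<close>, and also one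
  of the localisation built by generators and relations: it is generated by the
  image of \<open>R\<close> and the entries of the adjoined inverses, so its cardinality is at most that of
  \<open>'r univ\<close>. Initiality among these \<open>T\<close> is therefore equivalent to initiality among all rings.
\<close>

definition universal_localisation ::
    "('r, 'k) ring_scheme \<Rightarrow> ('r, 'r univ) rmod set \<Rightarrow> ('s, 'l) ring_scheme \<Rightarrow> ('r \<Rightarrow> 's) \<Rightarrow> bool"
  where "universal_localisation R E S \<phi> \<longleftrightarrow>
    ring S \<and> \<phi> \<in> ring_hom R S \<and> inverts R E S \<phi> \<and>
    (\<forall>(T :: ('s + 'r univ) ring) \<psi>.
      ring T \<and> \<psi> \<in> ring_hom R T \<and> inverts R E T \<psi> \<longrightarrow>
      (\<exists>\<chi>\<in>ring_hom S T. (\<forall>a\<in>carrier R. \<chi> (\<phi> a) = \<psi> a) \<and>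
        (\<forall>\<chi>'\<in>ring_hom S T. (\<forall>a\<in>carrier R. \<chi>' (\<phi> a) = \<psi> a) \<longrightarrow>
          (\<forall>s\<in>carrier S. \<chi>' s = \<chi> s))))"

definition directed_union :: "'a set set \<Rightarrow> 'a set \<Rightarrow> bool"
  where "directed_union \<F> U \<longleftrightarrow>
    \<F> \<noteq> {} \<and> (\<forall>A\<in>\<F>. \<forall>B\<in>\<F>. \<exists>C\<in>\<F>. A \<subseteq> C \<and> B \<subseteq> C) \<and> \<Union> \<F> = U"

end

theory Submission
  imports Defs "HOL-Algebra.Weak_Morphisms" "HOL-Algebra.Subrings"
begin

text \<open>
  Call an \<open>R\<close>-module \<open>X\<close> local if it admits no nonzero map from an object of \<open>E\<close> and every map
  \<open>P \<rightarrow> X\<close> extends along the inclusions \<open>P \<subseteq> Q\<close> with \<open>Q / P\<close> in \<open>E\<close>. Modules over the localisation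
  \<open>S\<close> are local over \<open>R\<close>; conversely the ring of additive endomorphisms of a local module inverts the
  maps in question, so by universality a local module carries an \<open>S\<close>-action.

  A torsion-free \<open>M\<close> embeds in a local module \<open>L\<close>, a quotient of the sum of \<open>M\<close> and free modules
  \<open>R\<^sup>n\<close>, one for each map \<open>P \<rightarrow> M\<close> with \<open>R\<^sup>n / P\<close> in \<open>E\<close>. Since \<open>L\<close> is an \<open>S\<close>-module, \<open>M \<rightarrow> L\<close> factors
  through \<open>M \<otimes> S\<close>. Hence the kernel of \<open>M \<rightarrow> M \<otimes> S\<close> is, for every finitely presented \<open>M\<close>, the smallest submodule
  with torsion-free quotient. That submodule has no nonzero maps to \<open>R\<close>, and over a hereditary ring this
  forces it to be finitely generated.

  If \<open>M \<rightarrow> M \<otimes> S\<close> is injective, the submodules \<open>N \<supseteq> M\<close> with \<open>N / M\<close> in \<open>E\<close> are directed: comparison with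
  \<open>L\<close> shows that sums of such submodules are again of this kind. Their union is local, so the elements of \<open>S\<close>
  that preserve it form a subring to which the universal property applies. This subring is all of \<open>S\<close>,
  so the union is \<open>M \<otimes> S\<close>.
\<close>

section \<open>Right modules\<close>

text \<open>The obstacle is that \<open>E\<close> is closed under images, kernels and cokernels only
  of maps between its own objects, not under submodules. A submodule of an object has to be
  exhibited through such a map, or as a directed union that is finitely generated and so stops.
  Finite generation comes from Hom(A, R) = 0 for A in \<open>E\<close>, the only place where
  homological dimension 1 enters: the image of A in R is a projective right ideal, so it splits off
  A as a projective object of \<open>E\<close>. The modules P are projective, so maps from P lift
  through quotients. This is why attaching all R^n in a single round, followed by killing torsion,
  already yields a local module. Universality speaks only of test rings in one fixed type. The
  endomorphism ring of a hull fits there if the hull consists of sequences over R; to keep the hull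
  that small, the maps P to M are listed by generators of P and their images.\<close>

abbreviation sub :: "('r, 'm, 'z) rmod_scheme \<Rightarrow> 'm set \<Rightarrow> ('r, 'm, 'z) rmod_scheme"
  where "sub M K \<equiv> M\<lparr>carrier := K\<rparr>"

lemma sub_simps: "carrier (sub M K) = K" "\<zero>\<^bsub>sub M K\<^esub> = \<zero>\<^bsub>M\<^esub>"
  by simp_all

section \<open>Homomorphisms of right modules\<close>

lemma rmod_homI:
  assumes "\<And>x. x \<in> carrier M \<Longrightarrow> f x \<in> carrier N"
    and "\<And>x y. x \<in> carrier M \<Longrightarrow> y \<in> carrier M \<Longrightarrow> f (x \<oplus>\<^bsub>M\<^esub> y) = f x \<oplus>\<^bsub>N\<^esub> f y"
    and "\<And>x a. x \<in> carrier M \<Longrightarrow> a \<in> carrier R \<Longrightarrow> f (x \<star>\<^bsub>M\<^esub> a) = f x \<star>\<^bsub>N\<^esub> a"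
  shows "f \<in> rmod_hom R M N"
  using assms by (auto simp: rmod_hom_def)

lemma hom_closed: "f \<in> rmod_hom R M N \<Longrightarrow> x \<in> carrier M \<Longrightarrow> f x \<in> carrier N"
  by (auto simp: rmod_hom_def)

lemma hom_add: "f \<in> rmod_hom R M N \<Longrightarrow> x \<in> carrier M \<Longrightarrow> y \<in> carrier M
    \<Longrightarrow> f (x \<oplus>\<^bsub>M\<^esub> y) = f x \<oplus>\<^bsub>N\<^esub> f y"
  by (auto simp: rmod_hom_def)

lemma hom_act: "f \<in> rmod_hom R M N \<Longrightarrow> x \<in> carrier M \<Longrightarrow> a \<in> carrier R
    \<Longrightarrow> f (x \<star>\<^bsub>M\<^esub> a) = f x \<star>\<^bsub>N\<^esub> a"
  by (auto simp: rmod_hom_def)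

lemma right_module_ring: "right_module R M \<Longrightarrow> ring R"
  by (simp add: right_module_def)

lemma right_module_abelian_group: "right_module R M \<Longrightarrow> abelian_group M"
  by (simp add: right_module_def)

lemma right_moduleI:
  assumes "ring R"
    and "\<And>x y. x \<in> carrier M \<Longrightarrow> y \<in> carrier M \<Longrightarrow> x \<oplus>\<^bsub>M\<^esub> y \<in> carrier M"
    and "\<zero>\<^bsub>M\<^esub> \<in> carrier M"
    and "\<And>x y z. x \<in> carrier M \<Longrightarrow> y \<in> carrier M \<Longrightarrow> z \<in> carrier M
      \<Longrightarrow> (x \<oplus>\<^bsub>M\<^esub> y) \<oplus>\<^bsub>M\<^esub> z = x \<oplus>\<^bsub>M\<^esub> (y \<oplus>\<^bsub>M\<^esub> z)"
    and "\<And>x y. x \<in> carrier M \<Longrightarrow> y \<in> carrier M \<Longrightarrow> x \<oplus>\<^bsub>M\<^esub> y = y \<oplus>\<^bsub>M\<^esub> x"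
    and "\<And>x. x \<in> carrier M \<Longrightarrow> \<zero>\<^bsub>M\<^esub> \<oplus>\<^bsub>M\<^esub> x = x"
    and "\<And>x. x \<in> carrier M \<Longrightarrow> \<exists>y\<in>carrier M. y \<oplus>\<^bsub>M\<^esub> x = \<zero>\<^bsub>M\<^esub>"
    and "\<And>x a. x \<in> carrier M \<Longrightarrow> a \<in> carrier R \<Longrightarrow> x \<star>\<^bsub>M\<^esub> a \<in> carrier M"
    and "\<And>x y a. x \<in> carrier M \<Longrightarrow> y \<in> carrier M \<Longrightarrow> a \<in> carrier R
      \<Longrightarrow> (x \<oplus>\<^bsub>M\<^esub> y) \<star>\<^bsub>M\<^esub> a = x \<star>\<^bsub>M\<^esub> a \<oplus>\<^bsub>M\<^esub> y \<star>\<^bsub>M\<^esub> a"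
    and "\<And>x a b. x \<in> carrier M \<Longrightarrow> a \<in> carrier R \<Longrightarrow> b \<in> carrier R
      \<Longrightarrow> x \<star>\<^bsub>M\<^esub> (a \<oplus>\<^bsub>R\<^esub> b) = x \<star>\<^bsub>M\<^esub> a \<oplus>\<^bsub>M\<^esub> x \<star>\<^bsub>M\<^esub> b"
    and "\<And>x a b. x \<in> carrier M \<Longrightarrow> a \<in> carrier R \<Longrightarrow> b \<in> carrier R
      \<Longrightarrow> x \<star>\<^bsub>M\<^esub> (a \<otimes>\<^bsub>R\<^esub> b) = (x \<star>\<^bsub>M\<^esub> a) \<star>\<^bsub>M\<^esub> b"
    and "\<And>x. x \<in> carrier M \<Longrightarrow> x \<star>\<^bsub>M\<^esub> \<one>\<^bsub>R\<^esub> = x"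
  shows "right_module R M"
  unfolding right_module_def right_module_axioms_def
  using assms by (auto intro!: abelian_groupI)

lemma hom_zero:
  assumes "abelian_group M" "abelian_group N" "f \<in> rmod_hom R M N"
  shows "f \<zero>\<^bsub>M\<^esub> = \<zero>\<^bsub>N\<^esub>"
proof -
  interpret M: abelian_group M by fact
  interpret N: abelian_group N by fact
  have "f \<zero>\<^bsub>M\<^esub> \<oplus>\<^bsub>N\<^esub> f \<zero>\<^bsub>M\<^esub> = f \<zero>\<^bsub>M\<^esub>"
    using hom_add[OF assms(3), of "\<zero>\<^bsub>M\<^esub>" "\<zero>\<^bsub>M\<^esub>"] hom_closed[OF assms(3)] by simp
  then show ?thesis using hom_closed[OF assms(3), of "\<zero>\<^bsub>M\<^esub>"] N.add.l_cancel_one by simp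
qed

lemma hom_a_inv:
  assumes "abelian_group M" "abelian_group N" "f \<in> rmod_hom R M N" "x \<in> carrier M"
  shows "f (\<ominus>\<^bsub>M\<^esub> x) = \<ominus>\<^bsub>N\<^esub> f x"
proof -
  interpret M: abelian_group M by fact
  interpret N: abelian_group N by fact
  have "f (\<ominus>\<^bsub>M\<^esub> x) \<oplus>\<^bsub>N\<^esub> f x = \<zero>\<^bsub>N\<^esub>"
    using hom_add[OF assms(3), of "\<ominus>\<^bsub>M\<^esub> x" x] hom_zero[OF assms(1-3)] assms(4)
    by (simp add: M.l_neg)
  then show ?thesis
    using hom_closed[OF assms(3)] assms(4) by (metis M.a_inv_closed N.minus_equality)
qed

lemma hom_diff:
  assumes "abelian_group M" "abelian_group N" "f \<in> rmod_hom R M N" "x \<in> carrier M" "y \<in> carrier M"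
  shows "f (x \<ominus>\<^bsub>M\<^esub> y) = f x \<ominus>\<^bsub>N\<^esub> f y"
proof -
  interpret M: abelian_group M by fact
  show ?thesis
    using assms hom_add[OF assms(3)] hom_a_inv[OF assms(1-3)] by (simp add: a_minus_def)
qed

lemma hom_comp: "f \<in> rmod_hom R M N \<Longrightarrow> g \<in> rmod_hom R N Z \<Longrightarrow> (\<lambda>x. g (f x)) \<in> rmod_hom R M Z"
  by (auto simp: rmod_hom_def Pi_iff)

lemma hom_sub_dom: "f \<in> rmod_hom R M N \<Longrightarrow> K \<subseteq> carrier M \<Longrightarrow> f \<in> rmod_hom R (sub M K) N"
  by (auto simp: rmod_hom_def Pi_iff subset_iff)

lemma hom_sub_cod: "f \<in> rmod_hom R M N \<Longrightarrow> f ` carrier M \<subseteq> K \<Longrightarrow> f \<in> rmod_hom R M (sub N K)"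
  by (auto simp: rmod_hom_def)

lemma hom_sub_incl: "f \<in> rmod_hom R M (sub N K) \<Longrightarrow> K \<subseteq> carrier N \<Longrightarrow> f \<in> rmod_hom R M N"
  by (auto simp: rmod_hom_def)

lemma hom_zero_map: "right_module R N \<Longrightarrow> (\<lambda>x. \<zero>\<^bsub>N\<^esub>) \<in> rmod_hom R M N"
proof -
  assume "right_module R N"
  then interpret N: right_module R N .
  have "\<zero>\<^bsub>N\<^esub> \<star>\<^bsub>N\<^esub> a = \<zero>\<^bsub>N\<^esub>" if "a \<in> carrier R" for a
    using N.ract_add_left[of "\<zero>\<^bsub>N\<^esub>" "\<zero>\<^bsub>N\<^esub>" a] N.ract_closed[of "\<zero>\<^bsub>N\<^esub>" a] that
    by (metis N.M.add.l_cancel_one N.M.l_zero N.M.zero_closed)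
  then show ?thesis by (auto simp: rmod_hom_def)
qed

context right_module
begin

lemma zero_ract: "a \<in> carrier R \<Longrightarrow> \<zero>\<^bsub>M\<^esub> \<star>\<^bsub>M\<^esub> a = \<zero>\<^bsub>M\<^esub>"
  using hom_zero_map[of R M M] right_module_axioms hom_act[of "\<lambda>x. \<zero>\<^bsub>M\<^esub>" R M M "\<zero>\<^bsub>M\<^esub>" a] by auto

lemma ract_zero: "x \<in> carrier M \<Longrightarrow> x \<star>\<^bsub>M\<^esub> \<zero> = \<zero>\<^bsub>M\<^esub>"
  using ract_add_right[of x \<zero> \<zero>] ract_closed[of x \<zero>]
  by (metis M.add.l_cancel_one R.l_zero R.zero_closed M.zero_closed)

lemma ract_minus_one: "x \<in> carrier M \<Longrightarrow> x \<star>\<^bsub>M\<^esub> (\<ominus> \<one>) = \<ominus>\<^bsub>M\<^esub> x"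
  using ract_add_right[of x "\<ominus> \<one>" \<one>] ract_zero[of x] ract_one[of x]
    ract_closed[of x "\<ominus> \<one>"] M.minus_equality by (simp add: R.l_neg)

lemma a_inv_ract: "x \<in> carrier M \<Longrightarrow> a \<in> carrier R \<Longrightarrow> (\<ominus>\<^bsub>M\<^esub> x) \<star>\<^bsub>M\<^esub> a = \<ominus>\<^bsub>M\<^esub> (x \<star>\<^bsub>M\<^esub> a)"
  using ract_add_left[of "\<ominus>\<^bsub>M\<^esub> x" x a] zero_ract[of a] ract_closed M.minus_equality
  by (simp add: M.l_neg)

lemma diff_add: "x \<in> carrier M \<Longrightarrow> y \<in> carrier M \<Longrightarrow> (x \<ominus>\<^bsub>M\<^esub> y) \<oplus>\<^bsub>M\<^esub> y = x"
  by (simp add: a_minus_def M.a_assoc M.l_neg)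

lemma diff_eq_zero: "x \<in> carrier M \<Longrightarrow> y \<in> carrier M \<Longrightarrow> x \<ominus>\<^bsub>M\<^esub> y = \<zero>\<^bsub>M\<^esub> \<longleftrightarrow> x = y"
  using diff_add[of x y] by (auto simp: a_minus_def M.r_neg)

lemma add_diff: "x \<in> carrier M \<Longrightarrow> y \<in> carrier M \<Longrightarrow> x \<oplus>\<^bsub>M\<^esub> (y \<ominus>\<^bsub>M\<^esub> x) = y"
  by (metis M.add.inv_closed M.add.m_closed M.add.m_comm a_minus_def diff_add)

lemma hom_plus:
  assumes "f \<in> rmod_hom R N M" "g \<in> rmod_hom R N M" 
  shows "(\<lambda>x. f x \<oplus>\<^bsub>M\<^esub> g x) \<in> rmod_hom R N M"
  by (rule rmod_homI)
    (use assms in \<open>auto simp: hom_closed hom_add hom_act ract_add_left M.a_ac\<close>)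

lemma hom_uminus:
  assumes "f \<in> rmod_hom R N M"
  shows "(\<lambda>x. \<ominus>\<^bsub>M\<^esub> f x) \<in> rmod_hom R N M"
  by (rule rmod_homI)
    (use assms in \<open>auto simp: hom_closed hom_add hom_act a_inv_ract M.minus_add\<close>)

lemma hom_minus:
  assumes "f \<in> rmod_hom R N M" "g \<in> rmod_hom R N M" 
  shows "(\<lambda>x. f x \<ominus>\<^bsub>M\<^esub> g x) \<in> rmod_hom R N M"
  unfolding a_minus_def using assms hom_plus hom_uminus by blast

lemma hom_id: "(\<lambda>x. x) \<in> rmod_hom R M M"
  by (auto intro: rmod_homI)

text \<open>Closure under negation is not among the assumptions; it comes from the action of
  -1.\<close>

lemma rsubmoduleI:
  assumes "N \<subseteq> carrier M" "\<zero>\<^bsub>M\<^esub> \<in> N" "\<And>x y. x \<in> N \<Longrightarrow> y \<in> N \<Longrightarrow> x \<oplus>\<^bsub>M\<^esub> y \<in> N"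
    "\<And>x a. x \<in> N \<Longrightarrow> a \<in> carrier R \<Longrightarrow> x \<star>\<^bsub>M\<^esub> a \<in> N"
  shows "rsubmodule R M N"
proof -
  have "\<ominus>\<^bsub>M\<^esub> x \<in> N" if "x \<in> N" for x
    using assms(4)[OF that, of "\<ominus> \<one>"] that assms(1) ract_minus_one[of x] by auto
  then have "subgroup N (add_monoid M)"
    using assms by (auto intro!: subgroup.intro simp: a_inv_def)
  then show ?thesis using assms by (auto simp: rsubmodule_def additive_subgroup_def)
qed

end

section \<open>Submodules and spans\<close>

lemma rsubmoduleD:
  assumes "rsubmodule R M N"
  shows "N \<subseteq> carrier M" "\<zero>\<^bsub>M\<^esub> \<in> N" "\<And>x y. x \<in> N \<Longrightarrow> y \<in> N \<Longrightarrow> x \<oplus>\<^bsub>M\<^esub> y \<in> N"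
    "\<And>x a. x \<in> N \<Longrightarrow> a \<in> carrier R \<Longrightarrow> x \<star>\<^bsub>M\<^esub> a \<in> N"
    "\<And>x. x \<in> N \<Longrightarrow> x \<in> carrier M"
  using assms additive_subgroup.a_subset[of N M] additive_subgroup.zero_closed[of N M]
    additive_subgroup.a_closed[of N M]
  by (auto simp: rsubmodule_def)

context right_module
begin

lemma rsubmodule_a_inv: "rsubmodule R M N \<Longrightarrow> x \<in> N \<Longrightarrow> \<ominus>\<^bsub>M\<^esub> x \<in> N"
  using rsubmoduleD(4)[of R M N x "\<ominus> \<one>"] ract_minus_one rsubmoduleD(5)[of R M N x] by fastforce

lemma rsubmodule_diff: "rsubmodule R M N \<Longrightarrow> x \<in> N \<Longrightarrow> y \<in> N \<Longrightarrow> x \<ominus>\<^bsub>M\<^esub> y \<in> N"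
  by (simp add: a_minus_def rsubmoduleD(3) rsubmodule_a_inv)

lemma rsubmodule_carrier: "rsubmodule R M (carrier M)"
  by (rule rsubmoduleI) (auto simp: ract_closed)

lemma rsubmodule_zero: "rsubmodule R M {\<zero>\<^bsub>M\<^esub>}"
  by (rule rsubmoduleI) (auto simp: zero_ract)

lemma rsubmodule_Inter:
  "\<N> \<noteq> {} \<Longrightarrow> (\<And>N. N \<in> \<N> \<Longrightarrow> rsubmodule R M N) \<Longrightarrow> rsubmodule R M (\<Inter>\<N>)"
  by (rule rsubmoduleI) (auto dest: rsubmoduleD)

lemma right_module_sub:
  assumes "rsubmodule R M N"
  shows "right_module R (sub M N)"
proof (rule right_moduleI)
  show "\<exists>y\<in>carrier (sub M N). y \<oplus>\<^bsub>sub M N\<^esub> x = \<zero>\<^bsub>sub M N\<^esub>" if "x \<in> carrier (sub M N)" for x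
    using rsubmodule_a_inv[OF assms, of x] rsubmoduleD(5)[OF assms, of x] that
    by (auto simp: M.l_neg intro!: bexI[of _ "\<ominus>\<^bsub>M\<^esub> x"])
qed (use rsubmoduleD[OF assms] in \<open>auto simp: R.ring_axioms M.a_ac ract_add_left
      ract_add_right ract_assoc ract_one\<close>)

lemma rsubmodule_sub_iff:
  assumes "rsubmodule R M N"
  shows "rsubmodule R (sub M N) K \<longleftrightarrow> rsubmodule R M K \<and> K \<subseteq> N"
proof -
  interpret N: right_module R "sub M N" by (rule right_module_sub[OF assms])
  show ?thesis
  proof (intro iffI)
    assume "rsubmodule R (sub M N) K"
    then show "rsubmodule R M K \<and> K \<subseteq> N"
      using rsubmoduleD[of R "sub M N" K] rsubmoduleD(1)[OF assms]
      by (auto intro!: rsubmoduleI)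
  next
    assume "rsubmodule R M K \<and> K \<subseteq> N"
    then show "rsubmodule R (sub M N) K"
      using rsubmoduleD[of R M K] by (auto intro!: N.rsubmoduleI)
  qed
qed

lemma rsubmodule_trans:
  "rsubmodule R M N \<Longrightarrow> rsubmodule R (sub M N) K \<Longrightarrow> rsubmodule R M K"
  using rsubmodule_sub_iff by blast

lemma rspan_rsubmodule: "X \<subseteq> carrier M \<Longrightarrow> rsubmodule R M (rspan R M X)"
  unfolding rspan_def using rsubmodule_carrier by (intro rsubmodule_Inter) auto

lemma rspan_least: "rsubmodule R M N \<Longrightarrow> X \<subseteq> N \<Longrightarrow> rspan R M X \<subseteq> N"
  by (auto simp: rspan_def)

lemma rspan_superset: "X \<subseteq> rspan R M X"
  by (auto simp: rspan_def)

end

lemma rsubmodule_vimage: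
  assumes M: "right_module R M" and N: "right_module R N" and h: "h \<in> rmod_hom R M N"
    and K: "rsubmodule R N K"
  shows "rsubmodule R M {x \<in> carrier M. h x \<in> K}"
proof -
  interpret M: right_module R M by fact
  interpret N: right_module R N by fact
  show ?thesis
    using rsubmoduleD[OF K] h
    by (intro M.rsubmoduleI)
      (auto simp: hom_zero[OF M.M.abelian_group_axioms N.M.abelian_group_axioms h] hom_add hom_act
        M.ract_closed)
qed

lemma rsubmodule_image:
  assumes M: "right_module R M" and N: "right_module R N" and h: "h \<in> rmod_hom R M N"
    and K: "rsubmodule R M K"
  shows "rsubmodule R N (h ` K)"
proof -
  interpret M: right_module R M by fact
  interpret N: right_module R N by fact
  show ?thesis
  proof (rule N.rsubmoduleI)
    show "\<zero>\<^bsub>N\<^esub> \<in> h ` K"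
      using hom_zero[OF M.M.abelian_group_axioms N.M.abelian_group_axioms h] rsubmoduleD(2)[OF K]
      by force
    show "x \<oplus>\<^bsub>N\<^esub> y \<in> h ` K" if "x \<in> h ` K" "y \<in> h ` K" for x y
      using that rsubmoduleD(3,5)[OF K] hom_add[OF h] by (smt (verit) image_iff)
    show "x \<star>\<^bsub>N\<^esub> a \<in> h ` K" if "x \<in> h ` K" "a \<in> carrier R" for x a
      using that rsubmoduleD(4,5)[OF K] hom_act[OF h] by (smt (verit) image_iff)
  qed (use h rsubmoduleD[OF K] in \<open>auto simp: hom_closed\<close>)
qed

lemma rsubmodule_kernel:
  assumes M: "right_module R M" and N: "right_module R N" and h: "h \<in> rmod_hom R M N"
  shows "rsubmodule R M {x \<in> carrier M. h x = \<zero>\<^bsub>N\<^esub>}"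
  using rsubmodule_vimage[OF M N h right_module.rsubmodule_zero[OF N]] by simp

lemma rsubmodule_image_carrier:
  assumes M: "right_module R M" and N: "right_module R N" and h: "h \<in> rmod_hom R M N"
  shows "rsubmodule R N (h ` carrier M)"
  by (rule rsubmodule_image[OF assms right_module.rsubmodule_carrier[OF M]])

lemma a_kernel_eq: "a_kernel A B f = {x \<in> carrier A. f x = \<zero>\<^bsub>B\<^esub>}"
  by (auto simp: a_kernel_def kernel_def)

section \<open>Injectivity, factorisation through quotients, inverses\<close>

lemma hom_inj_iff:
  assumes M: "right_module R M" and N: "right_module R N" and h: "h \<in> rmod_hom R M N"
  shows "inj_on h (carrier M) \<longleftrightarrow> (\<forall>x\<in>carrier M. h x = \<zero>\<^bsub>N\<^esub> \<longrightarrow> x = \<zero>\<^bsub>M\<^esub>)"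
proof -
  interpret M: right_module R M by fact
  interpret N: right_module R N by fact
  have 0: "h \<zero>\<^bsub>M\<^esub> = \<zero>\<^bsub>N\<^esub>" by (rule hom_zero[OF M.M.abelian_group_axioms N.M.abelian_group_axioms h])
  show ?thesis
  proof
    assume "inj_on h (carrier M)"
    then show "\<forall>x\<in>carrier M. h x = \<zero>\<^bsub>N\<^esub> \<longrightarrow> x = \<zero>\<^bsub>M\<^esub>"
      using 0 by (metis M.M.zero_closed inj_onD)
  next
    assume *: "\<forall>x\<in>carrier M. h x = \<zero>\<^bsub>N\<^esub> \<longrightarrow> x = \<zero>\<^bsub>M\<^esub>"
    show "inj_on h (carrier M)"
    proof (rule inj_onI)
      fix x y assume xy: "x \<in> carrier M" "y \<in> carrier M" "h x = h y"
      then have "h (x \<ominus>\<^bsub>M\<^esub> y) = \<zero>\<^bsub>N\<^esub>"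
        using hom_diff[OF M.M.abelian_group_axioms N.M.abelian_group_axioms h]
        by (simp add: hom_closed[OF h] N.diff_eq_zero xy)
      then show "x = y" using * xy M.diff_eq_zero[of x y] by auto
    qed
  qed
qed

text \<open>The preimages chosen by \<open>s\<close> are not additive in c, but \<open>h\<close>
  takes the same value on all preimages of c because it kills the kernel of \<open>q\<close>. The
  quotient enters only as a surjection with a known kernel, so coset modules and abstract objects of
  \<open>E\<close> are served alike.\<close>

lemma hom_factor:
  assumes Y: "right_module R Y" and C: "right_module R C" and Z: "right_module R Z"
    and q: "q \<in> rmod_hom R Y C" "q ` carrier Y = carrier C"
    and h: "h \<in> rmod_hom R Y Z" and k: "\<And>y. y \<in> carrier Y \<Longrightarrow> q y = \<zero>\<^bsub>C\<^esub> \<Longrightarrow> h y = \<zero>\<^bsub>Z\<^esub>"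
  shows "\<exists>g\<in>rmod_hom R C Z. \<forall>y\<in>carrier Y. g (q y) = h y"
proof -
  interpret Y: right_module R Y by fact
  interpret C: right_module R C by fact
  interpret Z: right_module R Z by fact
  define s where "s c = (SOME y. y \<in> carrier Y \<and> q y = c)" for c
  have s: "s c \<in> carrier Y" "q (s c) = c" if "c \<in> carrier C" for c
  proof -
    have "\<exists>y. y \<in> carrier Y \<and> q y = c" using that q(2) by (metis image_iff)
    from someI_ex[OF this] show "s c \<in> carrier Y" "q (s c) = c" by (auto simp: s_def)
  qed
  have eq: "h y = h y'" if "y \<in> carrier Y" "y' \<in> carrier Y" "q y = q y'" for y y'
  proof -
    have "q (y \<ominus>\<^bsub>Y\<^esub> y') = \<zero>\<^bsub>C\<^esub>"
      using hom_diff[OF Y.M.abelian_group_axioms C.M.abelian_group_axioms q(1)] that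
      by (simp add: hom_closed[OF q(1)] C.diff_eq_zero)
    then have "h y \<ominus>\<^bsub>Z\<^esub> h y' = \<zero>\<^bsub>Z\<^esub>"
      using k[of "y \<ominus>\<^bsub>Y\<^esub> y'"] hom_diff[OF Y.M.abelian_group_axioms Z.M.abelian_group_axioms h] that
      by simp
    then show ?thesis using that hom_closed[OF h] Z.diff_eq_zero by simp
  qed
  have gq: "h (s (q y)) = h y" if "y \<in> carrier Y" for y
    using eq s that hom_closed[OF q(1) that] by metis
  have "(\<lambda>c. h (s c)) \<in> rmod_hom R C Z"
  proof (rule rmod_homI)
    fix c d assume cd: "c \<in> carrier C" "d \<in> carrier C"
    have "h (s (c \<oplus>\<^bsub>C\<^esub> d)) = h (s c \<oplus>\<^bsub>Y\<^esub> s d)"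
      using cd s by (intro eq) (auto simp: hom_add[OF q(1)])
    then show "h (s (c \<oplus>\<^bsub>C\<^esub> d)) = h (s c) \<oplus>\<^bsub>Z\<^esub> h (s d)" using cd s hom_add[OF h] by auto
  next
    fix c a assume cd: "c \<in> carrier C" "a \<in> carrier R"
    have "h (s (c \<star>\<^bsub>C\<^esub> a)) = h (s c \<star>\<^bsub>Y\<^esub> a)"
      using cd s by (intro eq) (auto simp: hom_act[OF q(1)] Y.ract_closed C.ract_closed)
    then show "h (s (c \<star>\<^bsub>C\<^esub> a)) = h (s c) \<star>\<^bsub>Z\<^esub> a" using cd s hom_act[OF h] by auto
  qed (use s hom_closed[OF h] in auto)
  then show ?thesis using gq by (intro bexI[of _ "\<lambda>c. h (s c)"]) simp_all
qed

lemma inverse_hom: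
  assumes M: "right_module R M" and f: "f \<in> rmod_hom R M N" "bij_betw f (carrier M) (carrier N)"
  shows "inv_into (carrier M) f \<in> rmod_hom R N M"
proof -
  interpret M: right_module R M by fact
  let ?g = "inv_into (carrier M) f"
  have g: "?g y \<in> carrier M" "f (?g y) = y" if "y \<in> carrier N" for y
    using that f(2) by (auto simp: bij_betw_def inv_into_into f_inv_into_f)
  have gf: "?g (f x) = x" if "x \<in> carrier M" for x
    using that f(2) by (simp add: bij_betw_def)
  show ?thesis
  proof (rule rmod_homI)
    fix x y assume xy: "x \<in> carrier N" "y \<in> carrier N"
    have "?g (x \<oplus>\<^bsub>N\<^esub> y) = ?g (f (?g x \<oplus>\<^bsub>M\<^esub> ?g y))" using g xy hom_add[OF f(1)] by simp
    then show "?g (x \<oplus>\<^bsub>N\<^esub> y) = ?g x \<oplus>\<^bsub>M\<^esub> ?g y" using g xy gf by simp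
  next
    fix x a assume xy: "x \<in> carrier N" "a \<in> carrier R"
    have "?g (x \<star>\<^bsub>N\<^esub> a) = ?g (f (?g x \<star>\<^bsub>M\<^esub> a))" using g xy hom_act[OF f(1)] by simp
    then show "?g (x \<star>\<^bsub>N\<^esub> a) = ?g x \<star>\<^bsub>M\<^esub> a" using g xy gf by (simp add: M.ract_closed)
  qed (use g in auto)
qed

subsection \<open>Quotients and products\<close>

context right_module
begin

text \<open>These four facts characterise the coset module: the coset map is a surjection of modules
  with kernel \<open>N\<close>. No later argument unfolds \<open>rquot\<close>.\<close>

lemma rquot_facts:
  assumes N: "rsubmodule R M N"
  shows "right_module R (rquot M N)" (is ?thesis1)
    and "a_r_coset M N \<in> rmod_hom R M (rquot M N)" (is ?thesis2)
    and "a_r_coset M N ` carrier M = carrier (rquot M N)" (is ?thesis3)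
    and "\<And>x. x \<in> carrier M \<Longrightarrow> a_r_coset M N x = \<zero>\<^bsub>rquot M N\<^esub> \<longleftrightarrow> x \<in> N" (is "PROP ?thesis4")
proof -
  interpret S: abelian_subgroup N M
    by (rule abelian_subgroupI3)
      (use N in \<open>auto simp: rsubmodule_def M.abelian_group_axioms\<close>)
  let ?q = "a_r_coset M N"
  note sm = rsubmoduleD[OF N]
  have add: "?q x <+>\<^bsub>M\<^esub> ?q y = ?q (x \<oplus>\<^bsub>M\<^esub> y)" if "x \<in> carrier M" "y \<in> carrier M" for x y
    using S.a_rcos_sum that by auto
  have eq: "?q x = ?q y \<longleftrightarrow> x \<ominus>\<^bsub>M\<^esub> y \<in> N" if "x \<in> carrier M" "y \<in> carrier M" for x y
  proof -
    have "x \<ominus>\<^bsub>M\<^esub> y \<in> N \<longleftrightarrow> x \<in> ?q y"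
      using S.a_rcos_module[of y x] that by (simp add: a_minus_def)
    also have "\<dots> \<longleftrightarrow> ?q x = ?q y"
      using S.a_repr_independence'[of x y] S.a_rcos_self[of x] that by auto
    finally show ?thesis by simp
  qed
  have zero: "?q \<zero>\<^bsub>M\<^esub> = N" using M.a_coset_add_zero[of N] sm(1) by simp
  have mem: "x \<in> ?q y \<longleftrightarrow> x \<in> carrier M \<and> x \<ominus>\<^bsub>M\<^esub> y \<in> N" if "y \<in> carrier M" for x y
    using that eq[of x y] S.a_rcos_self[of x] S.a_elemrcos_carrier[of y x]
      S.a_repr_independence'[of x y] by auto
  have act: "(\<Union>y\<in>?q x. ?q (y \<star>\<^bsub>M\<^esub> a)) = ?q (x \<star>\<^bsub>M\<^esub> a)" if "x \<in> carrier M" "a \<in> carrier R" for x a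
  proof -
    have "?q (y \<star>\<^bsub>M\<^esub> a) = ?q (x \<star>\<^bsub>M\<^esub> a)" if y: "y \<in> ?q x" for y
    proof -
      have "y \<in> carrier M" "y \<ominus>\<^bsub>M\<^esub> x \<in> N" using mem y \<open>x \<in> carrier M\<close> by auto
      moreover have "(y \<ominus>\<^bsub>M\<^esub> x) \<star>\<^bsub>M\<^esub> a = y \<star>\<^bsub>M\<^esub> a \<ominus>\<^bsub>M\<^esub> x \<star>\<^bsub>M\<^esub> a"
        using \<open>x \<in> carrier M\<close> \<open>a \<in> carrier R\<close> \<open>y \<in> carrier M\<close>
        by (simp add: a_minus_def ract_add_left a_inv_ract)
      ultimately show ?thesis using eq sm(4) that ract_closed
        by (metis \<open>a \<in> carrier R\<close> \<open>x \<in> carrier M\<close>)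
    qed
    moreover have "x \<in> ?q x" using S.a_rcos_self that(1) M.abelian_group_axioms by blast
    ultimately show ?thesis by blast
  qed
  have car: "carrier (rquot M N) = ?q ` carrier M"
    by (auto simp: rquot_def A_RCOSETS_def' )
  show ?thesis3 by (simp add: car)
  show hom: ?thesis2
    by (rule rmod_homI) (use add act in \<open>auto simp: car, auto simp: rquot_def\<close>)
  show "PROP ?thesis4"
  proof -
    fix x assume x: "x \<in> carrier M"
    have "x \<ominus>\<^bsub>M\<^esub> \<zero>\<^bsub>M\<^esub> = x" using diff_add[of x "\<zero>\<^bsub>M\<^esub>"] x by simp
    then show "?q x = \<zero>\<^bsub>rquot M N\<^esub> \<longleftrightarrow> x \<in> N"
      using eq[OF x M.zero_closed] zero by (simp add: rquot_def)
  qed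
  have ops: "\<zero>\<^bsub>rquot M N\<^esub> = ?q \<zero>\<^bsub>M\<^esub>"
    "\<And>x y. x \<in> carrier M \<Longrightarrow> y \<in> carrier M \<Longrightarrow> ?q x \<oplus>\<^bsub>rquot M N\<^esub> ?q y = ?q (x \<oplus>\<^bsub>M\<^esub> y)"
    "\<And>x a. x \<in> carrier M \<Longrightarrow> a \<in> carrier R \<Longrightarrow> ?q x \<star>\<^bsub>rquot M N\<^esub> a = ?q (x \<star>\<^bsub>M\<^esub> a)"
    using zero add act by (simp_all add: rquot_def)
  show ?thesis1
  proof (rule right_moduleI)
    show "\<exists>y\<in>carrier (rquot M N). y \<oplus>\<^bsub>rquot M N\<^esub> x = \<zero>\<^bsub>rquot M N\<^esub>" if x: "x \<in> carrier (rquot M N)" for x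
    proof -
      obtain z where "z \<in> carrier M" "x = ?q z" using x by (auto simp: car)
      then show ?thesis
        by (intro bexI[of _ "?q (\<ominus>\<^bsub>M\<^esub> z)"]) (auto simp: car ops M.l_neg)
    qed
  qed (auto simp: car ops R.ring_axioms M.a_ac ract_add_left ract_add_right ract_assoc ract_one
      ract_closed)
qed

end

lemma rmod_prod_simps:
  "carrier (rmod_prod M N) = carrier M \<times> carrier N"
  "\<zero>\<^bsub>rmod_prod M N\<^esub> = (\<zero>\<^bsub>M\<^esub>, \<zero>\<^bsub>N\<^esub>)"
  "(x, y) \<oplus>\<^bsub>rmod_prod M N\<^esub> (x', y') = (x \<oplus>\<^bsub>M\<^esub> x', y \<oplus>\<^bsub>N\<^esub> y')"
  "(x, y) \<star>\<^bsub>rmod_prod M N\<^esub> a = (x \<star>\<^bsub>M\<^esub> a, y \<star>\<^bsub>N\<^esub> a)"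
  by (auto simp: rmod_prod_def)

lemma rmod_prod_module:
  assumes M: "right_module R M" and N: "right_module R N"
  shows "right_module R (rmod_prod M N)"
proof -
  interpret M: right_module R M by fact
  interpret N: right_module R N by fact
  show ?thesis
  proof (rule right_moduleI)
    show "\<exists>y\<in>carrier (rmod_prod M N). y \<oplus>\<^bsub>rmod_prod M N\<^esub> x = \<zero>\<^bsub>rmod_prod M N\<^esub>"
      if "x \<in> carrier (rmod_prod M N)" for x
      using that by (intro bexI[of _ "(\<ominus>\<^bsub>M\<^esub> fst x, \<ominus>\<^bsub>N\<^esub> snd x)"])
        (auto simp: rmod_prod_simps M.M.l_neg N.M.l_neg)
  qed (auto simp: rmod_prod_simps M.R.ring_axioms M.M.a_ac N.M.a_ac
      M.ract_add_left M.ract_add_right M.ract_assoc M.ract_one M.ract_closed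
      N.ract_add_left N.ract_add_right N.ract_assoc N.ract_one N.ract_closed)
qed

lemma hom_fst: "fst \<in> rmod_hom R (rmod_prod M N) M"
  and hom_snd: "snd \<in> rmod_hom R (rmod_prod M N) N"
  by (auto intro!: rmod_homI simp: rmod_prod_simps)

lemma hom_pair:
  "f \<in> rmod_hom R A M \<Longrightarrow> g \<in> rmod_hom R A N \<Longrightarrow> (\<lambda>x. (f x, g x)) \<in> rmod_hom R A (rmod_prod M N)"
  by (auto intro!: rmod_homI simp: rmod_prod_simps hom_closed hom_add hom_act)

lemma hom_copair:
  assumes "right_module R Z" "f \<in> rmod_hom R M Z" "g \<in> rmod_hom R N Z"
  shows "(\<lambda>p. f (fst p) \<oplus>\<^bsub>Z\<^esub> g (snd p)) \<in> rmod_hom R (rmod_prod M N) Z"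
  using right_module.hom_plus[OF assms(1) hom_comp[OF hom_fst assms(2)] hom_comp[OF hom_snd assms(3)]]
  by simp

lemma hom_inl: "right_module R N \<Longrightarrow> (\<lambda>x. (x, \<zero>\<^bsub>N\<^esub>)) \<in> rmod_hom R M (rmod_prod M N)"
  by (auto intro!: rmod_homI
      simp: rmod_prod_simps right_module.zero_ract right_module_def abelian_group_def
        abelian_monoid.zero_closed abelian_monoid.l_zero)

lemma hom_inr: "right_module R M \<Longrightarrow> (\<lambda>x. (\<zero>\<^bsub>M\<^esub>, x)) \<in> rmod_hom R N (rmod_prod M N)"
  by (auto intro!: rmod_homI
      simp: rmod_prod_simps right_module.zero_ract right_module_def abelian_group_def
        abelian_monoid.zero_closed abelian_monoid.l_zero)

subsection \<open>Free and projective modules\<close>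

lemma free_rmod_simps:
  "f \<in> carrier (free_rmod R X) \<longleftrightarrow>
    (\<forall>x. f x \<in> carrier R) \<and> finite {x. f x \<noteq> \<zero>\<^bsub>R\<^esub>} \<and> (\<forall>x. x \<notin> X \<longrightarrow> f x = \<zero>\<^bsub>R\<^esub>)"
  "\<zero>\<^bsub>free_rmod R X\<^esub> = (\<lambda>_. \<zero>\<^bsub>R\<^esub>)"
  "f \<oplus>\<^bsub>free_rmod R X\<^esub> g = (\<lambda>x. f x \<oplus>\<^bsub>R\<^esub> g x)"
  "f \<star>\<^bsub>free_rmod R X\<^esub> a = (\<lambda>x. f x \<otimes>\<^bsub>R\<^esub> a)"
  by (auto simp: free_rmod_def)

lemma free_rmod_module:
  assumes "ring R"
  shows "right_module R (free_rmod R X)"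
proof -
  interpret R: ring R by fact
  have add: "finite {x. f x \<oplus>\<^bsub>R\<^esub> g x \<noteq> \<zero>\<^bsub>R\<^esub>}"
    if "finite {x. f x \<noteq> \<zero>\<^bsub>R\<^esub>}" "finite {x. g x \<noteq> \<zero>\<^bsub>R\<^esub>}" for f g :: "'z \<Rightarrow> 'a"
    by (rule finite_subset[OF _ finite_UnI[OF that]]) auto
  have act: "finite {x. f x \<otimes>\<^bsub>R\<^esub> a \<noteq> \<zero>\<^bsub>R\<^esub>}"
    if "finite {x. f x \<noteq> \<zero>\<^bsub>R\<^esub>}" "a \<in> carrier R" for f :: "'z \<Rightarrow> 'a" and a
    by (rule finite_subset[OF _ that(1)]) (use that in auto)
  show ?thesis
  proof (rule right_moduleI)
    show "\<exists>y\<in>carrier (free_rmod R X). y \<oplus>\<^bsub>free_rmod R X\<^esub> f = \<zero>\<^bsub>free_rmod R X\<^esub>"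
      if "f \<in> carrier (free_rmod R X)" for f
      using that by (intro bexI[of _ "\<lambda>x. f x \<otimes>\<^bsub>R\<^esub> (\<ominus>\<^bsub>R\<^esub> \<one>\<^bsub>R\<^esub>)"])
        (auto simp: free_rmod_simps act R.r_minus R.l_neg)
  qed (auto simp: free_rmod_simps add act assms R.a_ac R.l_distr R.r_distr R.m_assoc)
qed

section \<open>Bases and the universal property of free modules\<close>

definition unit_vec :: "('r, 'k) ring_scheme \<Rightarrow> 'x \<Rightarrow> 'x \<Rightarrow> 'r"
  where "unit_vec R x y = (if y = x then \<one>\<^bsub>R\<^esub> else \<zero>\<^bsub>R\<^esub>)"

lemma unit_vec_closed: "ring R \<Longrightarrow> x \<in> X \<Longrightarrow> unit_vec R x \<in> carrier (free_rmod R X)"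
  by (auto simp: free_rmod_simps unit_vec_def ring.ring_simprules)

lemma free_decompose:
  assumes "ring R" "f \<in> carrier (free_rmod R X)"
  shows "f = (f(x := \<zero>\<^bsub>R\<^esub>)) \<oplus>\<^bsub>free_rmod R X\<^esub> (unit_vec R x \<star>\<^bsub>free_rmod R X\<^esub> f x)"
proof -
  interpret R: ring R by fact
  show ?thesis using assms(2) by (auto simp: free_rmod_simps unit_vec_def fun_eq_iff)
qed

lemma free_upd_closed:
  assumes "ring R" "f \<in> carrier (free_rmod R X)"
  shows "f(x := \<zero>\<^bsub>R\<^esub>) \<in> carrier (free_rmod R X)"
proof -
  interpret R: ring R by fact
  have "{y. (f(x := \<zero>\<^bsub>R\<^esub>)) y \<noteq> \<zero>\<^bsub>R\<^esub>} \<subseteq> {y. f y \<noteq> \<zero>\<^bsub>R\<^esub>}" by auto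
  then have "finite {y. (f(x := \<zero>\<^bsub>R\<^esub>)) y \<noteq> \<zero>\<^bsub>R\<^esub>}"
    by (rule finite_subset) (use assms(2) in \<open>simp add: free_rmod_simps\<close>)
  then show ?thesis using assms(2) by (simp add: free_rmod_simps)
qed

text \<open>Induction on \<open>A\<close>, splitting off one coordinate at a time; \<open>f\<close>
  varies, because the hypothesis is applied to \<open>f\<close> with the coordinate a set to zero.
  \<open>A\<close> may exceed the support, so one index set can serve many vectors.\<close>

lemma free_expand:
  assumes M: "right_module R M" and h: "h \<in> rmod_hom R (free_rmod R X) M"
    and f: "f \<in> carrier (free_rmod R X)" and A: "finite A" "A \<subseteq> X" "\<And>x. x \<notin> A \<Longrightarrow> f x = \<zero>\<^bsub>R\<^esub>"
  shows "h f = (\<Oplus>\<^bsub>M\<^esub>x\<in>A. h (unit_vec R x) \<star>\<^bsub>M\<^esub> f x)"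
  using A f
proof (induction A arbitrary: f rule: finite_induct)
  case empty
  interpret M: right_module R M by fact
  interpret F: right_module R "free_rmod R X" by (rule free_rmod_module) (rule M.R.ring_axioms)
  have "f = \<zero>\<^bsub>free_rmod R X\<^esub>" using empty by (auto simp: free_rmod_simps)
  then show ?case using hom_zero[OF F.M.abelian_group_axioms M.M.abelian_group_axioms h] by simp
next
  case (insert a A)
  interpret M: right_module R M by fact
  interpret F: right_module R "free_rmod R X" by (rule free_rmod_module) (rule M.R.ring_axioms)
  note up = free_upd_closed[OF M.R.ring_axioms insert.prems(3), of a]
  have fx: "\<And>x. f x \<in> carrier R" using insert.prems(3) by (simp add: free_rmod_simps)
  have hu: "h (unit_vec R x) \<in> carrier M" if "x \<in> X" for x
    using that by (intro hom_closed[OF h] unit_vec_closed M.R.ring_axioms)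
  have a: "a \<in> X" "A \<subseteq> X" using insert.prems by auto
  have "h f = h (f(a := \<zero>\<^bsub>R\<^esub>)) \<oplus>\<^bsub>M\<^esub> h (unit_vec R a \<star>\<^bsub>free_rmod R X\<^esub> f a)"
    by (subst free_decompose[OF M.R.ring_axioms insert.prems(3), of a], rule hom_add[OF h up])
      (auto intro!: F.ract_closed unit_vec_closed M.R.ring_axioms fx a)
  also have "h (unit_vec R a \<star>\<^bsub>free_rmod R X\<^esub> f a) = h (unit_vec R a) \<star>\<^bsub>M\<^esub> f a"
    by (rule hom_act[OF h]) (auto intro!: unit_vec_closed M.R.ring_axioms fx a)
  also have "h (f(a := \<zero>\<^bsub>R\<^esub>)) = (\<Oplus>\<^bsub>M\<^esub>x\<in>A. h (unit_vec R x) \<star>\<^bsub>M\<^esub> (f(a := \<zero>\<^bsub>R\<^esub>)) x)"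
    by (rule insert.IH) (use insert.prems up in \<open>auto simp del: fun_upd_apply\<close>, auto)
  also have "\<dots> = (\<Oplus>\<^bsub>M\<^esub>x\<in>A. h (unit_vec R x) \<star>\<^bsub>M\<^esub> f x)"
    using a insert.hyps by (intro M.M.finsum_cong') (auto intro!: M.ract_closed hu fx)
  finally show ?case
    using insert.hyps a by (subst M.M.finsum_insert) (auto intro!: M.ract_closed hu fx M.M.a_comm M.M.finsum_closed)
qed

lemma free_hom_eq:
  assumes M: "right_module R M"
    and h: "h \<in> rmod_hom R (free_rmod R X) M" "k \<in> rmod_hom R (free_rmod R X) M"
    and eq: "\<And>x. x \<in> X \<Longrightarrow> h (unit_vec R x) = k (unit_vec R x)"
    and f: "f \<in> carrier (free_rmod R X)"
  shows "h f = k f"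
proof -
  interpret M: right_module R M by fact
  let ?A = "{x. f x \<noteq> \<zero>\<^bsub>R\<^esub>}"
  have A: "finite ?A" "?A \<subseteq> X" "\<And>x. x \<notin> ?A \<Longrightarrow> f x = \<zero>\<^bsub>R\<^esub>" using f by (auto simp: free_rmod_simps)
  have fx: "\<And>x. f x \<in> carrier R" using f by (simp add: free_rmod_simps)
  have "h f = (\<Oplus>\<^bsub>M\<^esub>x\<in>?A. h (unit_vec R x) \<star>\<^bsub>M\<^esub> f x)"
    by (rule free_expand[OF M h(1) f A])
  also have "\<dots> = (\<Oplus>\<^bsub>M\<^esub>x\<in>?A. k (unit_vec R x) \<star>\<^bsub>M\<^esub> f x)"
    using A(2) eq by (intro M.M.finsum_cong')
      (auto intro!: M.ract_closed hom_closed[OF h(2)] unit_vec_closed M.R.ring_axioms fx)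
  also have "\<dots> = k f"
    by (rule free_expand[OF M h(2) f A, symmetric])
  finally show ?thesis .
qed

lemma free_universal:
  assumes M: "right_module R M" and v: "\<And>x. x \<in> X \<Longrightarrow> v x \<in> carrier M"
  shows "\<exists>h\<in>rmod_hom R (free_rmod R X) M. \<forall>x\<in>X. h (unit_vec R x) = v x"
proof -
  interpret M: right_module R M by fact
  let ?S = "\<lambda>f. {x. f x \<noteq> \<zero>\<^bsub>R\<^esub>}"
  define h where "h f = (\<Oplus>\<^bsub>M\<^esub>x\<in>?S f. v x \<star>\<^bsub>M\<^esub> f x)" for f
  \<comment> \<open>The sum over the support may be taken over any finite larger index set.
    Additivity needs this, since the supports of \<open>f\<close>, of \<open>g\<close> and of their
    sum differ.\<close>
  have *: "h f = (\<Oplus>\<^bsub>M\<^esub>x\<in>A. v x \<star>\<^bsub>M\<^esub> f x)"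
    if "f \<in> carrier (free_rmod R X)" "finite A" "?S f \<subseteq> A" "A \<subseteq> X" for f A
    unfolding h_def using that v
    by (intro M.M.add.finprod_mono_neutral_cong_left)
      (auto simp: free_rmod_simps M.ract_zero intro!: M.ract_closed)
  have S: "finite (?S f)" "?S f \<subseteq> X" "\<And>x. f x \<in> carrier R" if "f \<in> carrier (free_rmod R X)" for f
    using that by (auto simp: free_rmod_simps)
  interpret F: right_module R "free_rmod R X" by (rule free_rmod_module) (rule M.R.ring_axioms)
  have "h \<in> rmod_hom R (free_rmod R X) M"
  proof (rule rmod_homI)
    fix f assume f: "f \<in> carrier (free_rmod R X)"
    show "h f \<in> carrier M"
      unfolding h_def using S[OF f] v by (auto intro!: M.M.finsum_closed M.ract_closed)
  next
    fix f g assume f: "f \<in> carrier (free_rmod R X)" and g: "g \<in> carrier (free_rmod R X)"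
    let ?A = "?S f \<union> ?S g"
    have A: "finite ?A" "?A \<subseteq> X" using S f g by auto
    have "h (f \<oplus>\<^bsub>free_rmod R X\<^esub> g) = (\<Oplus>\<^bsub>M\<^esub>x\<in>?A. v x \<star>\<^bsub>M\<^esub> (f x \<oplus>\<^bsub>R\<^esub> g x))"
    proof -
      have "?S (f \<oplus>\<^bsub>free_rmod R X\<^esub> g) \<subseteq> ?A" by (auto simp: free_rmod_simps)
      then show ?thesis using *[OF F.M.a_closed[OF f g] A(1) _ A(2)] by (simp only: free_rmod_simps)
    qed
    also have "\<dots> = (\<Oplus>\<^bsub>M\<^esub>x\<in>?A. v x \<star>\<^bsub>M\<^esub> f x \<oplus>\<^bsub>M\<^esub> v x \<star>\<^bsub>M\<^esub> g x)"
      using A S f g v by (intro M.M.finsum_cong') (auto simp: M.ract_add_right subset_iff intro!: M.ract_closed M.M.a_closed)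
    also have "\<dots> = (\<Oplus>\<^bsub>M\<^esub>x\<in>?A. v x \<star>\<^bsub>M\<^esub> f x) \<oplus>\<^bsub>M\<^esub> (\<Oplus>\<^bsub>M\<^esub>x\<in>?A. v x \<star>\<^bsub>M\<^esub> g x)"
      using A S f g v by (intro M.M.finsum_addf) (auto simp: subset_iff intro!: M.ract_closed)
    also have "\<dots> = h f \<oplus>\<^bsub>M\<^esub> h g" using *[OF f A(1)] *[OF g A(1)] A by auto
    finally show "h (f \<oplus>\<^bsub>free_rmod R X\<^esub> g) = h f \<oplus>\<^bsub>M\<^esub> h g" .
  next
    fix f a assume f: "f \<in> carrier (free_rmod R X)" and a: "a \<in> carrier R"
    have sum: "(\<Oplus>\<^bsub>M\<^esub>x\<in>A. v x \<star>\<^bsub>M\<^esub> (f x \<otimes>\<^bsub>R\<^esub> a)) = (\<Oplus>\<^bsub>M\<^esub>x\<in>A. v x \<star>\<^bsub>M\<^esub> f x) \<star>\<^bsub>M\<^esub> a"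
      if "finite A" "A \<subseteq> X" for A
      using that
    proof (induction A rule: finite_induct)
      case empty
      then show ?case using a by (simp add: M.zero_ract)
    next
      case (insert y A)
      have c: "v x \<star>\<^bsub>M\<^esub> f x \<in> carrier M" "v x \<star>\<^bsub>M\<^esub> (f x \<otimes>\<^bsub>R\<^esub> a) \<in> carrier M" if "x \<in> insert y A" for x
        using insert.prems that v a S(3)[OF f] by (auto intro!: M.ract_closed M.R.m_closed)
      have "(\<Oplus>\<^bsub>M\<^esub>x\<in>insert y A. v x \<star>\<^bsub>M\<^esub> (f x \<otimes>\<^bsub>R\<^esub> a))
        = v y \<star>\<^bsub>M\<^esub> (f y \<otimes>\<^bsub>R\<^esub> a) \<oplus>\<^bsub>M\<^esub> (\<Oplus>\<^bsub>M\<^esub>x\<in>A. v x \<star>\<^bsub>M\<^esub> (f x \<otimes>\<^bsub>R\<^esub> a))"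
        using insert.hyps c by (intro M.M.finsum_insert) auto
      also have "\<dots> = (v y \<star>\<^bsub>M\<^esub> f y) \<star>\<^bsub>M\<^esub> a \<oplus>\<^bsub>M\<^esub> (\<Oplus>\<^bsub>M\<^esub>x\<in>A. v x \<star>\<^bsub>M\<^esub> f x) \<star>\<^bsub>M\<^esub> a"
        using insert v a S(3)[OF f] by (simp add: M.ract_assoc)
      also have "\<dots> = (v y \<star>\<^bsub>M\<^esub> f y \<oplus>\<^bsub>M\<^esub> (\<Oplus>\<^bsub>M\<^esub>x\<in>A. v x \<star>\<^bsub>M\<^esub> f x)) \<star>\<^bsub>M\<^esub> a"
        using c a by (intro M.ract_add_left[symmetric] M.M.finsum_closed) auto
      also have "v y \<star>\<^bsub>M\<^esub> f y \<oplus>\<^bsub>M\<^esub> (\<Oplus>\<^bsub>M\<^esub>x\<in>A. v x \<star>\<^bsub>M\<^esub> f x) = (\<Oplus>\<^bsub>M\<^esub>x\<in>insert y A. v x \<star>\<^bsub>M\<^esub> f x)"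
        using insert.hyps c by (intro M.M.finsum_insert[symmetric]) auto
      finally show ?case .
    qed
    have "h (f \<star>\<^bsub>free_rmod R X\<^esub> a) = (\<Oplus>\<^bsub>M\<^esub>x\<in>?S f. v x \<star>\<^bsub>M\<^esub> (f x \<otimes>\<^bsub>R\<^esub> a))"
    proof -
      have "?S (f \<star>\<^bsub>free_rmod R X\<^esub> a) \<subseteq> ?S f" using a by (auto simp: free_rmod_simps)
      then show ?thesis using *[OF F.ract_closed[OF f a] S(1)[OF f] _ S(2)[OF f]] by (simp only: free_rmod_simps)
    qed
    also have "\<dots> = h f \<star>\<^bsub>M\<^esub> a" unfolding h_def using sum S[OF f] by auto
    finally show "h (f \<star>\<^bsub>free_rmod R X\<^esub> a) = h f \<star>\<^bsub>M\<^esub> a" .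
  qed
  moreover have "h (unit_vec R x) = v x" if "x \<in> X" for x
  proof -
    have "h (unit_vec R x) = (\<Oplus>\<^bsub>M\<^esub>y\<in>{x}. v y \<star>\<^bsub>M\<^esub> unit_vec R x y)"
      by (rule *) (use that in \<open>auto simp: unit_vec_def intro!: unit_vec_closed M.R.ring_axioms\<close>)
    also have "\<dots> = v x"
      using that v by (subst M.M.finsum_insert)
        (auto simp: unit_vec_def M.ract_one)
    finally show ?thesis .
  qed
  ultimately show ?thesis by (intro bexI[of _ h]) simp_all
qed

text \<open>Stated with an inclusion of images instead of surjectivity of \<open>g\<close>, so that
  no target has to be cut down to an image first. \<open>projective_lift\<close> keeps this
  form.\<close>

lemma free_lift:
  assumes Y: "right_module R Y" and Z: "right_module R Z"
    and g: "g \<in> rmod_hom R Y Z" and h: "h \<in> rmod_hom R (free_rmod R X) Z"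
    and surj: "h ` carrier (free_rmod R X) \<subseteq> g ` carrier Y"
  shows "\<exists>l\<in>rmod_hom R (free_rmod R X) Y. \<forall>x\<in>carrier (free_rmod R X). g (l x) = h x"
proof -
  have R: "ring R" using Y right_module_ring by auto
  have "\<forall>x\<in>X. \<exists>y\<in>carrier Y. g y = h (unit_vec R x)"
  proof
    fix x assume "x \<in> X"
    then have "h (unit_vec R x) \<in> g ` carrier Y"
      by (intro subsetD[OF surj imageI] unit_vec_closed[OF R])
    then show "\<exists>y\<in>carrier Y. g y = h (unit_vec R x)" by (metis imageE)
  qed
  then obtain v where v: "\<And>x. x \<in> X \<Longrightarrow> v x \<in> carrier Y" "\<And>x. x \<in> X \<Longrightarrow> g (v x) = h (unit_vec R x)"
    by metis
  obtain l where l: "l \<in> rmod_hom R (free_rmod R X) Y" "\<forall>x\<in>X. l (unit_vec R x) = v x"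
    using free_universal[OF Y, of X v] v(1) by auto
  have "g (l f) = h f" if f: "f \<in> carrier (free_rmod R X)" for f
  proof (rule free_hom_eq[OF Z hom_comp[OF l(1) g] h _ f])
    fix x assume "x \<in> X"
    then show "g (l (unit_vec R x)) = h (unit_vec R x)" using l(2) v(2) by simp
  qed
  with l(1) show ?thesis by blast
qed

lemma projective_lift:
  fixes P :: "('r, 'p, 'z) rmod_scheme"
  assumes P: "projective_rmod R P" and Y: "right_module R Y" and Z: "right_module R Z"
    and g: "g \<in> rmod_hom R Y Z" and h: "h \<in> rmod_hom R P Z"
    and surj: "h ` carrier P \<subseteq> g ` carrier Y"
  shows "\<exists>l\<in>rmod_hom R P Y. \<forall>x\<in>carrier P. g (l x) = h x"
proof -
  obtain X :: "'p set" and i p where i: "i \<in> rmod_hom R P (free_rmod R X)"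
    and p: "p \<in> rmod_hom R (free_rmod R X) P" and pi: "\<forall>x\<in>carrier P. p (i x) = x"
    using P unfolding projective_rmod_def by blast
  have "(\<lambda>x. h (p x)) ` carrier (free_rmod R X) \<subseteq> g ` carrier Y"
    using surj hom_closed[OF p] by (auto simp: image_subset_iff)
  then obtain l where l: "l \<in> rmod_hom R (free_rmod R X) Y"
    "\<forall>x\<in>carrier (free_rmod R X). g (l x) = h (p x)"
    using free_lift[OF Y Z g hom_comp[OF p h]] by blast
  show ?thesis
    by (rule bexI[OF _ hom_comp[OF i l(1)]]) (use l(2) hom_closed[OF i] pi in simp)
qed

text \<open>The definition of projectivity confines index sets to the type of \<open>P\<close>;
  accordingly the surjection to be split starts from the free module on the elements of
  \<open>P\<close>.\<close>

lemma projectiveI: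
  assumes P: "right_module R P"
    and l: "\<And>p. p \<in> rmod_hom R (free_rmod R (carrier P)) P \<Longrightarrow>
      p ` carrier (free_rmod R (carrier P)) = carrier P \<Longrightarrow>
      \<exists>i\<in>rmod_hom R P (free_rmod R (carrier P)). \<forall>x\<in>carrier P. p (i x) = x"
  shows "projective_rmod R P"
proof -
  obtain p where p: "p \<in> rmod_hom R (free_rmod R (carrier P)) P"
    "\<forall>x\<in>carrier P. p (unit_vec R x) = x"
    using free_universal[OF P, of "carrier P" "\<lambda>x. x"] by auto
  have "p ` carrier (free_rmod R (carrier P)) = carrier P"
  proof
    show "carrier P \<subseteq> p ` carrier (free_rmod R (carrier P))"
    proof
      fix x assume x: "x \<in> carrier P"
      have "p (unit_vec R x) \<in> p ` carrier (free_rmod R (carrier P))"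
        by (intro imageI unit_vec_closed[OF right_module_ring[OF P]] x)
      then show "x \<in> p ` carrier (free_rmod R (carrier P))" using p(2) x by simp
    qed
  qed (use hom_closed[OF p(1)] in auto)
  then show ?thesis using l[OF p(1)] P p(1) unfolding projective_rmod_def by blast
qed

section \<open>Submodules of free modules over a hereditary ring\<close>

lemma right_hereditary_projective:
  "right_hereditary R \<Longrightarrow> rsubmodule R (regular_rmod R) I
    \<Longrightarrow> projective_rmod R (sub (regular_rmod R) I)"
  by (simp add: right_hereditary_def)

lemma regular_rmod_simps:
  "carrier (regular_rmod R) = carrier R" "\<zero>\<^bsub>regular_rmod R\<^esub> = \<zero>\<^bsub>R\<^esub>"
  "x \<oplus>\<^bsub>regular_rmod R\<^esub> y = x \<oplus>\<^bsub>R\<^esub> y" "x \<star>\<^bsub>regular_rmod R\<^esub> y = x \<otimes>\<^bsub>R\<^esub> y"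
  by (auto simp: regular_rmod_def)

lemma regular_rmod_module:
  assumes "ring R"
  shows "right_module R (regular_rmod R)"
proof -
  interpret R: ring R by fact
  show ?thesis
  proof (rule right_moduleI)
    show "\<exists>y\<in>carrier (regular_rmod R). y \<oplus>\<^bsub>regular_rmod R\<^esub> x = \<zero>\<^bsub>regular_rmod R\<^esub>"
      if "x \<in> carrier (regular_rmod R)" for x
      using that by (intro bexI[of _ "\<ominus>\<^bsub>R\<^esub> x"]) (auto simp: regular_rmod_simps R.l_neg)
  qed (auto simp: regular_rmod_simps assms R.a_ac R.l_distr R.r_distr R.m_assoc)
qed

lemma coord_hom: "(\<lambda>f. f x) \<in> rmod_hom R (free_rmod R X) (regular_rmod R)"
  by (rule rmod_homI) (auto simp: regular_rmod_simps free_rmod_simps)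

text \<open>Kaplansky's argument, splitting off the last coordinate.\<close>

lemma hereditary_submodule_lift:
  fixes R :: "('r, 'k) ring_scheme" and n :: nat
  assumes her: "right_hereditary R" and K: "rsubmodule R (free_rmod R {..<n}) K"
    and Y: "right_module R Y" and Z: "right_module R Z"
    and g: "g \<in> rmod_hom R Y Z" and h: "h \<in> rmod_hom R (sub (free_rmod R {..<n}) K) Z"
    and surj: "h ` K \<subseteq> g ` carrier Y"
  shows "\<exists>l\<in>rmod_hom R (sub (free_rmod R {..<n}) K) Y. \<forall>x\<in>K. g (l x) = h x"
proof -
  have R: "ring R" using Y right_module_ring by auto
  interpret Y: right_module R Y by fact
  interpret Z: right_module R Z by fact
  show ?thesis
    using K h surj
  \<comment> \<open>\<open>K\<close> and \<open>h\<close> vary: the hypothesis is applied to the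
    vectors of \<open>K\<close> whose last coordinate is zero.\<close>
  proof (induction n arbitrary: K h)
    case 0
    interpret F: right_module R "free_rmod R {..<0}" by (rule free_rmod_module[OF R])
    interpret K: right_module R "sub (free_rmod R {..<0}) K" by (rule F.right_module_sub[OF 0(1)])
    have "K \<subseteq> {\<zero>\<^bsub>free_rmod R {..<0}\<^esub>}"
      using rsubmoduleD(1)[OF 0(1)] by (auto simp: free_rmod_simps subset_iff fun_eq_iff)
    then have "h x = \<zero>\<^bsub>Z\<^esub>" if "x \<in> K" for x
      using that hom_zero[OF K.M.abelian_group_axioms Z.M.abelian_group_axioms 0(2)] by auto
    moreover have "g \<zero>\<^bsub>Y\<^esub> = \<zero>\<^bsub>Z\<^esub>" by (rule hom_zero[OF Y.M.abelian_group_axioms Z.M.abelian_group_axioms g])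
    ultimately show ?case by (intro bexI[of _ "\<lambda>_. \<zero>\<^bsub>Y\<^esub>"] hom_zero_map Y) auto
  next
    case (Suc n)
    let ?F = "free_rmod R {..<Suc n}" and ?G = "free_rmod R {..<n}"
    let ?c = "\<lambda>f :: nat \<Rightarrow> 'r. f n"
    interpret F: right_module R ?F by (rule free_rmod_module[OF R])
    interpret K: right_module R "sub ?F K" by (rule F.right_module_sub[OF Suc.prems(1)])
    interpret G: right_module R ?G by (rule free_rmod_module[OF R])
    interpret R1: right_module R "regular_rmod R" by (rule regular_rmod_module[OF R])
    define I where "I = ?c ` K"
    have c: "?c \<in> rmod_hom R ?F (regular_rmod R)" by (rule coord_hom)
    have I: "rsubmodule R (regular_rmod R) I"
      unfolding I_def by (rule rsubmodule_image[OF F.right_module_axioms R1.right_module_axioms c Suc.prems(1)])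
    interpret I: right_module R "sub (regular_rmod R) I" by (rule R1.right_module_sub[OF I])
    have P: "projective_rmod R (sub (regular_rmod R) I)" using right_hereditary_projective[OF her I] .
    have cK: "?c \<in> rmod_hom R (sub ?F K) (sub (regular_rmod R) I)"
      using hom_sub_cod[OF hom_sub_dom[OF c rsubmoduleD(1)[OF Suc.prems(1)]]] by (auto simp: I_def)
    \<comment> \<open>The last coordinates of \<open>K\<close> form a right ideal \<open>I\<close>,
      projective by heredity, so the coordinate map from \<open>K\<close> onto \<open>I\<close> has
      a section \<open>s\<close>.\<close>
    obtain s where s: "s \<in> rmod_hom R (sub (regular_rmod R) I) (sub ?F K)" "\<forall>a\<in>I. s a n = a"
      using projective_lift[OF P K.right_module_axioms I.right_module_axioms cK I.hom_id]
      by (auto simp: I_def)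
    define K0 where "K0 = {x \<in> K. x n = \<zero>\<^bsub>R\<^esub>}"
    have K0F: "rsubmodule R (sub ?F K) K0"
      using rsubmodule_kernel[OF K.right_module_axioms I.right_module_axioms cK]
      by (simp add: K0_def regular_rmod_simps)
    have K0car: "K0 \<subseteq> carrier ?G"
      using rsubmoduleD(1)[OF Suc.prems(1)] unfolding K0_def
      by (auto simp: free_rmod_simps subset_iff less_Suc_eq)
    \<comment> \<open>The free modules of rank n and n + 1 share their operations and their zero;
      only the carriers differ. So \<open>K0\<close> is a submodule of both without any
      transport.\<close>
    have simps: "add ?G = add ?F" "ract ?G = ract ?F" "\<zero>\<^bsub>?G\<^esub> = \<zero>\<^bsub>?F\<^esub>"
      by (auto simp: free_rmod_def)
    have K0: "rsubmodule R ?G K0"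
      using rsubmoduleD[OF K0F] K0car by (intro G.rsubmoduleI) (auto simp: simps)
    have h0: "h \<in> rmod_hom R (sub ?G K0) Z"
      using Suc.prems(2) by (auto simp: rmod_hom_def simps K0_def)
    obtain l0 where l0: "l0 \<in> rmod_hom R (sub ?G K0) Y" "\<forall>x\<in>K0. g (l0 x) = h x"
      using Suc.IH[OF K0 h0] Suc.prems(3) by (auto simp: K0_def)
    then have l0': "l0 \<in> rmod_hom R (sub ?F K0) Y" by (auto simp: rmod_hom_def simps)
    have hs: "(\<lambda>a. h (s a)) \<in> rmod_hom R (sub (regular_rmod R) I) Z" by (rule hom_comp[OF s(1) Suc.prems(2)])
    have "(\<lambda>a. h (s a)) ` I \<subseteq> g ` carrier Y" using Suc.prems(3) hom_closed[OF s(1)] by auto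
    then obtain l1 where l1: "l1 \<in> rmod_hom R (sub (regular_rmod R) I) Y" "\<forall>a\<in>I. g (l1 a) = h (s a)"
      using projective_lift[OF P Y Z g hs] by auto
    have d: "(\<lambda>x. x \<ominus>\<^bsub>sub ?F K\<^esub> s (x n)) \<in> rmod_hom R (sub ?F K) (sub ?F K)"
      by (rule K.hom_minus[OF K.hom_id hom_comp[OF cK s(1)]])
    have dK: "x \<ominus>\<^bsub>sub ?F K\<^esub> s (x n) \<in> K0" if "x \<in> K" for x
    proof -
      have 1: "s (x n) \<in> K" using hom_closed[OF s(1), of "x n"] that by (auto simp: I_def)
      have "(x \<ominus>\<^bsub>sub ?F K\<^esub> s (x n)) n = x n \<ominus>\<^bsub>sub (regular_rmod R) I\<^esub> s (x n) n"
        using hom_diff[OF K.M.abelian_group_axioms I.M.abelian_group_axioms cK, of x "s (x n)"] that 1 by auto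
      also have "s (x n) n = x n" using s(2) that by (auto simp: I_def)
      also have "x n \<ominus>\<^bsub>sub (regular_rmod R) I\<^esub> x n = \<zero>\<^bsub>R\<^esub>"
        using I.diff_eq_zero[of "x n" "x n"] that by (auto simp: I_def regular_rmod_simps)
      finally show ?thesis using K.M.minus_closed[of x "s (x n)"] that 1 by (auto simp: K0_def)
    qed
    have d': "(\<lambda>x. x \<ominus>\<^bsub>sub ?F K\<^esub> s (x n)) \<in> rmod_hom R (sub ?F K) (sub ?F K0)"
      using hom_sub_cod[OF d, of K0] dK by (auto simp: image_subset_iff)
    \<comment> \<open>\<open>K\<close> is the direct sum of \<open>K0\<close> and the image of
      \<open>s\<close>: the lift is \<open>l0\<close> on x - s (x n) plus \<open>l1\<close> on the
      last coordinate.\<close>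
    define l where "l x = l0 (x \<ominus>\<^bsub>sub ?F K\<^esub> s (x n)) \<oplus>\<^bsub>Y\<^esub> l1 (x n)" for x
    have "l \<in> rmod_hom R (sub ?F K) Y"
      unfolding l_def using Y.hom_plus[OF hom_comp[OF d' l0'] hom_comp[OF cK l1(1)]] by simp
    moreover have "g (l x) = h x" if x: "x \<in> K" for x
    proof -
      have 1: "x n \<in> I" using x by (auto simp: I_def)
      have 2: "s (x n) \<in> K" using hom_closed[OF s(1), of "x n"] 1 by auto
      have "g (l x) = g (l0 (x \<ominus>\<^bsub>sub ?F K\<^esub> s (x n))) \<oplus>\<^bsub>Z\<^esub> g (l1 (x n))"
        unfolding l_def using hom_closed[OF l0'] hom_closed[OF l1(1)] dK[OF x] 1 by (intro hom_add[OF g]) auto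
      also have "\<dots> = h (x \<ominus>\<^bsub>sub ?F K\<^esub> s (x n)) \<oplus>\<^bsub>Z\<^esub> h (s (x n))"
        using l0(2) l1(2) dK[OF x] 1 by simp
      also have "\<dots> = h x"
        using hom_add[OF Suc.prems(2), of "x \<ominus>\<^bsub>sub ?F K\<^esub> s (x n)" "s (x n)"] K.diff_add[of x "s (x n)"]
          dK[OF x] x 2 by (auto simp: K0_def)
      finally show ?thesis .
    qed
    ultimately show ?case by blast
  qed
qed

text \<open>Projectivity is defined relative to the element type, so a copy \<open>P\<close> in
  another type needs its own splitting; the lifting property is carried along the isomorphism. With
  \<open>P\<close> the submodule itself, this is projectivity of submodules of R^n.\<close>

lemma hereditary_submodule_projective_iso:
  fixes n :: nat
  assumes her: "right_hereditary R" and K: "rsubmodule R (free_rmod R {..<n}) K"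
    and P: "right_module R P" and iso: "rmod_iso R (sub (free_rmod R {..<n}) K) P"
  shows "projective_rmod R P"
proof (rule projectiveI[OF P])
  have R: "ring R" using P right_module_ring by auto
  let ?S = "sub (free_rmod R {..<n}) K" and ?F = "free_rmod R (carrier P)"
  interpret S: right_module R ?S
    by (rule right_module.right_module_sub[OF free_rmod_module[OF R] K])
  fix p assume p: "p \<in> rmod_hom R ?F P" "p ` carrier ?F = carrier P"
  obtain u where u: "u \<in> rmod_hom R ?S P" "bij_betw u (carrier ?S) (carrier P)"
    using iso by (auto simp: rmod_iso_def)
  let ?v = "inv_into (carrier ?S) u"
  have v: "?v \<in> rmod_hom R P ?S" by (rule inverse_hom[OF S.right_module_axioms u])
  have "u ` K \<subseteq> p ` carrier ?F" using p(2) hom_closed[OF u(1)] by auto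
  then obtain l where l: "l \<in> rmod_hom R ?S ?F" "\<forall>x\<in>K. p (l x) = u x"
    using hereditary_submodule_lift[OF her K free_rmod_module[OF R] P p(1) u(1)] by blast
  have "p (l (?v x)) = x" if "x \<in> carrier P" for x
    using l(2) hom_closed[OF v that] u(2) that by (simp add: bij_betw_def f_inv_into_f)
  then show "\<exists>i\<in>rmod_hom R P ?F. \<forall>x\<in>carrier P. p (i x) = x"
    by (intro bexI[OF _ hom_comp[OF v l(1)]]) blast
qed

subsection \<open>Finitely presented modules\<close>

lemma rspan_image:
  assumes M: "right_module R M" and N: "right_module R N" and h: "h \<in> rmod_hom R M N"
    and X: "X \<subseteq> carrier M"
  shows "h ` rspan R M X = rspan R N (h ` X)"
proof
  have hX: "h ` X \<subseteq> carrier N" using X hom_closed[OF h] by auto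
  show "rspan R N (h ` X) \<subseteq> h ` rspan R M X"
    by (intro right_module.rspan_least[OF N] rsubmodule_image[OF M N h]
        right_module.rspan_rsubmodule[OF M X] image_mono right_module.rspan_superset[OF M])
  let ?V = "{x \<in> carrier M. h x \<in> rspan R N (h ` X)}"
  have "rspan R M X \<subseteq> ?V"
    by (rule right_module.rspan_least[OF M rsubmodule_vimage[OF M N h right_module.rspan_rsubmodule[OF N hX]]])
      (use X right_module.rspan_superset[OF N] in blast)
  then show "h ` rspan R M X \<subseteq> rspan R N (h ` X)" by auto
qed

lemma fin_gen_rsubmodule: "right_module R M \<Longrightarrow> fin_gen R M N \<Longrightarrow> rsubmodule R M N"
  by (auto simp: fin_gen_def right_module.rspan_rsubmodule)

lemma fin_gen_image:
  assumes "right_module R M" "right_module R N" "h \<in> rmod_hom R M N" "fin_gen R M K"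
  shows "fin_gen R N (h ` K)"
proof -
  obtain X where X: "finite X" "X \<subseteq> carrier M" "K = rspan R M X"
    using assms(4) by (auto simp: fin_gen_def)
  show ?thesis unfolding fin_gen_def X(3) rspan_image[OF assms(1-3) X(2)]
    by (rule exI[of _ "h ` X"]) (use X hom_closed[OF assms(3)] in auto)
qed

text \<open>Lifts \<open>W\<close> of generators of the image and generators \<open>U\<close> of the
  kernel part together span \<open>K\<close>: each y agrees under \<open>h\<close> with some w in
  the span of \<open>W\<close>, and y - w lies in the span of \<open>U\<close>.\<close>

lemma fin_gen_extension:
  assumes Y: "right_module R Y" and Z: "right_module R Z" and h: "h \<in> rmod_hom R Y Z"
    and K: "rsubmodule R Y K"
    and im: "fin_gen R Z (h ` K)" and ker: "fin_gen R Y {y \<in> K. h y = \<zero>\<^bsub>Z\<^esub>}"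
  shows "fin_gen R Y K"
proof -
  interpret Y: right_module R Y by fact
  interpret Z: right_module R Z by fact
  obtain V where V: "finite V" "V \<subseteq> carrier Z" "h ` K = rspan R Z V"
    using im by (auto simp: fin_gen_def)
  obtain U where U: "finite U" "U \<subseteq> carrier Y" "{y \<in> K. h y = \<zero>\<^bsub>Z\<^esub>} = rspan R Y U"
    using ker by (auto simp: fin_gen_def)
  have "V \<subseteq> h ` K" using V(3) Z.rspan_superset by auto
  then obtain W where W: "finite W" "W \<subseteq> K" "V = h ` W"
    using finite_subset_image[OF V(1), of h K] by auto
  have UK: "U \<subseteq> K" using U(3) Y.rspan_superset by blast
  have WY: "W \<subseteq> carrier Y" using W rsubmoduleD[OF K] by auto
  let ?S = "rspan R Y (U \<union> W)"
  have UW: "U \<union> W \<subseteq> carrier Y" using U(2) WY by auto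
  have S: "rsubmodule R Y ?S" by (rule Y.rspan_rsubmodule[OF UW])
  have "K \<subseteq> ?S"
  proof
    fix y assume y: "y \<in> K"
    have "h y \<in> rspan R Z V" using y V(3) by auto
    also have "rspan R Z V = h ` rspan R Y W" unfolding W(3)
      by (rule rspan_image[symmetric, OF Y Z h WY])
    finally obtain w where w: "w \<in> rspan R Y W" "h y = h w" by auto
    have wK: "w \<in> K" using Y.rspan_least[OF K W(2)] w(1) by auto
    have wS: "w \<in> ?S" using Y.rspan_least[OF S, of W] Y.rspan_superset[of "U \<union> W"] w(1) by auto
    have c: "y \<in> carrier Y" "w \<in> carrier Y" using rsubmoduleD(5)[OF K] y wK by auto
    have "h (y \<ominus>\<^bsub>Y\<^esub> w) = \<zero>\<^bsub>Z\<^esub>"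
      using hom_diff[OF Y.M.abelian_group_axioms Z.M.abelian_group_axioms h c] w(2)
        Z.diff_eq_zero[of "h w" "h w"] hom_closed[OF h c(2)] by simp
    then have "y \<ominus>\<^bsub>Y\<^esub> w \<in> rspan R Y U"
      using Y.rsubmodule_diff[OF K y wK] unfolding U(3)[symmetric] by simp
    then have "y \<ominus>\<^bsub>Y\<^esub> w \<in> ?S" using Y.rspan_least[OF S, of U] Y.rspan_superset[of "U \<union> W"] by auto
    then show "y \<in> ?S" using rsubmoduleD(3)[OF S _ wS] Y.diff_add[OF c] by fastforce
  qed
  moreover have "?S \<subseteq> K" using Y.rspan_least[OF K] UK W(2) by auto
  ultimately have "K = ?S" by auto
  then show ?thesis unfolding fin_gen_def using UW U(1) W(1) by blast
qed

text \<open>Horseshoe argument: R^n onto \<open>A\<close> and a lift of R^m onto \<open>C\<close>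
  combine to a map from R^(n+m) onto \<open>B\<close>. Its kernel is an extension of the kernel over
  \<open>C\<close> by the kernel over \<open>A\<close>, hence finitely generated.\<close>

lemma fin_presented_extension:
  assumes A: "fin_presented R A" and C: "fin_presented R C" and B: "right_module R B"
    and ex: "short_exact R A f B g C"
  shows "fin_presented R B"
proof -
  obtain n :: nat and p where p: "p \<in> rmod_hom R (free_rmod R {..<n}) A"
    "p ` carrier (free_rmod R {..<n}) = carrier A"
    "fin_gen R (free_rmod R {..<n}) (a_kernel (free_rmod R {..<n}) A p)"
    using A unfolding fin_presented_def by blast
  obtain m :: nat and r where r: "r \<in> rmod_hom R (free_rmod R {..<m}) C"
    "r ` carrier (free_rmod R {..<m}) = carrier C"
    "fin_gen R (free_rmod R {..<m}) (a_kernel (free_rmod R {..<m}) C r)"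
    using C unfolding fin_presented_def by blast
  let ?N = "free_rmod R {..<n}" and ?M = "free_rmod R {..<m}" and ?F = "free_rmod R {..<n + m}"
  have R: "ring R" using B right_module_ring by auto
  interpret R: ring R by fact
  interpret A: right_module R A using A by (simp add: fin_presented_def)
  interpret B: right_module R B by fact
  interpret C: right_module R C using C by (simp add: fin_presented_def)
  interpret N: right_module R ?N by (rule free_rmod_module[OF R])
  interpret M: right_module R ?M by (rule free_rmod_module[OF R])
  interpret F: right_module R ?F by (rule free_rmod_module[OF R])
  have f: "f \<in> rmod_hom R A B" "inj_on f (carrier A)" and g: "g \<in> rmod_hom R B C" "g ` carrier B = carrier C"
    and fg: "f ` carrier A = {y \<in> carrier B. g y = \<zero>\<^bsub>C\<^esub>}"
    using ex by (auto simp: short_exact_def a_kernel_eq)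
  obtain l where l: "l \<in> rmod_hom R ?M B" "\<forall>x\<in>carrier ?M. g (l x) = r x"
    using free_lift[OF B.right_module_axioms C.right_module_axioms g(1) r(1)] r(2) g(2) by auto
  \<comment> \<open>\<open>a\<close> and \<open>b\<close> cut a vector into its first n and its last
    m coordinates; \<open>e\<close> joins two blocks again, the second one shifted by n.\<close>
  define a where "a x = (\<lambda>i. if i < n then x i else \<zero>\<^bsub>R\<^esub>)" for x :: "nat \<Rightarrow> 'a"
  define b where "b x = (\<lambda>i. x (i + n))" for x :: "nat \<Rightarrow> 'a"
  define e where "e u v = (\<lambda>i. if i < n then u i else v (i - n))" for u v :: "nat \<Rightarrow> 'a"
  have a: "a \<in> rmod_hom R ?F ?N"
    by (rule rmod_homI) (auto simp: a_def free_rmod_simps intro: finite_subset[of _ "{..<n}"])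
  have fin: "finite {i. x (i + n) \<noteq> \<zero>\<^bsub>R\<^esub>}" if "\<forall>i. \<not> i < n + m \<longrightarrow> x i = \<zero>\<^bsub>R\<^esub>" for x :: "nat \<Rightarrow> 'a"
  proof (rule finite_subset)
    show "{i. x (i + n) \<noteq> \<zero>\<^bsub>R\<^esub>} \<subseteq> {..<m}"
    proof
      fix i assume "i \<in> {i. x (i + n) \<noteq> \<zero>\<^bsub>R\<^esub>}"
      then have "i + n < n + m" using that by blast
      then show "i \<in> {..<m}" by simp
    qed
  qed simp
  have b: "b \<in> rmod_hom R ?F ?M"
    by (rule rmod_homI) (auto simp: b_def free_rmod_simps fin)
  have ecl: "e u v \<in> carrier ?F" if "u \<in> carrier ?N" "v \<in> carrier ?M" for u v
  proof -
    have "{i. e u v i \<noteq> \<zero>\<^bsub>R\<^esub>} \<subseteq> {..<n + m}"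
    proof
      fix i assume "i \<in> {i. e u v i \<noteq> \<zero>\<^bsub>R\<^esub>}"
      then have "i < n \<or> \<not> i < n \<and> i - n < m"
        using that by (auto simp: e_def free_rmod_simps split: if_splits)
      then show "i \<in> {..<n + m}" by auto
    qed
    then show ?thesis
      using that finite_subset[of "{i. e u v i \<noteq> \<zero>\<^bsub>R\<^esub>}" "{..<n+m}"] by (auto simp: free_rmod_simps e_def)
  qed
  have ab: "a (e u v) = u" "b (e u v) = v" if "u \<in> carrier ?N" "v \<in> carrier ?M" for u v
    using that by (auto simp: a_def b_def e_def free_rmod_simps fun_eq_iff)
  have eab: "e (a x) (b x) = x" for x by (auto simp: a_def b_def e_def fun_eq_iff)
  define \<pi> where "\<pi> x = f (p (a x)) \<oplus>\<^bsub>B\<^esub> l (b x)" for x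
  have \<pi>: "\<pi> \<in> rmod_hom R ?F B"
    unfolding \<pi>_def by (intro B.hom_plus hom_comp[OF a hom_comp[OF p(1) f(1)]] hom_comp[OF b l(1)])
  have fp: "f (p u) \<in> carrier B" "g (f (p u)) = \<zero>\<^bsub>C\<^esub>" if "u \<in> carrier ?N" for u
    using hom_closed[OF p(1) that] fg by auto
  have lB: "l v \<in> carrier B" if "v \<in> carrier ?M" for v using hom_closed[OF l(1) that] .
  have pre: "\<exists>u\<in>carrier ?N. f (p u) = y" if "y \<in> carrier B" "g y = \<zero>\<^bsub>C\<^esub>" for y
  proof -
    have "y \<in> f ` carrier A" using that fg by simp
    then obtain z where "z \<in> carrier A" "y = f z" by auto
    moreover have "z \<in> p ` carrier ?N" using p(2) \<open>z \<in> carrier A\<close> by simp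
    ultimately show ?thesis by auto
  qed
  have surj: "\<pi> ` carrier ?F = carrier B"
  proof
    show "carrier B \<subseteq> \<pi> ` carrier ?F"
    proof
      fix y assume y: "y \<in> carrier B"
      have "g y \<in> r ` carrier ?M" using hom_closed[OF g(1) y] r(2) by simp
      then obtain v where v: "v \<in> carrier ?M" "g y = r v" by auto
      have "g (y \<ominus>\<^bsub>B\<^esub> l v) = \<zero>\<^bsub>C\<^esub>"
        using hom_diff[OF B.M.abelian_group_axioms C.M.abelian_group_axioms g(1) y lB[OF v(1)]] v l(2)
          C.diff_eq_zero[of "r v" "r v"] hom_closed[OF r(1) v(1)] by simp
      then obtain u where u: "u \<in> carrier ?N" "f (p u) = y \<ominus>\<^bsub>B\<^esub> l v"
        using pre y lB[OF v(1)] by (metis B.M.minus_closed)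
      have "\<pi> (e u v) = y"
        using ab[OF u(1) v(1)] u(2) B.diff_add[OF y lB[OF v(1)]] by (simp add: \<pi>_def)
      then show "y \<in> \<pi> ` carrier ?F" using ecl[OF u(1) v(1)] by blast
    qed
  qed (use hom_closed[OF \<pi>] in auto)
  let ?K = "{x \<in> carrier ?F. \<pi> x = \<zero>\<^bsub>B\<^esub>}"
  have K: "rsubmodule R ?F ?K" by (rule rsubmodule_kernel[OF F.right_module_axioms B.right_module_axioms \<pi>])
  \<comment> \<open>Projection to the last m coordinates reaches the whole kernel of
    \<open>r\<close>: for v in it, \<open>l v\<close> comes from \<open>A\<close> and can be
    cancelled in the first block.\<close>
  have bK: "b ` ?K = a_kernel ?M C r"
  proof
    show "b ` ?K \<subseteq> a_kernel ?M C r"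
    proof
      fix v assume "v \<in> b ` ?K"
      then obtain x where x: "x \<in> carrier ?F" "\<pi> x = \<zero>\<^bsub>B\<^esub>" "v = b x" by auto
      have v: "v \<in> carrier ?M" using hom_closed[OF b x(1)] x(3) by simp
      have "\<zero>\<^bsub>C\<^esub> = g (\<pi> x)"
        using x(2) hom_zero[OF B.M.abelian_group_axioms C.M.abelian_group_axioms g(1)] by simp
      also have "\<dots> = g (f (p (a x))) \<oplus>\<^bsub>C\<^esub> g (l v)"
        unfolding \<pi>_def x(3)[symmetric] using fp hom_closed[OF a x(1)] lB[OF v] by (intro hom_add[OF g(1)]) auto
      also have "\<dots> = r v" using fp hom_closed[OF a x(1)] l(2) v hom_closed[OF r(1) v] by simp
      finally show "v \<in> a_kernel ?M C r" using v by (simp add: a_kernel_eq)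
    qed
    show "a_kernel ?M C r \<subseteq> b ` ?K"
    proof
      fix v assume "v \<in> a_kernel ?M C r"
      then have v: "v \<in> carrier ?M" "r v = \<zero>\<^bsub>C\<^esub>" by (auto simp: a_kernel_eq)
      have "g (\<ominus>\<^bsub>B\<^esub> l v) = \<ominus>\<^bsub>C\<^esub> \<zero>\<^bsub>C\<^esub>"
        using hom_a_inv[OF B.M.abelian_group_axioms C.M.abelian_group_axioms g(1) lB[OF v(1)]] l(2) v by simp
      also have "\<dots> = \<zero>\<^bsub>C\<^esub>" using C.M.l_neg[of "\<zero>\<^bsub>C\<^esub>"] by simp
      finally obtain u where u: "u \<in> carrier ?N" "f (p u) = \<ominus>\<^bsub>B\<^esub> l v"
        using pre lB[OF v(1)] by (metis B.M.a_inv_closed)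
      have "\<pi> (e u v) = \<zero>\<^bsub>B\<^esub>" using ab[OF u(1) v(1)] u(2) lB[OF v(1)] by (simp add: \<pi>_def B.M.l_neg)
      then show "v \<in> b ` ?K" using ecl[OF u(1) v(1)] ab[OF u(1) v(1)] by force
    qed
  qed
  let ?i = "\<lambda>u. e u (\<lambda>_. \<zero>\<^bsub>R\<^esub>)"
  have z: "(\<lambda>_. \<zero>\<^bsub>R\<^esub>) \<in> carrier ?M" by (auto simp: free_rmod_simps)
  have i: "?i \<in> rmod_hom R ?N ?F"
    by (rule rmod_homI) (use ecl[OF _ z] in \<open>auto simp: e_def free_rmod_simps\<close>)
  have l0: "l (\<lambda>_. \<zero>\<^bsub>R\<^esub>) = \<zero>\<^bsub>B\<^esub>"
    using hom_zero[OF M.M.abelian_group_axioms B.M.abelian_group_axioms l(1)] by (simp add: free_rmod_simps)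
  \<comment> \<open>What this projection kills is a copy of the kernel of \<open>p\<close>, because
    \<open>f\<close> is injective.\<close>
  have "{x \<in> ?K. b x = \<zero>\<^bsub>?M\<^esub>} = ?i ` a_kernel ?N A p"
  proof
    show "{x \<in> ?K. b x = \<zero>\<^bsub>?M\<^esub>} \<subseteq> ?i ` a_kernel ?N A p"
    proof
      fix x assume "x \<in> {x \<in> ?K. b x = \<zero>\<^bsub>?M\<^esub>}"
      then have x: "x \<in> carrier ?F" "\<pi> x = \<zero>\<^bsub>B\<^esub>" "b x = (\<lambda>_. \<zero>\<^bsub>R\<^esub>)" by (auto simp: free_rmod_simps)
      have "f (p (a x)) = \<zero>\<^bsub>B\<^esub>" using x(2) fp hom_closed[OF a x(1)] by (simp add: \<pi>_def x(3) l0)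
      then have "p (a x) = \<zero>\<^bsub>A\<^esub>"
        using f hom_inj_iff[OF A.right_module_axioms B.right_module_axioms f(1)]
          hom_closed[OF p(1) hom_closed[OF a x(1)]] by simp
      moreover have "x = ?i (a x)" using eab[of x] x(3) by simp
      ultimately show "x \<in> ?i ` a_kernel ?N A p"
        using hom_closed[OF a x(1)] by (auto simp: a_kernel_eq)
    qed
    show "?i ` a_kernel ?N A p \<subseteq> {x \<in> ?K. b x = \<zero>\<^bsub>?M\<^esub>}"
    proof
      fix x assume "x \<in> ?i ` a_kernel ?N A p"
      then obtain u where u: "u \<in> carrier ?N" "p u = \<zero>\<^bsub>A\<^esub>" "x = ?i u" by (auto simp: a_kernel_eq)
      have "\<pi> x = \<zero>\<^bsub>B\<^esub>"
        using ab[OF u(1) z] u hom_zero[OF A.M.abelian_group_axioms B.M.abelian_group_axioms f(1)]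
        by (simp add: \<pi>_def l0)
      then show "x \<in> {x \<in> ?K. b x = \<zero>\<^bsub>?M\<^esub>}"
        using ecl[OF u(1) z] u ab[OF u(1) z] by (simp add: free_rmod_simps)
    qed
  qed
  then have "fin_gen R ?F ?K"
    using fin_gen_extension[OF F.right_module_axioms M.right_module_axioms b K] r(3) bK
      fin_gen_image[OF N.right_module_axioms F.right_module_axioms i p(3)] by simp
  then show ?thesis
    unfolding fin_presented_def a_kernel_eq using B.right_module_axioms \<pi> surj by blast
qed

text \<open>The axioms of \<open>well_placed\<close> speak of modules with elements in
  \<open>'r univ\<close>. A presentation supplies a copy there, since cosets in R^n are sets of
  functions from the naturals to R.\<close>

lemma fin_presented_copy:
  assumes "fin_presented R B"
  shows "\<exists>B'\<in>fpmod R. rmod_iso R B' B"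
proof -
  obtain n :: nat and p where p: "p \<in> rmod_hom R (free_rmod R {..<n}) B"
    "p ` carrier (free_rmod R {..<n}) = carrier B"
    "fin_gen R (free_rmod R {..<n}) (a_kernel (free_rmod R {..<n}) B p)"
    using assms unfolding fin_presented_def by blast
  let ?F = "free_rmod R {..<n}"
  interpret B: right_module R B using assms by (simp add: fin_presented_def)
  interpret F: right_module R ?F by (rule free_rmod_module[OF B.R.ring_axioms])
  let ?K = "a_kernel ?F B p" and ?Q = "rquot ?F (a_kernel ?F B p)"
  have K: "rsubmodule R ?F ?K"
    using fin_gen_rsubmodule[OF F.right_module_axioms p(3)] .
  note q = F.rquot_facts[OF K]
  have ker: "a_kernel ?F ?Q (a_r_coset ?F ?K) = ?K"
    using q(4) rsubmoduleD(5)[OF K] by (auto simp: a_kernel_eq[of ?F ?Q])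
  have "fin_presented R ?Q"
    unfolding fin_presented_def using q(1-3) p(3) ker by metis
  moreover obtain g where g: "g \<in> rmod_hom R ?Q B" "\<forall>y\<in>carrier ?F. g (a_r_coset ?F ?K y) = p y"
    using hom_factor[OF F.right_module_axioms q(1) B.right_module_axioms q(2,3) p(1)] q(4)
    by (auto simp: a_kernel_eq)
  have "bij_betw g (carrier ?Q) (carrier B)"
    unfolding bij_betw_def
  proof
    show "inj_on g (carrier ?Q)"
      unfolding hom_inj_iff[OF q(1) B.right_module_axioms g(1)]
    proof (intro ballI impI)
      fix x assume x: "x \<in> carrier ?Q" "g x = \<zero>\<^bsub>B\<^esub>"
      then obtain y where y: "y \<in> carrier ?F" "x = a_r_coset ?F ?K y" unfolding q(3)[symmetric] by (elim imageE)
      then show "x = \<zero>\<^bsub>?Q\<^esub>" using x(2) g(2) q(4)[OF y(1)] by (simp add: a_kernel_eq)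
    qed
    have "g ` carrier ?Q = p ` carrier ?F" unfolding q(3)[symmetric] image_image using g(2) by auto
    then show "g ` carrier ?Q = carrier B" using p(2) by simp
  qed
  ultimately show ?thesis using g(1) by (auto simp: rmod_iso_def fpmod_def)
qed

section \<open>Quotients lying in a well-placed subcategory\<close>

text \<open>Expresses that Y / Y0 lies in \<open>E\<close> up to isomorphism, through a surjection
  onto an object with kernel \<open>Y0\<close>. No coset module is formed, so element types do not
  grow when such pairs are nested, and maps out of the quotient come from
  \<open>hom_factor\<close>.\<close>

definition quot_in ::
    "('r, 'k) ring_scheme \<Rightarrow> ('r, 'r univ) rmod set \<Rightarrow> ('r, 'm, 'z) rmod_scheme \<Rightarrow> 'm set \<Rightarrow> bool"
  where "quot_in R E Y Y0 \<longleftrightarrow> right_module R Y \<and>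
    (\<exists>C\<in>E. \<exists>q\<in>rmod_hom R Y C. q ` carrier Y = carrier C \<and> Y0 = {y \<in> carrier Y. q y = \<zero>\<^bsub>C\<^esub>})"

lemma quot_in_module: "quot_in R E Y Y0 \<Longrightarrow> right_module R Y"
  by (simp add: quot_in_def)

context well_placed
begin

lemma object_module: "A \<in> E \<Longrightarrow> right_module R A"
  and object_fp: "A \<in> E \<Longrightarrow> fin_presented R A"
  using objects by (auto simp: fpmod_def fin_presented_def)

lemma quot_inD:
  assumes "quot_in R E Y Y0"
  shows "\<exists>C q. right_module R Y \<and> C \<in> E \<and> right_module R C \<and> q \<in> rmod_hom R Y C \<and>
    q ` carrier Y = carrier C \<and> Y0 = {y \<in> carrier Y. q y = \<zero>\<^bsub>C\<^esub>}"
  using assms object_module unfolding quot_in_def by meson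

lemma quot_in_rsubmodule: "quot_in R E Y Y0 \<Longrightarrow> rsubmodule R Y Y0"
  by (drule quot_inD) (elim exE conjE, simp add: rsubmodule_kernel)

text \<open>The target may be any module isomorphic to an object, in any type; the isomorphism is
  absorbed into the surjection. In this way the \<open>belongs_to\<close> conclusions of the closure
  axioms become usable.\<close>

lemma quot_inI:
  assumes Y: "right_module R Y" and Z: "belongs_to R E Z"
    and q: "q \<in> rmod_hom R Y Z" "q ` carrier Y = carrier Z"
    and Y0: "Y0 = {y \<in> carrier Y. q y = \<zero>\<^bsub>Z\<^esub>}" and Zm: "right_module R Z"
  shows "quot_in R E Y Y0"
proof -
  obtain A f where A: "A \<in> E" and f: "f \<in> rmod_hom R A Z" "bij_betw f (carrier A) (carrier Z)"
    using Z by (auto simp: belongs_to_def rmod_iso_def)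
  interpret A: right_module R A by (rule object_module[OF A])
  interpret Z: right_module R Z by fact
  let ?g = "inv_into (carrier A) f"
  have g: "?g \<in> rmod_hom R Z A" by (rule inverse_hom[OF A.right_module_axioms f])
  have bij: "bij_betw ?g (carrier Z) (carrier A)" by (rule bij_betw_inv_into[OF f(2)])
  have "(\<lambda>y. ?g (q y)) ` carrier Y = carrier A"
    using bij q(2) by (metis bij_betw_imp_surj_on image_image)
  moreover have "?g (q y) = \<zero>\<^bsub>A\<^esub> \<longleftrightarrow> q y = \<zero>\<^bsub>Z\<^esub>" if "y \<in> carrier Y" for y
    using hom_closed[OF q(1) that] hom_zero[OF Z.M.abelian_group_axioms A.M.abelian_group_axioms g]
      bij hom_inj_iff[OF Z.right_module_axioms A.right_module_axioms g] by (metis bij_betw_def)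
  ultimately show ?thesis
    unfolding quot_in_def using Y A hom_comp[OF q(1) g] Y0
    by (intro conjI bexI[of _ A] bexI[of _ "\<lambda>y. ?g (q y)"]) auto
qed

lemma belongs_to_object: "A \<in> E \<Longrightarrow> belongs_to R E A"
  unfolding belongs_to_def rmod_iso_def
  by (intro bexI[of _ A] bexI[of _ "\<lambda>x. x"])
    (auto intro: right_module.hom_id object_module simp: bij_betw_def)

lemma short_exact_quot_in:
  assumes A: "A \<in> E" and Q: "right_module R Q" and se: "short_exact R P f Q g A"
  shows "quot_in R E Q (f ` carrier P)"
  by (rule quot_inI[OF Q belongs_to_object[OF A] _ _ _ object_module[OF A]])
    (use se in \<open>auto simp: short_exact_def a_kernel_eq\<close>)

text \<open>Translation back to coset modules, needed to state the final result.\<close>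

lemma quot_in_belongs_to:
  assumes "quot_in R E Y Y0"
  shows "belongs_to R E (rquot Y Y0)"
proof -
  obtain C q where Y: "right_module R Y" and C: "C \<in> E" "right_module R C" and q: "q \<in> rmod_hom R Y C"
    "q ` carrier Y = carrier C" and Y0: "Y0 = {y \<in> carrier Y. q y = \<zero>\<^bsub>C\<^esub>}"
    using quot_inD[OF assms] by (elim exE conjE) (rule that)
  note r = right_module.rquot_facts[OF Y quot_in_rsubmodule[OF assms]]
  obtain g where g: "g \<in> rmod_hom R C (rquot Y Y0)" "\<forall>y\<in>carrier Y. g (q y) = a_r_coset Y Y0 y"
    using hom_factor[OF Y C(2) r(1) q r(2)] r(4) Y0 by auto
  have "inj_on g (carrier C)"
    unfolding hom_inj_iff[OF C(2) r(1) g(1)]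
  proof (intro ballI impI)
    fix x assume x: "x \<in> carrier C" "g x = \<zero>\<^bsub>rquot Y Y0\<^esub>"
    have "x \<in> q ` carrier Y" using x q(2) by simp
    then obtain y where "y \<in> carrier Y" "x = q y" by auto
    then show "x = \<zero>\<^bsub>C\<^esub>" using x(2) g(2) r(4)[of y] Y0 by auto
  qed
  moreover have "g ` carrier C = carrier (rquot Y Y0)"
    unfolding r(3)[symmetric] q(2)[symmetric] image_image using g(2) by auto
  ultimately show ?thesis
    using C(1) g(1) by (auto simp: belongs_to_def rmod_iso_def bij_betw_def)
qed

text \<open>The composite of \<open>h\<close> with Z to Z / Z0 is onto by \<open>surj\<close>, and
  its kernel is the preimage of \<open>Z0\<close>; so the same object serves for both
  quotients.\<close>

lemma quot_in_preimage:
  assumes Z: "quot_in R E Z Z0" and Y: "right_module R Y" and h: "h \<in> rmod_hom R Y Z"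
    and surj: "\<And>z. z \<in> carrier Z \<Longrightarrow> \<exists>y\<in>carrier Y. \<exists>z0\<in>Z0. z = h y \<oplus>\<^bsub>Z\<^esub> z0"
  shows "quot_in R E Y {y \<in> carrier Y. h y \<in> Z0}"
proof -
  obtain C q where Zm: "right_module R Z" and C: "C \<in> E" "right_module R C" and q: "q \<in> rmod_hom R Z C"
    "q ` carrier Z = carrier C" and Z0: "Z0 = {y \<in> carrier Z. q y = \<zero>\<^bsub>C\<^esub>}"
    using quot_inD[OF Z] by (elim exE conjE) (rule that)
  interpret C: right_module R C by (rule C(2))
  have "(\<lambda>y. q (h y)) ` carrier Y = carrier C"
  proof
    show "carrier C \<subseteq> (\<lambda>y. q (h y)) ` carrier Y"
    proof
      fix c assume "c \<in> carrier C"
      then obtain z where z: "z \<in> carrier Z" "c = q z" using q(2) by auto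
      obtain y z0 where y: "y \<in> carrier Y" "z0 \<in> Z0" "z = h y \<oplus>\<^bsub>Z\<^esub> z0" using surj[OF z(1)] by auto
      have "c = q (h y) \<oplus>\<^bsub>C\<^esub> q z0"
        unfolding z(2) y(3) by (rule hom_add[OF q(1) hom_closed[OF h y(1)]]) (use y(2) Z0 in auto)
      also have "\<dots> = q (h y)" using y(2) Z0 hom_closed[OF q(1) hom_closed[OF h y(1)]] by simp
      finally show "c \<in> (\<lambda>y. q (h y)) ` carrier Y" using y(1) by auto
    qed
  qed (use hom_closed[OF hom_comp[OF h q(1)]] in auto)
  then show ?thesis
    by (intro quot_inI[OF Y belongs_to_object[OF C(1)] hom_comp[OF h q(1)] _ _ C(2)])
      (use Z0 hom_closed[OF h] in auto)
qed

text \<open>\<open>h\<close> induces a map \<open>k\<close> between the objects Y / Y0 and Z / Z0.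
  The four conclusions are its kernel, coimage, image and cokernel, read back as submodules of
  \<open>Y\<close> and \<open>Z\<close>; the coimage is isomorphic to the image of \<open>k\<close>,
  so the same axiom gives both.\<close>

lemma quot_in_map:
  fixes Z :: "('r, 'b, 'z) rmod_scheme"
  assumes Y: "quot_in R E Y Y0" and Z: "quot_in R E Z Z0" and h: "h \<in> rmod_hom R Y Z"
    and h0: "\<And>y. y \<in> Y0 \<Longrightarrow> h y \<in> Z0"
  shows quot_in_kernel: "quot_in R E (sub Y {y \<in> carrier Y. h y \<in> Z0}) Y0" (is ?ker)
    and quot_in_coimage: "quot_in R E Y {y \<in> carrier Y. h y \<in> Z0}" (is ?coim)
    and quot_in_image: "quot_in R E (sub Z {h y \<oplus>\<^bsub>Z\<^esub> z | y z. y \<in> carrier Y \<and> z \<in> Z0}) Z0" (is ?im)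
    and quot_in_cokernel: "quot_in R E Z {h y \<oplus>\<^bsub>Z\<^esub> z | y z. y \<in> carrier Y \<and> z \<in> Z0}" (is ?coker)
proof -
  let ?D = "{y \<in> carrier Y. h y \<in> Z0}" and ?V = "{h y \<oplus>\<^bsub>Z\<^esub> z | y z. y \<in> carrier Y \<and> z \<in> Z0}"
  obtain C q where Ym: "right_module R Y" and C: "C \<in> E" "right_module R C" and q: "q \<in> rmod_hom R Y C"
    "q ` carrier Y = carrier C" and Y0: "Y0 = {y \<in> carrier Y. q y = \<zero>\<^bsub>C\<^esub>}"
    using quot_inD[OF Y] by (elim exE conjE) (rule that)
  obtain C' q' where Zm: "right_module R Z" and C': "C' \<in> E" "right_module R C'" and q': "q' \<in> rmod_hom R Z C'"
    "q' ` carrier Z = carrier C'" and Z0: "Z0 = {y \<in> carrier Z. q' y = \<zero>\<^bsub>C'\<^esub>}"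
    using quot_inD[OF Z] by (elim exE conjE) (rule that)
  interpret Y: right_module R Y by fact
  interpret Z: right_module R Z by fact
  interpret C: right_module R C by fact
  interpret C': right_module R C' by fact
  obtain k where k: "k \<in> rmod_hom R C C'" "\<forall>y\<in>carrier Y. k (q y) = q' (h y)"
    using hom_factor[OF Ym C(2) C'(2) q hom_comp[OF h q'(1)]] Y0 Z0 h0 by auto
  have Dker: "?D = {y \<in> carrier Y. k (q y) = \<zero>\<^bsub>C'\<^esub>}" using Z0 k(2) hom_closed[OF h] by auto
  have Y0D: "Y0 \<subseteq> ?D" using h0 Y0 by auto
  have D: "rsubmodule R Y ?D" by (rule rsubmodule_vimage[OF Ym Zm h quot_in_rsubmodule[OF Z]])
  let ?K = "{x \<in> carrier C. k x = \<zero>\<^bsub>C'\<^esub>}"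
  have K: "rsubmodule R C ?K" by (rule rsubmodule_kernel[OF C(2) C'(2) k(1)])
  have im: "rsubmodule R C' (k ` carrier C)" by (rule rsubmodule_image_carrier[OF C(2) C'(2) k(1)])
  have qD: "q ` ?D = ?K"
  proof
    show "?K \<subseteq> q ` ?D"
    proof
      fix x assume x: "x \<in> ?K"
      then have "x \<in> q ` carrier Y" using q(2) by simp
      then obtain y where "y \<in> carrier Y" "x = q y" by (elim imageE)
      then show "x \<in> q ` ?D" using x unfolding Dker by auto
    qed
  qed (use Dker hom_closed[OF q(1)] in auto)
  have "belongs_to R E (sub C ?K)" using kernels[OF C(1) C'(1) k(1)] by (simp add: a_kernel_eq)
  then show ?ker
    by (rule quot_inI[OF Y.right_module_sub[OF D] _ hom_sub_cod[OF hom_sub_dom[OF q(1)]]])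
      (use qD Y0 Y0D C.right_module_sub[OF K] in auto)
  have b: "belongs_to R E (sub C' (k ` carrier C))" using images[OF C(1) C'(1) k(1)] .
  show ?coim
    by (rule quot_inI[OF Ym b hom_sub_cod[OF hom_comp[OF q(1) k(1)]]])
      (use q(2) Dker C'.right_module_sub[OF im] in \<open>auto simp: image_image[symmetric]\<close>)
  \<comment> \<open>\<open>?V\<close> is h(Y) + Z0, the preimage in \<open>Z\<close> of the image of
    \<open>k\<close>.\<close>
  have q'V: "q' z \<in> k ` carrier C \<longleftrightarrow> z \<in> ?V" if z: "z \<in> carrier Z" for z
  proof
    assume "q' z \<in> k ` carrier C"
    then obtain c where "c \<in> carrier C" "q' z = k c" by auto
    moreover obtain y where y: "y \<in> carrier Y" "c = q y" using q(2) calculation(1) by auto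
    ultimately have e: "q' z = q' (h y)" using k(2) by simp
    have hy: "h y \<in> carrier Z" using hom_closed[OF h y(1)] .
    have "q' (z \<ominus>\<^bsub>Z\<^esub> h y) = \<zero>\<^bsub>C'\<^esub>"
      using hom_diff[OF Z.M.abelian_group_axioms C'.M.abelian_group_axioms q'(1) z hy] e
        C'.diff_eq_zero[of "q' z" "q' z"] hom_closed[OF q'(1) z] by simp
    then have "z \<ominus>\<^bsub>Z\<^esub> h y \<in> Z0" using Z0 z hy by simp
    moreover have "z = h y \<oplus>\<^bsub>Z\<^esub> (z \<ominus>\<^bsub>Z\<^esub> h y)" using Z.add_diff[OF hy z] by simp
    ultimately show "z \<in> ?V" using y(1) by blast
  next
    assume "z \<in> ?V"
    then obtain y z0 where y: "z = h y \<oplus>\<^bsub>Z\<^esub> z0" "y \<in> carrier Y" "z0 \<in> Z0" by auto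
    have "q' z = k (q y)"
      unfolding y(1) using hom_add[OF q'(1) hom_closed[OF h y(2)], of z0] y Z0 k(2)
        hom_closed[OF q'(1) hom_closed[OF h y(2)]] by simp
    then show "q' z \<in> k ` carrier C" using hom_closed[OF q(1) y(2)] by auto
  qed
  have VZ: "?V \<subseteq> carrier Z" using hom_closed[OF h] Z0 by auto
  have Veq: "?V = {z \<in> carrier Z. q' z \<in> k ` carrier C}"
  proof -
    have "V = {z \<in> D. P z}" if "\<And>z. z \<in> D \<Longrightarrow> P z \<longleftrightarrow> z \<in> V" "V \<subseteq> D" for V D :: "'b set" and P
      using that by blast
    from this[OF q'V VZ] show ?thesis .
  qed
  have V: "rsubmodule R Z ?V" unfolding Veq by (rule rsubmodule_vimage[OF Zm C'(2) q'(1) im])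
  have Z0V: "Z0 \<subseteq> ?V"
    unfolding Veq using Z0 rsubmoduleD(2)[OF im] by auto
  have q'im: "q' ` ?V = k ` carrier C"
  proof
    show "k ` carrier C \<subseteq> q' ` ?V"
    proof
      fix x assume x: "x \<in> k ` carrier C"
      then have "x \<in> q' ` carrier Z" using q'(2) rsubmoduleD(1)[OF im] by auto
      then show "x \<in> q' ` ?V" unfolding Veq using x by auto
    qed
  qed (auto simp: Veq)
  have Z0': "Z0 = {y \<in> carrier (sub Z ?V). q' y = \<zero>\<^bsub>sub C' (k ` carrier C)\<^esub>}"
  proof -
    have "Z0 = {y \<in> V. P y}" if "Z0 \<subseteq> V" "V \<subseteq> carrier Z" "Z0 = {y \<in> carrier Z. P y}" for V P
      using that by blast
    from this[OF Z0V VZ Z0] show ?thesis unfolding sub_simps .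
  qed
  have im1: "q' ` carrier (sub Z ?V) = carrier (sub C' (k ` carrier C))"
    "q' ` carrier (sub Z ?V) \<subseteq> k ` carrier C"
    using q'im by (simp_all only: sub_simps order_refl)
  show ?im
    by (rule quot_inI[OF Z.right_module_sub[OF V] b hom_sub_cod[OF hom_sub_dom[OF q'(1) VZ] im1(2)] im1(1) Z0'
          C'.right_module_sub[OF im]])
  note r = C'.rquot_facts[OF im]
  show ?coker
  proof (rule quot_inI[OF Zm cokernels[OF C(1) C'(1) k(1)] hom_comp[OF q'(1) r(2)] _ _ r(1)])
    show "(\<lambda>z. a_r_coset C' (k ` carrier C) (q' z)) ` carrier Z = carrier (rquot C' (k ` carrier C))"
      using r(3) q'(2) by (metis image_image)
    show "?V = {z \<in> carrier Z. a_r_coset C' (k ` carrier C) (q' z) = \<zero>\<^bsub>rquot C' (k ` carrier C)\<^esub>}"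
      unfolding Veq using r(4) hom_closed[OF q'(1)] by auto
  qed
qed

text \<open>Y / Y0 is an extension of Y / Y1 by Y1 / Y0. The axiom on extensions wants a finitely
  presented middle term with elements in \<open>'r univ\<close>, so finite presentation is derived
  first and the sequence is then moved to a copy \<open>B'\<close>.\<close>

lemma quot_in_trans:
  assumes Y1: "quot_in R E Y Y1" and Y0: "quot_in R E (sub Y Y1) Y0"
  shows "quot_in R E Y Y0"
proof -
  obtain C q where Y: "right_module R Y" and C: "C \<in> E" "right_module R C" and q: "q \<in> rmod_hom R Y C"
    "q ` carrier Y = carrier C" and Y1eq: "Y1 = {y \<in> carrier Y. q y = \<zero>\<^bsub>C\<^esub>}"
    using quot_inD[OF Y1] by (elim exE conjE) (rule that)
  obtain A p where Y1m: "right_module R (sub Y Y1)" and A: "A \<in> E" "right_module R A"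
    and p: "p \<in> rmod_hom R (sub Y Y1) A"
    "p ` Y1 = carrier A" and Y0eq: "Y0 = {y \<in> Y1. p y = \<zero>\<^bsub>A\<^esub>}"
    using quot_inD[OF Y0] by (elim exE conjE) (rule that, simp_all)
  interpret Y: right_module R Y by fact
  have sub: "rsubmodule R Y Y0"
    using Y.rsubmodule_trans[OF quot_in_rsubmodule[OF Y1] quot_in_rsubmodule[OF Y0]] .
  let ?B = "rquot Y Y0" and ?c = "a_r_coset Y Y0"
  note r = Y.rquot_facts[OF sub]
  have Y1sub: "Y1 \<subseteq> carrier Y" using Y1eq by auto
  obtain f where f: "f \<in> rmod_hom R A ?B" "\<forall>y\<in>Y1. f (p y) = ?c y"
  proof -
    have "?c y = \<zero>\<^bsub>?B\<^esub>" if "y \<in> carrier (sub Y Y1)" "p y = \<zero>\<^bsub>A\<^esub>" for y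
      using that r(4)[of y] Y0eq Y1sub by auto
    then have "\<exists>f\<in>rmod_hom R A ?B. \<forall>y\<in>Y1. f (p y) = ?c y"
      using hom_factor[OF Y1m A(2) r(1) p(1) _ hom_sub_dom[OF r(2) Y1sub]] p(2) by simp
    then show ?thesis using that by blast
  qed
  obtain g where g: "g \<in> rmod_hom R ?B C" "\<forall>y\<in>carrier Y. g (?c y) = q y"
    using hom_factor[OF Y r(1) C(2) r(2,3) q(1)] r(4) Y0eq Y1eq by auto
  have finj: "inj_on f (carrier A)"
    unfolding hom_inj_iff[OF A(2) r(1) f(1)]
  proof (intro ballI impI)
    fix x assume x: "x \<in> carrier A" "f x = \<zero>\<^bsub>?B\<^esub>"
    then have "x \<in> p ` Y1" using p(2) by simp
    then obtain y where y: "y \<in> Y1" "x = p y" by (elim imageE)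
    then show "x = \<zero>\<^bsub>A\<^esub>" using x(2) f(2) r(4)[of y] Y0eq Y1sub by auto
  qed
  have fim: "f ` carrier A = a_kernel ?B C g"
  proof -
    have "f ` carrier A = ?c ` Y1" unfolding p(2)[symmetric] image_image using f(2) by auto
    also have "\<dots> = a_kernel ?B C g"
      unfolding a_kernel_eq r(3)[symmetric] Y1eq using g(2) by auto
    finally show ?thesis .
  qed
  have gsurj: "g ` carrier ?B = carrier C"
    unfolding r(3)[symmetric] q(2)[symmetric] image_image using g(2) by auto
  have ex: "short_exact R A f ?B g C" using f(1) g(1) finj fim gsurj by (simp add: short_exact_def)
  have "fin_presented R ?B"
    by (rule fin_presented_extension[OF object_fp[OF A(1)] object_fp[OF C(1)] r(1) ex])
  then obtain B' u where B': "B' \<in> fpmod R" and u: "u \<in> rmod_hom R B' ?B" "bij_betw u (carrier B') (carrier ?B)"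
    using fin_presented_copy by (metis rmod_iso_def)
  have B'm: "right_module R B'" using B' by (simp add: fpmod_def fin_presented_def)
  let ?v = "inv_into (carrier B') u"
  have v: "?v \<in> rmod_hom R ?B B'" by (rule inverse_hom[OF B'm u])
  have vu: "?v (u x) = x" if "x \<in> carrier B'" for x using u(2) that by (simp add: bij_betw_def)
  have uv: "u (?v x) = x" "?v x \<in> carrier B'" if "x \<in> carrier ?B" for x
    using u(2) that by (simp_all add: bij_betw_def f_inv_into_f inv_into_into)
  have "short_exact R A (\<lambda>x. ?v (f x)) B' (\<lambda>x. g (u x)) C"
    unfolding short_exact_def
  proof (intro conjI)
    show "inj_on (\<lambda>x. ?v (f x)) (carrier A)"
      using finj uv(1) hom_closed[OF f(1)] unfolding inj_on_def by metis
    have "(\<lambda>x. g (u x)) ` carrier B' = g ` carrier ?B"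
      using u(2) by (metis bij_betw_def image_image)
    then show "(\<lambda>x. g (u x)) ` carrier B' = carrier C" using gsurj by simp
    have "(\<lambda>x. ?v (f x)) ` carrier A = ?v ` a_kernel ?B C g" using fim by (metis image_image)
    also have "\<dots> = a_kernel B' C (\<lambda>x. g (u x))"
    proof
      show "a_kernel B' C (\<lambda>x. g (u x)) \<subseteq> ?v ` a_kernel ?B C g"
      proof
        fix x assume "x \<in> a_kernel B' C (\<lambda>x. g (u x))"
        then have "x \<in> carrier B'" "u x \<in> a_kernel ?B C g"
          using hom_closed[OF u(1)] by (auto simp: a_kernel_eq)
        then show "x \<in> ?v ` a_kernel ?B C g" using vu by force
      qed
    qed (use uv in \<open>auto simp: a_kernel_eq\<close>)
    finally show "(\<lambda>x. ?v (f x)) ` carrier A = a_kernel B' C (\<lambda>x. g (u x))" .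
  qed (rule hom_comp[OF f(1) v], rule hom_comp[OF u(1) g(1)])
  then have "B' \<in> E" by (rule extensions[OF A(1) C(1) B'])
  then have "belongs_to R E ?B" using u by (auto simp: belongs_to_def rmod_iso_def)
  then show ?thesis
    by (rule quot_inI[OF Y _ r(2,3) _ r(1)]) (use r(4) rsubmoduleD(5)[OF sub] in auto)
qed

text \<open>A presentation of Y / Y0 by R^n is lifted to \<open>Y\<close>, so that Y = Y0 + l(R^n),
  and R^n modulo the preimage of \<open>Y0\<close> is the same object. Questions about arbitrary
  pairs are thereby reduced to finitely generated submodules of R^n, which a small set can
  index.\<close>

lemma quot_in_presentation:
  assumes "quot_in R E Y Y0"
  shows "\<exists>(n :: nat) l. l \<in> rmod_hom R (free_rmod R {..<n}) Y \<and>
    quot_in R E (free_rmod R {..<n}) {x \<in> carrier (free_rmod R {..<n}). l x \<in> Y0} \<and>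
    fin_gen R (free_rmod R {..<n}) {x \<in> carrier (free_rmod R {..<n}). l x \<in> Y0} \<and>
    (\<forall>y\<in>carrier Y. \<exists>x\<in>carrier (free_rmod R {..<n}). \<exists>y0\<in>Y0. y = y0 \<oplus>\<^bsub>Y\<^esub> l x)"
proof -
  obtain C q where Y: "right_module R Y" and C: "C \<in> E" "right_module R C" and q: "q \<in> rmod_hom R Y C"
    "q ` carrier Y = carrier C" and Y0: "Y0 = {y \<in> carrier Y. q y = \<zero>\<^bsub>C\<^esub>}"
    using quot_inD[OF assms] by (elim exE conjE) (rule that)
  interpret Y: right_module R Y by fact
  interpret C: right_module R C by fact
  obtain n :: nat and p where p: "p \<in> rmod_hom R (free_rmod R {..<n}) C"
    "p ` carrier (free_rmod R {..<n}) = carrier C"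
    "fin_gen R (free_rmod R {..<n}) (a_kernel (free_rmod R {..<n}) C p)"
    using object_fp[OF C(1)] unfolding fin_presented_def by blast
  let ?F = "free_rmod R {..<n}"
  have F: "right_module R ?F" by (rule free_rmod_module[OF Y.R.ring_axioms])
  obtain l where l: "l \<in> rmod_hom R ?F Y" "\<forall>x\<in>carrier ?F. q (l x) = p x"
    using free_lift[OF Y C(2) q(1) p(1)] p(2) q(2) by auto
  have eq: "{x \<in> carrier ?F. l x \<in> Y0} = a_kernel ?F C p"
    using l(2) hom_closed[OF l(1)] Y0 by (auto simp: a_kernel_eq)
  have 1: "quot_in R E ?F (a_kernel ?F C p)"
    by (rule quot_inI[OF F belongs_to_object[OF C(1)] p(1,2) _ C(2)]) (simp add: a_kernel_eq)
  have "\<exists>x\<in>carrier ?F. \<exists>y0\<in>Y0. y = y0 \<oplus>\<^bsub>Y\<^esub> l x" if y: "y \<in> carrier Y" for y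
  proof -
    have "q y \<in> p ` carrier ?F" using hom_closed[OF q(1) y] p(2) by simp
    then obtain x where x: "x \<in> carrier ?F" "q y = p x" by auto
    have lx: "l x \<in> carrier Y" by (rule hom_closed[OF l(1) x(1)])
    have "q (y \<ominus>\<^bsub>Y\<^esub> l x) = \<zero>\<^bsub>C\<^esub>"
      using hom_diff[OF Y.M.abelian_group_axioms C.M.abelian_group_axioms q(1) y lx] x l(2)
        C.diff_eq_zero[of "p x" "p x"] hom_closed[OF p(1) x(1)] by simp
    then have "y \<ominus>\<^bsub>Y\<^esub> l x \<in> Y0" using Y0 y lx by simp
    then show ?thesis using x(1) Y.diff_add[OF y lx] by force
  qed
  then have "\<forall>y\<in>carrier Y. \<exists>x\<in>carrier ?F. \<exists>y0\<in>Y0. y = y0 \<oplus>\<^bsub>Y\<^esub> l x" by simp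
  with l(1) 1 p(3) show ?thesis unfolding eq[symmetric] by (intro exI[of _ n] exI[of _ l] conjI)
qed

text \<open>The quotient is the pushout of the inclusion of \<open>P\<close> in \<open>Q\<close> and
  of \<open>c\<close> followed by Z to Z / Z0, written as a quotient of Z x Q. The submodule Z x P
  lies in between, with Q / P above it and, through (z, p) to z + c p, a copy of Z / Z0
  below.\<close>

lemma quot_in_pushout:
  assumes Z: "quot_in R E Z Z0" and Q: "quot_in R E Q P" and c: "c \<in> rmod_hom R (sub Q P) Z"
  shows "quot_in R E (rmod_prod Z Q) {w \<in> carrier Z \<times> P. fst w \<oplus>\<^bsub>Z\<^esub> c (snd w) \<in> Z0}"
proof -
  interpret Z: right_module R Z by (rule quot_in_module[OF Z])
  interpret Q: right_module R Q by (rule quot_in_module[OF Q])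
  have P: "rsubmodule R Q P" by (rule quot_in_rsubmodule[OF Q])
  interpret P: right_module R "sub Q P" by (rule Q.right_module_sub[OF P])
  have Z0: "rsubmodule R Z Z0" by (rule quot_in_rsubmodule[OF Z])
  let ?X = "rmod_prod Z Q" and ?X1 = "carrier Z \<times> P"
  interpret X: right_module R ?X by (rule rmod_prod_module[OF Z.right_module_axioms Q.right_module_axioms])
  have "quot_in R E ?X {w \<in> carrier ?X. snd w \<in> P}"
  proof (rule quot_in_preimage[OF Q X.right_module_axioms hom_snd])
    fix z assume "z \<in> carrier Q"
    then show "\<exists>y\<in>carrier ?X. \<exists>z0\<in>P. z = snd y \<oplus>\<^bsub>Q\<^esub> z0"
      by (intro bexI[of _ "(\<zero>\<^bsub>Z\<^esub>, z)"] bexI[of _ "\<zero>\<^bsub>Q\<^esub>"])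
        (auto simp: rmod_prod_simps rsubmoduleD(2)[OF P])
  qed
  moreover have "{w \<in> carrier ?X. snd w \<in> P} = ?X1"
    using rsubmoduleD(1)[OF P] by (auto simp: rmod_prod_simps)
  ultimately have 1: "quot_in R E ?X ?X1" by simp
  have eq: "sub ?X ?X1 = rmod_prod Z (sub Q P)"
    by (simp add: rmod_prod_def)
  interpret X1: right_module R "rmod_prod Z (sub Q P)"
    by (rule rmod_prod_module[OF Z.right_module_axioms P.right_module_axioms])
  have h: "(\<lambda>w. fst w \<oplus>\<^bsub>Z\<^esub> c (snd w)) \<in> rmod_hom R (rmod_prod Z (sub Q P)) Z"
    using hom_copair[OF Z.right_module_axioms Z.hom_id c] by simp
  have c0: "c \<zero>\<^bsub>Q\<^esub> = \<zero>\<^bsub>Z\<^esub>"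
    using hom_zero[OF P.M.abelian_group_axioms Z.M.abelian_group_axioms c] by simp
  have "quot_in R E (rmod_prod Z (sub Q P))
      {w \<in> carrier (rmod_prod Z (sub Q P)). fst w \<oplus>\<^bsub>Z\<^esub> c (snd w) \<in> Z0}"
  proof (rule quot_in_preimage[OF Z X1.right_module_axioms h])
    fix z assume "z \<in> carrier Z"
    then show "\<exists>y\<in>carrier (rmod_prod Z (sub Q P)). \<exists>z0\<in>Z0. z = fst y \<oplus>\<^bsub>Z\<^esub> c (snd y) \<oplus>\<^bsub>Z\<^esub> z0"
      by (intro bexI[of _ "(z, \<zero>\<^bsub>Q\<^esub>)"] bexI[of _ "\<zero>\<^bsub>Z\<^esub>"])
        (auto simp: rmod_prod_simps c0 rsubmoduleD(2)[OF P] rsubmoduleD(2)[OF Z0])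
  qed
  then have "quot_in R E (sub ?X ?X1) {w \<in> carrier Z \<times> P. fst w \<oplus>\<^bsub>Z\<^esub> c (snd w) \<in> Z0}"
    unfolding eq by (simp add: rmod_prod_simps)
  then show ?thesis by (rule quot_in_trans[OF 1])
qed

lemma quot_in_prod:
  assumes Z: "quot_in R E Z Z0" and Q: "quot_in R E Q P"
  shows "quot_in R E (rmod_prod Z Q) (Z0 \<times> P)"
proof -
  interpret Z: right_module R Z by (rule quot_in_module[OF Z])
  have "{w \<in> carrier Z \<times> P. fst w \<oplus>\<^bsub>Z\<^esub> \<zero>\<^bsub>Z\<^esub> \<in> Z0} = Z0 \<times> P"
    using rsubmoduleD(1)[OF quot_in_rsubmodule[OF Z]] by auto
  then show ?thesis
    using quot_in_pushout[OF Z Q hom_zero_map[OF Z.right_module_axioms]] by simp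
qed

end

section \<open>Torsion-free modules\<close>

definition torsion_free ::
    "('r, 'k) ring_scheme \<Rightarrow> ('r, 'r univ) rmod set \<Rightarrow> ('r, 'm, 'z) rmod_scheme \<Rightarrow> bool"
  where "torsion_free R E X \<longleftrightarrow> right_module R X \<and>
    (\<forall>A\<in>E. \<forall>h\<in>rmod_hom R A X. \<forall>a\<in>carrier A. h a = \<zero>\<^bsub>X\<^esub>)"

text \<open>Defined from above, as an intersection: that every map to a torsion-free module kills it
  is then immediate once kernels of such maps are seen to have torsion-free quotients.\<close>

definition torsion_part ::
    "('r, 'k) ring_scheme \<Rightarrow> ('r, 'r univ) rmod set \<Rightarrow> ('r, 'm, 'z) rmod_scheme \<Rightarrow> 'm set"
  where "torsion_part R E M = \<Inter> {K. rsubmodule R M K \<and> torsion_free R E (rquot M K)}"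

lemma rsubmodule_finsum:
  assumes Y: "right_module R Y" and N: "rsubmodule R Y N" and f: "\<And>x. x \<in> A \<Longrightarrow> f x \<in> N"
  shows "finsum Y f A \<in> N"
proof -
  interpret Y: right_module R Y by fact
  show ?thesis
  proof (cases "finite A")
    case True
    then show ?thesis using f
    proof (induction A rule: finite_induct)
      case (insert x A)
      have "finsum Y f (insert x A) = f x \<oplus>\<^bsub>Y\<^esub> finsum Y f A"
        using insert rsubmoduleD(5)[OF N] by (intro Y.M.finsum_insert) auto
      then show ?case using insert rsubmoduleD(3)[OF N] by simp
    qed (simp add: rsubmoduleD(2)[OF N])
  qed (simp add: rsubmoduleD(2)[OF N])
qed

lemma rsubmodule_sum:
  assumes Y: "right_module R Y" and A: "rsubmodule R Y A" and B: "rsubmodule R Y B"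
  shows "rsubmodule R Y {a \<oplus>\<^bsub>Y\<^esub> b | a b. a \<in> A \<and> b \<in> B}"
proof -
  interpret Y: right_module R Y by fact
  interpret A: right_module R "sub Y A" by (rule Y.right_module_sub[OF A])
  interpret B: right_module R "sub Y B" by (rule Y.right_module_sub[OF B])
  have h: "(\<lambda>w. fst w \<oplus>\<^bsub>Y\<^esub> snd w) \<in> rmod_hom R (rmod_prod (sub Y A) (sub Y B)) Y"
    using hom_copair[OF Y hom_sub_dom[OF Y.hom_id rsubmoduleD(1)[OF A]] hom_sub_dom[OF Y.hom_id rsubmoduleD(1)[OF B]]] .
  have "rsubmodule R Y ((\<lambda>w. fst w \<oplus>\<^bsub>Y\<^esub> snd w) ` carrier (rmod_prod (sub Y A) (sub Y B)))"
    by (rule rsubmodule_image_carrier[OF rmod_prod_module[OF A.right_module_axioms B.right_module_axioms] Y h])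
  also have "(\<lambda>w. fst w \<oplus>\<^bsub>Y\<^esub> snd w) ` carrier (rmod_prod (sub Y A) (sub Y B)) = {a \<oplus>\<^bsub>Y\<^esub> b | a b. a \<in> A \<and> b \<in> B}"
    by (force simp: rmod_prod_simps)
  finally show ?thesis .
qed

lemma torsion_free_module: "torsion_free R E X \<Longrightarrow> right_module R X"
  by (simp add: torsion_free_def)

lemma torsion_freeD:
  "torsion_free R E X \<Longrightarrow> A \<in> E \<Longrightarrow> h \<in> rmod_hom R A X \<Longrightarrow> a \<in> carrier A \<Longrightarrow> h a = \<zero>\<^bsub>X\<^esub>"
  by (auto simp: torsion_free_def)

lemma torsion_freeI:
  "right_module R X \<Longrightarrow> (\<And>A h a. A \<in> E \<Longrightarrow> h \<in> rmod_hom R A X \<Longrightarrow> a \<in> carrier A \<Longrightarrow> h a = \<zero>\<^bsub>X\<^esub>)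
    \<Longrightarrow> torsion_free R E X"
  by (auto simp: torsion_free_def)

section \<open>Maps into torsion-free modules\<close>

context well_placed
begin

lemma torsion_free_quot:
  assumes X: "torsion_free R E X" and Y: "quot_in R E Y Y0" and h: "h \<in> rmod_hom R Y X"
    and 0: "\<And>y. y \<in> Y0 \<Longrightarrow> h y = \<zero>\<^bsub>X\<^esub>" and y: "y \<in> carrier Y"
  shows "h y = \<zero>\<^bsub>X\<^esub>"
proof -
  obtain C q where Ym: "right_module R Y" and C: "C \<in> E" "right_module R C" and q: "q \<in> rmod_hom R Y C"
    "q ` carrier Y = carrier C" and Y0: "Y0 = {y \<in> carrier Y. q y = \<zero>\<^bsub>C\<^esub>}"
    using quot_inD[OF Y] by (elim exE conjE) (rule that)
  obtain g where g: "g \<in> rmod_hom R C X" "\<forall>y\<in>carrier Y. g (q y) = h y"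
    using hom_factor[OF Ym C(2) torsion_free_module[OF X] q h] 0 Y0 by auto
  then show ?thesis using torsion_freeD[OF X C(1) g(1) hom_closed[OF q(1) y]] y by simp
qed

text \<open>The difference of the two maps kills \<open>Y0\<close> and so factors through the object
  Y / Y0. This uniqueness is what later makes independently chosen extensions additive and
  compatible with each other.\<close>

lemma torsion_free_extension_unique:
  assumes X: "torsion_free R E X" and Y: "quot_in R E Y Y0"
    and h: "h \<in> rmod_hom R Y X" "k \<in> rmod_hom R Y X"
    and 0: "\<And>y. y \<in> Y0 \<Longrightarrow> h y = k y" and y: "y \<in> carrier Y"
  shows "h y = k y"
proof -
  interpret X: right_module R X by (rule torsion_free_module[OF X])
  have "h y \<ominus>\<^bsub>X\<^esub> k y = \<zero>\<^bsub>X\<^esub>"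
  proof (rule torsion_free_quot[OF X Y X.hom_minus[OF h] _ y])
    fix z assume z: "z \<in> Y0"
    then have "z \<in> carrier Y" using rsubmoduleD(5)[OF quot_in_rsubmodule[OF Y]] by simp
    then show "h z \<ominus>\<^bsub>X\<^esub> k z = \<zero>\<^bsub>X\<^esub>"
      using 0[OF z] X.diff_eq_zero[of "k z" "k z"] hom_closed[OF h(2)] by simp
  qed
  then show ?thesis using X.diff_eq_zero hom_closed[OF h(1) y] hom_closed[OF h(2) y] by simp
qed

lemma torsion_free_embed:
  assumes X: "torsion_free R E X" and Y: "right_module R Y" and g: "g \<in> rmod_hom R Y X"
    and inj: "\<And>y. y \<in> carrier Y \<Longrightarrow> g y = \<zero>\<^bsub>X\<^esub> \<Longrightarrow> y = \<zero>\<^bsub>Y\<^esub>"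
  shows "torsion_free R E Y"
  by (rule torsion_freeI[OF Y])
    (use inj hom_closed torsion_freeD[OF X _ hom_comp[OF _ g]] in metis)

lemma torsion_free_rquot_kernel:
  assumes X: "torsion_free R E X" and M: "right_module R M" and h: "h \<in> rmod_hom R M X"
  shows "torsion_free R E (rquot M {x \<in> carrier M. h x = \<zero>\<^bsub>X\<^esub>})"
proof -
  let ?K = "{x \<in> carrier M. h x = \<zero>\<^bsub>X\<^esub>}"
  note Xm = torsion_free_module[OF X]
  have K: "rsubmodule R M ?K" by (rule rsubmodule_kernel[OF M Xm h])
  note r = right_module.rquot_facts[OF M K]
  obtain g where g: "g \<in> rmod_hom R (rquot M ?K) X" "\<forall>x\<in>carrier M. g (a_r_coset M ?K x) = h x"
    using hom_factor[OF M r(1) Xm r(2,3) h] r(4) by auto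
  show ?thesis
  proof (rule torsion_free_embed[OF X r(1) g(1)])
    fix y assume y: "y \<in> carrier (rquot M ?K)" "g y = \<zero>\<^bsub>X\<^esub>"
    then obtain x where x: "x \<in> carrier M" "y = a_r_coset M ?K x" unfolding r(3)[symmetric] by (elim imageE)
    then show "y = \<zero>\<^bsub>rquot M ?K\<^esub>" using y(2) g(2) r(4)[OF x(1)] by simp
  qed
qed

lemma torsion_part_least:
  assumes X: "torsion_free R E X" and M: "right_module R M" and h: "h \<in> rmod_hom R M X"
    and x: "x \<in> torsion_part R E M"
  shows "h x = \<zero>\<^bsub>X\<^esub>"
proof -
  have "{x \<in> carrier M. h x = \<zero>\<^bsub>X\<^esub>} \<in> {K. rsubmodule R M K \<and> torsion_free R E (rquot M K)}"
    using torsion_free_rquot_kernel[OF X M h] rsubmodule_kernel[OF M torsion_free_module[OF X] h] by simp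
  then show ?thesis using x unfolding torsion_part_def by blast
qed

lemma rsubmodule_torsion_part:
  assumes M: "right_module R M"
  shows "rsubmodule R M (torsion_part R E M)"
proof -
  note s = right_module.rsubmodule_carrier[OF M]
  note r = right_module.rquot_facts[OF M s]
  have z: "y = \<zero>\<^bsub>rquot M (carrier M)\<^esub>" if "y \<in> carrier (rquot M (carrier M))" for y
    using that r(4) unfolding r(3)[symmetric] by auto
  have "torsion_free R E (rquot M (carrier M))"
    by (intro torsion_freeI[OF r(1)] z) (rule hom_closed)
  then show ?thesis
    unfolding torsion_part_def using s by (intro right_module.rsubmodule_Inter[OF M]) auto
qed

text \<open>A map from an object to M / T becomes zero in M / K for every \<open>K\<close> in the
  intersection, so a representative of any of its values lies in all these \<open>K\<close>, hence
  in T.\<close>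

lemma torsion_free_rquot_torsion_part:
  assumes M: "right_module R M"
  shows "torsion_free R E (rquot M (torsion_part R E M))"
proof -
  let ?T = "torsion_part R E M"
  note r = right_module.rquot_facts[OF M rsubmodule_torsion_part[OF M]]
  show ?thesis
  proof (rule torsion_freeI[OF r(1)])
    fix A h a assume A: "A \<in> E" "h \<in> rmod_hom R A (rquot M ?T)" "a \<in> carrier A"
    have "h a \<in> a_r_coset M ?T ` carrier M" using hom_closed[OF A(2,3)] r(3) by simp
    then obtain x where x: "x \<in> carrier M" "h a = a_r_coset M ?T x" by auto
    have "x \<in> K" if K: "rsubmodule R M K" "torsion_free R E (rquot M K)" for K
    proof -
      note rK = right_module.rquot_facts[OF M K(1)]
      have "?T \<subseteq> K" using K unfolding torsion_part_def by blast
      then obtain g where g: "g \<in> rmod_hom R (rquot M ?T) (rquot M K)"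
        "\<forall>x\<in>carrier M. g (a_r_coset M ?T x) = a_r_coset M K x"
        using hom_factor[OF M r(1) rK(1) r(2,3) rK(2)] r(4) rK(4) by blast
      then show "x \<in> K"
        using torsion_freeD[OF K(2) A(1) hom_comp[OF A(2) g(1)] A(3)] x rK(4) by simp
    qed
    then have "x \<in> ?T" by (auto simp: torsion_part_def)
    then show "h a = \<zero>\<^bsub>rquot M ?T\<^esub>" using x r(4) by simp
  qed
qed

end

section \<open>Consequences of heredity and of homological dimension one\<close>

locale hereditary_placed = well_placed R E
  for R :: "('r, 'k) ring_scheme" and E :: "('r, 'r univ) rmod set" +
  assumes right_hereditary: "right_hereditary R"
    and dim_one: "A \<in> E \<Longrightarrow> carrier A \<noteq> {\<zero>\<^bsub>A\<^esub>} \<Longrightarrow> hom_dim_one R A"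
begin

lemma base_ring: "ring R"
  using right_hereditary by (simp add: right_hereditary_def)

text \<open>The image of h : A to R is a projective right ideal, so A maps onto it with a section
  \<open>s\<close>. That image is not known to lie in \<open>E\<close>, since R need not be an
  object, but it is isomorphic to the image of the endomorphism e = s h of A, which does. This
  object is projective, hence zero by the dimension hypothesis, and h = h e vanishes.\<close>

lemma torsion_free_regular: "torsion_free R E (regular_rmod R)"
proof (rule torsion_freeI[OF regular_rmod_module[OF base_ring]])
  fix A h a assume A: "A \<in> E" and h: "h \<in> rmod_hom R A (regular_rmod R)" and a: "a \<in> carrier A"
  interpret A: right_module R A by (rule object_module[OF A])
  interpret R1: right_module R "regular_rmod R" by (rule regular_rmod_module[OF base_ring])
  let ?I = "h ` carrier A"
  let ?J = "sub (regular_rmod R) ?I"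
  have I: "rsubmodule R (regular_rmod R) ?I"
    by (rule rsubmodule_image_carrier[OF A.right_module_axioms R1.right_module_axioms h])
  have P: "projective_rmod R ?J" by (rule right_hereditary_projective[OF right_hereditary I])
  interpret J: right_module R ?J by (rule R1.right_module_sub[OF I])
  have hJ: "h \<in> rmod_hom R A ?J" by (rule hom_sub_cod[OF h]) simp
  obtain s where s: "s \<in> rmod_hom R ?J A" "\<forall>x\<in>?I. h (s x) = x"
    using projective_lift[OF P A.right_module_axioms J.right_module_axioms hJ J.hom_id] by auto
  define e where "e x = s (h x)" for x
  have e: "e \<in> rmod_hom R A A" unfolding e_def by (rule hom_comp[OF hJ s(1)])
  have he: "h (e x) = h x" if "x \<in> carrier A" for x using s(2) that by (simp add: e_def)
  obtain A' u where A': "A' \<in> E" and u: "u \<in> rmod_hom R A' (sub A (e ` carrier A))"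
    "bij_betw u (carrier A') (e ` carrier A)"
    using images[OF A A e] by (auto simp: belongs_to_def rmod_iso_def)
  interpret A': right_module R A' by (rule object_module[OF A'])
  interpret eA: right_module R "sub A (e ` carrier A)"
    by (rule A.right_module_sub[OF rsubmodule_image_carrier[OF A.right_module_axioms A.right_module_axioms e]])
  let ?v = "inv_into (carrier A') u"
  have v: "?v \<in> rmod_hom R (sub A (e ` carrier A)) A'"
    by (rule inverse_hom[OF A'.right_module_axioms u(1)]) (use u(2) in simp)
  have sI: "s x \<in> e ` carrier A" if x: "x \<in> ?I" for x
  proof -
    have "s x \<in> carrier A" using hom_closed[OF s(1)] x by simp
    moreover have "e (s x) = s x" using bspec[OF s(2) x] by (simp only: e_def)
    ultimately show ?thesis by (metis imageI)
  qed
  have sJ: "s \<in> rmod_hom R ?J (sub A (e ` carrier A))"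
    by (rule hom_sub_cod[OF s(1)]) (use sI in auto)
  have eA_sub: "e ` carrier A \<subseteq> carrier A" using hom_closed[OF e] by auto
  have hu: "(\<lambda>x. h (u x)) \<in> rmod_hom R A' ?J"
    by (rule hom_comp[OF hom_sub_incl[OF u(1) eA_sub] hJ])
  have suh: "s (h (u x)) = u x" if x: "x \<in> carrier A'" for x
  proof -
    have "u x \<in> e ` carrier A" using hom_closed[OF u(1) x] by simp
    then obtain y where "y \<in> carrier A" "u x = e y" by auto
    then show ?thesis using he by (simp add: e_def)
  qed
  \<comment> \<open>\<open>A'\<close> is a copy of e(A), isomorphic to the ideal by \<open>h\<close>
    and \<open>s\<close>. The splitting is found over the ideal and carried over, because
    projectivity of \<open>A'\<close> must be witnessed in its own type.\<close>
  have "projective_rmod R A'"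
  proof (rule projectiveI[OF A'.right_module_axioms])
    fix p assume p: "p \<in> rmod_hom R (free_rmod R (carrier A')) A'"
      "p ` carrier (free_rmod R (carrier A')) = carrier A'"
    have "(\<lambda>x. ?v (s x)) ` carrier ?J \<subseteq> p ` carrier (free_rmod R (carrier A'))"
      using hom_closed[OF hom_comp[OF sJ v]] p(2) by auto
    then obtain l where l: "l \<in> rmod_hom R ?J (free_rmod R (carrier A'))" "\<forall>x\<in>carrier ?J. p (l x) = ?v (s x)"
      using projective_lift[OF P free_rmod_module[OF base_ring] A'.right_module_axioms p(1) hom_comp[OF sJ v]] by auto
    show "\<exists>i\<in>rmod_hom R A' (free_rmod R (carrier A')). \<forall>x\<in>carrier A'. p (i x) = x"
    proof (rule bexI[OF _ hom_comp[OF hu l(1)]], rule ballI)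
      fix x assume x: "x \<in> carrier A'"
      have "p (l (h (u x))) = ?v (s (h (u x)))" using bspec[OF l(2) hom_closed[OF hu x]] .
      also have "\<dots> = x" using suh[OF x] u(2) x by (simp add: bij_betw_def)
      finally show "p (l (h (u x))) = x" .
    qed
  qed
  then have "carrier A' = {\<zero>\<^bsub>A'\<^esub>}" using dim_one[OF A'] by (auto simp: hom_dim_one_def)
  then have "e ` carrier A = {u \<zero>\<^bsub>A'\<^esub>}" using u(2) by (simp add: bij_betw_def)
  also have "u \<zero>\<^bsub>A'\<^esub> = \<zero>\<^bsub>A\<^esub>"
    using hom_zero[OF A'.M.abelian_group_axioms eA.M.abelian_group_axioms u(1)] by simp
  finally have "e a = \<zero>\<^bsub>A\<^esub>" using a by auto
  then show "h a = \<zero>\<^bsub>regular_rmod R\<^esub>"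
    using he[OF a] hom_zero[OF A.M.abelian_group_axioms R1.M.abelian_group_axioms h] by simp
qed

text \<open>A module without nonzero maps to \<open>R\<close> is called bound. The preimage of a bound submodule
  in a free module is projective, and any coordinate functional on it that kills the finitely many
  relations of \<open>M\<close> descends to \<open>D\<close> and so vanishes: finitely many coordinates remain.\<close>

lemma fin_gen_bound:
  assumes M: "fin_presented R M" and D: "rsubmodule R M D"
    and bound: "\<And>h d. h \<in> rmod_hom R (sub M D) (regular_rmod R) \<Longrightarrow> d \<in> D \<Longrightarrow> h d = \<zero>\<^bsub>R\<^esub>"
  shows "fin_gen R M D"
proof -
  obtain n :: nat and p where p: "p \<in> rmod_hom R (free_rmod R {..<n}) M"
    "p ` carrier (free_rmod R {..<n}) = carrier M"
    "fin_gen R (free_rmod R {..<n}) (a_kernel (free_rmod R {..<n}) M p)"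
    using M unfolding fin_presented_def by blast
  let ?F = "free_rmod R {..<n}"
  interpret M: right_module R M using M by (simp add: fin_presented_def)
  interpret F: right_module R ?F by (rule free_rmod_module[OF base_ring])
  interpret R1: right_module R "regular_rmod R" by (rule regular_rmod_module[OF base_ring])
  interpret D: right_module R "sub M D" by (rule M.right_module_sub[OF D])
  obtain U where U: "finite U" "U \<subseteq> carrier ?F" "a_kernel ?F M p = rspan R ?F U"
    using p(3) by (auto simp: fin_gen_def)
  define Q where "Q = {x \<in> carrier ?F. p x \<in> D}"
  have Q: "rsubmodule R ?F Q"
    unfolding Q_def by (rule rsubmodule_vimage[OF F.right_module_axioms M.right_module_axioms p(1) D])
  interpret Q: right_module R "sub ?F Q" by (rule F.right_module_sub[OF Q])
  have "rmod_iso R (sub ?F Q) (sub ?F Q)"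
    unfolding rmod_iso_def by (intro bexI[OF _ Q.hom_id]) (simp add: bij_betw_def)
  then have "projective_rmod R (sub ?F Q)"
    by (rule hereditary_submodule_projective_iso[OF right_hereditary Q Q.right_module_axioms])
  then obtain X :: "(nat \<Rightarrow> 'r) set" and i r where i: "i \<in> rmod_hom R (sub ?F Q) (free_rmod R X)"
    and r: "r \<in> rmod_hom R (free_rmod R X) (sub ?F Q)" and ri: "\<forall>x\<in>Q. r (i x) = x"
    unfolding projective_rmod_def by auto
  \<comment> \<open>\<open>S\<close> collects the coordinates that occur in generators of the
    relations of \<open>M\<close>; a coordinate outside \<open>S\<close> vanishes on all
    relations.\<close>
  define S where "S = (\<Union>u\<in>U. {y. i u y \<noteq> \<zero>\<^bsub>R\<^esub>})"
  have kerQ: "a_kernel ?F M p \<subseteq> Q" using rsubmoduleD(2)[OF D] by (auto simp: a_kernel_eq Q_def)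
  have UQ: "U \<subseteq> Q" using U(3) kerQ F.rspan_superset by auto
  have iu: "i u \<in> carrier (free_rmod R X)" if "u \<in> Q" for u using hom_closed[OF i] that by simp
  have S: "finite S" "S \<subseteq> X" using U(1) UQ iu by (auto simp: S_def free_rmod_simps subset_iff)
  have pQ: "p \<in> rmod_hom R (sub ?F Q) (sub M D)"
    by (rule hom_sub_cod[OF hom_sub_dom[OF p(1)]]) (auto simp: Q_def)
  have pQD: "p ` Q = D"
  proof
    show "D \<subseteq> p ` Q"
    proof
      fix d assume d: "d \<in> D"
      then have "d \<in> p ` carrier ?F" using p(2) rsubmoduleD(5)[OF D] by simp
      then show "d \<in> p ` Q" using d by (auto simp: Q_def)
    qed
  qed (auto simp: Q_def)
  have van: "i q y = \<zero>\<^bsub>R\<^esub>" if y: "y \<notin> S" and q: "q \<in> Q" for y q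
  proof -
    let ?c = "\<lambda>q. i q y"
    have c: "?c \<in> rmod_hom R (sub ?F Q) (regular_rmod R)" by (rule hom_comp[OF i coord_hom])
    let ?V = "{q \<in> carrier (sub ?F Q). ?c q = \<zero>\<^bsub>regular_rmod R\<^esub>}"
    have V: "rsubmodule R ?F ?V"
      by (rule F.rsubmodule_trans[OF Q rsubmodule_kernel[OF Q.right_module_axioms R1.right_module_axioms c]])
    have "U \<subseteq> ?V" using UQ y by (auto simp: S_def regular_rmod_simps)
    then have "a_kernel ?F M p \<subseteq> ?V" unfolding U(3) by (rule F.rspan_least[OF V])
    then have ker: "?c q = \<zero>\<^bsub>regular_rmod R\<^esub>" if "q \<in> carrier (sub ?F Q)" "p q = \<zero>\<^bsub>sub M D\<^esub>" for q
      using that by (auto simp: a_kernel_eq Q_def)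
    obtain g where g: "g \<in> rmod_hom R (sub M D) (regular_rmod R)" "\<forall>q\<in>Q. g (p q) = ?c q"
      using hom_factor[OF Q.right_module_axioms D.right_module_axioms R1.right_module_axioms pQ _ c] ker pQD by auto
    show ?thesis using bound[OF g(1), of "p q"] g(2) q by (simp add: Q_def)
  qed
  let ?W = "(\<lambda>y. r (unit_vec R y)) ` S"
  have W: "?W \<subseteq> Q"
    using S(2) hom_closed[OF r unit_vec_closed[OF base_ring]] by auto
  have span: "rsubmodule R (sub ?F Q) (rspan R (sub ?F Q) ?W)" using W by (intro Q.rspan_rsubmodule) simp
  have "Q \<subseteq> rspan R (sub ?F Q) ?W"
  proof
    fix q assume q: "q \<in> Q"
    have fx: "i q x \<in> carrier R" for x using iu[OF q] by (simp add: free_rmod_simps)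
    have "q = r (i q)" using ri q by simp
    also have "\<dots> = (\<Oplus>\<^bsub>sub ?F Q\<^esub>x\<in>S. r (unit_vec R x) \<star>\<^bsub>sub ?F Q\<^esub> i q x)"
      by (rule free_expand[OF Q.right_module_axioms r iu[OF q] S]) (rule van[OF _ q])
    also have "\<dots> \<in> rspan R (sub ?F Q) ?W"
      using Q.rspan_superset[of ?W]
      by (intro rsubmodule_finsum[OF Q.right_module_axioms span] rsubmoduleD(4)[OF span] fx) auto
    finally show "q \<in> rspan R (sub ?F Q) ?W" .
  qed
  then have "fin_gen R (sub ?F Q) Q"
    unfolding fin_gen_def using S(1) W rsubmoduleD(1)[OF span] by (intro exI[of _ ?W]) auto
  from fin_gen_image[OF Q.right_module_axioms M.right_module_axioms hom_sub_incl[OF pQ rsubmoduleD(1)[OF D]] this]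
  show ?thesis using pQD by simp
qed

text \<open>Submodules of an object need not lie in \<open>E\<close>, but unions of ones that do
  again do: D / Y0 has no nonzero map to R because none of the pieces has, so it is finitely
  generated by \<open>fin_gen_bound\<close>, and a single piece contains its generators. Two pieces
  lie in a common one, as their sum is the image of a map from their product to
  \<open>Y\<close>.\<close>

lemma quot_in_union:
  assumes Y: "quot_in R E Y Y0" and D: "rsubmodule R Y D"
    and loc: "\<And>y. y \<in> D \<Longrightarrow> \<exists>D'. y \<in> D' \<and> D' \<subseteq> D \<and> quot_in R E (sub Y D') Y0 \<and> rsubmodule R Y D'"
  shows "quot_in R E (sub Y D) Y0"
proof -
  obtain C q where Ym: "right_module R Y" and C: "C \<in> E" "right_module R C" and q: "q \<in> rmod_hom R Y C"
    "q ` carrier Y = carrier C" and Y0: "Y0 = {y \<in> carrier Y. q y = \<zero>\<^bsub>C\<^esub>}"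
    using quot_inD[OF Y] by (elim exE conjE) (rule that)
  interpret Y: right_module R Y by fact
  interpret C: right_module R C by fact
  have Dsub: "D \<subseteq> carrier Y" by (rule rsubmoduleD(1)[OF D])
  have fin: "\<exists>D'. W \<subseteq> D' \<and> D' \<subseteq> D \<and> quot_in R E (sub Y D') Y0 \<and> rsubmodule R Y D'"
    if "finite W" "W \<subseteq> D" for W
    using that
  proof (induction W rule: finite_induct)
    case empty
    then show ?case using loc[OF rsubmoduleD(2)[OF D]] by blast
  next
    case (insert w W)
    obtain D1 where D1: "W \<subseteq> D1" "D1 \<subseteq> D" "quot_in R E (sub Y D1) Y0" "rsubmodule R Y D1"
      using insert by auto
    obtain D2 where D2: "w \<in> D2" "D2 \<subseteq> D" "quot_in R E (sub Y D2) Y0" "rsubmodule R Y D2"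
      using insert.prems loc by blast
    let ?P = "rmod_prod (sub Y D1) (sub Y D2)" and ?h = "\<lambda>w. fst w \<oplus>\<^bsub>Y\<^esub> snd w"
    have h: "?h \<in> rmod_hom R ?P Y"
      using hom_copair[OF Ym hom_sub_dom[OF Y.hom_id rsubmoduleD(1)[OF D1(4)]]
          hom_sub_dom[OF Y.hom_id rsubmoduleD(1)[OF D2(4)]]] .
    have P: "quot_in R E ?P (Y0 \<times> Y0)" by (rule quot_in_prod[OF D1(3) D2(3)])
    note Y0s = quot_in_rsubmodule[OF Y]
    let ?V = "{?h y \<oplus>\<^bsub>Y\<^esub> z | y z. y \<in> carrier ?P \<and> z \<in> Y0}"
    have V: "quot_in R E (sub Y ?V) Y0"
      by (rule quot_in_image[OF P Y h]) (use rsubmoduleD(3)[OF Y0s] in auto)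
    have "Y0 \<subseteq> D1" using rsubmoduleD(1)[OF quot_in_rsubmodule[OF D1(3)]] by simp
    have VD: "?V \<subseteq> D"
    proof
      fix x assume "x \<in> ?V"
      then obtain a b z where abz: "x = a \<oplus>\<^bsub>Y\<^esub> b \<oplus>\<^bsub>Y\<^esub> z" "a \<in> D1" "b \<in> D2" "z \<in> Y0"
        by (auto simp: rmod_prod_simps)
      show "x \<in> D" unfolding abz(1)
        by (intro rsubmoduleD(3)[OF D]) (use abz D1(2) D2(2) \<open>Y0 \<subseteq> D1\<close> in blast)+
    qed
    have Veq: "?V = {a \<oplus>\<^bsub>Y\<^esub> b | a b. a \<in> ?h ` carrier ?P \<and> b \<in> Y0}" by blast
    have Vs: "rsubmodule R Y ?V"
      unfolding Veq
      by (rule rsubmodule_sum[OF Ym rsubmodule_image_carrier[OF quot_in_module[OF P] Ym h] Y0s])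
    have z: "\<zero>\<^bsub>Y\<^esub> \<in> Y0" "\<zero>\<^bsub>Y\<^esub> \<in> D1" "\<zero>\<^bsub>Y\<^esub> \<in> D2"
      using rsubmoduleD(2) Y0s D1(4) D2(4) by auto
    have "x \<in> ?V" if "x \<in> insert w W" for x
    proof -
      have "?h (if x = w then (\<zero>\<^bsub>Y\<^esub>, x) else (x, \<zero>\<^bsub>Y\<^esub>)) \<oplus>\<^bsub>Y\<^esub> \<zero>\<^bsub>Y\<^esub> = x"
        using that insert.prems Dsub by (auto simp: subset_iff)
      moreover have "(if x = w then (\<zero>\<^bsub>Y\<^esub>, x) else (x, \<zero>\<^bsub>Y\<^esub>)) \<in> carrier ?P"
        using that D1(1) D2(1) z by (auto simp: rmod_prod_simps)
      ultimately show ?thesis using z(1) unfolding mem_Collect_eq by (intro exI conjI) (rule sym)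
    qed
    then show ?case using V VD Vs by blast
  qed
  have Y0D: "Y0 \<subseteq> D"
    using fin[of "{}"] rsubmoduleD(1)[OF quot_in_rsubmodule] by fastforce
  have qD: "rsubmodule R C (q ` D)" by (rule rsubmodule_image[OF Ym C(2) q(1) D])
  have "fin_gen R C (q ` D)"
  proof (rule fin_gen_bound[OF object_fp[OF C(1)] qD])
    fix h d assume h: "h \<in> rmod_hom R (sub C (q ` D)) (regular_rmod R)" and "d \<in> q ` D"
    then obtain y where y: "y \<in> D" "d = q y" by auto
    obtain D' where D': "y \<in> D'" "D' \<subseteq> D" "quot_in R E (sub Y D') Y0" "rsubmodule R Y D'"
      using loc[OF y(1)] by auto
    have q': "q \<in> rmod_hom R (sub Y D') (sub C (q ` D))"
      using D'(2) by (intro hom_sub_cod[OF hom_sub_dom[OF q(1)]] rsubmoduleD(1)[OF D'(4)]) auto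
    interpret qD: right_module R "sub C (q ` D)" by (rule C.right_module_sub[OF qD])
    have "h (q y) = \<zero>\<^bsub>regular_rmod R\<^esub>"
    proof (rule torsion_free_quot[OF torsion_free_regular D'(3) hom_comp[OF q' h]])
      fix y assume "y \<in> Y0"
      then have "q y = \<zero>\<^bsub>sub C (q ` D)\<^esub>" using Y0 by simp
      then show "h (q y) = \<zero>\<^bsub>regular_rmod R\<^esub>"
        using hom_zero[OF qD.M.abelian_group_axioms right_module_abelian_group[OF regular_rmod_module[OF base_ring]] h] by simp
    qed (use D'(1) in simp)
    then show "h d = \<zero>\<^bsub>R\<^esub>" using y(2) by (simp add: regular_rmod_simps)
  qed
  then obtain V where V: "finite V" "q ` D = rspan R C V" by (auto simp: fin_gen_def)
  then have "V \<subseteq> q ` D" using C.rspan_superset[of V] by simp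
  then obtain W where W: "W \<subseteq> D" "finite W" "V = q ` W" using V(1) by (meson finite_subset_image)
  obtain D' where D': "W \<subseteq> D'" "D' \<subseteq> D" "quot_in R E (sub Y D') Y0" "rsubmodule R Y D'"
    using fin[OF W(2,1)] by auto
  have Y0D': "Y0 \<subseteq> D'" using rsubmoduleD(1)[OF quot_in_rsubmodule[OF D'(3)]] by simp
  have "D \<subseteq> D'"
  proof
    fix y assume y: "y \<in> D"
    have "q y \<in> rspan R C V" using y V(2) by auto
    also have "\<dots> \<subseteq> q ` D'"
      by (rule C.rspan_least[OF rsubmodule_image[OF Ym C(2) q(1) D'(4)]]) (use W(3) D'(1) in auto)
    finally obtain d where d: "d \<in> D'" "q y = q d" by auto
    have c: "y \<in> carrier Y" "d \<in> carrier Y" using y d(1) D'(2) Dsub by auto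
    have "q (y \<ominus>\<^bsub>Y\<^esub> d) = \<zero>\<^bsub>C\<^esub>"
      using hom_diff[OF Y.M.abelian_group_axioms C.M.abelian_group_axioms q(1) c] d(2)
        C.diff_eq_zero[of "q d" "q d"] hom_closed[OF q(1) c(2)] by simp
    then have "y \<ominus>\<^bsub>Y\<^esub> d \<in> D'" using Y0 c Y0D' by auto
    then show "y \<in> D'" using rsubmoduleD(3)[OF D'(4) _ d(1)] Y.diff_add[OF c] by fastforce
  qed
  then show ?thesis using D'(2,3) by (simp add: subset_antisym)
qed

text \<open>Let K be the kernel of h : T to R, for T the torsion part. Then M / K has the submodule
  T / K, which embeds in R, with quotient M / T. Both are torsion-free, hence so is M / K, and
  minimality of T gives K = T. So T has no nonzero map to R and \<open>fin_gen_bound\<close>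
  applies.\<close>

lemma fin_gen_torsion_part:
  assumes "fin_presented R M"
  shows "fin_gen R M (torsion_part R E M)"
proof (rule fin_gen_bound[OF assms])
  interpret M: right_module R M using assms by (simp add: fin_presented_def)
  let ?T = "torsion_part R E M"
  show T: "rsubmodule R M ?T" by (rule rsubmodule_torsion_part[OF M.right_module_axioms])
  fix h d assume h: "h \<in> rmod_hom R (sub M ?T) (regular_rmod R)" and d: "d \<in> ?T"
  interpret T: right_module R "sub M ?T" by (rule M.right_module_sub[OF T])
  interpret R1: right_module R "regular_rmod R" by (rule regular_rmod_module[OF base_ring])
  let ?K = "{x \<in> carrier (sub M ?T). h x = \<zero>\<^bsub>regular_rmod R\<^esub>}"
  have K: "rsubmodule R M ?K"
    by (rule M.rsubmodule_trans[OF T rsubmodule_kernel[OF T.right_module_axioms R1.right_module_axioms h]])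
  note rK = M.rquot_facts[OF K] and rT = M.rquot_facts[OF T]
  note tf = torsion_free_rquot_torsion_part[OF M.right_module_axioms]
  let ?c = "a_r_coset M ?K"
  have KT: "?K \<subseteq> ?T" by auto
  obtain g where g: "g \<in> rmod_hom R (rquot M ?K) (rquot M ?T)"
    "\<forall>x\<in>carrier M. g (?c x) = a_r_coset M ?T x"
    using hom_factor[OF M.right_module_axioms rK(1) rT(1) rK(2,3) rT(2)] rK(4) rT(4) KT by auto
  have cT: "rsubmodule R (rquot M ?K) (?c ` ?T)"
    by (rule rsubmodule_image[OF M.right_module_axioms rK(1,2) T])
  have c: "?c \<in> rmod_hom R (sub M ?T) (sub (rquot M ?K) (?c ` ?T))"
    by (rule hom_sub_cod[OF hom_sub_dom[OF rK(2) rsubmoduleD(1)[OF T]]]) simp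
  have cker: "h y = \<zero>\<^bsub>regular_rmod R\<^esub>"
    if "y \<in> carrier (sub M ?T)" "?c y = \<zero>\<^bsub>sub (rquot M ?K) (?c ` ?T)\<^esub>" for y
    using that rK(4)[of y] rsubmoduleD(5)[OF T] by auto
  have "\<exists>k\<in>rmod_hom R (sub (rquot M ?K) (?c ` ?T)) (regular_rmod R). \<forall>y\<in>carrier (sub M ?T). k (?c y) = h y"
    by (rule hom_factor[OF T.right_module_axioms right_module.right_module_sub[OF rK(1) cT]
          R1.right_module_axioms c _ h cker]) (simp_all only: sub_simps)
  then obtain k where k: "k \<in> rmod_hom R (sub (rquot M ?K) (?c ` ?T)) (regular_rmod R)" "\<forall>y\<in>?T. k (?c y) = h y"
    unfolding sub_simps by blast
  have "torsion_free R E (rquot M ?K)"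
  proof (rule torsion_freeI[OF rK(1)])
    fix A f a assume A: "A \<in> E" "f \<in> rmod_hom R A (rquot M ?K)" "a \<in> carrier A"
    have fT: "\<exists>y\<in>?T. f a = ?c y" if a: "a \<in> carrier A" for a
    proof -
      have "f a \<in> ?c ` carrier M" using hom_closed[OF A(2) a] unfolding rK(3) .
      then obtain x where x: "x \<in> carrier M" "f a = ?c x" by (elim imageE)
      have "g (f a) = \<zero>\<^bsub>rquot M ?T\<^esub>" by (rule torsion_freeD[OF tf A(1) hom_comp[OF A(2) g(1)] a])
      then have "x \<in> ?T" using x g(2) rT(4)[OF x(1)] by simp
      then show ?thesis using x(2) by blast
    qed
    have "f ` carrier A \<subseteq> ?c ` ?T"
    proof
      fix z assume "z \<in> f ` carrier A"
      then obtain a where a: "z = f a" "a \<in> carrier A" by (elim imageE)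
      obtain y where "y \<in> ?T" "f a = ?c y" using fT[OF a(2)] by blast
      then show "z \<in> ?c ` ?T" unfolding a(1) by blast
    qed
    then have f: "f \<in> rmod_hom R A (sub (rquot M ?K) (?c ` ?T))" by (rule hom_sub_cod[OF A(2)])
    obtain y where y: "y \<in> ?T" "f a = ?c y" using fT[OF A(3)] by blast
    have "h y = \<zero>\<^bsub>regular_rmod R\<^esub>"
      using torsion_freeD[OF torsion_free_regular A(1) hom_comp[OF f k(1)] A(3)] k(2) y by simp
    then show "f a = \<zero>\<^bsub>rquot M ?K\<^esub>" using y rK(4)[of y] rsubmoduleD(5)[OF T y(1)] by simp
  qed
  then have "?K \<in> {K. rsubmodule R M K \<and> torsion_free R E (rquot M K)}" using K by simp
  from Inter_lower[OF this] have "?T \<subseteq> ?K" unfolding torsion_part_def[symmetric] .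
  then show "h d = \<zero>\<^bsub>R\<^esub>" using d by (auto simp: regular_rmod_simps)
qed

end

section \<open>Local modules\<close>

text \<open>The presentations range over the same types as in \<open>inverts\<close>, so that the
  two notions can be compared. Uniqueness of the extension \<open>e\<close> is not demanded, as it
  follows from torsion-freeness by \<open>torsion_free_extension_unique\<close>.\<close>

definition local_module ::
    "('r, 'k) ring_scheme \<Rightarrow> ('r, 'r univ) rmod set \<Rightarrow> ('r, 'm, 'z) rmod_scheme \<Rightarrow> bool"
  where "local_module R E X \<longleftrightarrow> torsion_free R E X \<and>
    (\<forall>A\<in>E. \<forall>(P :: ('r, 'r univ) rmod) (Q :: ('r, 'r univ) rmod) f g.
      fg_projective_rmod R P \<and> fg_projective_rmod R Q \<and> short_exact R P f Q g A \<longrightarrow>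
      (\<forall>c\<in>rmod_hom R P X. \<exists>e\<in>rmod_hom R Q X. \<forall>p\<in>carrier P. e (f p) = c p))"

text \<open>Carries modules of vectors into \<open>'r univ\<close>, the type in which
  \<open>inverts\<close> and \<open>local_module\<close> expect their presentations: a vector x
  becomes the set {x}.\<close>

definition singleton_rmod :: "('r, 'm, 'z) rmod_scheme \<Rightarrow> ('r, 'm set) rmod"
  where "singleton_rmod M =
    \<lparr>carrier = (\<lambda>x. {x}) ` carrier M, monoid.mult = (\<lambda>_ _. undefined), one = undefined,
     ring.zero = {\<zero>\<^bsub>M\<^esub>}, add = (\<lambda>X Y. {the_elem X \<oplus>\<^bsub>M\<^esub> the_elem Y}),
     ract = (\<lambda>X a. {the_elem X \<star>\<^bsub>M\<^esub> a})\<rparr>"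

lemma singleton_rmod_facts:
  assumes M: "right_module R M"
  shows "right_module R (singleton_rmod M)"
    and "(\<lambda>x. {x}) \<in> rmod_hom R M (singleton_rmod M)"
    and "bij_betw (\<lambda>x. {x}) (carrier M) (carrier (singleton_rmod M))"
    and "the_elem \<in> rmod_hom R (singleton_rmod M) M"
    and "carrier (singleton_rmod M) = (\<lambda>x. {x}) ` carrier M"
proof -
  interpret M: right_module R M by fact
  show "right_module R (singleton_rmod M)"
  proof (rule right_moduleI)
    show "\<exists>y\<in>carrier (singleton_rmod M). y \<oplus>\<^bsub>singleton_rmod M\<^esub> x = \<zero>\<^bsub>singleton_rmod M\<^esub>"
      if "x \<in> carrier (singleton_rmod M)" for x
      using that by (intro bexI[of _ "{\<ominus>\<^bsub>M\<^esub> the_elem x}"])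
        (auto simp: singleton_rmod_def M.M.l_neg)
  qed (auto simp: singleton_rmod_def M.R.ring_axioms M.M.a_ac
      M.ract_add_left M.ract_add_right M.ract_assoc M.ract_one M.ract_closed)
qed (auto intro!: rmod_homI simp: singleton_rmod_def bij_betw_def)

lemma fin_gen_sub:
  assumes M: "right_module R M" and N: "fin_gen R M N"
  shows "fin_gen R (sub M N) N"
proof -
  interpret M: right_module R M by fact
  have Ns: "rsubmodule R M N" by (rule fin_gen_rsubmodule[OF M N])
  interpret N: right_module R "sub M N" by (rule M.right_module_sub[OF Ns])
  obtain X where X: "finite X" "X \<subseteq> carrier M" "N = rspan R M X" using N by (auto simp: fin_gen_def)
  have XN: "X \<subseteq> N" unfolding X(3) by (rule M.rspan_superset)
  have s: "rsubmodule R (sub M N) (rspan R (sub M N) X)" by (rule N.rspan_rsubmodule) (simp add: XN)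
  have "rspan R M X \<subseteq> rspan R (sub M N) X"
    by (rule M.rspan_least[OF M.rsubmodule_trans[OF Ns s] N.rspan_superset])
  then have "N = rspan R (sub M N) X" using X(3) rsubmoduleD(1)[OF s] by auto
  then show ?thesis unfolding fin_gen_def using X(1) XN by (intro exI[of _ X]) simp
qed

lemma fin_gen_free:
  assumes R: "ring R"
  shows "fin_gen R (free_rmod R {..<n :: nat}) (carrier (free_rmod R {..<n}))"
proof -
  let ?F = "free_rmod R {..<n}" and ?X = "unit_vec R ` {..<n}"
  interpret F: right_module R ?F by (rule free_rmod_module[OF R])
  have X: "?X \<subseteq> carrier ?F" using unit_vec_closed[OF R, of _ "{..<n}"] by auto
  have s: "rsubmodule R ?F (rspan R ?F ?X)" by (rule F.rspan_rsubmodule[OF X])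
  have "f \<in> rspan R ?F ?X" if f: "f \<in> carrier ?F" for f
  proof -
    have fx: "f x \<in> carrier R" for x using f by (simp add: free_rmod_simps)
    have "f = (\<Oplus>\<^bsub>?F\<^esub>x\<in>{..<n}. unit_vec R x \<star>\<^bsub>?F\<^esub> f x)"
      by (rule free_expand[OF F.right_module_axioms F.hom_id f]) (use f in \<open>auto simp: free_rmod_simps\<close>)
    also have "\<dots> \<in> rspan R ?F ?X"
      using F.rspan_superset[of ?X] by (intro rsubmodule_finsum[OF F.right_module_axioms s] rsubmoduleD(4)[OF s] fx) auto
    finally show ?thesis .
  qed
  then have "carrier ?F = rspan R ?F ?X" using rsubmoduleD(1)[OF s] by blast
  then show ?thesis unfolding fin_gen_def using X by (intro exI[of _ ?X]) simp
qed

text \<open>\<open>Y\<close> is the quotient of Y0 x F by the pairs (-l x, x) with l x in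
  \<open>Y0\<close>, and on these the two given maps cancel by \<open>eq\<close>.\<close>

lemma hom_glue:
  assumes Y: "right_module R Y" and F: "right_module R F" and X: "right_module R X"
    and Y0: "rsubmodule R Y Y0" and l: "l \<in> rmod_hom R F Y"
    and cover: "\<forall>y\<in>carrier Y. \<exists>x\<in>carrier F. \<exists>y0\<in>Y0. y = y0 \<oplus>\<^bsub>Y\<^esub> l x"
    and c: "c \<in> rmod_hom R (sub Y Y0) X" and e: "e \<in> rmod_hom R F X"
    and eq: "\<And>x. x \<in> carrier F \<Longrightarrow> l x \<in> Y0 \<Longrightarrow> e x = c (l x)"
  shows "\<exists>G\<in>rmod_hom R Y X. (\<forall>y\<in>Y0. G y = c y) \<and> (\<forall>x\<in>carrier F. G (l x) = e x)"
proof -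
  interpret Y: right_module R Y by fact
  interpret F: right_module R F by fact
  interpret X: right_module R X by fact
  interpret Y0: right_module R "sub Y Y0" by (rule Y.right_module_sub[OF Y0])
  let ?P = "rmod_prod (sub Y Y0) F"
  have P: "right_module R ?P" by (rule rmod_prod_module[OF Y0.right_module_axioms F])
  have q: "(\<lambda>w. fst w \<oplus>\<^bsub>Y\<^esub> l (snd w)) \<in> rmod_hom R ?P Y"
    using hom_copair[OF Y hom_sub_dom[OF Y.hom_id rsubmoduleD(1)[OF Y0]] l] .
  have h: "(\<lambda>w. c (fst w) \<oplus>\<^bsub>X\<^esub> e (snd w)) \<in> rmod_hom R ?P X"
    by (rule hom_copair[OF X c e])
  have surj: "(\<lambda>w. fst w \<oplus>\<^bsub>Y\<^esub> l (snd w)) ` carrier ?P = carrier Y"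
  proof
    show "carrier Y \<subseteq> (\<lambda>w. fst w \<oplus>\<^bsub>Y\<^esub> l (snd w)) ` carrier ?P"
    proof
      fix y assume "y \<in> carrier Y"
      then obtain x y0 where "x \<in> carrier F" "y0 \<in> Y0" "y = y0 \<oplus>\<^bsub>Y\<^esub> l x" using cover by blast
      then show "y \<in> (\<lambda>w. fst w \<oplus>\<^bsub>Y\<^esub> l (snd w)) ` carrier ?P"
        by (intro image_eqI[of _ _ "(y0, x)"]) (auto simp: rmod_prod_simps)
    qed
  qed (use hom_closed[OF q] in auto)
  have c0: "c \<zero>\<^bsub>Y\<^esub> = \<zero>\<^bsub>X\<^esub>"
    using hom_zero[OF Y0.M.abelian_group_axioms X.M.abelian_group_axioms c] by simp
  have ker: "c (fst w) \<oplus>\<^bsub>X\<^esub> e (snd w) = \<zero>\<^bsub>X\<^esub>"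
    if w: "w \<in> carrier ?P" "fst w \<oplus>\<^bsub>Y\<^esub> l (snd w) = \<zero>\<^bsub>Y\<^esub>" for w
  proof -
    have m: "fst w \<in> Y0" "snd w \<in> carrier F" using w(1) by (auto simp: rmod_prod_simps)
    have lc: "l (snd w) \<in> carrier Y" by (rule hom_closed[OF l m(2)])
    have "l (snd w) = \<ominus>\<^bsub>Y\<^esub> fst w"
      using w(2) Y.M.minus_equality[of "l (snd w)" "fst w"] lc rsubmoduleD(5)[OF Y0 m(1)] Y.M.a_comm by simp
    then have l0: "l (snd w) \<in> Y0" using Y.rsubmodule_a_inv[OF Y0 m(1)] by simp
    have "c (fst w) \<oplus>\<^bsub>X\<^esub> e (snd w) = c (fst w \<oplus>\<^bsub>Y\<^esub> l (snd w))"
      using hom_add[OF c, of "fst w" "l (snd w)"] m(1) l0 eq[OF m(2) l0] by simp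
    then show ?thesis using w(2) c0 by simp
  qed
  have "\<exists>G\<in>rmod_hom R Y X. \<forall>w\<in>carrier ?P. G (fst w \<oplus>\<^bsub>Y\<^esub> l (snd w)) = c (fst w) \<oplus>\<^bsub>X\<^esub> e (snd w)"
    by (rule hom_factor[OF P Y X q surj h ker])
  then obtain G where G: "G \<in> rmod_hom R Y X"
    "\<forall>w\<in>carrier ?P. G (fst w \<oplus>\<^bsub>Y\<^esub> l (snd w)) = c (fst w) \<oplus>\<^bsub>X\<^esub> e (snd w)" by blast
  have l0: "l \<zero>\<^bsub>F\<^esub> = \<zero>\<^bsub>Y\<^esub>" "e \<zero>\<^bsub>F\<^esub> = \<zero>\<^bsub>X\<^esub>"
    using hom_zero[OF F.M.abelian_group_axioms Y.M.abelian_group_axioms l]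
      hom_zero[OF F.M.abelian_group_axioms X.M.abelian_group_axioms e] by auto
  have "G y = c y" if "y \<in> Y0" for y
    using G(2)[rule_format, of "(y, \<zero>\<^bsub>F\<^esub>)"] that l0 rsubmoduleD(5)[OF Y0 that] hom_closed[OF c, of y]
    by (simp add: rmod_prod_simps)
  moreover have "G (l x) = e x" if "x \<in> carrier F" for x
    using G(2)[rule_format, of "(\<zero>\<^bsub>Y\<^esub>, x)"] that rsubmoduleD(2)[OF Y0] hom_closed[OF l that] hom_closed[OF e that] c0
    by (simp add: rmod_prod_simps)
  ultimately show ?thesis using G(1) by blast
qed

lemma local_module_torsion_free: "local_module R E X \<Longrightarrow> torsion_free R E X"
  by (simp add: local_module_def)

lemma local_module_extend:
  fixes P Q :: "('r, 'r univ) rmod"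
  assumes "local_module R E X" "A \<in> E" "fg_projective_rmod R P" "fg_projective_rmod R Q"
    "short_exact R P f Q g A" "c \<in> rmod_hom R P X"
  shows "\<exists>e\<in>rmod_hom R Q X. \<forall>p\<in>carrier P. e (f p) = c p"
  using assms unfolding local_module_def by blast

context well_placed
begin

text \<open>This is the zero object; an explicit zero module in \<open>'r univ\<close> is made from
  R^0.\<close>

lemma quot_in_carrier:
  assumes Y: "right_module R Y"
  shows "quot_in R E Y (carrier Y)"
proof -
  let ?F = "free_rmod R {..<0 :: nat}"
  have F: "right_module R ?F" by (rule free_rmod_module[OF right_module_ring[OF Y]])
  interpret F: right_module R ?F by (rule F)
  let ?Z = "singleton_rmod ?F"
  note s = singleton_rmod_facts[OF F]
  have cF: "carrier ?F = {\<zero>\<^bsub>?F\<^esub>}"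
    by (auto simp: free_rmod_simps F.R.zero_closed fun_eq_iff)
  have cZ: "carrier ?Z = {\<zero>\<^bsub>?Z\<^esub>}" unfolding s(5) cF by (simp add: singleton_rmod_def)
  have "a_kernel ?F ?Z (\<lambda>x. {x}) = carrier ?F" using cF by (auto simp: a_kernel_eq singleton_rmod_def)
  then have "fin_presented R ?Z"
    unfolding fin_presented_def using s fin_gen_free[OF right_module_ring[OF Y], of 0]
    by (intro conjI exI[of _ "0 :: nat"] exI[of _ "\<lambda>x. {x}"]) auto
  then have Z: "?Z \<in> E" using zero_object[of ?Z] cZ by (simp add: fpmod_def)
  interpret Y: right_module R Y by (rule Y)
  show ?thesis
    by (rule quot_inI[OF Y belongs_to_object[OF Z] hom_zero_map[OF s(1)] _ _ s(1)])
      (use cZ Y.M.zero_closed in auto)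
qed

end

context hereditary_placed
begin

text \<open>Turns a presentation of an object by R^n into one to which \<open>inverts\<close> and
  \<open>local_module\<close> apply. Heredity makes the kernel projective, and with singletons as
  elements its inclusion is the identity function.\<close>

lemma standard_presentation:
  fixes n :: nat
  assumes A: "right_module R A" and q: "q \<in> rmod_hom R (free_rmod R {..<n}) A"
    "q ` carrier (free_rmod R {..<n}) = carrier A"
    and P: "P = a_kernel (free_rmod R {..<n}) A q" "fin_gen R (free_rmod R {..<n}) P"
  shows "fg_projective_rmod R (singleton_rmod (sub (free_rmod R {..<n}) P))"
    and "fg_projective_rmod R (singleton_rmod (free_rmod R {..<n}))"
    and "short_exact R (singleton_rmod (sub (free_rmod R {..<n}) P)) (\<lambda>x. x)
      (singleton_rmod (free_rmod R {..<n})) (\<lambda>x. q (the_elem x)) A"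
proof -
  let ?F = "free_rmod R {..<n}"
  interpret F: right_module R ?F by (rule free_rmod_module[OF base_ring])
  have Ps: "rsubmodule R ?F P" by (rule fin_gen_rsubmodule[OF F.right_module_axioms P(2)])
  have Peq: "P = {y \<in> carrier ?F. q y = \<zero>\<^bsub>A\<^esub>}" using P(1) by (simp add: a_kernel_eq)
  let ?F' = "singleton_rmod ?F" and ?P' = "singleton_rmod (sub ?F P)"
  note s = singleton_rmod_facts[OF F.right_module_axioms]
  have Pm: "right_module R (sub ?F P)" by (rule F.right_module_sub[OF Ps])
  note sP = singleton_rmod_facts[OF Pm]
  have "projective_rmod R ?P'"
    by (rule hereditary_submodule_projective_iso[OF right_hereditary Ps sP(1)])
      (use sP(2,3) in \<open>auto simp: rmod_iso_def\<close>)
  moreover have "fin_gen R ?P' (carrier ?P')"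
    unfolding sP(5) using fin_gen_image[OF Pm sP(1,2) fin_gen_sub[OF F.right_module_axioms P(2)]] by simp
  ultimately show "fg_projective_rmod R ?P'" by (simp add: fg_projective_rmod_def)
  have "projective_rmod R ?F'"
    by (rule hereditary_submodule_projective_iso[OF right_hereditary F.rsubmodule_carrier s(1)])
      (use s(2,3) in \<open>auto simp: rmod_iso_def\<close>)
  moreover have "fin_gen R ?F' (carrier ?F')"
    unfolding s(5) using fin_gen_image[OF F.right_module_axioms s(1,2) fin_gen_free[OF base_ring]] .
  ultimately show "fg_projective_rmod R ?F'" by (simp add: fg_projective_rmod_def)
  have PF: "P \<subseteq> carrier ?F" by (rule rsubmoduleD(1)[OF Ps])
  have id: "(\<lambda>x. x) \<in> rmod_hom R ?P' ?F'"
    by (rule rmod_homI) (use PF in \<open>auto simp: singleton_rmod_def\<close>)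
  show "short_exact R ?P' (\<lambda>x. x) ?F' (\<lambda>x. q (the_elem x)) A"
    unfolding short_exact_def
  proof (intro conjI id hom_comp[OF s(4) q(1)])
    have gen: "(\<lambda>x. x) ` (\<lambda>x. {x}) ` {y \<in> D. B y} = {x \<in> (\<lambda>x. {x}) ` D. B (the_elem x)}"
      for D :: "(nat \<Rightarrow> 'r) set" and B by auto
    show "(\<lambda>x. x) ` carrier ?P' = a_kernel ?F' A (\<lambda>x. q (the_elem x))"
      unfolding a_kernel_eq sP(5) s(5) sub_simps unfolding Peq by (rule gen)
    show "(\<lambda>x. q (the_elem x)) ` carrier ?F' = carrier A"
      unfolding s(5) q(2)[symmetric] image_image by simp
  qed simp
qed

end

subsection \<open>The hull of a torsion-free module\<close>

text \<open>\<open>F / F0\<close> is locally in \<open>E\<close>, and \<open>a\<close> has every map \<open>P \<rightarrow> M\<close> with \<open>R\<^sup>n / P\<close> in \<open>E\<close> as a pullback.\<close>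

locale local_hull = hereditary_placed R E
  for R :: "('r, 'k) ring_scheme" and E :: "('r, 'r univ) rmod set" +
  fixes M :: "('r, 'm, 'z) rmod_scheme" and F :: "('r, 'f, 'w) rmod_scheme"
    and F0 :: "'f set" and a :: "'f \<Rightarrow> 'm" and j :: "'m \<Rightarrow> 'f"
  assumes tfM: "torsion_free R E M" and F: "right_module R F" and F0: "rsubmodule R F F0"
    and a: "a \<in> rmod_hom R (sub F F0) M" and j: "j \<in> rmod_hom R M F"
    and jF0: "m \<in> carrier M \<Longrightarrow> j m \<in> F0" and aj: "m \<in> carrier M \<Longrightarrow> a (j m) = m"
    and locally: "\<lbrakk>finite Z; Z \<subseteq> carrier F\<rbrakk>
      \<Longrightarrow> \<exists>F1. rsubmodule R F F1 \<and> Z \<subseteq> F1 \<and> quot_in R E (sub F F1) (F1 \<inter> F0)"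
    and generic: "\<lbrakk>quot_in R E (free_rmod R {..<n :: nat}) P; fin_gen R (free_rmod R {..<n}) P;
        c \<in> rmod_hom R (sub (free_rmod R {..<n}) P) M\<rbrakk>
      \<Longrightarrow> \<exists>i\<in>rmod_hom R (free_rmod R {..<n}) F. \<forall>p\<in>P. i p \<in> F0 \<and> a (i p) = c p"
begin

text \<open>\<open>F / W\<close> is a pushout, an extension of \<open>M\<close> by the directed union \<open>F / F0\<close> of objects of \<open>E\<close>,
  and \<open>K / W\<close> is the torsion of it.\<close>

definition "W = {z \<in> F0. a z = \<zero>\<^bsub>M\<^esub>}"

text \<open>A \<open>W_hom\<close> is a map from the object R^n / P to F / W, given by a lift
  \<open>\<psi>\<close> on R^n; \<open>W_range\<close> is the preimage in \<open>F\<close> of its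
  image. With lifts, the module F / W never has to be formed.\<close>

definition "W_hom n \<psi> P \<longleftrightarrow> \<psi> \<in> rmod_hom R (free_rmod R {..<n :: nat}) F \<and>
  quot_in R E (free_rmod R {..<n}) P \<and> (\<forall>p\<in>P. \<psi> p \<in> W)"

definition "W_range n \<psi> = {\<psi> y \<oplus>\<^bsub>F\<^esub> w | y w. y \<in> carrier (free_rmod R {..<n :: nat}) \<and> w \<in> W}"

definition "K = {z. \<exists>n \<psi> P. W_hom n \<psi> P \<and> z \<in> W_range n \<psi>}"

definition "L = rquot F K"

definition "\<pi> = a_r_coset F K"

definition "\<kappa> m = \<pi> (j m)"

lemma M: "right_module R M"
  by (rule torsion_free_module[OF tfM])

lemma F0_module: "right_module R (sub F F0)"
  by (rule right_module.right_module_sub[OF F F0])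

lemma a_zero: "a \<zero>\<^bsub>F\<^esub> = \<zero>\<^bsub>M\<^esub>"
  using hom_zero[OF right_module_abelian_group[OF F0_module] right_module_abelian_group[OF M] a] by simp

lemma W_rsubmodule: "rsubmodule R F W"
  using right_module.rsubmodule_trans[OF F F0 rsubmodule_kernel[OF F0_module M a]] by (simp add: W_def)

lemma W_subset: "W \<subseteq> F0"
  by (auto simp: W_def)

lemma W_range_rsubmodule: "\<psi> \<in> rmod_hom R (free_rmod R {..<n :: nat}) F \<Longrightarrow> rsubmodule R F (W_range n \<psi>)"
proof -
  assume \<psi>: "\<psi> \<in> rmod_hom R (free_rmod R {..<n}) F"
  have eq: "W_range n \<psi> = {x \<oplus>\<^bsub>F\<^esub> w | x w. x \<in> \<psi> ` carrier (free_rmod R {..<n}) \<and> w \<in> W}"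
    unfolding W_range_def by blast
  show ?thesis unfolding eq
    by (rule rsubmodule_sum[OF F rsubmodule_image_carrier[OF free_rmod_module[OF base_ring] F \<psi>] W_rsubmodule])
qed

text \<open>Justifies that \<open>K\<close> is defined with free modules only: pulling a map back
  along a presentation of Y / Y0 loses nothing modulo \<open>W\<close>.\<close>

lemma W_range_cover:
  assumes Y: "quot_in R E Y Y0" and \<psi>: "\<psi> \<in> rmod_hom R Y F" and 0: "\<And>y. y \<in> Y0 \<Longrightarrow> \<psi> y \<in> W"
  shows "\<exists>n \<psi>' P. W_hom n \<psi>' P \<and> (\<forall>y\<in>carrier Y. \<forall>w\<in>W. \<psi> y \<oplus>\<^bsub>F\<^esub> w \<in> W_range n \<psi>')"
proof -
  interpret F: right_module R F by (rule F)
  obtain n :: nat and l where l: "l \<in> rmod_hom R (free_rmod R {..<n}) Y"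
    "quot_in R E (free_rmod R {..<n}) {x \<in> carrier (free_rmod R {..<n}). l x \<in> Y0}"
    "fin_gen R (free_rmod R {..<n}) {x \<in> carrier (free_rmod R {..<n}). l x \<in> Y0}"
    "\<forall>y\<in>carrier Y. \<exists>x\<in>carrier (free_rmod R {..<n}). \<exists>y0\<in>Y0. y = y0 \<oplus>\<^bsub>Y\<^esub> l x"
    using quot_in_presentation[OF Y] by (elim exE conjE) (rule that)
  have h: "W_hom n (\<lambda>x. \<psi> (l x)) {x \<in> carrier (free_rmod R {..<n}). l x \<in> Y0}"
    unfolding W_hom_def using hom_comp[OF l(1) \<psi>] l(2) 0 by simp
  have "\<psi> y \<oplus>\<^bsub>F\<^esub> w \<in> W_range n (\<lambda>x. \<psi> (l x))" if y: "y \<in> carrier Y" and w: "w \<in> W" for y w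
  proof -
    obtain x y0 where x: "x \<in> carrier (free_rmod R {..<n})" "y0 \<in> Y0" "y = y0 \<oplus>\<^bsub>Y\<^esub> l x"
      using l(4) y by blast
    have c: "y0 \<in> carrier Y" "l x \<in> carrier Y" "w \<in> carrier F" "\<psi> y0 \<in> W"
      using rsubmoduleD(5)[OF quot_in_rsubmodule[OF Y] x(2)] hom_closed[OF l(1) x(1)]
        rsubmoduleD(5)[OF W_rsubmodule w] 0[OF x(2)] by auto
    have "\<psi> y \<oplus>\<^bsub>F\<^esub> w = \<psi> (l x) \<oplus>\<^bsub>F\<^esub> (\<psi> y0 \<oplus>\<^bsub>F\<^esub> w)"
      unfolding x(3) using hom_add[OF \<psi> c(1,2)] c hom_closed[OF \<psi>] by (simp add: F.M.a_ac)
    then show ?thesis unfolding W_range_def using x(1) rsubmoduleD(3)[OF W_rsubmodule c(4) w] by blast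
  qed
  then show ?thesis using h by blast
qed

lemma K_mem:
  assumes Y: "quot_in R E Y Y0" and \<psi>: "\<psi> \<in> rmod_hom R Y F" and 0: "\<And>y. y \<in> Y0 \<Longrightarrow> \<psi> y \<in> W"
    and y: "y \<in> carrier Y" and w: "w \<in> W"
  shows "\<psi> y \<oplus>\<^bsub>F\<^esub> w \<in> K"
  using W_range_cover[OF Y \<psi> 0] y w unfolding K_def by blast

lemma K_mem0:
  assumes Y: "quot_in R E Y Y0" and \<psi>: "\<psi> \<in> rmod_hom R Y F" and 0: "\<And>y. y \<in> Y0 \<Longrightarrow> \<psi> y \<in> W"
    and y: "y \<in> carrier Y"
  shows "\<psi> y \<in> K"
proof -
  interpret F: right_module R F by (rule F)
  show ?thesis
    using K_mem[OF assms rsubmoduleD(2)[OF W_rsubmodule]] hom_closed[OF \<psi> y] by simp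
qed

text \<open>The two maps combine to one on the product of the free modules, and
  \<open>W_range_cover\<close> replaces that product by a single free module. So the ranges are
  directed and their union \<open>K\<close> is closed under addition.\<close>

lemma W_range_join:
  assumes 1: "W_hom n1 \<psi>1 P1" and 2: "W_hom n2 \<psi>2 P2"
  shows "\<exists>n \<psi> P. W_hom n \<psi> P \<and> (\<forall>x\<in>W_range n1 \<psi>1. \<forall>y\<in>W_range n2 \<psi>2. x \<oplus>\<^bsub>F\<^esub> y \<in> W_range n \<psi>)"
proof -
  interpret F: right_module R F by (rule F)
  let ?F1 = "free_rmod R {..<n1}" and ?F2 = "free_rmod R {..<n2}"
  let ?\<psi> = "\<lambda>w. \<psi>1 (fst w) \<oplus>\<^bsub>F\<^esub> \<psi>2 (snd w)"
  have \<psi>12: "\<psi>1 \<in> rmod_hom R ?F1 F" "\<psi>2 \<in> rmod_hom R ?F2 F" using 1 2 by (auto simp: W_hom_def)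
  have "\<exists>n \<psi> P. W_hom n \<psi> P \<and> (\<forall>y\<in>carrier (rmod_prod ?F1 ?F2). \<forall>w\<in>W. ?\<psi> y \<oplus>\<^bsub>F\<^esub> w \<in> W_range n \<psi>)"
    by (rule W_range_cover[OF quot_in_prod hom_copair[OF F \<psi>12]])
      (use 1 2 rsubmoduleD(3)[OF W_rsubmodule] in \<open>auto simp: W_hom_def\<close>)
  then obtain n \<psi> P where n: "W_hom n \<psi> P"
    "\<forall>y\<in>carrier (rmod_prod ?F1 ?F2). \<forall>w\<in>W. ?\<psi> y \<oplus>\<^bsub>F\<^esub> w \<in> W_range n \<psi>" by blast
  have "x \<oplus>\<^bsub>F\<^esub> y \<in> W_range n \<psi>" if x: "x \<in> W_range n1 \<psi>1" and y: "y \<in> W_range n2 \<psi>2" for x y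
  proof -
    obtain u v where u: "x = \<psi>1 u \<oplus>\<^bsub>F\<^esub> v" "u \<in> carrier ?F1" "v \<in> W" using x by (auto simp: W_range_def)
    obtain u' v' where u': "y = \<psi>2 u' \<oplus>\<^bsub>F\<^esub> v'" "u' \<in> carrier ?F2" "v' \<in> W" using y by (auto simp: W_range_def)
    have "x \<oplus>\<^bsub>F\<^esub> y = ?\<psi> (u, u') \<oplus>\<^bsub>F\<^esub> (v \<oplus>\<^bsub>F\<^esub> v')"
      using hom_closed[OF \<psi>12(1) u(2)] hom_closed[OF \<psi>12(2) u'(2)] rsubmoduleD(5)[OF W_rsubmodule] u u'
      by (simp add: F.M.a_ac)
    then show ?thesis
      using n(2)[rule_format, of "(u, u')" "v \<oplus>\<^bsub>F\<^esub> v'"] u u' rsubmoduleD(3)[OF W_rsubmodule]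
      by (simp add: rmod_prod_simps)
  qed
  then show ?thesis using n(1) by blast
qed

lemma W_range_exists: "\<exists>n \<psi> P. W_hom n \<psi> P"
  unfolding W_hom_def
  using quot_in_carrier[OF free_rmod_module[OF base_ring, of "{..<0 :: nat}"]] hom_zero_map[OF F]
    rsubmoduleD(2)[OF W_rsubmodule] by blast

lemma W_range_zero: "W_hom n \<psi> P \<Longrightarrow> \<zero>\<^bsub>F\<^esub> \<in> W_range n \<psi>"
  using rsubmoduleD(2)[OF W_range_rsubmodule] by (auto simp: W_hom_def)

lemma K_rsubmodule: "rsubmodule R F K"
proof -
  interpret F: right_module R F by (rule F)
  show ?thesis
  proof (rule F.rsubmoduleI)
    show "K \<subseteq> carrier F"
      using rsubmoduleD(1)[OF W_range_rsubmodule] by (auto simp: K_def W_hom_def)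
    show "\<zero>\<^bsub>F\<^esub> \<in> K" using W_range_exists W_range_zero unfolding K_def mem_Collect_eq by meson
    show "x \<oplus>\<^bsub>F\<^esub> y \<in> K" if "x \<in> K" "y \<in> K" for x y
      using that W_range_join unfolding K_def mem_Collect_eq by meson
    show "x \<star>\<^bsub>F\<^esub> r \<in> K" if "x \<in> K" "r \<in> carrier R" for x r
      using that rsubmoduleD(4)[OF W_range_rsubmodule] unfolding K_def W_hom_def mem_Collect_eq by meson
  qed
qed

lemma W_K: "W \<subseteq> K"
proof
  interpret F: right_module R F by (rule F)
  fix w assume w: "w \<in> W"
  obtain n \<psi> P where n: "W_hom n \<psi> P" using W_range_exists by blast
  interpret G: right_module R "free_rmod R {..<n}" by (rule free_rmod_module[OF base_ring])
  have "\<psi> \<zero>\<^bsub>free_rmod R {..<n}\<^esub> = \<zero>\<^bsub>F\<^esub>"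
    using n hom_zero[OF G.M.abelian_group_axioms F.M.abelian_group_axioms] by (auto simp: W_hom_def)
  then have "w = \<psi> \<zero>\<^bsub>free_rmod R {..<n}\<^esub> \<oplus>\<^bsub>F\<^esub> w"
    using rsubmoduleD(5)[OF W_rsubmodule w] by simp
  then have "w \<in> W_range n \<psi>" unfolding W_range_def using w G.M.zero_closed by blast
  then show "w \<in> K" using n by (auto simp: K_def)
qed

text \<open>Directedness of the ranges, in the form that confines the image in \<open>K\<close> of a
  finitely generated module to the range of a single object.\<close>

lemma K_finite:
  assumes "finite Z" "Z \<subseteq> K"
  shows "\<exists>n \<psi> P. W_hom n \<psi> P \<and> Z \<subseteq> W_range n \<psi>"
  using assms
proof (induction Z rule: finite_induct)
  case empty
  then show ?case using W_range_exists by auto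
next
  case (insert z Z)
  interpret F: right_module R F by (rule F)
  obtain n1 \<psi>1 P1 where 1: "W_hom n1 \<psi>1 P1" "z \<in> W_range n1 \<psi>1" using insert.prems by (auto simp: K_def)
  obtain n2 \<psi>2 P2 where 2: "W_hom n2 \<psi>2 P2" "Z \<subseteq> W_range n2 \<psi>2" using insert by auto
  obtain n \<psi> P where n: "W_hom n \<psi> P"
    "\<forall>x\<in>W_range n1 \<psi>1. \<forall>y\<in>W_range n2 \<psi>2. x \<oplus>\<^bsub>F\<^esub> y \<in> W_range n \<psi>"
    using W_range_join[OF 1(1) 2(1)] by blast
  have c: "x \<in> carrier F" if "x \<in> insert z Z" for x
    using that insert.prems rsubmoduleD(5)[OF K_rsubmodule] by auto
  have "z \<in> W_range n \<psi>"
    using n(2)[rule_format, OF 1(2) W_range_zero[OF 2(1)]] c[of z] by simp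
  moreover have "x \<in> W_range n \<psi>" if "x \<in> Z" for x
    using n(2)[rule_format, OF W_range_zero[OF 1(1)] subsetD[OF 2(2) that]] c[of x] that by simp
  ultimately show ?case using n(1) by blast
qed

lemma L: "right_module R L"
  and \<pi>: "\<pi> \<in> rmod_hom R F L"
  and \<pi>_surj: "\<pi> ` carrier F = carrier L"
  and \<pi>_zero_iff: "z \<in> carrier F \<Longrightarrow> \<pi> z = \<zero>\<^bsub>L\<^esub> \<longleftrightarrow> z \<in> K"
  unfolding L_def \<pi>_def using right_module.rquot_facts[OF F K_rsubmodule] by auto

lemma \<kappa>: "\<kappa> \<in> rmod_hom R M L"
  unfolding \<kappa>_def by (rule hom_comp[OF j \<pi>])

text \<open>\<open>z\<close> and \<open>j (a z)\<close> have the same value under \<open>a\<close>,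
  so they differ by an element of \<open>W\<close>, which \<open>\<pi>\<close> kills.\<close>

lemma \<pi>_F0:
  assumes z: "z \<in> F0"
  shows "\<pi> z = \<kappa> (a z)"
proof -
  interpret F: right_module R F by (rule F)
  interpret L: right_module R L by (rule L)
  interpret M: right_module R M by (rule M)
  have az: "a z \<in> carrier M" using hom_closed[OF a] z by simp
  define w where "w = z \<ominus>\<^bsub>F\<^esub> j (a z)"
  have c: "z \<in> carrier F" "j (a z) \<in> carrier F" "j (a z) \<in> F0"
    using rsubmoduleD(5)[OF F0] z jF0[OF az] by auto
  have w0: "w \<in> F0" unfolding w_def by (rule F.rsubmodule_diff[OF F0 z c(3)])
  have wz: "w \<oplus>\<^bsub>F\<^esub> j (a z) = z" unfolding w_def by (rule F.diff_add[OF c(1,2)])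
  have "a z = a w \<oplus>\<^bsub>M\<^esub> a (j (a z))"
    using hom_add[OF a, of w "j (a z)"] w0 c(3) wz by simp
  then have "a z = a w \<oplus>\<^bsub>M\<^esub> a z" using aj[OF az] by simp
  then have "a w = \<zero>\<^bsub>M\<^esub>"
    using az hom_closed[OF a, of w] w0 M.M.add.r_cancel_one'[of "a z" "a w"] by simp
  then have "w \<in> K" using w0 W_K by (auto simp: W_def)
  then have "\<pi> w = \<zero>\<^bsub>L\<^esub>" using \<pi>_zero_iff rsubmoduleD(5)[OF F0 w0] by simp
  then have "\<pi> z = \<pi> (j (a z))"
    using hom_add[OF \<pi> rsubmoduleD(5)[OF F0 w0] c(2)] wz hom_closed[OF \<pi> c(2)] by simp
  then show ?thesis by (simp add: \<kappa>_def)
qed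

text \<open>F / F0 need not be an object, so the axiom on kernels does not apply to it. But a
  finitely generated \<open>Y\<close> lands in some \<open>F1\<close> with F1 / (F1 \<inter> F0) in
  \<open>E\<close>, and the submodule in question is the kernel of the induced map to that
  object.\<close>

lemma locally_kernel:
  assumes Y: "quot_in R E Y Y0" and fg: "fin_gen R Y (carrier Y)" and \<psi>: "\<psi> \<in> rmod_hom R Y F"
    and 0: "\<And>y. y \<in> Y0 \<Longrightarrow> \<psi> y \<in> F0"
  shows "quot_in R E (sub Y {y \<in> carrier Y. \<psi> y \<in> F0}) Y0"
proof -
  note Ym = quot_in_module[OF Y]
  obtain X where X: "finite X" "X \<subseteq> carrier Y" "carrier Y = rspan R Y X" using fg by (auto simp: fin_gen_def)
  have "finite (\<psi> ` X)" "\<psi> ` X \<subseteq> carrier F" using X hom_closed[OF \<psi>] by auto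
  then obtain F1 where F1: "rsubmodule R F F1" "\<psi> ` X \<subseteq> F1" "quot_in R E (sub F F1) (F1 \<inter> F0)"
    using locally by blast
  have "\<psi> ` carrier Y = rspan R F (\<psi> ` X)"
    using rspan_image[OF Ym F \<psi> X(2)] X(3) by simp
  also have "\<dots> \<subseteq> F1" by (rule right_module.rspan_least[OF F F1(1,2)])
  finally have im: "\<psi> ` carrier Y \<subseteq> F1" .
  have "quot_in R E (sub Y {y \<in> carrier Y. \<psi> y \<in> F1 \<inter> F0}) Y0"
    by (rule quot_in_kernel[OF Y F1(3) hom_sub_cod[OF \<psi> im]])
      (use 0 im rsubmoduleD(5)[OF quot_in_rsubmodule[OF Y]] in auto)
  moreover have "{y \<in> carrier Y. \<psi> y \<in> F1 \<inter> F0} = {y \<in> carrier Y. \<psi> y \<in> F0}" using im by auto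
  ultimately show ?thesis by simp
qed

text \<open>If j m lies in \<open>K\<close>, it equals \<psi> u + w with w in \<open>W\<close>. Then
  u lies in the preimage D of \<open>F0\<close> under \<psi>, and D / P is in \<open>E\<close> by
  \<open>locally_kernel\<close>. On D the composite of \<psi> and \<open>a\<close> kills P, so it
  vanishes since \<open>M\<close> is torsion-free; hence m = a (j m) = a w = 0.\<close>

lemma \<kappa>_inj:
  assumes m: "m \<in> carrier M" "\<kappa> m = \<zero>\<^bsub>L\<^esub>"
  shows "m = \<zero>\<^bsub>M\<^esub>"
proof -
  interpret F: right_module R F by (rule F)
  interpret M: right_module R M by (rule M)
  have "j m \<in> K" using m \<pi>_zero_iff hom_closed[OF j m(1)] by (simp add: \<kappa>_def)
  then obtain n \<psi> P where n: "W_hom n \<psi> P" "j m \<in> W_range n \<psi>" by (auto simp: K_def)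
  then obtain u w where u: "u \<in> carrier (free_rmod R {..<n})" "w \<in> W" "j m = \<psi> u \<oplus>\<^bsub>F\<^esub> w"
    by (auto simp: W_range_def)
  let ?D = "{y \<in> carrier (free_rmod R {..<n}). \<psi> y \<in> F0}"
  have \<psi>: "\<psi> \<in> rmod_hom R (free_rmod R {..<n}) F" using n(1) by (simp add: W_hom_def)
  have D: "quot_in R E (sub (free_rmod R {..<n}) ?D) P"
    by (rule locally_kernel[OF _ fin_gen_free[OF base_ring] \<psi>]) (use n(1) W_subset in \<open>auto simp: W_hom_def\<close>)
  have c: "\<psi> u \<in> carrier F" "w \<in> carrier F" "w \<in> F0"
    using hom_closed[OF \<psi> u(1)] rsubmoduleD(5)[OF W_rsubmodule u(2)] W_subset u(2) by auto
  have "\<psi> u = j m \<ominus>\<^bsub>F\<^esub> w"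
    using c unfolding u(3) by (simp add: a_minus_def F.M.a_assoc F.M.r_neg)
  then have uF0: "\<psi> u \<in> F0" using F.rsubmodule_diff[OF F0 jF0[OF m(1)] c(3)] by simp
  have \<psi>D: "\<psi> \<in> rmod_hom R (sub (free_rmod R {..<n}) ?D) (sub F F0)"
    by (rule hom_sub_cod[OF hom_sub_dom[OF \<psi>]]) auto
  have "a (\<psi> u) = \<zero>\<^bsub>M\<^esub>"
    by (rule torsion_free_quot[OF tfM D hom_comp[OF \<psi>D a]]) (use n(1) u(1) uF0 in \<open>auto simp: W_hom_def W_def\<close>)
  moreover have "a (j m) = a (\<psi> u) \<oplus>\<^bsub>M\<^esub> a w"
    unfolding u(3) using hom_add[OF a, of "\<psi> u" w] uF0 c(3) by simp
  ultimately show ?thesis using u(2) aj[OF m(1)] by (simp add: W_def)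
qed

text \<open>A map from an object A = R^n / P to \<open>L\<close> lifts to \<psi> : R^n to F with
  \<psi>(P) inside \<open>K\<close>. As P is finitely generated, \<psi>(P) lies in the range of one
  object R^k / P1. The pushout of that object with R^n along P is an extension of A by it, so it
  lies in \<open>E\<close>; it maps to F / W, and therefore \<psi> takes all its values in
  \<open>K\<close>.\<close>

lemma torsion_free_L: "torsion_free R E L"
proof (rule torsion_freeI[OF L])
  fix A \<alpha> x assume A: "A \<in> E" and \<alpha>: "\<alpha> \<in> rmod_hom R A L" and x: "x \<in> carrier A"
  interpret F: right_module R F by (rule F)
  have Am: "right_module R A" by (rule object_module[OF A])
  obtain n :: nat and p where p: "p \<in> rmod_hom R (free_rmod R {..<n}) A"
    "p ` carrier (free_rmod R {..<n}) = carrier A"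
    "fin_gen R (free_rmod R {..<n}) (a_kernel (free_rmod R {..<n}) A p)"
    using object_fp[OF A] unfolding fin_presented_def by blast
  let ?G = "free_rmod R {..<n}" and ?P = "a_kernel (free_rmod R {..<n}) A p"
  interpret G: right_module R ?G by (rule free_rmod_module[OF base_ring])
  have P: "rsubmodule R ?G ?P" by (rule fin_gen_rsubmodule[OF G.right_module_axioms p(3)])
  have Q: "quot_in R E ?G ?P"
    by (rule quot_inI[OF G.right_module_axioms belongs_to_object[OF A] p(1,2) a_kernel_eq Am])
  have \<alpha>p: "(\<lambda>y. \<alpha> (p y)) \<in> rmod_hom R ?G L" by (rule hom_comp[OF p(1) \<alpha>])
  obtain \<psi> where \<psi>: "\<psi> \<in> rmod_hom R ?G F" "\<forall>y\<in>carrier ?G. \<pi> (\<psi> y) = \<alpha> (p y)"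
    using free_lift[OF F L \<pi> \<alpha>p] hom_closed[OF \<alpha>p] \<pi>_surj by auto
  have \<psi>P: "\<psi> y \<in> K" if "y \<in> ?P" for y
  proof -
    have "\<pi> (\<psi> y) = \<zero>\<^bsub>L\<^esub>"
      using that \<psi>(2) hom_zero[OF right_module_abelian_group[OF Am] right_module_abelian_group[OF L] \<alpha>]
      by (simp add: a_kernel_eq)
    then show ?thesis using \<pi>_zero_iff hom_closed[OF \<psi>(1)] that by (simp add: a_kernel_eq)
  qed
  obtain X where X: "finite X" "X \<subseteq> carrier ?G" "?P = rspan R ?G X" using p(3) by (auto simp: fin_gen_def)
  have XP: "X \<subseteq> ?P" unfolding X(3) by (rule G.rspan_superset)
  have "finite (\<psi> ` X)" "\<psi> ` X \<subseteq> K" using X(1) XP \<psi>P by auto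
  from K_finite[OF this] obtain k \<psi>1 P1 where k: "W_hom k \<psi>1 P1" "\<psi> ` X \<subseteq> W_range k \<psi>1" by (elim exE conjE)
  let ?H = "free_rmod R {..<k}"
  have \<psi>1: "\<psi>1 \<in> rmod_hom R ?H F" and H: "quot_in R E ?H P1" and P1W: "\<forall>p\<in>P1. \<psi>1 p \<in> W"
    using k(1) by (auto simp: W_hom_def)
  have Hm: "right_module R ?H" by (rule quot_in_module[OF H])
  have Wm: "right_module R (sub F W)" by (rule F.right_module_sub[OF W_rsubmodule])
  let ?HW = "rmod_prod ?H (sub F W)" and ?s = "\<lambda>w. \<psi>1 (fst w) \<oplus>\<^bsub>F\<^esub> snd w"
  have s: "?s \<in> rmod_hom R ?HW F"
    using hom_copair[OF F \<psi>1 hom_sub_dom[OF F.hom_id rsubmoduleD(1)[OF W_rsubmodule]]] .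
  have simg: "W_range k \<psi>1 \<subseteq> ?s ` carrier ?HW"
    by (auto simp: W_range_def rmod_prod_simps image_iff) force
  have "\<psi> ` ?P = rspan R F (\<psi> ` X)" using rspan_image[OF G.right_module_axioms F \<psi>(1) X(2)] X(3) by simp
  also have "\<dots> \<subseteq> W_range k \<psi>1" by (rule F.rspan_least[OF W_range_rsubmodule[OF \<psi>1] k(2)])
  finally have "\<psi> ` ?P \<subseteq> ?s ` carrier ?HW" using simg by simp
  \<comment> \<open>As P is a submodule of a free module, heredity lifts \<psi> on P through R^k x
    W.\<close>
  then obtain c where c: "c \<in> rmod_hom R (sub ?G ?P) ?HW" "\<forall>y\<in>?P. ?s (c y) = \<psi> y"
    using hereditary_submodule_lift[OF right_hereditary P rmod_prod_module[OF Hm Wm] F s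
        hom_sub_dom[OF \<psi>(1) rsubmoduleD(1)[OF P]]] by blast
  have c1: "(\<lambda>y. fst (c y)) \<in> rmod_hom R (sub ?G ?P) ?H" by (rule hom_comp[OF c(1) hom_fst])
  \<comment> \<open>With c1 the first component of \<open>c\<close>, \<psi>1 h + \<psi> p differs
    from \<psi>1 (h + c1 p) by an element of \<open>W\<close>; hence the condition that h + c1 p lie
    in \<open>P1\<close>.\<close>
  let ?Y0 = "{w \<in> carrier ?H \<times> ?P. fst w \<oplus>\<^bsub>?H\<^esub> fst (c (snd w)) \<in> P1}"
  have Y: "quot_in R E (rmod_prod ?H ?G) ?Y0" by (rule quot_in_pushout[OF H Q c1])
  have \<Psi>: "(\<lambda>w. \<psi>1 (fst w) \<oplus>\<^bsub>F\<^esub> \<psi> (snd w)) \<in> rmod_hom R (rmod_prod ?H ?G) F"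
    by (rule hom_copair[OF F \<psi>1 \<psi>(1)])
  have \<Psi>0: "\<psi>1 (fst w) \<oplus>\<^bsub>F\<^esub> \<psi> (snd w) \<in> W" if w: "w \<in> ?Y0" for w
  proof -
    have m: "fst w \<in> carrier ?H" "snd w \<in> ?P" "fst w \<oplus>\<^bsub>?H\<^esub> fst (c (snd w)) \<in> P1" using w by auto
    have cc: "fst (c (snd w)) \<in> carrier ?H" "snd (c (snd w)) \<in> W"
      using hom_closed[OF c(1)] m(2) by (auto simp: rmod_prod_simps mem_Times_iff)
    have cl: "\<psi>1 (fst w) \<in> carrier F" "\<psi>1 (fst (c (snd w))) \<in> carrier F" "snd (c (snd w)) \<in> carrier F"
      using hom_closed[OF \<psi>1] m(1) cc rsubmoduleD(5)[OF W_rsubmodule] by auto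
    have "\<psi>1 (fst w) \<oplus>\<^bsub>F\<^esub> \<psi> (snd w) = \<psi>1 (fst w) \<oplus>\<^bsub>F\<^esub> (\<psi>1 (fst (c (snd w))) \<oplus>\<^bsub>F\<^esub> snd (c (snd w)))"
      using c(2) m(2) by simp
    also have "\<dots> = \<psi>1 (fst w \<oplus>\<^bsub>?H\<^esub> fst (c (snd w))) \<oplus>\<^bsub>F\<^esub> snd (c (snd w))"
      using hom_add[OF \<psi>1 m(1) cc(1)] cl by (simp add: F.M.a_assoc)
    also have "\<dots> \<in> W" using P1W m(3) cc(2) rsubmoduleD(3)[OF W_rsubmodule] by simp
    finally show ?thesis .
  qed
  have \<psi>10: "\<psi>1 \<zero>\<^bsub>?H\<^esub> = \<zero>\<^bsub>F\<^esub>"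
    by (rule hom_zero[OF right_module_abelian_group[OF Hm] F.M.abelian_group_axioms \<psi>1])
  have z: "\<zero>\<^bsub>?H\<^esub> \<in> carrier ?H"
    by (rule abelian_monoid.zero_closed) (use right_module_abelian_group[OF Hm] in \<open>simp add: abelian_group_def\<close>)
  obtain y where y: "y \<in> carrier ?G" "x = p y" using x p(2) by auto
  have "\<psi>1 (fst (\<zero>\<^bsub>?H\<^esub>, y)) \<oplus>\<^bsub>F\<^esub> \<psi> (snd (\<zero>\<^bsub>?H\<^esub>, y)) \<in> K"
    by (rule K_mem0[OF Y \<Psi> \<Psi>0]) (use y z in \<open>auto simp: rmod_prod_simps\<close>)
  then have "\<psi> y \<in> K" using \<psi>10 hom_closed[OF \<psi>(1) y(1)] by simp
  then show "\<alpha> x = \<zero>\<^bsub>L\<^esub>" using \<psi>(2) y \<pi>_zero_iff hom_closed[OF \<psi>(1) y(1)] by metis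
qed

text \<open>\<open>generic\<close> supplies a map i : R^n to F that restricts to the pullback of
  \<open>c\<close>; gluing its composite with \<open>\<pi>\<close> to that of \<open>c\<close> with
  \<open>\<kappa>\<close> gives the extension \<open>G\<close>. The auxiliary \<open>l\<close> and
  \<open>i\<close> are returned too, because \<open>quot_in_preimage_base\<close> computes with
  them.\<close>

lemma extend_to_L:
  assumes Y: "quot_in R E Y Y0" and c: "c \<in> rmod_hom R (sub Y Y0) M"
  obtains n :: nat and l i G where "l \<in> rmod_hom R (free_rmod R {..<n}) Y"
    "quot_in R E (free_rmod R {..<n}) {x \<in> carrier (free_rmod R {..<n}). l x \<in> Y0}"
    "\<forall>y\<in>carrier Y. \<exists>x\<in>carrier (free_rmod R {..<n}). \<exists>y0\<in>Y0. y = y0 \<oplus>\<^bsub>Y\<^esub> l x"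
    "i \<in> rmod_hom R (free_rmod R {..<n}) F"
    "\<forall>x\<in>carrier (free_rmod R {..<n}). l x \<in> Y0 \<longrightarrow> i x \<in> F0 \<and> a (i x) = c (l x)"
    "G \<in> rmod_hom R Y L" "\<forall>y\<in>Y0. G y = \<kappa> (c y)" "\<forall>x\<in>carrier (free_rmod R {..<n}). G (l x) = \<pi> (i x)"
proof -
  obtain n :: nat and l where l: "l \<in> rmod_hom R (free_rmod R {..<n}) Y"
    "quot_in R E (free_rmod R {..<n}) {x \<in> carrier (free_rmod R {..<n}). l x \<in> Y0}"
    "fin_gen R (free_rmod R {..<n}) {x \<in> carrier (free_rmod R {..<n}). l x \<in> Y0}"
    "\<forall>y\<in>carrier Y. \<exists>x\<in>carrier (free_rmod R {..<n}). \<exists>y0\<in>Y0. y = y0 \<oplus>\<^bsub>Y\<^esub> l x"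
    using quot_in_presentation[OF Y] by (elim exE conjE) (rule that)
  let ?G = "free_rmod R {..<n}" and ?P = "{x \<in> carrier (free_rmod R {..<n}). l x \<in> Y0}"
  have "l \<in> rmod_hom R (sub ?G ?P) (sub Y Y0)"
    by (rule hom_sub_cod[OF hom_sub_dom[OF l(1)]]) auto
  from generic[OF l(2,3) hom_comp[OF this c]]
  obtain i where i: "i \<in> rmod_hom R ?G F" "\<forall>p\<in>?P. i p \<in> F0 \<and> a (i p) = c (l p)" by blast
  have "\<exists>G\<in>rmod_hom R Y L. (\<forall>y\<in>Y0. G y = \<kappa> (c y)) \<and> (\<forall>x\<in>carrier ?G. G (l x) = \<pi> (i x))"
    by (rule hom_glue[OF quot_in_module[OF Y] free_rmod_module[OF base_ring] L quot_in_rsubmodule[OF Y] l(1,4)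
          hom_comp[OF c \<kappa>] hom_comp[OF i(1) \<pi>]]) (use i(2) \<pi>_F0 in auto)
  then show thesis using that[OF l(1,2,4) i(1)] i(2) by blast
qed

lemma extend_base:
  assumes "quot_in R E Y Y0" "c \<in> rmod_hom R (sub Y Y0) M"
  shows "\<exists>G\<in>rmod_hom R Y L. \<forall>y\<in>Y0. G y = \<kappa> (c y)"
  by (rule extend_to_L[OF assms]) (rule bexI)

text \<open>One round of attaching suffices. A map c : P to L lifts by projectivity to d : P to F,
  and d(P) lies in some \<open>F1\<close>. The pushout of F1 / (F1 \<inter> F0) with Q along P is in
  \<open>E\<close>, and its relations \<open>B0\<close> are mapped to \<open>M\<close> through
  \<open>a\<close>; extending this map to \<open>L\<close> and restricting to Q gives what is
  required.\<close>

lemma local_L: "local_module R E L"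
  unfolding local_module_def
proof (intro conjI torsion_free_L ballI allI impI, elim conjE)
  fix A P Q f g c
  assume A: "A \<in> E" and P: "fg_projective_rmod R P" and Q: "fg_projective_rmod R Q"
    and ex: "short_exact R P f Q g A" and c: "c \<in> rmod_hom R P L"
  have f: "f \<in> rmod_hom R P Q" "inj_on f (carrier P)" and g: "g \<in> rmod_hom R Q A" "g ` carrier Q = carrier A"
    and fg: "f ` carrier P = {q \<in> carrier Q. g q = \<zero>\<^bsub>A\<^esub>}" using ex by (auto simp: short_exact_def a_kernel_eq)
  interpret P: right_module R P using P by (simp add: fg_projective_rmod_def projective_rmod_def)
  interpret Q: right_module R Q using Q by (simp add: fg_projective_rmod_def projective_rmod_def)
  interpret F: right_module R F by (rule F)
  interpret M: right_module R M by (rule M)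
  interpret L: right_module R L by (rule L)
  obtain d where d: "d \<in> rmod_hom R P F" "\<forall>p\<in>carrier P. \<pi> (d p) = c p"
    using projective_lift[OF _ F L \<pi> c] P \<pi>_surj hom_closed[OF c] by (auto simp: fg_projective_rmod_def)
  obtain X where X: "finite X" "X \<subseteq> carrier P" "carrier P = rspan R P X"
    using P by (auto simp: fg_projective_rmod_def fin_gen_def)
  have "finite (d ` X)" "d ` X \<subseteq> carrier F" using X hom_closed[OF d(1)] by auto
  then obtain F1 where F1: "rsubmodule R F F1" "d ` X \<subseteq> F1" "quot_in R E (sub F F1) (F1 \<inter> F0)"
    using locally by blast
  interpret F1: right_module R "sub F F1" by (rule F.right_module_sub[OF F1(1)])
  have "d ` carrier P = rspan R F (d ` X)" using rspan_image[OF P.right_module_axioms F d(1) X(2)] X(3) by simp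
  also have "\<dots> \<subseteq> F1" by (rule F.rspan_least[OF F1(1,2)])
  finally have dF1: "d ` carrier P \<subseteq> F1" .
  have Qq: "quot_in R E Q (f ` carrier P)"
    by (rule quot_inI[OF Q.right_module_axioms belongs_to_object[OF A] g fg object_module[OF A]])
  have fim: "rsubmodule R Q (f ` carrier P)" by (rule quot_in_rsubmodule[OF Qq])
  have bij: "bij_betw f (carrier P) (carrier (sub Q (f ` carrier P)))" using f(2) by (simp add: bij_betw_def)
  let ?v = "inv_into (carrier P) f"
  have v: "?v \<in> rmod_hom R (sub Q (f ` carrier P)) P"
    by (rule inverse_hom[OF P.right_module_axioms hom_sub_cod[OF f(1)] bij]) simp
  have vf: "?v (f p) = p" if "p \<in> carrier P" for p using f(2) that by simp
  have c2: "(\<lambda>q. d (?v q)) \<in> rmod_hom R (sub Q (f ` carrier P)) (sub F F1)"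
    by (rule hom_comp[OF v hom_sub_cod[OF d(1) dF1]])
  let ?B = "rmod_prod (sub F F1) Q"
  \<comment> \<open>An element of \<open>B0\<close> is a pair (z, f p) with z + d p in
    \<open>F1\<close> and \<open>F0\<close>; it is sent to a (z + d p) in \<open>M\<close>.\<close>
  define B0 where "B0 = {w \<in> carrier (sub F F1) \<times> f ` carrier P. fst w \<oplus>\<^bsub>sub F F1\<^esub> d (?v (snd w)) \<in> F1 \<inter> F0}"
  have B: "quot_in R E ?B B0" unfolding B0_def by (rule quot_in_pushout[OF F1(3) Qq c2])
  have B0P: "rmod_prod (sub F F1) (sub Q (f ` carrier P)) = sub ?B (F1 \<times> f ` carrier P)"
    by (simp add: rmod_prod_def)
  have h: "(\<lambda>w. fst w \<oplus>\<^bsub>F\<^esub> d (?v (snd w))) \<in> rmod_hom R (sub ?B (F1 \<times> f ` carrier P)) (sub F F1)"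
    using hom_copair[OF F1.right_module_axioms F1.hom_id c2] unfolding B0P by simp
  have "(\<lambda>w. fst w \<oplus>\<^bsub>F\<^esub> d (?v (snd w))) \<in> rmod_hom R (sub (sub ?B (F1 \<times> f ` carrier P)) B0) (sub F F0)"
    by (rule hom_sub_cod[OF hom_sub_incl[OF hom_sub_dom[OF h] rsubmoduleD(1)[OF F1(1)]]]) (auto simp: B0_def)
  then have h0: "(\<lambda>w. fst w \<oplus>\<^bsub>F\<^esub> d (?v (snd w))) \<in> rmod_hom R (sub ?B B0) (sub F F0)" by simp
  obtain G where G: "G \<in> rmod_hom R ?B L" "\<forall>y\<in>B0. G y = \<kappa> (a (fst y \<oplus>\<^bsub>F\<^esub> d (?v (snd y))))"
    using extend_base[OF B hom_comp[OF h0 a]] by (elim bexE)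
  have d0: "d (?v \<zero>\<^bsub>Q\<^esub>) = \<zero>\<^bsub>F\<^esub>"
  proof -
    have "f \<zero>\<^bsub>P\<^esub> = \<zero>\<^bsub>Q\<^esub>" by (rule hom_zero[OF P.M.abelian_group_axioms Q.M.abelian_group_axioms f(1)])
    then have "?v \<zero>\<^bsub>Q\<^esub> = \<zero>\<^bsub>P\<^esub>" using vf[OF P.M.zero_closed] by simp
    then show ?thesis using hom_zero[OF P.M.abelian_group_axioms F.M.abelian_group_axioms d(1)] by simp
  qed
  have zQ: "\<zero>\<^bsub>Q\<^esub> \<in> f ` carrier P" using rsubmoduleD(2)[OF fim] .
  \<comment> \<open>\<open>G\<close> was prescribed only on \<open>B0\<close>. That it equals \<pi>
    on all of \<open>F1\<close> follows by uniqueness, as both agree on F1 \<inter> F0.\<close>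
  have Gz: "G (z, \<zero>\<^bsub>Q\<^esub>) = \<pi> z" if z: "z \<in> F1" for z
  proof (rule torsion_free_extension_unique[OF torsion_free_L F1(3) hom_comp[OF hom_inl[OF Q.right_module_axioms] G(1)]
        hom_sub_dom[OF \<pi> rsubmoduleD(1)[OF F1(1)]]])
    fix y assume y: "y \<in> F1 \<inter> F0"
    then have yc: "y \<in> carrier F" using rsubmoduleD(5)[OF F0] by simp
    have "(y, \<zero>\<^bsub>Q\<^esub>) \<in> B0" using y zQ d0 yc by (simp add: B0_def)
    then show "G (y, \<zero>\<^bsub>Q\<^esub>) = \<pi> y" using G(2) \<pi>_F0[of y] y d0 yc by simp
  qed (use z in simp)
  show "\<exists>e\<in>rmod_hom R Q L. \<forall>p\<in>carrier P. e (f p) = c p"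
  proof (rule bexI[OF _ hom_comp[OF hom_inr[OF F1.right_module_axioms] G(1)]], rule ballI)
    fix p assume p: "p \<in> carrier P"
    have dp: "d p \<in> F1" "d p \<in> carrier F" using dF1 p hom_closed[OF d(1) p] by auto
    have ndp: "\<ominus>\<^bsub>F\<^esub> d p \<in> F1" by (rule F.rsubmodule_a_inv[OF F1(1) dp(1)])
    have fp: "f p \<in> carrier Q" by (rule hom_closed[OF f(1) p])
    have s0: "\<ominus>\<^bsub>F\<^esub> d p \<oplus>\<^bsub>F\<^esub> d p = \<zero>\<^bsub>F\<^esub>" by (rule F.M.l_neg[OF dp(2)])
    \<comment> \<open>For the pair (-d p, f p) the sum with d p is zero, so \<open>G\<close> kills
      it; adding (d p, 0) then yields G (0, f p) = \<pi> (d p) = c p.\<close>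
    have "(\<ominus>\<^bsub>F\<^esub> d p, f p) \<in> B0"
      using ndp p vf[OF p] s0 rsubmoduleD(2)[OF F0] rsubmoduleD(2)[OF F1(1)] by (simp add: B0_def)
    then have G1: "G (\<ominus>\<^bsub>F\<^esub> d p, f p) = \<zero>\<^bsub>L\<^esub>"
      using G(2) vf[OF p] s0 a_zero hom_zero[OF M.M.abelian_group_axioms L.M.abelian_group_axioms \<kappa>] by simp
    have "(\<ominus>\<^bsub>F\<^esub> d p, f p) \<oplus>\<^bsub>?B\<^esub> (d p, \<zero>\<^bsub>Q\<^esub>) = (\<zero>\<^bsub>F\<^esub>, f p)"
      using s0 fp by (simp add: rmod_prod_simps)
    then have "G (\<zero>\<^bsub>F\<^esub>, f p) = G (\<ominus>\<^bsub>F\<^esub> d p, f p) \<oplus>\<^bsub>L\<^esub> G (d p, \<zero>\<^bsub>Q\<^esub>)"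
      using hom_add[OF G(1), of "(\<ominus>\<^bsub>F\<^esub> d p, f p)" "(d p, \<zero>\<^bsub>Q\<^esub>)"] ndp fp dp(1) by (simp add: rmod_prod_simps)
    also have "\<dots> = c p"
      using G1 Gz[OF dp(1)] d(2) p hom_closed[OF c p] by simp
    finally show "G (\<zero>\<^bsub>sub F F1\<^esub>, f p) = c p" by simp
  qed
qed

text \<open>Neither \<open>M\<close> nor \<open>L\<close> need be an object, so D / Y0, for D the
  preimage of \<kappa>(M), is not directly a kernel within \<open>E\<close>. Instead each y in D is
  caught in a submodule obtained from a kernel between objects, and \<open>quot_in_union\<close>
  collects these. The second claim is the cokernel of the inclusion of D / Y0 in Y / Y0.\<close>

lemma quot_in_preimage_base:
  assumes Y: "quot_in R E Y Y0" and c: "c \<in> rmod_hom R (sub Y Y0) M"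
    and H: "H \<in> rmod_hom R Y L" "\<And>y. y \<in> Y0 \<Longrightarrow> H y = \<kappa> (c y)"
  shows "quot_in R E (sub Y {y \<in> carrier Y. H y \<in> \<kappa> ` carrier M}) Y0" (is ?thesis1)
    and "quot_in R E Y {y \<in> carrier Y. H y \<in> \<kappa> ` carrier M}" (is ?thesis2)
proof -
  let ?D = "{y \<in> carrier Y. H y \<in> \<kappa> ` carrier M}"
  note Ym = quot_in_module[OF Y] and Y0 = quot_in_rsubmodule[OF Y]
  interpret Y: right_module R Y by (rule Ym)
  interpret F: right_module R F by (rule F)
  interpret M: right_module R M by (rule M)
  interpret L: right_module R L by (rule L)
  obtain n :: nat and l i G where l: "l \<in> rmod_hom R (free_rmod R {..<n}) Y"
    "quot_in R E (free_rmod R {..<n}) {x \<in> carrier (free_rmod R {..<n}). l x \<in> Y0}"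
    "\<forall>y\<in>carrier Y. \<exists>x\<in>carrier (free_rmod R {..<n}). \<exists>y0\<in>Y0. y = y0 \<oplus>\<^bsub>Y\<^esub> l x"
    and i: "i \<in> rmod_hom R (free_rmod R {..<n}) F"
    "\<forall>x\<in>carrier (free_rmod R {..<n}). l x \<in> Y0 \<longrightarrow> i x \<in> F0 \<and> a (i x) = c (l x)"
    and G: "G \<in> rmod_hom R Y L" "\<forall>y\<in>Y0. G y = \<kappa> (c y)"
    "\<forall>x\<in>carrier (free_rmod R {..<n}). G (l x) = \<pi> (i x)"
    by (rule extend_to_L[OF Y c])
  let ?G = "free_rmod R {..<n}" and ?P = "{x \<in> carrier (free_rmod R {..<n}). l x \<in> Y0}"
  interpret G: right_module R ?G by (rule free_rmod_module[OF base_ring])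
  have HG: "H y = G y" if "y \<in> carrier Y" for y
    by (rule torsion_free_extension_unique[OF torsion_free_L Y H(1) G(1) _ that]) (use H(2) G(2) in simp)
  have \<kappa>M: "rsubmodule R L (\<kappa> ` carrier M)" by (rule rsubmodule_image_carrier[OF M L \<kappa>])
  have D: "rsubmodule R Y ?D" by (rule rsubmodule_vimage[OF Ym L H(1) \<kappa>M])
  show *: ?thesis1
  proof (rule quot_in_union[OF Y D])
    fix y assume "y \<in> ?D"
    then have y: "y \<in> carrier Y" "H y \<in> \<kappa> ` carrier M" by auto
    obtain x y0 where x: "x \<in> carrier ?G" "y0 \<in> Y0" "y = y0 \<oplus>\<^bsub>Y\<^esub> l x" using l(3) y(1) by blast
    have c0: "y0 \<in> carrier Y" "l x \<in> carrier Y" "c y0 \<in> carrier M" "i x \<in> carrier F"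
      using rsubmoduleD(5)[OF Y0 x(2)] hom_closed[OF l(1) x(1)] hom_closed[OF c] x(2) hom_closed[OF i(1) x(1)] by auto
    have "H y = \<kappa> (c y0) \<oplus>\<^bsub>L\<^esub> \<pi> (i x)"
      unfolding x(3) using hom_add[OF H(1) c0(1,2)] H(2)[OF x(2)] HG[OF c0(2)] G(3) x(1) by simp
    then have "\<pi> (i x) = H y \<ominus>\<^bsub>L\<^esub> \<kappa> (c y0)"
      using hom_closed[OF \<kappa> c0(3)] hom_closed[OF \<pi> c0(4)]
      by (simp add: a_minus_def L.M.a_comm[of "\<kappa> (c y0)"] L.M.a_assoc L.M.r_neg)
    then have "\<pi> (i x) \<in> \<kappa> ` carrier M"
      using L.rsubmodule_diff[OF \<kappa>M y(2), of "\<kappa> (c y0)"] c0(3) by simp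
    then obtain m where m: "m \<in> carrier M" "\<pi> (i x) = \<pi> (j m)" by (auto simp: \<kappa>_def)
    have jm: "j m \<in> carrier F" by (rule hom_closed[OF j m(1)])
    have "\<pi> (i x \<ominus>\<^bsub>F\<^esub> j m) = \<zero>\<^bsub>L\<^esub>"
      using hom_diff[OF F.M.abelian_group_axioms L.M.abelian_group_axioms \<pi> c0(4) jm] m(2)
        L.diff_eq_zero[of "\<pi> (j m)" "\<pi> (j m)"] hom_closed[OF \<pi> jm] by simp
    then have "i x \<ominus>\<^bsub>F\<^esub> j m \<in> K" using \<pi>_zero_iff c0(4) jm by simp
    then obtain k \<psi> P1 where k: "W_hom k \<psi> P1" "i x \<ominus>\<^bsub>F\<^esub> j m \<in> W_range k \<psi>" by (auto simp: K_def)
    let ?H = "free_rmod R {..<k}"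
    obtain u w where u: "u \<in> carrier ?H" "w \<in> W" "i x \<ominus>\<^bsub>F\<^esub> j m = \<psi> u \<oplus>\<^bsub>F\<^esub> w"
      using k(2) by (auto simp: W_range_def)
    have \<psi>: "\<psi> \<in> rmod_hom R ?H F" and Hq: "quot_in R E ?H P1" and P1W: "\<forall>p\<in>P1. \<psi> p \<in> W"
      using k(1) by (auto simp: W_hom_def)
    have Hm: "right_module R ?H" by (rule quot_in_module[OF Hq])
    \<comment> \<open>Since i x - j m = \<psi> u + w, the pair (x, u) satisfies i x - \<psi> u in
      \<open>F0\<close>. The pairs with this property form \<open>?D2\<close>, an object modulo ?P x
      P1 by \<open>locally_kernel\<close>, and \<open>?D'\<close> is its image in \<open>Y\<close>,
      enlarged by \<open>Y0\<close>.\<close>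
    let ?Q = "rmod_prod ?G ?H" and ?h = "\<lambda>v. i (fst v) \<oplus>\<^bsub>F\<^esub> \<ominus>\<^bsub>F\<^esub> \<psi> (snd v)"
    have Q: "quot_in R E ?Q (?P \<times> P1)" by (rule quot_in_prod[OF l(2) Hq])
    have Qm: "right_module R ?Q" by (rule quot_in_module[OF Q])
    have h: "?h \<in> rmod_hom R ?Q F" by (rule hom_copair[OF F i(1) F.hom_uminus[OF \<psi>]])
    have fgQ: "fin_gen R ?Q (carrier ?Q)"
    proof (rule fin_gen_extension[OF Qm G.right_module_axioms hom_fst right_module.rsubmodule_carrier[OF Qm]])
      have "fst ` carrier ?Q = carrier ?G"
        using rsubmoduleD(2)[OF right_module.rsubmodule_carrier[OF Hm]] by (auto simp: rmod_prod_simps image_iff) 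
      then show "fin_gen R ?G (fst ` carrier ?Q)" using fin_gen_free[OF base_ring] by simp
      have "{y \<in> carrier ?Q. fst y = \<zero>\<^bsub>?G\<^esub>} = (\<lambda>x. (\<zero>\<^bsub>?G\<^esub>, x)) ` carrier ?H"
        by (auto simp: rmod_prod_simps)
      then show "fin_gen R ?Q {y \<in> carrier ?Q. fst y = \<zero>\<^bsub>?G\<^esub>}"
        using fin_gen_image[OF Hm Qm hom_inr[OF G.right_module_axioms] fin_gen_free[OF base_ring]] by simp
    qed
    let ?D2 = "{v \<in> carrier ?Q. ?h v \<in> F0}"
    have D2: "quot_in R E (sub ?Q ?D2) (?P \<times> P1)"
    proof (rule locally_kernel[OF Q fgQ h])
      fix v assume v: "v \<in> ?P \<times> P1"
      then show "?h v \<in> F0"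
        using i(2) P1W W_subset by (intro rsubmoduleD(3)[OF F0] F.rsubmodule_a_inv[OF F0]) auto
    qed
    have D2s: "rsubmodule R ?Q ?D2" by (rule rsubmodule_vimage[OF Qm F h F0])
    have lf: "(\<lambda>v. l (fst v)) \<in> rmod_hom R (sub ?Q ?D2) Y"
      by (rule hom_sub_dom[OF hom_comp[OF hom_fst l(1)] rsubmoduleD(1)[OF D2s]])
    let ?D' = "{l (fst v) \<oplus>\<^bsub>Y\<^esub> z | v z. v \<in> carrier (sub ?Q ?D2) \<and> z \<in> Y0}"
    have D': "quot_in R E (sub Y ?D') Y0"
      by (rule quot_in_image[OF D2 Y lf]) auto
    have D'eq: "?D' = {b \<oplus>\<^bsub>Y\<^esub> z | b z. b \<in> (\<lambda>v. l (fst v)) ` carrier (sub ?Q ?D2) \<and> z \<in> Y0}" by blast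
    have D's: "rsubmodule R Y ?D'"
      unfolding D'eq by (rule rsubmodule_sum[OF Ym rsubmodule_image_carrier[OF quot_in_module[OF D2] Ym lf] Y0])
    have \<psi>u: "\<psi> u \<in> carrier F" "w \<in> carrier F" "w \<in> F0"
      using hom_closed[OF \<psi> u(1)] rsubmoduleD(5)[OF W_rsubmodule u(2)] W_subset u(2) by auto
    have "i x = \<psi> u \<oplus>\<^bsub>F\<^esub> w \<oplus>\<^bsub>F\<^esub> j m"
      using F.diff_add[OF c0(4) jm] u(3) by simp
    also have "\<dots> = (w \<oplus>\<^bsub>F\<^esub> j m) \<oplus>\<^bsub>F\<^esub> \<psi> u" using \<psi>u jm by (simp add: F.M.a_ac)
    finally have "?h (x, u) = w \<oplus>\<^bsub>F\<^esub> j m" using \<psi>u jm by (simp add: F.M.a_assoc F.M.r_neg)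
    then have "?h (x, u) \<in> F0" using rsubmoduleD(3)[OF F0 \<psi>u(3) jF0[OF m(1)]] by simp
    then have "(x, u) \<in> carrier (sub ?Q ?D2)" using x(1) u(1) by (simp add: rmod_prod_simps)
    moreover have "y = l (fst (x, u)) \<oplus>\<^bsub>Y\<^esub> y0" using x(3) c0(1,2) by (simp add: Y.M.a_comm)
    ultimately have yD': "y \<in> ?D'" using x(2) by blast
    \<comment> \<open>Values of \<psi> lie in \<open>K\<close>, so \<pi> sends i (fst v) to the same
      element as a member of \<open>F0\<close>, hence into \<kappa>(M).\<close>
    have "?D' \<subseteq> ?D"
    proof
      fix z assume "z \<in> ?D'"
      then obtain v z0 where v: "z = l (fst v) \<oplus>\<^bsub>Y\<^esub> z0" "v \<in> carrier ?Q" "?h v \<in> F0" "z0 \<in> Y0" by auto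
      have vc: "fst v \<in> carrier ?G" "snd v \<in> carrier ?H" using v(2) by (auto simp: rmod_prod_simps)
      have cl: "l (fst v) \<in> carrier Y" "z0 \<in> carrier Y" "i (fst v) \<in> carrier F" "\<psi> (snd v) \<in> carrier F"
        "c z0 \<in> carrier M" "a (?h v) \<in> carrier M"
        using hom_closed[OF l(1) vc(1)] rsubmoduleD(5)[OF Y0 v(4)] hom_closed[OF i(1) vc(1)]
          hom_closed[OF \<psi> vc(2)] hom_closed[OF c] v(3,4) hom_closed[OF a] by auto
      have "\<psi> (snd v) \<in> K" by (rule K_mem0[OF Hq \<psi> _ vc(2)]) (use P1W in simp)
      then have \<psi>0: "\<pi> (\<psi> (snd v)) = \<zero>\<^bsub>L\<^esub>" using \<pi>_zero_iff cl(4) by simp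
      have "i (fst v) = ?h v \<oplus>\<^bsub>F\<^esub> \<psi> (snd v)" using cl by (simp add: F.M.a_assoc F.M.l_neg)
      then have "\<pi> (i (fst v)) = \<pi> (?h v) \<oplus>\<^bsub>L\<^esub> \<pi> (\<psi> (snd v))"
        using hom_add[OF \<pi> rsubmoduleD(5)[OF F0 v(3)] cl(4)] by simp
      also have "\<dots> = \<kappa> (a (?h v))" using \<psi>0 \<pi>_F0[OF v(3)] hom_closed[OF \<kappa> cl(6)] by simp
      finally have "\<pi> (i (fst v)) = \<kappa> (a (?h v))" .
      then have "H z = \<kappa> (a (?h v)) \<oplus>\<^bsub>L\<^esub> \<kappa> (c z0)"
        unfolding v(1) using hom_add[OF H(1) cl(1,2)] HG[OF cl(1)] G(3) vc(1) H(2)[OF v(4)] by simp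
      then have "H z = \<kappa> (a (?h v) \<oplus>\<^bsub>M\<^esub> c z0)" using hom_add[OF \<kappa> cl(6,5)] by simp
      then show "z \<in> ?D" using cl v(1) by simp
    qed
    then show "\<exists>D'. y \<in> D' \<and> D' \<subseteq> ?D \<and> quot_in R E (sub Y D') Y0 \<and> rsubmodule R Y D'"
      by (intro exI[of _ ?D'] conjI yD' D' D's)
  qed
  have incl: "(\<lambda>y. y) \<in> rmod_hom R (sub Y ?D) Y" by (rule hom_sub_dom[OF Y.hom_id rsubmoduleD(1)[OF D]])
  have Y0D: "Y0 \<subseteq> ?D" using rsubmoduleD(1)[OF quot_in_rsubmodule[OF *]] by simp
  have "quot_in R E Y {y \<oplus>\<^bsub>Y\<^esub> z | y z. y \<in> carrier (sub Y ?D) \<and> z \<in> Y0}"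
    by (rule quot_in_cokernel[OF * Y incl])
  moreover have "{y \<oplus>\<^bsub>Y\<^esub> z | y z. y \<in> carrier (sub Y ?D) \<and> z \<in> Y0} = ?D"
  proof (intro equalityI subsetI)
    fix x assume "x \<in> {y \<oplus>\<^bsub>Y\<^esub> z | y z. y \<in> carrier (sub Y ?D) \<and> z \<in> Y0}"
    then obtain y z where "x = y \<oplus>\<^bsub>Y\<^esub> z" "y \<in> ?D" "z \<in> Y0" unfolding sub_simps by blast
    then show "x \<in> ?D" using rsubmoduleD(3)[OF D, of y z] Y0D by (simp only: subsetD)
  next
    fix x assume x: "x \<in> ?D"
    have "x = x \<oplus>\<^bsub>Y\<^esub> \<zero>\<^bsub>Y\<^esub>" using x by simp
    then show "x \<in> {y \<oplus>\<^bsub>Y\<^esub> z | y z. y \<in> carrier (sub Y ?D) \<and> z \<in> Y0}"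
      unfolding sub_simps using x rsubmoduleD(2)[OF Y0] by blast
  qed
  ultimately show ?thesis2 by simp
qed

end

text \<open>An index \<open>t\<close> stands for a submodule \<open>P t\<close> of \<open>R\<^sup>n\<close>, \<open>n = rk t\<close>, with a map \<open>att t\<close> from it to \<open>M\<close>, along which
  \<open>R\<^sup>n\<close> is to be attached to \<open>M\<close>.\<close>

locale symbol_family = hereditary_placed R E
  for R :: "('r, 'k) ring_scheme" and E :: "('r, 'r univ) rmod set" +
  fixes M :: "('r, 'm, 'z) rmod_scheme" and T :: "'t set" and rk :: "'t \<Rightarrow> nat"
    and P :: "'t \<Rightarrow> (nat \<Rightarrow> 'r) set" and att :: "'t \<Rightarrow> (nat \<Rightarrow> 'r) \<Rightarrow> 'm"
  assumes tf: "torsion_free R E M"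
    and quot: "t \<in> T \<Longrightarrow> quot_in R E (free_rmod R {..<rk t}) (P t)"
    and att: "t \<in> T \<Longrightarrow> att t \<in> rmod_hom R (sub (free_rmod R {..<rk t}) (P t)) M"
    and all: "\<lbrakk>quot_in R E (free_rmod R {..<n}) N; fin_gen R (free_rmod R {..<n}) N;
        c \<in> rmod_hom R (sub (free_rmod R {..<n}) N) M\<rbrakk>
      \<Longrightarrow> \<exists>t\<in>T. rk t = n \<and> P t = N \<and> (\<forall>p\<in>N. att t p = c p)"
begin

text \<open>The direct sum of all R^(rk t), realised as one free module on pairs (t, i);
  \<open>comp\<close> and \<open>inj\<close> are its projections and injections. \<open>F\<close>
  adds \<open>M\<close> as a summand, \<open>F0\<close> replaces each R^(rk t) by
  \<open>P t\<close>, and on \<open>F0\<close> the map \<open>a\<close> is the identity of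
  \<open>M\<close> plus all the maps \<open>att t\<close>.\<close>

definition "Q = free_rmod R {(t, i). t \<in> T \<and> i < rk t}"

definition comp :: "'t \<Rightarrow> ('t \<times> nat \<Rightarrow> 'r) \<Rightarrow> nat \<Rightarrow> 'r"
  where "comp t q = (\<lambda>i. q (t, i))"

definition inj :: "'t \<Rightarrow> (nat \<Rightarrow> 'r) \<Rightarrow> 't \<times> nat \<Rightarrow> 'r"
  where "inj t x = (\<lambda>(s, i). if s = t then x i else \<zero>\<^bsub>R\<^esub>)"

definition "supp q = {t \<in> T. comp t q \<noteq> (\<lambda>_. \<zero>\<^bsub>R\<^esub>)}"

definition "F = rmod_prod M Q"

definition "F0 = {z \<in> carrier F. \<forall>t\<in>T. comp t (snd z) \<in> P t}"

definition "asum q = (\<Oplus>\<^bsub>M\<^esub>t\<in>supp q. att t (comp t q))"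

definition "a z = fst z \<oplus>\<^bsub>M\<^esub> asum (snd z)"

definition "stage S = {z \<in> carrier F. supp (snd z) \<subseteq> S}"

lemma Mm: "right_module R M"
  by (rule torsion_free_module[OF tf])

lemma Qm: "right_module R Q"
  unfolding Q_def by (rule free_rmod_module[OF base_ring])

lemma Fm: "right_module R F"
  unfolding F_def by (rule rmod_prod_module[OF Mm Qm])

lemma P_sub: "t \<in> T \<Longrightarrow> rsubmodule R (free_rmod R {..<rk t}) (P t)"
  by (rule quot_in_rsubmodule[OF quot])

lemma P_zero: "t \<in> T \<Longrightarrow> (\<lambda>_. \<zero>\<^bsub>R\<^esub>) \<in> P t"
  using rsubmoduleD(2)[OF P_sub] by (simp add: free_rmod_simps)

lemma att_zero: "t \<in> T \<Longrightarrow> att t (\<lambda>_. \<zero>\<^bsub>R\<^esub>) = \<zero>\<^bsub>M\<^esub>"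
  using hom_zero[OF right_module_abelian_group[OF right_module.right_module_sub[OF
        free_rmod_module[OF base_ring] P_sub[of t]]] right_module_abelian_group[OF Mm] att[of t]]
  by (simp add: free_rmod_simps)

lemma comp_hom:
  assumes "t \<in> T"
  shows "comp t \<in> rmod_hom R Q (free_rmod R {..<rk t})"
proof (rule rmod_homI)
  fix q assume q: "q \<in> carrier Q"
  have z: "\<forall>x. q x \<in> carrier R" "\<forall>x. x \<notin> {(t, i). t \<in> T \<and> i < rk t} \<longrightarrow> q x = \<zero>\<^bsub>R\<^esub>"
    using q by (simp_all add: Q_def free_rmod_simps)
  have "comp t q i = \<zero>\<^bsub>R\<^esub>" if "\<not> i < rk t" for i
    using z(2) that by (auto simp: comp_def)
  moreover from this have "{i. comp t q i \<noteq> \<zero>\<^bsub>R\<^esub>} \<subseteq> {..<rk t}" by auto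
  ultimately show "comp t q \<in> carrier (free_rmod R {..<rk t})"
    using finite_subset[OF _ finite_lessThan] z(1) by (auto simp: free_rmod_simps comp_def)
qed (auto simp: Q_def free_rmod_simps comp_def)

lemma inj_hom:
  assumes t: "t \<in> T"
  shows "inj t \<in> rmod_hom R (free_rmod R {..<rk t}) Q"
proof (rule rmod_homI)
  interpret R: ring R by (rule base_ring)
  fix x assume x: "x \<in> carrier (free_rmod R {..<rk t})"
  have "{p. inj t x p \<noteq> \<zero>\<^bsub>R\<^esub>} \<subseteq> {t} \<times> {i. x i \<noteq> \<zero>\<^bsub>R\<^esub>}" by (auto simp: inj_def split: if_splits)
  moreover have "finite ({t} \<times> {i. x i \<noteq> \<zero>\<^bsub>R\<^esub>})" using x by (simp add: free_rmod_simps)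
  ultimately have "finite {p. inj t x p \<noteq> \<zero>\<^bsub>R\<^esub>}" by (rule finite_subset)
  then show "inj t x \<in> carrier Q" using x t by (auto simp: Q_def free_rmod_simps inj_def)
next
  interpret R: ring R by (rule base_ring)
  show "inj t (x \<oplus>\<^bsub>free_rmod R {..<rk t}\<^esub> y) = inj t x \<oplus>\<^bsub>Q\<^esub> inj t y" for x y
    by (auto simp: Q_def free_rmod_simps inj_def fun_eq_iff)
  show "inj t (x \<star>\<^bsub>free_rmod R {..<rk t}\<^esub> r) = inj t x \<star>\<^bsub>Q\<^esub> r" if "r \<in> carrier R" for x r
    using that by (auto simp: Q_def free_rmod_simps inj_def fun_eq_iff)
qed

lemma comp_inj: "comp s (inj t x) = (if s = t then x else (\<lambda>_. \<zero>\<^bsub>R\<^esub>))"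
  by (auto simp: comp_def inj_def fun_eq_iff)

lemma supp_finite: "q \<in> carrier Q \<Longrightarrow> finite (supp q)"
proof -
  assume "q \<in> carrier Q"
  then have "finite {x. q x \<noteq> \<zero>\<^bsub>R\<^esub>}" by (simp add: Q_def free_rmod_simps)
  then have "finite (fst ` {x. q x \<noteq> \<zero>\<^bsub>R\<^esub>})" by simp
  moreover have "supp q \<subseteq> fst ` {x. q x \<noteq> \<zero>\<^bsub>R\<^esub>}"
    by (auto simp: supp_def comp_def fun_eq_iff image_iff)
  ultimately show ?thesis by (rule finite_subset[rotated])
qed

text \<open>The sum may run over any finite set of indices containing the support, so that sums with
  different supports can be compared on a common set.\<close>

lemma asum_superset:
  assumes q: "\<And>t. t \<in> T \<Longrightarrow> comp t q \<in> P t" and S: "finite S" "supp q \<subseteq> S" "S \<subseteq> T"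
  shows "asum q = (\<Oplus>\<^bsub>M\<^esub>t\<in>S. att t (comp t q))"
proof -
  interpret M: right_module R M by (rule Mm)
  show ?thesis
    unfolding asum_def
  proof (rule M.M.add.finprod_mono_neutral_cong_left[OF S(1,2)])
    show "\<And>i. i \<in> S - supp q \<Longrightarrow> att i (comp i q) = \<zero>\<^bsub>M\<^esub>"
      using S(3) att_zero by (auto simp: supp_def)
    show "(\<lambda>t. att t (comp t q)) \<in> S \<rightarrow> carrier M"
      using hom_closed[OF att] q S(3) by auto
  qed simp
qed

lemma F0_sub: "rsubmodule R F F0"
proof -
  interpret F: right_module R F by (rule Fm)
  have "rsubmodule R F (\<Inter> (insert (carrier F) ((\<lambda>t. {z \<in> carrier F. comp t (snd z) \<in> P t}) ` T)))"
  proof (rule F.rsubmodule_Inter)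
    fix N assume "N \<in> insert (carrier F) ((\<lambda>t. {z \<in> carrier F. comp t (snd z) \<in> P t}) ` T)"
    then show "rsubmodule R F N"
      using F.rsubmodule_carrier
        rsubmodule_vimage[OF Fm free_rmod_module[OF base_ring] hom_comp[OF hom_snd[of R M Q, folded F_def] comp_hom] P_sub]
      by auto
  qed simp
  also have "\<Inter> (insert (carrier F) ((\<lambda>t. {z \<in> carrier F. comp t (snd z) \<in> P t}) ` T)) = F0"
    by (auto simp: F0_def)
  finally show ?thesis .
qed

lemma carrier_F: "carrier F = carrier M \<times> carrier Q"
  by (simp add: F_def rmod_prod_simps)

lemma F_snd: "z \<in> carrier F \<Longrightarrow> snd z \<in> carrier Q"
  by (auto simp: carrier_F)

lemma F0_fst: "z \<in> F0 \<Longrightarrow> fst z \<in> carrier M"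
  using rsubmoduleD(5)[OF F0_sub, of z] by (auto simp: carrier_F)

lemma F0_comp: "z \<in> F0 \<Longrightarrow> t \<in> T \<Longrightarrow> comp t (snd z) \<in> P t"
  by (simp add: F0_def)

lemma a_hom: "a \<in> rmod_hom R (sub F F0) M"
proof -
  interpret M: right_module R M by (rule Mm)
  interpret Q: right_module R Q by (rule Qm)
  interpret F: right_module R F by (rule Fm)
  have cl: "att t (comp t (snd z)) \<in> carrier M" if "z \<in> F0" "t \<in> T" for z t
    using hom_closed[OF att[OF that(2)]] F0_comp[OF that] by simp
  have acl: "asum (snd z) \<in> carrier M" if "z \<in> F0" for z
    unfolding asum_def using cl[OF that] by (intro M.M.finsum_closed) (auto simp: supp_def)
  have fin: "finite (supp (snd z))" "supp (snd z) \<subseteq> T" if "z \<in> F0" for z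
    using that supp_finite F_snd rsubmoduleD(5)[OF F0_sub] by (auto simp: supp_def)
  show ?thesis
  proof (rule rmod_homI)
    fix z assume "z \<in> carrier (sub F F0)"
    then have "z \<in> F0" by simp
    then show "a z \<in> carrier M" unfolding a_def by (intro M.M.a_closed F0_fst acl)
  next
    fix y z assume "y \<in> carrier (sub F F0)" "z \<in> carrier (sub F F0)"
    then have yz: "y \<in> F0" "z \<in> F0" by auto
    note yzF = rsubmoduleD(5)[OF F0_sub yz(1)] rsubmoduleD(5)[OF F0_sub yz(2)]
    have s: "snd (y \<oplus>\<^bsub>F\<^esub> z) = snd y \<oplus>\<^bsub>Q\<^esub> snd z" "fst (y \<oplus>\<^bsub>F\<^esub> z) = fst y \<oplus>\<^bsub>M\<^esub> fst z"
      by (simp_all add: F_def rmod_prod_def split_beta)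
    let ?S = "supp (snd y) \<union> supp (snd z)"
    have S: "finite ?S" "?S \<subseteq> T" using fin[OF yz(1)] fin[OF yz(2)] by auto
    have cadd: "comp t (snd (y \<oplus>\<^bsub>F\<^esub> z)) = comp t (snd y) \<oplus>\<^bsub>free_rmod R {..<rk t}\<^esub> comp t (snd z)" if "t \<in> T" for t
      unfolding s using hom_add[OF comp_hom[OF that] F_snd[OF yzF(1)] F_snd[OF yzF(2)]] .
    have "supp (snd (y \<oplus>\<^bsub>F\<^esub> z)) \<subseteq> ?S"
      using cadd M.R.l_zero[OF M.R.zero_closed] by (auto simp: supp_def free_rmod_simps)
    then have "asum (snd (y \<oplus>\<^bsub>F\<^esub> z)) = (\<Oplus>\<^bsub>M\<^esub>t\<in>?S. att t (comp t (snd (y \<oplus>\<^bsub>F\<^esub> z))))"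
      using S F0_comp[OF rsubmoduleD(3)[OF F0_sub yz]] by (intro asum_superset) auto
    also have "\<dots> = (\<Oplus>\<^bsub>M\<^esub>t\<in>?S. att t (comp t (snd y)) \<oplus>\<^bsub>M\<^esub> att t (comp t (snd z)))"
    proof (rule M.M.finsum_cong'[OF refl])
      show "(\<lambda>t. att t (comp t (snd y)) \<oplus>\<^bsub>M\<^esub> att t (comp t (snd z))) \<in> ?S \<rightarrow> carrier M"
        using cl[OF yz(1)] cl[OF yz(2)] S(2) by auto
      fix t assume "t \<in> ?S"
      then have t: "t \<in> T" using S(2) by auto
      show "att t (comp t (snd (y \<oplus>\<^bsub>F\<^esub> z))) = att t (comp t (snd y)) \<oplus>\<^bsub>M\<^esub> att t (comp t (snd z))"
        using hom_add[OF att[OF t], of "comp t (snd y)" "comp t (snd z)"] F0_comp[OF yz(1) t] F0_comp[OF yz(2) t] cadd[OF t] by simp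
    qed
    also have "\<dots> = (\<Oplus>\<^bsub>M\<^esub>t\<in>?S. att t (comp t (snd y))) \<oplus>\<^bsub>M\<^esub> (\<Oplus>\<^bsub>M\<^esub>t\<in>?S. att t (comp t (snd z)))"
      using cl[OF yz(1)] cl[OF yz(2)] S(2) by (intro M.M.finsum_addf) auto
    also have "(\<Oplus>\<^bsub>M\<^esub>t\<in>?S. att t (comp t (snd y))) = asum (snd y)"
      using F0_comp[OF yz(1)] S by (intro asum_superset[symmetric]) auto
    also have "(\<Oplus>\<^bsub>M\<^esub>t\<in>?S. att t (comp t (snd z))) = asum (snd z)"
      using F0_comp[OF yz(2)] S by (intro asum_superset[symmetric]) auto
    finally have "asum (snd (y \<oplus>\<^bsub>F\<^esub> z)) = asum (snd y) \<oplus>\<^bsub>M\<^esub> asum (snd z)" .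
    then show "a (y \<oplus>\<^bsub>sub F F0\<^esub> z) = a y \<oplus>\<^bsub>M\<^esub> a z"
      using acl[OF yz(1)] acl[OF yz(2)] F0_fst[OF yz(1)] F0_fst[OF yz(2)] s(2) by (simp add: a_def M.M.a_ac)
  next
    fix z r assume "z \<in> carrier (sub F F0)" and r: "r \<in> carrier R"
    then have z: "z \<in> F0" by simp
    note zF = rsubmoduleD(5)[OF F0_sub z]
    have s: "snd (z \<star>\<^bsub>F\<^esub> r) = snd z \<star>\<^bsub>Q\<^esub> r" "fst (z \<star>\<^bsub>F\<^esub> r) = fst z \<star>\<^bsub>M\<^esub> r"
      by (simp_all add: F_def rmod_prod_def split_beta)
    let ?S = "supp (snd z)"
    have S: "finite ?S" "?S \<subseteq> T" by (rule fin[OF z])+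
    have cact: "comp t (snd (z \<star>\<^bsub>F\<^esub> r)) = comp t (snd z) \<star>\<^bsub>free_rmod R {..<rk t}\<^esub> r" if "t \<in> T" for t
      unfolding s using hom_act[OF comp_hom[OF that] F_snd[OF zF] r] .
    have "supp (snd (z \<star>\<^bsub>F\<^esub> r)) \<subseteq> ?S"
      using cact M.R.l_null[OF r] by (auto simp: supp_def free_rmod_simps)
    then have "asum (snd (z \<star>\<^bsub>F\<^esub> r)) = (\<Oplus>\<^bsub>M\<^esub>t\<in>?S. att t (comp t (snd (z \<star>\<^bsub>F\<^esub> r))))"
      using S F0_comp[OF rsubmoduleD(4)[OF F0_sub z r]] by (intro asum_superset) auto
    also have "\<dots> = (\<Oplus>\<^bsub>M\<^esub>t\<in>?S. att t (comp t (snd z)) \<star>\<^bsub>M\<^esub> r)"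
    proof (rule M.M.finsum_cong'[OF refl])
      show "(\<lambda>t. att t (comp t (snd z)) \<star>\<^bsub>M\<^esub> r) \<in> ?S \<rightarrow> carrier M"
        using cl[OF z] S(2) r M.ract_closed by auto
      fix t assume "t \<in> ?S"
      then have t: "t \<in> T" using S(2) by auto
      show "att t (comp t (snd (z \<star>\<^bsub>F\<^esub> r))) = att t (comp t (snd z)) \<star>\<^bsub>M\<^esub> r"
        using hom_act[OF att[OF t], of "comp t (snd z)" r] F0_comp[OF z t] cact[OF t] r by simp
    qed
    also have "\<dots> = asum (snd z) \<star>\<^bsub>M\<^esub> r"
    proof -
      have "(\<Oplus>\<^bsub>M\<^esub>t\<in>A. att t (comp t (snd z)) \<star>\<^bsub>M\<^esub> r) = (\<Oplus>\<^bsub>M\<^esub>t\<in>A. att t (comp t (snd z))) \<star>\<^bsub>M\<^esub> r"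
        if "finite A" "A \<subseteq> T" for A
        using that
      proof (induction A rule: finite_induct)
        case empty
        then show ?case using r by (simp add: M.zero_ract)
      next
        case (insert x A)
        have "(\<Oplus>\<^bsub>M\<^esub>t\<in>insert x A. att t (comp t (snd z)) \<star>\<^bsub>M\<^esub> r)
          = att x (comp x (snd z)) \<star>\<^bsub>M\<^esub> r \<oplus>\<^bsub>M\<^esub> (\<Oplus>\<^bsub>M\<^esub>t\<in>A. att t (comp t (snd z)) \<star>\<^bsub>M\<^esub> r)"
          using insert cl[OF z] r by (intro M.M.finsum_insert) (auto intro!: M.ract_closed)
        also have "\<dots> = (att x (comp x (snd z)) \<oplus>\<^bsub>M\<^esub> (\<Oplus>\<^bsub>M\<^esub>t\<in>A. att t (comp t (snd z)))) \<star>\<^bsub>M\<^esub> r"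
          using insert cl[OF z] r by (subst M.ract_add_left) (auto intro!: M.M.finsum_closed)
        also have "att x (comp x (snd z)) \<oplus>\<^bsub>M\<^esub> (\<Oplus>\<^bsub>M\<^esub>t\<in>A. att t (comp t (snd z))) = (\<Oplus>\<^bsub>M\<^esub>t\<in>insert x A. att t (comp t (snd z)))"
          using insert cl[OF z] by (intro M.M.finsum_insert[symmetric]) auto
        finally show ?case .
      qed
      from this[OF S] show ?thesis by (simp add: asum_def)
    qed
    finally have "asum (snd (z \<star>\<^bsub>F\<^esub> r)) = asum (snd z) \<star>\<^bsub>M\<^esub> r" .
    then show "a (z \<star>\<^bsub>sub F F0\<^esub> r) = a z \<star>\<^bsub>M\<^esub> r"
      using acl[OF z] F0_fst[OF z] s(2) r by (simp add: a_def M.ract_add_left)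
  qed
qed

lemma stage_sub: "rsubmodule R F (stage S)"
proof -
  interpret F: right_module R F by (rule Fm)
  have G: "right_module R (free_rmod R {..<rk t})" for t by (rule free_rmod_module[OF base_ring])
  have "rsubmodule R F (\<Inter> (insert (carrier F) ((\<lambda>t. {z \<in> carrier F. comp t (snd z) = (\<lambda>_. \<zero>\<^bsub>R\<^esub>)}) ` (T - S))))"
  proof (rule F.rsubmodule_Inter)
    fix N assume "N \<in> insert (carrier F) ((\<lambda>t. {z \<in> carrier F. comp t (snd z) = (\<lambda>_. \<zero>\<^bsub>R\<^esub>)}) ` (T - S))"
    then show "rsubmodule R F N"
      using F.rsubmodule_carrier
        rsubmodule_kernel[OF Fm G hom_comp[OF hom_snd[of R M Q, folded F_def] comp_hom]]
      by (auto simp: free_rmod_simps)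
  qed simp
  also have "\<Inter> (insert (carrier F) ((\<lambda>t. {z \<in> carrier F. comp t (snd z) = (\<lambda>_. \<zero>\<^bsub>R\<^esub>)}) ` (T - S))) = stage S"
    by (auto simp: stage_def supp_def)
  finally show ?thesis .
qed

lemma stage_comp: "z \<in> stage S \<Longrightarrow> t \<in> T \<Longrightarrow> t \<notin> S \<Longrightarrow> comp t (snd z) = (\<lambda>_. \<zero>\<^bsub>R\<^esub>)"
  by (auto simp: stage_def supp_def)

text \<open>Adding \<open>t\<close> adds one layer. Between the new stage and its intersection with
  \<open>F0\<close> lies \<open>Y1\<close>, where only the component at \<open>t\<close> is
  restricted to \<open>P t\<close>. The upper quotient is R^(rk t) / P t; the lower one, after
  erasing the component at \<open>t\<close>, is the quotient of the old stage.\<close>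

lemma stage_quot:
  assumes "finite S" "S \<subseteq> T"
  shows "quot_in R E (sub F (stage S)) (stage S \<inter> F0)"
  using assms
proof (induction S rule: finite_induct)
  case empty
  have "stage {} \<inter> F0 = carrier (sub F (stage {}))"
    using P_zero stage_comp[of _ "{}"] by (auto simp: F0_def stage_def)
  then show ?case
    using quot_in_carrier[OF right_module.right_module_sub[OF Fm stage_sub[of "{}"]]] by simp
next
  case (insert t S)
  interpret R: ring R by (rule base_ring)
  interpret F: right_module R F by (rule Fm)
  interpret M: right_module R M by (rule Mm)
  interpret Q: right_module R Q by (rule Qm)
  have t: "t \<in> T" using insert.prems by simp
  let ?Y = "sub F (stage (insert t S))" and ?G = "free_rmod R {..<rk t}"
  define Y1 where "Y1 = {z \<in> carrier ?Y. comp t (snd z) \<in> P t}"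
  interpret G: right_module R ?G by (rule free_rmod_module[OF base_ring])
  have Ym: "right_module R ?Y" by (rule F.right_module_sub[OF stage_sub])
  have hc: "(\<lambda>z. comp t (snd z)) \<in> rmod_hom R ?Y ?G"
    by (rule hom_sub_dom[OF hom_comp[OF hom_snd[of R M Q, folded F_def] comp_hom[OF t]] rsubmoduleD(1)[OF stage_sub]])
  have Y1q: "quot_in R E ?Y Y1"
    unfolding Y1_def
  proof (rule quot_in_preimage[OF quot[OF t] Ym hc])
    fix z assume z: "z \<in> carrier ?G"
    have "(\<zero>\<^bsub>M\<^esub>, inj t z) \<in> stage (insert t S)"
      using hom_closed[OF inj_hom[OF t] z] by (auto simp: stage_def carrier_F supp_def comp_inj)
    moreover have "z = comp t (snd (\<zero>\<^bsub>M\<^esub>, inj t z)) \<oplus>\<^bsub>?G\<^esub> \<zero>\<^bsub>?G\<^esub>"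
      using z by (simp add: comp_inj)
    ultimately show "\<exists>y\<in>carrier ?Y. \<exists>z0\<in>P t. z = comp t (snd y) \<oplus>\<^bsub>?G\<^esub> z0"
      using rsubmoduleD(2)[OF P_sub[OF t]] unfolding sub_simps by blast
  qed
  have Y1F: "rsubmodule R F Y1" by (rule F.rsubmodule_trans[OF stage_sub quot_in_rsubmodule[OF Y1q]])
  have Y1m: "right_module R (sub F Y1)" by (rule F.right_module_sub[OF Y1F])
  define cut where "cut q = (\<lambda>(s, i). if s = t then \<zero>\<^bsub>R\<^esub> else q (s, i))" for q :: "'t \<times> nat \<Rightarrow> 'r"
  have ccut: "comp s (cut q) = (if s = t then (\<lambda>_. \<zero>\<^bsub>R\<^esub>) else comp s q)" for s q
    by (auto simp: comp_def cut_def)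
  have cutQ: "cut \<in> rmod_hom R Q Q"
  proof (rule rmod_homI)
    fix q assume q: "q \<in> carrier Q"
    have "{p. cut q p \<noteq> \<zero>\<^bsub>R\<^esub>} \<subseteq> {p. q p \<noteq> \<zero>\<^bsub>R\<^esub>}" by (auto simp: cut_def split: if_splits)
    moreover have "finite {p. q p \<noteq> \<zero>\<^bsub>R\<^esub>}" using q by (simp add: Q_def free_rmod_simps)
    ultimately have "finite {p. cut q p \<noteq> \<zero>\<^bsub>R\<^esub>}" by (rule finite_subset)
    then show "cut q \<in> carrier Q" using q by (auto simp: Q_def free_rmod_simps cut_def)
  next
    show "cut (x \<oplus>\<^bsub>Q\<^esub> y) = cut x \<oplus>\<^bsub>Q\<^esub> cut y" for x y
      by (auto simp: Q_def free_rmod_simps cut_def fun_eq_iff)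
    show "cut (x \<star>\<^bsub>Q\<^esub> r) = cut x \<star>\<^bsub>Q\<^esub> r" if "r \<in> carrier R" for x r
      using that by (auto simp: Q_def free_rmod_simps cut_def fun_eq_iff)
  qed
  let ?h = "\<lambda>z. (fst z, cut (snd z))"
  have hF: "?h \<in> rmod_hom R F F"
    unfolding F_def by (rule hom_pair[OF hom_fst hom_comp[OF hom_snd cutQ]])
  have hst: "?h z \<in> stage S" if "z \<in> stage (insert t S)" for z
    using that hom_closed[OF hF, of z] stage_comp[OF that] by (auto simp: stage_def supp_def ccut)
  have h: "?h \<in> rmod_hom R (sub F Y1) (sub F (stage S))"
    by (rule hom_sub_cod[OF hom_sub_dom[OF hF rsubmoduleD(1)[OF Y1F]]]) (use hst in \<open>auto simp: Y1_def\<close>)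
  have "quot_in R E (sub F Y1) {y \<in> carrier (sub F Y1). ?h y \<in> stage S \<inter> F0}"
  proof (rule quot_in_preimage[OF _ Y1m h])
    show "quot_in R E (sub F (stage S)) (stage S \<inter> F0)" using insert by simp
    fix z assume z: "z \<in> carrier (sub F (stage S))"
    then have zF: "z \<in> carrier F" and zs: "z \<in> stage S" by (auto simp: stage_def)
    have cz: "comp t (snd z) = (\<lambda>_. \<zero>\<^bsub>R\<^esub>)" using stage_comp[OF zs t insert.hyps(2)] .
    have "cut (snd z) = snd z"
    proof
      fix x :: "'t \<times> nat"
      show "cut (snd z) x = snd z x" using fun_cong[OF cz, of "snd x"] by (cases x) (auto simp: cut_def comp_def)
    qed
    then have "z = ?h z \<oplus>\<^bsub>F\<^esub> \<zero>\<^bsub>F\<^esub>" using zF by simp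
    moreover have "z \<in> Y1" using zs cz P_zero[OF t] by (auto simp: Y1_def stage_def)
    moreover have "\<zero>\<^bsub>F\<^esub> \<in> stage S \<inter> F0" using rsubmoduleD(2)[OF stage_sub] rsubmoduleD(2)[OF F0_sub] by simp
    ultimately show "\<exists>y\<in>carrier (sub F Y1). \<exists>z0\<in>stage S \<inter> F0. z = ?h y \<oplus>\<^bsub>sub F (stage S)\<^esub> z0"
      by (intro bexI[of _ z] bexI[of _ "\<zero>\<^bsub>F\<^esub>"]) simp_all
  qed
  moreover have "{y \<in> carrier (sub F Y1). ?h y \<in> stage S \<inter> F0} = stage (insert t S) \<inter> F0"
  proof (rule Set.set_eqI)
    fix z
    have "?h z \<in> F0 \<longleftrightarrow> (\<forall>s\<in>T. s \<noteq> t \<longrightarrow> comp s (snd z) \<in> P s)" if "z \<in> stage (insert t S)"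
      using hom_closed[OF hF, of z] that P_zero[OF t] by (auto simp: F0_def ccut stage_def)
    then show "z \<in> {y \<in> carrier (sub F Y1). ?h y \<in> stage S \<inter> F0} \<longleftrightarrow> z \<in> stage (insert t S) \<inter> F0"
      using hst[of z] t by (auto simp: Y1_def F0_def stage_def)
  qed
  ultimately have "quot_in R E (sub ?Y Y1) (stage (insert t S) \<inter> F0)" by simp
  then show ?case by (rule quot_in_trans[OF Y1q])
qed

text \<open>The local finiteness condition holds since finitely many elements have finite joint
  support and so lie in one stage. The genericity condition holds since every map in question occurs
  as a symbol t, and the injection at t restricts to it.\<close>

sublocale local_hull R E M F F0 a "\<lambda>m. (m, \<zero>\<^bsub>Q\<^esub>)"
proof (intro local_hull.intro local_hull_axioms.intro hereditary_placed_axioms)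
  interpret M: right_module R M by (rule Mm)
  interpret Q: right_module R Q by (rule Qm)
  show "torsion_free R E M" by (rule tf)
  show "right_module R F" by (rule Fm)
  show "rsubmodule R F F0" by (rule F0_sub)
  show "a \<in> rmod_hom R (sub F F0) M" by (rule a_hom)
  show "(\<lambda>m. (m, \<zero>\<^bsub>Q\<^esub>)) \<in> rmod_hom R M F" unfolding F_def by (rule hom_inl[OF Qm])
  have c0: "comp t \<zero>\<^bsub>Q\<^esub> = (\<lambda>_. \<zero>\<^bsub>R\<^esub>)" for t by (simp add: Q_def free_rmod_simps comp_def)
  show "(m, \<zero>\<^bsub>Q\<^esub>) \<in> F0" if "m \<in> carrier M" for m
    using that P_zero by (simp add: F0_def carrier_F c0)
  show "a (m, \<zero>\<^bsub>Q\<^esub>) = m" if "m \<in> carrier M" for m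
    using that by (simp add: a_def asum_def supp_def c0)
  show "\<exists>F1. rsubmodule R F F1 \<and> Z \<subseteq> F1 \<and> quot_in R E (sub F F1) (F1 \<inter> F0)"
    if Z: "finite Z" "Z \<subseteq> carrier F" for Z
  proof -
    let ?S = "\<Union>z\<in>Z. supp (snd z)"
    have "finite ?S" using Z supp_finite F_snd by auto
    moreover have "?S \<subseteq> T" by (auto simp: supp_def)
    moreover have "Z \<subseteq> stage ?S" using Z(2) by (auto simp: stage_def)
    ultimately show ?thesis using stage_sub stage_quot by blast
  qed
  show "\<exists>i\<in>rmod_hom R (free_rmod R {..<n}) F. \<forall>p\<in>N. i p \<in> F0 \<and> a (i p) = c p"
    if N: "quot_in R E (free_rmod R {..<n}) N" "fin_gen R (free_rmod R {..<n}) N"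
      "c \<in> rmod_hom R (sub (free_rmod R {..<n}) N) M" for n :: nat and N c
  proof -
    obtain t where t: "t \<in> T" "rk t = n" "P t = N" "\<forall>p\<in>N. att t p = c p" using all[OF N] by blast
    have i: "(\<lambda>x. (\<zero>\<^bsub>M\<^esub>, inj t x)) \<in> rmod_hom R (free_rmod R {..<n}) F"
      unfolding F_def using hom_comp[OF inj_hom[OF t(1)] hom_inr[OF Mm]] t(2) by simp
    have "(\<zero>\<^bsub>M\<^esub>, inj t p) \<in> F0 \<and> a (\<zero>\<^bsub>M\<^esub>, inj t p) = c p" if p: "p \<in> N" for p
    proof -
      have pc: "p \<in> carrier (free_rmod R {..<n})" using rsubmoduleD(5)[OF quot_in_rsubmodule[OF N(1)] p] .
      have c: "\<And>s. s \<in> T \<Longrightarrow> comp s (inj t p) \<in> P s" using P_zero p t(3) by (simp add: comp_inj)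
      have "asum (inj t p) = (\<Oplus>\<^bsub>M\<^esub>s\<in>{t}. att s (comp s (inj t p)))"
        by (rule asum_superset[OF c]) (use t(1) in \<open>auto simp: supp_def comp_inj\<close>)
      also have "\<dots> = c p"
        using hom_closed[OF N(3), of p] p t(4) by (subst M.M.finsum_insert) (auto simp: comp_inj)
      finally have "asum (inj t p) = c p" .
      then show ?thesis
        using hom_closed[OF N(3), of p] p hom_closed[OF i pc] c by (simp add: a_def F0_def)
    qed
    then show ?thesis by (intro bexI[OF _ i]) blast
  qed
qed

end

text \<open>Transport of structure along an injection, used to bring the hull into the type of
  sequences over R.\<close>

definition copy_rmod :: "('m \<Rightarrow> 'n) \<Rightarrow> ('r, 'm, 'z) rmod_scheme \<Rightarrow> ('r, 'n) rmod"
  where "copy_rmod f M =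
    \<lparr>carrier = f ` carrier M, monoid.mult = (\<lambda>_ _. undefined), one = undefined,
     ring.zero = f \<zero>\<^bsub>M\<^esub>,
     add = (\<lambda>x y. f (inv_into (carrier M) f x \<oplus>\<^bsub>M\<^esub> inv_into (carrier M) f y)),
     ract = (\<lambda>x a. f (inv_into (carrier M) f x \<star>\<^bsub>M\<^esub> a))\<rparr>"

lemma copy_rmod_facts:
  assumes M: "right_module R M" and f: "inj_on f (carrier M)"
  shows "right_module R (copy_rmod f M)"
    and "f \<in> rmod_hom R M (copy_rmod f M)"
    and "bij_betw f (carrier M) (carrier (copy_rmod f M))"
proof -
  interpret M: right_module R M by fact
  have inv: "inv_into (carrier M) f (f x) = x" if "x \<in> carrier M" for x
    using f that by simp
  show "right_module R (copy_rmod f M)"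
  proof (rule right_moduleI)
    show "\<exists>y\<in>carrier (copy_rmod f M). y \<oplus>\<^bsub>copy_rmod f M\<^esub> x = \<zero>\<^bsub>copy_rmod f M\<^esub>"
      if "x \<in> carrier (copy_rmod f M)" for x
      using that by (intro bexI[of _ "f (\<ominus>\<^bsub>M\<^esub> inv_into (carrier M) f x)"])
        (auto simp: copy_rmod_def inv M.M.l_neg)
  qed (auto simp: copy_rmod_def inv M.R.ring_axioms M.M.a_ac
      M.ract_add_left M.ract_add_right M.ract_assoc M.ract_one M.ract_closed)
  show "f \<in> rmod_hom R M (copy_rmod f M)"
    by (rule rmod_homI) (auto simp: copy_rmod_def inv)
  show "bij_betw f (carrier M) (carrier (copy_rmod f M))"
    using f by (simp add: copy_rmod_def bij_betw_def)
qed

lemma hom_eq_on_rspan: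
  assumes M: "right_module R M" and N: "right_module R N"
    and h: "h \<in> rmod_hom R (sub M (rspan R M X)) N" "k \<in> rmod_hom R (sub M (rspan R M X)) N"
    and X: "X \<subseteq> carrier M" and eq: "\<And>x. x \<in> X \<Longrightarrow> h x = k x" and x: "x \<in> rspan R M X"
  shows "h x = k x"
proof -
  interpret M: right_module R M by fact
  interpret N: right_module R N by fact
  let ?S = "rspan R M X"
  have S: "rsubmodule R M ?S" by (rule M.rspan_rsubmodule[OF X])
  interpret S: right_module R "sub M ?S" by (rule M.right_module_sub[OF S])
  have d: "(\<lambda>x. h x \<ominus>\<^bsub>N\<^esub> k x) \<in> rmod_hom R (sub M ?S) N" by (rule N.hom_minus[OF h])
  let ?V = "{x \<in> carrier (sub M ?S). h x \<ominus>\<^bsub>N\<^esub> k x = \<zero>\<^bsub>N\<^esub>}"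
  have V: "rsubmodule R M ?V"
    by (rule M.rsubmodule_trans[OF S rsubmodule_kernel[OF S.right_module_axioms N d]])
  have iff: "h y \<ominus>\<^bsub>N\<^esub> k y = \<zero>\<^bsub>N\<^esub> \<longleftrightarrow> h y = k y" if "y \<in> ?S" for y
    using that hom_closed[OF h(1)] hom_closed[OF h(2)] by (intro N.diff_eq_zero) auto
  have "X \<subseteq> ?V" using iff eq M.rspan_superset[of X] by auto
  from M.rspan_least[OF V this] show ?thesis using x iff by auto
qed

lemma (in well_placed) local_module_iso:
  assumes X: "local_module R E X" and u: "u \<in> rmod_hom R X X'" "bij_betw u (carrier X) (carrier X')"
    and X': "right_module R X'"
  shows "local_module R E X'"
  unfolding local_module_def
proof (intro conjI ballI allI impI)
  note Xm = torsion_free_module[OF local_module_torsion_free[OF X]]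
  let ?v = "inv_into (carrier X) u"
  have v: "?v \<in> rmod_hom R X' X" by (rule inverse_hom[OF Xm u])
  have vbij: "bij_betw ?v (carrier X') (carrier X)" by (rule bij_betw_inv_into[OF u(2)])
  show "torsion_free R E X'"
    by (rule torsion_free_embed[OF local_module_torsion_free[OF X] X' v])
      (use hom_inj_iff[OF X' Xm v] vbij in \<open>auto simp: bij_betw_def\<close>)
  fix A and P Q :: "('r, 'r univ) rmod" and f g c
  assume A: "A \<in> E" and conj: "fg_projective_rmod R P \<and> fg_projective_rmod R Q \<and> short_exact R P f Q g A"
    and c: "c \<in> rmod_hom R P X'"
  note * = A conj[THEN conjunct1] conj[THEN conjunct2, THEN conjunct1] conj[THEN conjunct2, THEN conjunct2]
  obtain e where e: "e \<in> rmod_hom R Q X" "\<forall>p\<in>carrier P. e (f p) = ?v (c p)"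
    using local_module_extend[OF X * hom_comp[OF c v]] by blast
  show "\<exists>e\<in>rmod_hom R Q X'. \<forall>p\<in>carrier P. e (f p) = c p"
  proof (rule bexI[OF _ hom_comp[OF e(1) u(1)]], rule ballI)
    fix p assume p: "p \<in> carrier P"
    have "u (?v (c p)) = c p" using u(2) hom_closed[OF c p] by (simp add: bij_betw_def f_inv_into_f)
    then show "u (e (f p)) = c p" using e(2) p by simp
  qed
qed

subsection \<open>Cardinality of the localised module\<close>

lemma infinite_sequences:
  assumes "(x :: 'r) \<noteq> y"
  shows "infinite (UNIV :: (nat \<Rightarrow> 'r) set)"
proof -
  have "inj (\<lambda>n i :: nat. if i = n then x else y)"
    using assms by (auto simp: inj_def fun_eq_iff)
  then show ?thesis using infinite_le_lepoll unfolding lepoll_def by blast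
qed

lemma times_lepoll_infinite:
  assumes "infinite C" "A \<lesssim> C" "B \<lesssim> C"
  shows "A \<times> B \<lesssim> C"
proof -
  have "C \<times> C \<approx> C"
    using card_of_Times_same_infinite[OF assms(1)] by (simp add: eqpoll_iff_card_of_ordIso)
  then show ?thesis by (rule lepoll_trans2[OF times_lepoll_mono[OF assms(2,3)]])
qed

lemma Fpow_lepoll_infinite:
  assumes "infinite C" "A \<lesssim> C"
  shows "Fpow A \<lesssim> C"
proof -
  obtain f where f: "inj_on f A" "f ` A \<subseteq> C" using assms(2) by (auto simp: lepoll_def)
  have "Fpow A \<lesssim> Fpow C"
    unfolding lepoll_def using inj_on_image_Fpow[OF f(1)] image_Fpow_mono[OF f(2)] by blast
  then show ?thesis using eqpoll_Fpow[OF assms(1)] lepoll_trans2 by blast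
qed

lemma sequences_lepoll: "(UNIV :: (nat \<Rightarrow> nat \<Rightarrow> 'r) set) \<lesssim> (UNIV :: (nat \<Rightarrow> 'r) set)"
proof -
  have "inj (\<lambda>g :: nat \<Rightarrow> nat \<Rightarrow> 'r. \<lambda>n. g (fst (prod_decode n)) (snd (prod_decode n)))"
  proof (rule injI)
    fix g h :: "nat \<Rightarrow> nat \<Rightarrow> 'r"
    assume eq: "(\<lambda>n. g (fst (prod_decode n)) (snd (prod_decode n)))
      = (\<lambda>n. h (fst (prod_decode n)) (snd (prod_decode n)))"
    show "g = h"
    proof (intro ext)
      fix i k show "g i k = h i k" using fun_cong[OF eq, of "prod_encode (i, k)"] by simp
    qed
  qed
  then show ?thesis unfolding lepoll_def by blast
qed

text \<open>Shaped to fit the cardinality bound \<open>lepoll_restricted_funspace\<close> for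
  finitely supported functions.\<close>

lemma free_rmod_subset:
  "carrier (free_rmod R X) \<subseteq>
    {f. f ` X \<subseteq> UNIV \<and> {x. f x \<noteq> \<zero>\<^bsub>R\<^esub>} \<subseteq> X \<and> finite {x. f x \<noteq> \<zero>\<^bsub>R\<^esub>}}"
  by (auto simp: free_rmod_simps)

lemma fin_presented_lepoll:
  fixes R :: "('r, 'k) ring_scheme"
  assumes "fin_presented R M"
  shows "carrier M \<lesssim> (UNIV :: (nat \<Rightarrow> 'r) set)"
proof -
  obtain n :: nat and p where p: "p ` carrier (free_rmod R {..<n}) = carrier M"
    using assms unfolding fin_presented_def by blast
  have "carrier M \<subseteq> p ` UNIV" unfolding p[symmetric] by auto
  then show ?thesis by (rule subset_image_lepoll)
qed

text \<open>The zero ring is treated apart: the cardinal arithmetic needs infinitely many sequences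
  over R, and these are built from the distinct elements 0 and 1.\<close>

lemma trivial_module:
  assumes "right_module R M" "\<one>\<^bsub>R\<^esub> = \<zero>\<^bsub>R\<^esub>"
  shows "carrier M = {\<zero>\<^bsub>M\<^esub>}"
proof -
  interpret M: right_module R M by fact
  have "x = \<zero>\<^bsub>M\<^esub>" if "x \<in> carrier M" for x
    using M.ract_one[OF that] M.ract_zero[OF that] assms(2) by simp
  then show ?thesis by auto
qed

context hereditary_placed
begin

text \<open>The last clause is a finiteness condition, as \<open>E\<close> is not closed under submodules: where the extension of
  \<open>c\<close> to \<open>R\<^sup>n\<close> stays within \<open>M\<close>, it does so on a module that differs from \<open>P\<close> by an object of \<open>E\<close>.\<close>

definition hull_of :: "('r, 'm, 'z) rmod_scheme \<Rightarrow> ('r, 'l, 'y) rmod_scheme \<Rightarrow> ('m \<Rightarrow> 'l) \<Rightarrow> bool"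
  where "hull_of M L \<kappa> \<longleftrightarrow> local_module R E L \<and> \<kappa> \<in> rmod_hom R M L \<and> inj_on \<kappa> (carrier M) \<and>
    (\<forall>(n :: nat) P c H. quot_in R E (free_rmod R {..<n}) P \<and> c \<in> rmod_hom R (sub (free_rmod R {..<n}) P) M \<and>
      H \<in> rmod_hom R (free_rmod R {..<n}) L \<and> (\<forall>y\<in>P. H y = \<kappa> (c y)) \<longrightarrow>
      quot_in R E (sub (free_rmod R {..<n}) {y \<in> carrier (free_rmod R {..<n}). H y \<in> \<kappa> ` carrier M}) P)"

lemma hull_ofD:
  assumes "hull_of M L \<kappa>" "quot_in R E (free_rmod R {..<n :: nat}) P"
    "c \<in> rmod_hom R (sub (free_rmod R {..<n}) P) M"
    "H \<in> rmod_hom R (free_rmod R {..<n}) L" "\<forall>y\<in>P. H y = \<kappa> (c y)"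
  shows "quot_in R E (sub (free_rmod R {..<n}) {y \<in> carrier (free_rmod R {..<n}). H y \<in> \<kappa> ` carrier M}) P"
  using assms unfolding hull_of_def by blast

lemma hull_of_copy:
  assumes h: "hull_of M L \<kappa>" and f: "inj_on f (carrier L)"
  shows "hull_of M (copy_rmod f L) (\<lambda>m. f (\<kappa> m))"
proof -
  have L: "local_module R E L" and \<kappa>: "\<kappa> \<in> rmod_hom R M L" "inj_on \<kappa> (carrier M)"
    using h by (auto simp: hull_of_def)
  note Lm = torsion_free_module[OF local_module_torsion_free[OF L]]
  note c = copy_rmod_facts[OF Lm f]
  let ?v = "inv_into (carrier L) f"
  have v: "?v \<in> rmod_hom R (copy_rmod f L) L" by (rule inverse_hom[OF Lm c(2,3)])
  have vf: "?v (f x) = x" if "x \<in> carrier L" for x using f that by simp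
  have fv: "f (?v x) = x" if "x \<in> carrier (copy_rmod f L)" for x
    using c(3) that by (simp add: bij_betw_def f_inv_into_f)
  show ?thesis
    unfolding hull_of_def
  proof (intro conjI allI impI)
    show "local_module R E (copy_rmod f L)" by (rule local_module_iso[OF L c(2,3,1)])
    show "(\<lambda>m. f (\<kappa> m)) \<in> rmod_hom R M (copy_rmod f L)" by (rule hom_comp[OF \<kappa>(1) c(2)])
    show "inj_on (\<lambda>m. f (\<kappa> m)) (carrier M)"
      using \<kappa>(2) f hom_closed[OF \<kappa>(1)] by (auto simp: inj_on_def)
    fix n :: nat and P d H
    assume *: "quot_in R E (free_rmod R {..<n}) P \<and> d \<in> rmod_hom R (sub (free_rmod R {..<n}) P) M \<and>
      H \<in> rmod_hom R (free_rmod R {..<n}) (copy_rmod f L) \<and> (\<forall>y\<in>P. H y = f (\<kappa> (d y)))"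
    let ?G = "free_rmod R {..<n}"
    have H: "H \<in> rmod_hom R ?G (copy_rmod f L)" using * by simp
    have d: "\<kappa> (d y) \<in> carrier L" if "y \<in> P" for y
      using * that hom_closed[of d R "sub ?G P" M y] hom_closed[OF \<kappa>(1)] by simp
    have "\<forall>y\<in>P. ?v (H y) = \<kappa> (d y)" using * vf[OF d] by simp
    then have q: "quot_in R E (sub ?G {y \<in> carrier ?G. ?v (H y) \<in> \<kappa> ` carrier M}) P"
      using * hom_comp[OF H v] by (intro hull_ofD[OF h]) auto
    have eq: "?v (H y) \<in> \<kappa> ` carrier M \<longleftrightarrow> H y \<in> (\<lambda>m. f (\<kappa> m)) ` carrier M" if y: "y \<in> carrier ?G" for y
    proof
      assume "?v (H y) \<in> \<kappa> ` carrier M"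
      then have "f (?v (H y)) \<in> f ` \<kappa> ` carrier M" by (rule imageI)
      then show "H y \<in> (\<lambda>m. f (\<kappa> m)) ` carrier M"
        unfolding fv[OF hom_closed[OF H y]] by (simp only: image_image)
    next
      assume "H y \<in> (\<lambda>m. f (\<kappa> m)) ` carrier M"
      then obtain m where "m \<in> carrier M" "H y = f (\<kappa> m)" by (elim imageE)
      then show "?v (H y) \<in> \<kappa> ` carrier M" using vf[OF hom_closed[OF \<kappa>(1)]] by simp
    qed
    have "{y \<in> carrier ?G. ?v (H y) \<in> \<kappa> ` carrier M} = {y \<in> carrier ?G. H y \<in> (\<lambda>m. f (\<kappa> m)) ` carrier M}"
      by (rule Collect_cong) (rule conj_cong[OF refl eq])
    with q show "quot_in R E (sub ?G {y \<in> carrier ?G. H y \<in> (\<lambda>m. f (\<kappa> m)) ` carrier M}) P"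
      by (simp only:)
  qed
qed

lemma hull_of_trivial:
  assumes one: "\<one>\<^bsub>R\<^esub> = \<zero>\<^bsub>R\<^esub>" and M: "right_module R M" and L: "right_module R L"
  shows "hull_of M L (\<lambda>_. \<zero>\<^bsub>L\<^esub>)"
proof -
  note triv = trivial_module[OF M one] trivial_module[OF L one]
  have tf: "torsion_free R E L"
    by (rule torsion_freeI[OF L]) (use triv hom_closed in fastforce)
  show ?thesis
    unfolding hull_of_def local_module_def
  proof (intro conjI ballI allI impI tf)
    show "\<exists>e\<in>rmod_hom R Q L. \<forall>p\<in>carrier P. e (f p) = c p" if "c \<in> rmod_hom R P L" for P Q :: "('r, 'r univ) rmod" and f c
      using hom_zero_map[OF L] hom_closed[OF that] triv by fastforce
    show "(\<lambda>_. \<zero>\<^bsub>L\<^esub>) \<in> rmod_hom R M L" by (rule hom_zero_map[OF L])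
    show "inj_on (\<lambda>_. \<zero>\<^bsub>L\<^esub>) (carrier M)" using triv by simp
    fix n :: nat and P c H
    assume *: "quot_in R E (free_rmod R {..<n}) P \<and> c \<in> rmod_hom R (sub (free_rmod R {..<n}) P) M \<and>
      H \<in> rmod_hom R (free_rmod R {..<n}) L \<and> (\<forall>y\<in>P. H y = \<zero>\<^bsub>L\<^esub>)"
    then have "H y = \<zero>\<^bsub>L\<^esub>" if "y \<in> carrier (free_rmod R {..<n})" for y
      using hom_closed[of H R "free_rmod R {..<n}" L y] that triv by simp
    then have "{y \<in> carrier (free_rmod R {..<n}). H y \<in> (\<lambda>_. \<zero>\<^bsub>L\<^esub>) ` carrier M} = carrier (free_rmod R {..<n})"
      using triv by auto
    then show "quot_in R E (sub (free_rmod R {..<n}) {y \<in> carrier (free_rmod R {..<n}). H y \<in> (\<lambda>_. \<zero>\<^bsub>L\<^esub>) ` carrier M}) P"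
      using * by simp
  qed
qed

text \<open>Maps in \<open>rmod_hom\<close> are arbitrary outside their domain, so using them as
  indices would give too many symbols. A symbol (n, k, g, v) records only generators g 0, ..., g (k
  - 1) of P in R^n and their images v 0, ..., v (k - 1). Then \<open>T\<close>, the free module over
  its pairs and finally \<open>L\<close> inject into the type of sequences over R.\<close>

lemma hull_exists:
  fixes M :: "('r, 'm, 'z) rmod_scheme"
  assumes M: "torsion_free R E M" and small: "carrier M \<lesssim> (UNIV :: (nat \<Rightarrow> 'r) set)"
  shows "\<exists>(L :: ('r, nat \<Rightarrow> 'r) rmod) \<kappa>. hull_of M L \<kappa>"
proof (cases "\<one>\<^bsub>R\<^esub> = \<zero>\<^bsub>R\<^esub>")
  case True
  show ?thesis
    using hull_of_trivial[OF True torsion_free_module[OF M] free_rmod_module[OF base_ring, of "{..<0 :: nat}"]] by blast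
next
  case False
  let ?C = "UNIV :: (nat \<Rightarrow> 'r) set"
  have C: "infinite ?C" by (rule infinite_sequences[OF False])
  define span where "span n k g = rspan R (free_rmod R {..<n :: nat}) (g ` {..<k :: nat})" for n k g
  define ok where "ok n k g v c \<longleftrightarrow> c \<in> rmod_hom R (sub (free_rmod R {..<n}) (span n k g)) M \<and> (\<forall>i<k. c (g i) = v i)"
    for n k g and v :: "nat \<Rightarrow> 'm" and c
  define T where "T = {(n, k, g, v). g ` {..<k} \<subseteq> carrier (free_rmod R {..<n}) \<and> range v \<subseteq> carrier M \<and>
    quot_in R E (free_rmod R {..<n}) (span n k g) \<and> (\<exists>c. ok n k g v c)}"
  define rk :: "nat \<times> nat \<times> (nat \<Rightarrow> nat \<Rightarrow> 'r) \<times> (nat \<Rightarrow> 'm) \<Rightarrow> nat" where "rk = fst"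
  define P where "P = (\<lambda>(n, k, g, v :: nat \<Rightarrow> 'm). span n k g)"
  \<comment> \<open>The map is recovered by choice from its values on the generators;
    \<open>hom_eq_on_rspan\<close> shows that the choice does not matter on P.\<close>
  define att where "att = (\<lambda>(n, k, g, v). SOME c. ok n k g v c)"
  have att_ok: "ok n k g v (att (n, k, g, v))" if "(n, k, g, v) \<in> T" for n k g v
  proof -
    have "\<exists>c. ok n k g v c" using that by (simp add: T_def)
    from someI_ex[OF this] show ?thesis by (simp add: att_def)
  qed
  interpret symbol_family R E M T rk P att
  proof (intro symbol_family.intro symbol_family_axioms.intro hereditary_placed_axioms M)
    fix t assume t: "t \<in> T"
    obtain n k g v where tt: "t = (n, k, g, v)" by (cases t)
    show "quot_in R E (free_rmod R {..<rk t}) (P t)" using t unfolding tt by (simp add: T_def rk_def P_def)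
    show "att t \<in> rmod_hom R (sub (free_rmod R {..<rk t}) (P t)) M"
      using att_ok t unfolding tt by (simp add: ok_def rk_def P_def)
  next
    fix n :: nat and N c
    assume N: "quot_in R E (free_rmod R {..<n}) N" "fin_gen R (free_rmod R {..<n}) N"
      "c \<in> rmod_hom R (sub (free_rmod R {..<n}) N) M"
    let ?G = "free_rmod R {..<n}"
    have G: "right_module R ?G" by (rule free_rmod_module[OF base_ring])
    interpret M: right_module R M by (rule torsion_free_module[OF M])
    obtain X where X: "finite X" "X \<subseteq> carrier ?G" "N = rspan R ?G X" using N(2) by (auto simp: fin_gen_def)
    obtain k :: nat and g where g: "X = g ` {..<k}"
      using finite_imp_nat_seg_image_inj_on[OF X(1)] by (metis lessThan_def)
    have XN: "X \<subseteq> N" unfolding X(3) by (rule right_module.rspan_superset[OF G])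
    \<comment> \<open>Only the first k values count. The default zero keeps the range of
      \<open>v\<close> inside \<open>M\<close>, as membership in \<open>T\<close> demands.\<close>
    define v where "v i = (if i < k then c (g i) else \<zero>\<^bsub>M\<^esub>)" for i
    have sp: "span n k g = N" by (simp add: span_def X(3) g)
    have "range v \<subseteq> carrier M"
      using hom_closed[OF N(3)] XN g by (auto simp: v_def)
    moreover have okc: "ok n k g v c" using N(3) by (simp add: ok_def sp v_def)
    ultimately have t: "(n, k, g, v) \<in> T" using N(1) X(2) g sp by (auto simp: T_def)
    have "att (n, k, g, v) p = c p" if "p \<in> N" for p
    proof (rule hom_eq_on_rspan[OF G M.right_module_axioms _ _ X(2)])
      show "att (n, k, g, v) \<in> rmod_hom R (sub ?G (rspan R ?G X)) M" "c \<in> rmod_hom R (sub ?G (rspan R ?G X)) M"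
        using att_ok[OF t] N(3) by (simp_all add: ok_def sp X(3)[symmetric])
      show "att (n, k, g, v) x = c x" if "x \<in> X" for x
        using att_ok[OF t] that okc g by (auto simp: ok_def)
      show "p \<in> rspan R ?G X" using that X(3) by simp
    qed
    then show "\<exists>t\<in>T. rk t = n \<and> P t = N \<and> (\<forall>p\<in>N. att t p = c p)"
      using t sp by (intro bexI[of _ "(n, k, g, v)"]) (auto simp: rk_def P_def)
  qed
  have "hull_of M L \<kappa>"
    unfolding hull_of_def
  proof (intro conjI local_L \<kappa> allI impI)
    show "inj_on \<kappa> (carrier M)"
      unfolding hom_inj_iff[OF torsion_free_module[OF tf] L \<kappa>] using \<kappa>_inj by blast
  qed (elim conjE, rule quot_in_preimage_base, auto)
  moreover have "carrier L \<lesssim> ?C"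
  proof -
    have nat: "(UNIV :: nat set) \<lesssim> ?C" using C infinite_le_lepoll by blast
    obtain e where e: "inj_on e (carrier M)" "e ` carrier M \<subseteq> ?C" using small unfolding lepoll_def by blast
    have "inj_on (\<lambda>v i. e (v i)) {v :: nat \<Rightarrow> 'm. range v \<subseteq> carrier M}"
    proof (rule inj_onI)
      fix v w :: "nat \<Rightarrow> 'm"
      assume v: "v \<in> {v. range v \<subseteq> carrier M}" "w \<in> {v. range v \<subseteq> carrier M}"
        and eq: "(\<lambda>i. e (v i)) = (\<lambda>i. e (w i))"
      have "v i = w i" for i
        using fun_cong[OF eq, of i] v by (intro inj_onD[OF e(1)]) auto
      then show "v = w" by auto
    qed
    then have "{v :: nat \<Rightarrow> 'm. range v \<subseteq> carrier M} \<lesssim> (UNIV :: (nat \<Rightarrow> nat \<Rightarrow> 'r) set)"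
      unfolding lepoll_def by blast
    then have v: "{v :: nat \<Rightarrow> 'm. range v \<subseteq> carrier M} \<lesssim> ?C" using sequences_lepoll by (rule lepoll_trans)
    have "T \<subseteq> UNIV \<times> UNIV \<times> UNIV \<times> {v :: nat \<Rightarrow> 'm. range v \<subseteq> carrier M}" by (auto simp: T_def)
    then have "T \<lesssim> (UNIV :: nat set) \<times> (UNIV :: nat set) \<times> (UNIV :: (nat \<Rightarrow> nat \<Rightarrow> 'r) set) \<times> {v :: nat \<Rightarrow> 'm. range v \<subseteq> carrier M}"
      by (rule subset_imp_lepoll)
    also have "\<dots> \<lesssim> ?C"
      by (intro times_lepoll_infinite C nat v sequences_lepoll)
    finally have T: "T \<lesssim> ?C" .
    let ?J = "{(t, i). t \<in> T \<and> i < rk t}"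
    have "?J \<lesssim> T \<times> (UNIV :: nat set)" by (rule subset_imp_lepoll) auto
    also have "\<dots> \<lesssim> ?C" by (intro times_lepoll_infinite C nat T)
    finally have J: "?J \<lesssim> ?C" .
    have "(UNIV :: 'r set) \<lesssim> ?C" unfolding lepoll_def by (rule exI[of _ "\<lambda>r _. r"]) (auto simp: inj_on_def fun_eq_iff)
    then have JC: "?J \<times> (UNIV :: 'r set) \<lesssim> ?C" by (intro times_lepoll_infinite C J)
    \<comment> \<open>A finitely supported function is determined by the finite set of pairs formed
      by the points of its support and its values there.\<close>
    have "carrier Q \<lesssim> Fpow (?J \<times> (UNIV :: 'r set))"
      unfolding Q_def
      by (rule lepoll_trans[OF subset_imp_lepoll[OF free_rmod_subset] lepoll_restricted_funspace[where k = "\<lambda>_. \<zero>\<^bsub>R\<^esub>" and A = ?J and B = UNIV]])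
    also have "\<dots> \<lesssim> ?C" by (rule Fpow_lepoll_infinite[OF C JC])
    finally have "carrier M \<times> carrier Q \<lesssim> ?C" by (intro times_lepoll_infinite C small)
    then show ?thesis
      unfolding \<pi>_surj[symmetric] carrier_F by (rule lepoll_trans[OF image_lepoll])
  qed
  then obtain f where "inj_on f (carrier L)" "f ` carrier L \<subseteq> ?C" unfolding lepoll_def by blast
  ultimately show ?thesis using hull_of_copy by blast
qed

text \<open>Carries the finiteness clause of \<open>hull_of\<close> from free modules to arbitrary
  pairs: \<open>H\<close> is pulled back along a presentation of Y / Y0, the clause is applied, and
  image and cokernel are taken in \<open>Y\<close>.\<close>

lemma hull_preimage:
  assumes h: "hull_of M L \<kappa>" and M: "right_module R M" and Y: "quot_in R E Y Y0" and c: "c \<in> rmod_hom R (sub Y Y0) M"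
    and H: "H \<in> rmod_hom R Y L" "\<And>y. y \<in> Y0 \<Longrightarrow> H y = \<kappa> (c y)"
  shows "quot_in R E (sub Y {y \<in> carrier Y. H y \<in> \<kappa> ` carrier M}) Y0" (is ?thesis1)
    and "quot_in R E Y {y \<in> carrier Y. H y \<in> \<kappa> ` carrier M}" (is ?thesis2)
proof -
  note Ym = quot_in_module[OF Y] and Y0 = quot_in_rsubmodule[OF Y]
  interpret Y: right_module R Y by (rule Ym)
  have \<kappa>: "\<kappa> \<in> rmod_hom R M L" and Lm: "right_module R L"
    using h torsion_free_module[OF local_module_torsion_free] by (auto simp: hull_of_def)
  interpret L: right_module R L by (rule Lm)
  obtain n :: nat and l where l: "l \<in> rmod_hom R (free_rmod R {..<n}) Y"
    "quot_in R E (free_rmod R {..<n}) {x \<in> carrier (free_rmod R {..<n}). l x \<in> Y0}"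
    "fin_gen R (free_rmod R {..<n}) {x \<in> carrier (free_rmod R {..<n}). l x \<in> Y0}"
    "\<forall>y\<in>carrier Y. \<exists>x\<in>carrier (free_rmod R {..<n}). \<exists>y0\<in>Y0. y = y0 \<oplus>\<^bsub>Y\<^esub> l x"
    using quot_in_presentation[OF Y] by (elim exE conjE) (rule that)
  let ?G = "free_rmod R {..<n}" and ?P = "{x \<in> carrier (free_rmod R {..<n}). l x \<in> Y0}"
  let ?D = "{y \<in> carrier Y. H y \<in> \<kappa> ` carrier M}" and ?D1 = "{x \<in> carrier ?G. H (l x) \<in> \<kappa> ` carrier M}"
  have \<kappa>M: "rsubmodule R L (\<kappa> ` carrier M)" by (rule rsubmodule_image_carrier[OF M Lm \<kappa>])
  have lP: "l \<in> rmod_hom R (sub ?G ?P) (sub Y Y0)" by (rule hom_sub_cod[OF hom_sub_dom[OF l(1)]]) auto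
  have D1: "quot_in R E (sub ?G ?D1) ?P"
    by (rule hull_ofD[OF h l(2) hom_comp[OF lP c] hom_comp[OF l(1) H(1)]]) (use H(2) in simp)
  have l1: "l \<in> rmod_hom R (sub ?G ?D1) Y" by (rule hom_sub_dom[OF l(1)]) auto
  have l0: "l x \<in> Y0" if "x \<in> ?P" for x using that by simp
  note im = quot_in_image[OF D1 Y l1 l0] and coker = quot_in_cokernel[OF D1 Y l1 l0]
  have HY0: "H y \<in> \<kappa> ` carrier M" if "y \<in> Y0" for y using H(2)[OF that] hom_closed[OF c] that by simp
  have "{l x \<oplus>\<^bsub>Y\<^esub> z | x z. x \<in> carrier (sub ?G ?D1) \<and> z \<in> Y0} = ?D"
  proof (intro equalityI subsetI)
    fix y assume "y \<in> {l x \<oplus>\<^bsub>Y\<^esub> z | x z. x \<in> carrier (sub ?G ?D1) \<and> z \<in> Y0}"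
    then obtain x z where x: "y = l x \<oplus>\<^bsub>Y\<^esub> z" "x \<in> carrier ?G" "H (l x) \<in> \<kappa> ` carrier M" "z \<in> Y0"
      unfolding sub_simps by blast
    have cl: "l x \<in> carrier Y" "z \<in> carrier Y" using hom_closed[OF l(1) x(2)] rsubmoduleD(5)[OF Y0 x(4)] by auto
    show "y \<in> ?D"
      using hom_add[OF H(1) cl] rsubmoduleD(3)[OF \<kappa>M x(3) HY0[OF x(4)]] cl x(1) by simp
  next
    fix y assume "y \<in> ?D"
    then have y: "y \<in> carrier Y" "H y \<in> \<kappa> ` carrier M" by auto
    obtain x y0 where x: "x \<in> carrier ?G" "y0 \<in> Y0" "y = y0 \<oplus>\<^bsub>Y\<^esub> l x" using l(4) y(1) by blast
    have cl: "l x \<in> carrier Y" "y0 \<in> carrier Y" using hom_closed[OF l(1) x(1)] rsubmoduleD(5)[OF Y0 x(2)] by auto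
    have Hc: "H (l x) \<in> carrier L" "H y0 \<in> carrier L" using hom_closed[OF H(1)] cl by auto
    have "H (l x) = H y \<ominus>\<^bsub>L\<^esub> H y0"
      unfolding x(3) hom_add[OF H(1) cl(2,1)]
      using Hc by (simp add: a_minus_def L.M.a_comm[of "H y0"] L.M.a_assoc L.M.r_neg)
    then have "H (l x) \<in> \<kappa> ` carrier M" using L.rsubmodule_diff[OF \<kappa>M y(2) HY0[OF x(2)]] by simp
    moreover have "y = l x \<oplus>\<^bsub>Y\<^esub> y0" using x(3) cl by (simp add: Y.M.a_comm)
    ultimately show "y \<in> {l x \<oplus>\<^bsub>Y\<^esub> z | x z. x \<in> carrier (sub ?G ?D1) \<and> z \<in> Y0}"
      unfolding sub_simps using x(1,2) by blast
  qed
  then show ?thesis1 ?thesis2 using im coker by simp_all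
qed

end

section \<open>Extension of scalars\<close>

text \<open>Additivity is isolated from \<open>rmod_hom\<close> for two uses: maps out of a tensor
  product that are not yet known to be linear, and the endomorphisms of a local module on which S is
  made to act.\<close>

definition additive_map :: "('a, 'x) ring_scheme \<Rightarrow> ('b, 'y) ring_scheme \<Rightarrow> ('a \<Rightarrow> 'b) \<Rightarrow> bool"
  where "additive_map G H f \<longleftrightarrow> (\<forall>x\<in>carrier G. f x \<in> carrier H) \<and>
    (\<forall>x\<in>carrier G. \<forall>y\<in>carrier G. f (x \<oplus>\<^bsub>G\<^esub> y) = f x \<oplus>\<^bsub>H\<^esub> f y)"

lemma additive_mapI:
  "(\<And>x. x \<in> carrier G \<Longrightarrow> f x \<in> carrier H) \<Longrightarrow>
    (\<And>x y. x \<in> carrier G \<Longrightarrow> y \<in> carrier G \<Longrightarrow> f (x \<oplus>\<^bsub>G\<^esub> y) = f x \<oplus>\<^bsub>H\<^esub> f y) \<Longrightarrow> additive_map G H f"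
  by (simp add: additive_map_def)

lemma additive_closed: "additive_map G H f \<Longrightarrow> x \<in> carrier G \<Longrightarrow> f x \<in> carrier H"
  by (simp add: additive_map_def)

lemma additive_add: "additive_map G H f \<Longrightarrow> x \<in> carrier G \<Longrightarrow> y \<in> carrier G
    \<Longrightarrow> f (x \<oplus>\<^bsub>G\<^esub> y) = f x \<oplus>\<^bsub>H\<^esub> f y"
  by (simp add: additive_map_def)

lemma additive_comp: "additive_map G H f \<Longrightarrow> additive_map H K g \<Longrightarrow> additive_map G K (\<lambda>x. g (f x))"
  by (simp add: additive_map_def)

lemma additive_zero:
  assumes "abelian_group G" "abelian_group H" "additive_map G H f"
  shows "f \<zero>\<^bsub>G\<^esub> = \<zero>\<^bsub>H\<^esub>"
proof -
  interpret G: abelian_group G by fact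
  interpret H: abelian_group H by fact
  have "f \<zero>\<^bsub>G\<^esub> \<oplus>\<^bsub>H\<^esub> f \<zero>\<^bsub>G\<^esub> = f \<zero>\<^bsub>G\<^esub>"
    using additive_add[OF assms(3), of "\<zero>\<^bsub>G\<^esub>" "\<zero>\<^bsub>G\<^esub>"] by simp
  then show ?thesis
    using additive_closed[OF assms(3), of "\<zero>\<^bsub>G\<^esub>"] H.add.l_cancel_one by simp
qed

lemma additive_finsum:
  assumes G: "abelian_group G" and H: "abelian_group H" and f: "additive_map G H f"
    and g: "\<And>x. x \<in> A \<Longrightarrow> g x \<in> carrier G"
  shows "f (finsum G g A) = (\<Oplus>\<^bsub>H\<^esub>x\<in>A. f (g x))"
proof (cases "finite A")
  case True
  interpret G: abelian_group G by fact
  interpret H: abelian_group H by fact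
  show ?thesis
    using True g
  proof (induction A rule: finite_induct)
    case empty
    show ?case using additive_zero[OF G H f] by simp
  next
    case (insert x A)
    have "finsum G g (insert x A) = g x \<oplus>\<^bsub>G\<^esub> finsum G g A"
      using insert by (intro G.finsum_insert) auto
    then have "f (finsum G g (insert x A)) = f (g x) \<oplus>\<^bsub>H\<^esub> f (finsum G g A)"
      using insert.prems by (auto intro!: additive_add[OF f] G.finsum_closed)
    also have "\<dots> = f (g x) \<oplus>\<^bsub>H\<^esub> (\<Oplus>\<^bsub>H\<^esub>x\<in>A. f (g x))" using insert by simp
    also have "\<dots> = (\<Oplus>\<^bsub>H\<^esub>x\<in>insert x A. f (g x))"
      using insert additive_closed[OF f] by (intro H.finsum_insert[symmetric]) auto
    finally show ?case .
  qed
next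
  case False
  interpret G: abelian_group G by fact
  interpret H: abelian_group H by fact
  show ?thesis using False additive_zero[OF G H f] by simp
qed

lemma additive_map_finsum:
  assumes H: "abelian_group H" and f: "\<And>i. i \<in> A \<Longrightarrow> additive_map G H (f i)"
    and "\<And>x y. x \<in> carrier G \<Longrightarrow> y \<in> carrier G \<Longrightarrow> x \<oplus>\<^bsub>G\<^esub> y \<in> carrier G"
  shows "additive_map G H (\<lambda>x. \<Oplus>\<^bsub>H\<^esub>i\<in>A. f i x)"
proof -
  interpret H: abelian_group H by fact
  show ?thesis
  proof (rule additive_mapI)
    fix x y assume xy: "x \<in> carrier G" "y \<in> carrier G"
    have "(\<Oplus>\<^bsub>H\<^esub>i\<in>A. f i (x \<oplus>\<^bsub>G\<^esub> y)) = (\<Oplus>\<^bsub>H\<^esub>i\<in>A. f i x \<oplus>\<^bsub>H\<^esub> f i y)"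
      using additive_add[OF f xy] additive_closed[OF f xy(1)] additive_closed[OF f xy(2)] by (intro H.finsum_cong') auto
    also have "\<dots> = (\<Oplus>\<^bsub>H\<^esub>i\<in>A. f i x) \<oplus>\<^bsub>H\<^esub> (\<Oplus>\<^bsub>H\<^esub>i\<in>A. f i y)"
      using additive_closed[OF f xy(1)] additive_closed[OF f xy(2)] by (intro H.finsum_addf) auto
    finally show "(\<Oplus>\<^bsub>H\<^esub>i\<in>A. f i (x \<oplus>\<^bsub>G\<^esub> y)) = (\<Oplus>\<^bsub>H\<^esub>i\<in>A. f i x) \<oplus>\<^bsub>H\<^esub> (\<Oplus>\<^bsub>H\<^esub>i\<in>A. f i y)" .
  qed (use additive_closed[OF f] in \<open>auto intro!: H.finsum_closed\<close>)
qed

lemma restrict_scalars_simps: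
  "carrier (restrict_scalars \<phi> M) = carrier M" "\<zero>\<^bsub>restrict_scalars \<phi> M\<^esub> = \<zero>\<^bsub>M\<^esub>"
  "x \<oplus>\<^bsub>restrict_scalars \<phi> M\<^esub> y = x \<oplus>\<^bsub>M\<^esub> y" "x \<star>\<^bsub>restrict_scalars \<phi> M\<^esub> a = x \<star>\<^bsub>M\<^esub> \<phi> a"
  by (auto simp: restrict_scalars_def)

section \<open>Tensor products and the adjunction with restriction of scalars\<close>

locale scalars =
  fixes R :: "('r, 'k) ring_scheme" and S :: "('s, 'l) ring_scheme" and \<phi> :: "'r \<Rightarrow> 's"
  assumes R: "ring R" and S: "ring S" and \<phi>: "\<phi> \<in> ring_hom R S"
begin

abbreviation ten :: "('r, 'm, 'z) rmod_scheme \<Rightarrow> ('s, ('m \<times> 's \<Rightarrow>\<^sub>0 int) set) rmod"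
  where "ten A \<equiv> tensor R A S \<phi>"

abbreviation frags :: "('r, 'm, 'z) rmod_scheme \<Rightarrow> ('m \<times> 's \<Rightarrow>\<^sub>0 int) monoid"
  where "frags A \<equiv> free_Abelian_group (carrier A \<times> carrier S)"

definition rels :: "('r, 'm, 'z) rmod_scheme \<Rightarrow> ('m \<times> 's \<Rightarrow>\<^sub>0 int) set"
  where "rels A = generate (frags A) (tensor_relators R A S \<phi>)"

definition coset :: "('r, 'm, 'z) rmod_scheme \<Rightarrow> ('m \<times> 's \<Rightarrow>\<^sub>0 int) \<Rightarrow> ('m \<times> 's \<Rightarrow>\<^sub>0 int) set"
  where "coset A c = tensor_coset R A S \<phi> c"

definition pure :: "('r, 'm, 'z) rmod_scheme \<Rightarrow> 'm \<Rightarrow> 's \<Rightarrow> ('m \<times> 's \<Rightarrow>\<^sub>0 int) set"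
  where "pure A x s = coset A (frag_of (x, s))"

lemma \<phi>_closed: "a \<in> carrier R \<Longrightarrow> \<phi> a \<in> carrier S"
  and \<phi>_mult: "a \<in> carrier R \<Longrightarrow> b \<in> carrier R \<Longrightarrow> \<phi> (a \<otimes>\<^bsub>R\<^esub> b) = \<phi> a \<otimes>\<^bsub>S\<^esub> \<phi> b"
  and \<phi>_add: "a \<in> carrier R \<Longrightarrow> b \<in> carrier R \<Longrightarrow> \<phi> (a \<oplus>\<^bsub>R\<^esub> b) = \<phi> a \<oplus>\<^bsub>S\<^esub> \<phi> b"
  and \<phi>_one: "\<phi> \<one>\<^bsub>R\<^esub> = \<one>\<^bsub>S\<^esub>"
  using \<phi> by (auto simp: ring_hom_def)

lemma restrict_module:
  assumes X: "right_module S X"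
  shows "right_module R (restrict_scalars \<phi> X)"
proof -
  interpret X: right_module S X by fact
  show ?thesis
  proof (rule right_moduleI)
    show "\<exists>y\<in>carrier (restrict_scalars \<phi> X). y \<oplus>\<^bsub>restrict_scalars \<phi> X\<^esub> x = \<zero>\<^bsub>restrict_scalars \<phi> X\<^esub>"
      if "x \<in> carrier (restrict_scalars \<phi> X)" for x
      using that by (intro bexI[of _ "\<ominus>\<^bsub>X\<^esub> x"]) (auto simp: restrict_scalars_simps X.M.l_neg)
  qed (auto simp: restrict_scalars_simps R \<phi>_closed \<phi>_mult \<phi>_add \<phi>_one X.M.a_ac
      X.ract_closed X.ract_add_left X.ract_add_right X.ract_assoc X.ract_one)
qed

lemma restrict_hom: "f \<in> rmod_hom S X Y \<Longrightarrow> f \<in> rmod_hom R (restrict_scalars \<phi> X) (restrict_scalars \<phi> Y)"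
  by (rule rmod_homI) (auto simp: restrict_scalars_simps hom_closed hom_add hom_act \<phi>_closed)

lemma relatorI:
  "\<lbrakk>x \<in> carrier A; y \<in> carrier A; s \<in> carrier S\<rbrakk>
    \<Longrightarrow> frag_of (x \<oplus>\<^bsub>A\<^esub> y, s) - frag_of (x, s) - frag_of (y, s) \<in> tensor_relators R A S \<phi>"
  "\<lbrakk>x \<in> carrier A; s \<in> carrier S; t \<in> carrier S\<rbrakk>
    \<Longrightarrow> frag_of (x, s \<oplus>\<^bsub>S\<^esub> t) - frag_of (x, s) - frag_of (x, t) \<in> tensor_relators R A S \<phi>"
  "\<lbrakk>x \<in> carrier A; a \<in> carrier R; s \<in> carrier S\<rbrakk>
    \<Longrightarrow> frag_of (x \<star>\<^bsub>A\<^esub> a, s) - frag_of (x, \<phi> a \<otimes>\<^bsub>S\<^esub> s) \<in> tensor_relators R A S \<phi>"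
  unfolding tensor_relators_def by blast+

lemma relatorE:
  assumes "r \<in> tensor_relators R A S \<phi>"
    and "\<And>x y s. \<lbrakk>r = frag_of (x \<oplus>\<^bsub>A\<^esub> y, s) - frag_of (x, s) - frag_of (y, s);
      x \<in> carrier A; y \<in> carrier A; s \<in> carrier S\<rbrakk> \<Longrightarrow> thesis"
    and "\<And>x s t. \<lbrakk>r = frag_of (x, s \<oplus>\<^bsub>S\<^esub> t) - frag_of (x, s) - frag_of (x, t);
      x \<in> carrier A; s \<in> carrier S; t \<in> carrier S\<rbrakk> \<Longrightarrow> thesis"
    and "\<And>x a s. \<lbrakk>r = frag_of (x \<star>\<^bsub>A\<^esub> a, s) - frag_of (x, \<phi> a \<otimes>\<^bsub>S\<^esub> s);
      x \<in> carrier A; a \<in> carrier R; s \<in> carrier S\<rbrakk> \<Longrightarrow> thesis"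
  shows thesis
  using assms unfolding tensor_relators_def by blast

lemma relators_subset:
  assumes A: "right_module R A"
  shows "tensor_relators R A S \<phi> \<subseteq> carrier (frags A)"
proof
  interpret A: right_module R A by fact
  interpret S: ring S by (rule S)
  have d: "x - y \<in> carrier (frags A)" if "x \<in> carrier (frags A)" "y \<in> carrier (frags A)" for x y
    using that keys_diff[of x y] by auto
  fix r assume "r \<in> tensor_relators R A S \<phi>"
  then show "r \<in> carrier (frags A)"
    by (rule relatorE)
      (simp_all only: d frag_of_in_free_Abelian_group mem_Sigma_iff A.M.a_closed S.a_closed S.m_closed
        A.ract_closed \<phi>_closed simp_thms)
qed

lemma rels_facts:
  assumes A: "right_module R A"
  shows "rels A \<subseteq> carrier (frags A)" "0 \<in> rels A"
    and "\<And>x y. x \<in> rels A \<Longrightarrow> y \<in> rels A \<Longrightarrow> x + y \<in> rels A"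
    and "\<And>x y. x \<in> rels A \<Longrightarrow> y \<in> rels A \<Longrightarrow> x - y \<in> rels A"
    and "tensor_relators R A S \<phi> \<subseteq> rels A"
proof -
  have s: "subgroup (rels A) (frags A)"
    unfolding rels_def using group.generate_is_subgroup[OF group_free_Abelian_group relators_subset[OF A]] .
  show c: "rels A \<subseteq> carrier (frags A)" using subgroup.subset[OF s] .
  show "0 \<in> rels A" using subgroup.one_closed[OF s] by simp
  show add: "x + y \<in> rels A" if "x \<in> rels A" "y \<in> rels A" for x y
    using subgroup.m_closed[OF s that] by simp
  show "x - y \<in> rels A" if "x \<in> rels A" "y \<in> rels A" for x y
  proof -
    have "Poly_Mapping.keys y \<subseteq> carrier A \<times> carrier S" using subsetD[OF c that(2)] by simp
    then have "- y \<in> rels A" using subgroup.m_inv_closed[OF s that(2)] by simp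
    then show ?thesis using add[OF that(1)] by (metis diff_conv_add_uminus)
  qed
  show "tensor_relators R A S \<phi> \<subseteq> rels A" by (auto simp: rels_def intro: generate.incl)
qed

lemma coset_eq: "coset A c = {n + c | n. n \<in> rels A}"
  by (auto simp: coset_def tensor_coset_def rels_def Let_def r_coset_def)

lemma coset_eq_iff:
  assumes A: "right_module R A"
  shows "coset A c = coset A d \<longleftrightarrow> c - d \<in> rels A"
proof
  note N = rels_facts[OF A]
  assume "coset A c = coset A d"
  moreover have "c \<in> coset A c" using N(2) by (force simp: coset_eq)
  ultimately show "c - d \<in> rels A" by (auto simp: coset_eq)
next
  note N = rels_facts[OF A]
  assume d: "c - d \<in> rels A"
  then have d': "d - c \<in> rels A" using N(4)[OF N(2) d] by simp
  have "coset A x \<subseteq> coset A y" if "x - y \<in> rels A" for x y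
  proof
    fix z assume "z \<in> coset A x"
    then obtain n where "z = n + x" "n \<in> rels A" by (auto simp: coset_eq)
    then have "z = (n + (x - y)) + y" "n + (x - y) \<in> rels A" using N(3) that by auto
    then show "z \<in> coset A y" unfolding coset_eq by blast
  qed
  then show "coset A c = coset A d" using d d' by blast
qed

lemma coset_mem: "right_module R A \<Longrightarrow> x \<in> coset A c \<Longrightarrow> x - c \<in> rels A"
  by (auto simp: coset_eq)

lemma ten_carrier: "carrier (ten A) = coset A ` carrier (frags A)"
  by (auto simp: tensor_def Let_def RCOSETS_def coset_def tensor_coset_def)

lemma ten_zero: "\<zero>\<^bsub>ten A\<^esub> = coset A 0"
  by (simp add: tensor_def Let_def coset_eq rels_def)

lemma ten_add:
  assumes A: "right_module R A"
  shows "coset A c \<oplus>\<^bsub>ten A\<^esub> coset A d = coset A (c + d)"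
proof -
  note N = rels_facts[OF A]
  have "coset A c \<oplus>\<^bsub>ten A\<^esub> coset A d = {x + y | x y. x \<in> coset A c \<and> y \<in> coset A d}"
    by (auto simp: tensor_def Let_def set_mult_def)
  also have "\<dots> = coset A (c + d)"
  proof (intro equalityI subsetI)
    fix z assume "z \<in> {x + y | x y. x \<in> coset A c \<and> y \<in> coset A d}"
    then obtain n m where "n \<in> rels A" "m \<in> rels A" "z = (n + c) + (m + d)" by (auto simp: coset_eq)
    then have "z = (n + m) + (c + d)" "n + m \<in> rels A" using N(3) by (auto simp: algebra_simps)
    then show "z \<in> coset A (c + d)" unfolding coset_eq by blast
  next
    fix z assume "z \<in> coset A (c + d)"
    then obtain n where "n \<in> rels A" "z = (n + c) + (0 + d)" by (auto simp: coset_eq algebra_simps)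
    then show "z \<in> {x + y | x y. x \<in> coset A c \<and> y \<in> coset A d}" using N(2) unfolding coset_eq by blast
  qed
  finally show ?thesis .
qed

lemma ten_abelian_group:
  assumes A: "right_module R A"
  shows "abelian_group (ten A)"
proof (rule abelian_groupI)
  note a = ten_add[OF A]
  have cl: "c + d \<in> carrier (frags A)" if "c \<in> carrier (frags A)" "d \<in> carrier (frags A)" for c d
    using that keys_add[of c d] by auto
  show "x \<oplus>\<^bsub>ten A\<^esub> y \<in> carrier (ten A)" if xy: "x \<in> carrier (ten A)" "y \<in> carrier (ten A)" for x y
  proof -
    obtain c d where cd: "c \<in> carrier (frags A)" "d \<in> carrier (frags A)" "x = coset A c" "y = coset A d"
      using xy unfolding ten_carrier by (elim imageE)
    show ?thesis unfolding cd(3,4) a ten_carrier by (rule imageI[OF cl[OF cd(1,2)]])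
  qed
  show "\<zero>\<^bsub>ten A\<^esub> \<in> carrier (ten A)" unfolding ten_zero ten_carrier by (rule imageI) simp
  show "\<exists>y\<in>carrier (ten A). y \<oplus>\<^bsub>ten A\<^esub> x = \<zero>\<^bsub>ten A\<^esub>" if x: "x \<in> carrier (ten A)" for x
  proof -
    obtain c where c: "c \<in> carrier (frags A)" "x = coset A c" using x by (auto simp: ten_carrier)
    have "- c \<in> carrier (frags A)" using c(1) by simp
    then show ?thesis using a[of "- c" c] c(2) by (intro bexI[of _ "coset A (- c)"]) (auto simp: ten_carrier ten_zero)
  qed
qed (auto simp: ten_carrier ten_zero ten_add[OF A] algebra_simps)

lemma frag_extend_rels:
  assumes A: "right_module R A" and B: "right_module R B"
    and g: "\<And>x s. x \<in> carrier A \<Longrightarrow> s \<in> carrier S \<Longrightarrow> g (x, s) \<in> carrier (frags B)"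
    and rel: "\<And>r. r \<in> tensor_relators R A S \<phi> \<Longrightarrow> frag_extend g r \<in> rels B"
    and n: "n \<in> rels A"
  shows "frag_extend g n \<in> rels B"
proof -
  note NB = rels_facts[OF B] and NA = rels_facts[OF A]
  have kc: "Poly_Mapping.keys c \<subseteq> carrier A \<times> carrier S" if "c \<in> carrier (frags A)" for c using that by simp
  let ?V = "{c \<in> carrier (frags A). frag_extend g c \<in> rels B}"
  have "subgroup ?V (frags A)"
  proof (rule group.subgroupI[OF group_free_Abelian_group])
    show "?V \<noteq> {}" using NB(2) by (auto intro!: exI[of _ 0])
    show "inv\<^bsub>frags A\<^esub> c \<in> ?V" if "c \<in> ?V" for c
      using that NB(4)[OF NB(2)] by (auto simp: frag_extend_minus)
    show "c \<otimes>\<^bsub>frags A\<^esub> d \<in> ?V" if "c \<in> ?V" "d \<in> ?V" for c d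
      using that NB(3) keys_add[of c d] by (auto simp: frag_extend_add)
  qed auto
  moreover have "tensor_relators R A S \<phi> \<subseteq> ?V"
    by (rule subsetI, intro CollectI conjI, erule subsetD[OF relators_subset[OF A]], erule rel)
  ultimately have "rels A \<subseteq> ?V"
    unfolding rels_def using group.generate_subgroup_incl[OF group_free_Abelian_group] by blast
  then show ?thesis using n by auto
qed

text \<open>The action on a tensor product and \<open>tensor_map\<close> are defined as unions over
  representatives. The union is the coset of any single representative as soon as relators are sent
  to relations.\<close>

lemma coset_extend:
  assumes A: "right_module R A" and B: "right_module R B"
    and g: "\<And>x s. x \<in> carrier A \<Longrightarrow> s \<in> carrier S \<Longrightarrow> g (x, s) \<in> carrier (frags B)"
    and rel: "\<And>r. r \<in> tensor_relators R A S \<phi> \<Longrightarrow> frag_extend g r \<in> rels B"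
  shows "(\<Union>c\<in>coset A c0. coset B (frag_extend g c)) = coset B (frag_extend g c0)"
proof -
  have "coset B (frag_extend g c) = coset B (frag_extend g c0)" if "c \<in> coset A c0" for c
    unfolding coset_eq_iff[OF B] frag_extend_diff[symmetric]
    by (rule frag_extend_rels[OF A B g rel coset_mem[OF A that]])
  moreover have "c0 \<in> coset A c0" using rels_facts(2)[OF A] by (force simp: coset_eq)
  ultimately show ?thesis by blast
qed

lemma pure_closed: "x \<in> carrier A \<Longrightarrow> s \<in> carrier S \<Longrightarrow> pure A x s \<in> carrier (ten A)"
  by (simp add: pure_def ten_carrier)

lemma pure_relations:
  assumes A: "right_module R A"
  shows "\<And>x y s. x \<in> carrier A \<Longrightarrow> y \<in> carrier A \<Longrightarrow> s \<in> carrier S \<Longrightarrow>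
      pure A (x \<oplus>\<^bsub>A\<^esub> y) s = pure A x s \<oplus>\<^bsub>ten A\<^esub> pure A y s"
    and "\<And>x s t. x \<in> carrier A \<Longrightarrow> s \<in> carrier S \<Longrightarrow> t \<in> carrier S \<Longrightarrow>
      pure A x (s \<oplus>\<^bsub>S\<^esub> t) = pure A x s \<oplus>\<^bsub>ten A\<^esub> pure A x t"
    and "\<And>x a s. x \<in> carrier A \<Longrightarrow> a \<in> carrier R \<Longrightarrow> s \<in> carrier S \<Longrightarrow>
      pure A (x \<star>\<^bsub>A\<^esub> a) s = pure A x (\<phi> a \<otimes>\<^bsub>S\<^esub> s)"
proof -
  note N = rels_facts(5)[OF A]
  have *: "c = d - e - f \<Longrightarrow> d - (e + f) = c" for c d e f :: "'c \<Rightarrow>\<^sub>0 int" by simp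
  show "pure A (x \<oplus>\<^bsub>A\<^esub> y) s = pure A x s \<oplus>\<^bsub>ten A\<^esub> pure A y s"
    if "x \<in> carrier A" "y \<in> carrier A" "s \<in> carrier S" for x y s
    unfolding pure_def ten_add[OF A] coset_eq_iff[OF A] diff_diff_eq[symmetric]
    by (rule subsetD[OF N], rule relatorI) (rule that)+
  show "pure A x (s \<oplus>\<^bsub>S\<^esub> t) = pure A x s \<oplus>\<^bsub>ten A\<^esub> pure A x t"
    if "x \<in> carrier A" "s \<in> carrier S" "t \<in> carrier S" for x s t
    unfolding pure_def ten_add[OF A] coset_eq_iff[OF A] diff_diff_eq[symmetric]
    by (rule subsetD[OF N], rule relatorI) (rule that)+
  show "pure A (x \<star>\<^bsub>A\<^esub> a) s = pure A x (\<phi> a \<otimes>\<^bsub>S\<^esub> s)"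
    if "x \<in> carrier A" "a \<in> carrier R" "s \<in> carrier S" for x a s
    unfolding pure_def coset_eq_iff[OF A]
    by (rule subsetD[OF N], rule relatorI) (rule that)+
qed

text \<open>Pure tensors generate the tensor product. The induction on the free abelian group
  proceeds by differences, so equality at x - y is obtained from that at x and y by
  cancellation.\<close>

lemma additive_eq_on_pure:
  assumes A: "right_module R A" and G: "abelian_group G"
    and f: "additive_map (ten A) G f" and g: "additive_map (ten A) G g"
    and eq: "\<And>x s. x \<in> carrier A \<Longrightarrow> s \<in> carrier S \<Longrightarrow> f (pure A x s) = g (pure A x s)"
    and X: "X \<in> carrier (ten A)"
  shows "f X = g X"
proof -
  interpret G: abelian_group G by fact
  interpret T: abelian_group "ten A" by (rule ten_abelian_group[OF A])
  have cc: "coset A c \<in> carrier (ten A)" if "Poly_Mapping.keys c \<subseteq> carrier A \<times> carrier S" for c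
    unfolding ten_carrier by (rule imageI) (simp add: that)
  obtain c where c: "c \<in> carrier (frags A)" "X = coset A c" using X by (auto simp: ten_carrier)
  have k: "Poly_Mapping.keys c \<subseteq> carrier A \<times> carrier S" using c(1) by simp
  have "f (coset A c) = g (coset A c)"
    using k
  proof (rule free_Abelian_group_induct)
    show "f (coset A 0) = g (coset A 0)"
      using additive_zero[OF T.abelian_group_axioms G f] additive_zero[OF T.abelian_group_axioms G g]
      by (simp add: ten_zero)
    show "f (coset A (frag_of p)) = g (coset A (frag_of p))" if "p \<in> carrier A \<times> carrier S" for p
      using that eq by (cases p) (auto simp: pure_def)
  next
    fix x y :: "'a \<times> 's \<Rightarrow>\<^sub>0 int"
    assume xy: "Poly_Mapping.keys x \<subseteq> carrier A \<times> carrier S" "Poly_Mapping.keys y \<subseteq> carrier A \<times> carrier S"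
      and e: "f (coset A x) = g (coset A x)" "f (coset A y) = g (coset A y)"
    have xy': "Poly_Mapping.keys (x - y) \<subseteq> carrier A \<times> carrier S" using xy keys_diff[of x y] by blast
    have s: "coset A (x - y) \<oplus>\<^bsub>ten A\<^esub> coset A y = coset A x" by (simp add: ten_add[OF A])
    have "f (coset A (x - y)) \<oplus>\<^bsub>G\<^esub> f (coset A y) = g (coset A (x - y)) \<oplus>\<^bsub>G\<^esub> f (coset A y)"
      using additive_add[OF f cc[OF xy'] cc[OF xy(2)]] additive_add[OF g cc[OF xy'] cc[OF xy(2)]] e s by simp
    then show "f (coset A (x - y)) = g (coset A (x - y))"
      using additive_closed[OF f] additive_closed[OF g] cc[OF xy'] cc[OF xy(2)] by simp
  qed
  then show ?thesis using c(2) by simp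
qed

text \<open>Stated for abelian groups as targets; S-linearity is added separately by
  \<open>additive_hom\<close>, where only pure tensors have to be inspected.\<close>

lemma ten_universal:
  assumes A: "right_module R A" and G: "abelian_group G"
    and b: "\<And>x s. x \<in> carrier A \<Longrightarrow> s \<in> carrier S \<Longrightarrow> b x s \<in> carrier G"
    and b1: "\<And>x y s. x \<in> carrier A \<Longrightarrow> y \<in> carrier A \<Longrightarrow> s \<in> carrier S \<Longrightarrow>
      b (x \<oplus>\<^bsub>A\<^esub> y) s = b x s \<oplus>\<^bsub>G\<^esub> b y s"
    and b2: "\<And>x s t. x \<in> carrier A \<Longrightarrow> s \<in> carrier S \<Longrightarrow> t \<in> carrier S \<Longrightarrow>
      b x (s \<oplus>\<^bsub>S\<^esub> t) = b x s \<oplus>\<^bsub>G\<^esub> b x t"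
    and b3: "\<And>x a s. x \<in> carrier A \<Longrightarrow> a \<in> carrier R \<Longrightarrow> s \<in> carrier S \<Longrightarrow>
      b (x \<star>\<^bsub>A\<^esub> a) s = b x (\<phi> a \<otimes>\<^bsub>S\<^esub> s)"
  shows "\<exists>\<Theta>. additive_map (ten A) G \<Theta> \<and>
    (\<forall>x\<in>carrier A. \<forall>s\<in>carrier S. \<Theta> (pure A x s) = b x s)"
proof -
  interpret A: right_module R A by fact
  interpret S: ring S by (rule S)
  interpret G: abelian_group G by fact
  have "(\<lambda>(x, s). b x s) ` (carrier A \<times> carrier S) \<subseteq> carrier (add_monoid G)" using b by auto
  then obtain h where h: "h \<in> hom (frags A) (add_monoid G)"
    "\<And>p. p \<in> carrier A \<times> carrier S \<Longrightarrow> h (frag_of p) = (\<lambda>(x, s). b x s) p"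
    using comm_group.free_Abelian_group_universal[OF G.a_comm_group] by metis
  have hcl: "h c \<in> carrier G" if "c \<in> carrier (frags A)" for c using hom_in_carrier[OF h(1) that] by simp
  have hadd: "h (c + d) = h c \<oplus>\<^bsub>G\<^esub> h d" if "c \<in> carrier (frags A)" "d \<in> carrier (frags A)" for c d
    using hom_mult[OF h(1) that] by simp
  have dcl: "c - d \<in> carrier (frags A)" if "c \<in> carrier (frags A)" "d \<in> carrier (frags A)" for c d
    using that keys_diff[of c d] by auto
  have hdiff: "h (c - d) = h c \<ominus>\<^bsub>G\<^esub> h d" if c: "c \<in> carrier (frags A)" "d \<in> carrier (frags A)" for c d
  proof -
    have "h c = h (c - d) \<oplus>\<^bsub>G\<^esub> h d" using hadd[OF dcl[OF c] c(2)] by simp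
    then show ?thesis using hcl[OF dcl[OF c]] hcl[OF c(2)]
      by (simp add: a_minus_def G.a_assoc G.r_neg)
  qed
  have hf: "h (frag_of (x, s)) = b x s" "frag_of (x, s) \<in> carrier (frags A)" if "x \<in> carrier A" "s \<in> carrier S" for x s
    using h(2)[of "(x, s)"] that by auto
  have "rels A \<subseteq> {c \<in> carrier (frags A). h c = \<zero>\<^bsub>G\<^esub>}" (is "_ \<subseteq> ?V")
    unfolding rels_def
  proof (rule group.generate_subgroup_incl[OF group_free_Abelian_group])
    have sub: "b x s \<ominus>\<^bsub>G\<^esub> b x s = \<zero>\<^bsub>G\<^esub>" if "x \<in> carrier A" "s \<in> carrier S" for x s
      using b[OF that] by (simp add: a_minus_def G.r_neg)
    have sub3: "(u \<oplus>\<^bsub>G\<^esub> v) \<ominus>\<^bsub>G\<^esub> u \<ominus>\<^bsub>G\<^esub> v = \<zero>\<^bsub>G\<^esub>" if "u \<in> carrier G" "v \<in> carrier G" for u v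
    proof -
      have "(u \<oplus>\<^bsub>G\<^esub> v) \<ominus>\<^bsub>G\<^esub> u = v" using that by (simp add: a_minus_def G.a_comm[of u v] G.a_assoc G.r_neg)
      then show ?thesis using that by (simp add: a_minus_def G.r_neg)
    qed
    show "tensor_relators R A S \<phi> \<subseteq> ?V"
    proof
      fix r assume r: "r \<in> tensor_relators R A S \<phi>"
      then have "r \<in> carrier (frags A)" using relators_subset[OF A] by blast
      moreover have "h r = \<zero>\<^bsub>G\<^esub>"
        using r
      proof (rule relatorE)
        fix x y s assume "r = frag_of (x \<oplus>\<^bsub>A\<^esub> y, s) - frag_of (x, s) - frag_of (y, s)"
          "x \<in> carrier A" "y \<in> carrier A" "s \<in> carrier S"
        then show ?thesis by (simp only: hdiff dcl hf A.M.a_closed b1 sub3 b)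
      next
        fix x s t assume "r = frag_of (x, s \<oplus>\<^bsub>S\<^esub> t) - frag_of (x, s) - frag_of (x, t)"
          "x \<in> carrier A" "s \<in> carrier S" "t \<in> carrier S"
        then show ?thesis by (simp only: hdiff dcl hf S.a_closed b2 sub3 b)
      next
        fix x a s assume "r = frag_of (x \<star>\<^bsub>A\<^esub> a, s) - frag_of (x, \<phi> a \<otimes>\<^bsub>S\<^esub> s)"
          "x \<in> carrier A" "a \<in> carrier R" "s \<in> carrier S"
        then show ?thesis by (simp only: hdiff dcl hf A.ract_closed S.m_closed \<phi>_closed b3 sub)
      qed
      ultimately show "r \<in> ?V" by simp
    qed
    show "subgroup ?V (frags A)"
    proof (rule group.subgroupI[OF group_free_Abelian_group])
      have h0: "h 0 = \<zero>\<^bsub>G\<^esub>" using hdiff[of 0 0] hcl[of 0] by (simp add: a_minus_def G.r_neg)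
      then show "?V \<noteq> {}" by (auto intro!: exI[of _ 0])
      show "inv\<^bsub>frags A\<^esub> c \<in> ?V" if "c \<in> ?V" for c
        using that hdiff[of 0 c] h0 by (auto simp: a_minus_def G.r_neg)
      show "c \<otimes>\<^bsub>frags A\<^esub> d \<in> ?V" if "c \<in> ?V" "d \<in> ?V" for c d
        using that hadd[of c d] keys_add[of c d] by auto
    qed auto
  qed
  then have h0: "h n = \<zero>\<^bsub>G\<^esub>" if "n \<in> rels A" for n using that by blast
  define \<Theta> where "\<Theta> X = h (SOME c. c \<in> carrier (frags A) \<and> X = coset A c)" for X
  have \<Theta>: "\<Theta> (coset A c) = h c" if c: "c \<in> carrier (frags A)" for c
  proof -
    define d where "d = (SOME d. d \<in> carrier (frags A) \<and> coset A c = coset A d)"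
    have "\<exists>d. d \<in> carrier (frags A) \<and> coset A c = coset A d" using c by blast
    from someI_ex[OF this] have d: "d \<in> carrier (frags A)" "coset A c = coset A d"
      unfolding d_def[symmetric] by blast+
    have "h c \<ominus>\<^bsub>G\<^esub> h d = \<zero>\<^bsub>G\<^esub>"
      using h0[of "c - d"] d(2) coset_eq_iff[OF A] hdiff[OF c d(1)] by simp
    moreover have "h c = (h c \<ominus>\<^bsub>G\<^esub> h d) \<oplus>\<^bsub>G\<^esub> h d"
      using hcl[OF c] hcl[OF d(1)] by (simp add: a_minus_def G.a_assoc G.l_neg)
    ultimately have "h c = h d" using hcl[OF d(1)] by simp
    then show ?thesis by (simp add: \<Theta>_def d_def)
  qed
  have "additive_map (ten A) G \<Theta>"
  proof (rule additive_mapI)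
    fix X assume "X \<in> carrier (ten A)"
    then obtain c where "c \<in> carrier (frags A)" "X = coset A c" by (auto simp: ten_carrier)
    then show "\<Theta> X \<in> carrier G" using \<Theta> hcl by simp
  next
    fix X Y assume "X \<in> carrier (ten A)" "Y \<in> carrier (ten A)"
    then obtain c d where c: "c \<in> carrier (frags A)" "X = coset A c" and d: "d \<in> carrier (frags A)" "Y = coset A d"
      by (auto simp: ten_carrier)
    have "c + d \<in> carrier (frags A)" using c(1) d(1) keys_add[of c d] by auto
    then show "\<Theta> (X \<oplus>\<^bsub>ten A\<^esub> Y) = \<Theta> X \<oplus>\<^bsub>G\<^esub> \<Theta> Y"
      using c d by (simp only: ten_add[OF A] \<Theta> hadd)
  qed
  moreover have "\<Theta> (pure A x s) = b x s" if "x \<in> carrier A" "s \<in> carrier S" for x s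
    using hf[OF that] by (simp only: pure_def \<Theta>)
  ultimately show ?thesis by blast
qed

lemma ract_coset:
  assumes A: "right_module R A" and b: "b \<in> carrier S"
  shows "coset A c \<star>\<^bsub>ten A\<^esub> b = coset A (frag_extend (\<lambda>(x, s). frag_of (x, s \<otimes>\<^bsub>S\<^esub> b)) c)"
proof -
  interpret S: ring S by (rule S)
  let ?g = "\<lambda>(x, s). frag_of (x, s \<otimes>\<^bsub>S\<^esub> b)"
  have "coset A c \<star>\<^bsub>ten A\<^esub> b = (\<Union>c\<in>coset A c. coset A (frag_extend ?g c))"
    by (simp add: tensor_def Let_def coset_def)
  also have "\<dots> = coset A (frag_extend ?g c)"
  proof (rule coset_extend[OF A A])
    show "?g (x, s) \<in> carrier (frags A)" if "x \<in> carrier A" "s \<in> carrier S" for x s using that b by simp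
    fix r assume r: "r \<in> tensor_relators R A S \<phi>"
    have "frag_extend ?g r \<in> tensor_relators R A S \<phi>"
      using r
    proof (rule relatorE)
      fix x y s assume *: "r = frag_of (x \<oplus>\<^bsub>A\<^esub> y, s) - frag_of (x, s) - frag_of (y, s)"
        "x \<in> carrier A" "y \<in> carrier A" "s \<in> carrier S"
      have "frag_extend ?g r = frag_of (x \<oplus>\<^bsub>A\<^esub> y, s \<otimes>\<^bsub>S\<^esub> b) - frag_of (x, s \<otimes>\<^bsub>S\<^esub> b) - frag_of (y, s \<otimes>\<^bsub>S\<^esub> b)"
        by (simp add: *(1) frag_extend_diff)
      moreover have "s \<otimes>\<^bsub>S\<^esub> b \<in> carrier S" using * b by simp
      ultimately show "frag_extend ?g r \<in> tensor_relators R A S \<phi>" using * by (simp only: relatorI)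
    next
      fix x s t assume *: "r = frag_of (x, s \<oplus>\<^bsub>S\<^esub> t) - frag_of (x, s) - frag_of (x, t)"
        "x \<in> carrier A" "s \<in> carrier S" "t \<in> carrier S"
      have "frag_extend ?g r = frag_of (x, s \<otimes>\<^bsub>S\<^esub> b \<oplus>\<^bsub>S\<^esub> t \<otimes>\<^bsub>S\<^esub> b) - frag_of (x, s \<otimes>\<^bsub>S\<^esub> b) - frag_of (x, t \<otimes>\<^bsub>S\<^esub> b)"
        using * b by (simp add: *(1) frag_extend_diff S.l_distr)
      moreover have "s \<otimes>\<^bsub>S\<^esub> b \<in> carrier S" "t \<otimes>\<^bsub>S\<^esub> b \<in> carrier S" using * b by simp_all
      ultimately show "frag_extend ?g r \<in> tensor_relators R A S \<phi>" using * by (simp only: relatorI)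
    next
      fix x a s assume *: "r = frag_of (x \<star>\<^bsub>A\<^esub> a, s) - frag_of (x, \<phi> a \<otimes>\<^bsub>S\<^esub> s)"
        "x \<in> carrier A" "a \<in> carrier R" "s \<in> carrier S"
      have "frag_extend ?g r = frag_of (x \<star>\<^bsub>A\<^esub> a, s \<otimes>\<^bsub>S\<^esub> b) - frag_of (x, \<phi> a \<otimes>\<^bsub>S\<^esub> (s \<otimes>\<^bsub>S\<^esub> b))"
        using * b by (simp add: *(1) frag_extend_diff S.m_assoc \<phi>_closed)
      moreover have "s \<otimes>\<^bsub>S\<^esub> b \<in> carrier S" using * b by simp
      ultimately show "frag_extend ?g r \<in> tensor_relators R A S \<phi>" using * by (simp only: relatorI)
    qed
    then show "frag_extend ?g r \<in> rels A" using rels_facts(5)[OF A] by blast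
  qed
  finally show ?thesis .
qed

lemma ract_pure:
  assumes A: "right_module R A" and "b \<in> carrier S"
  shows "pure A x s \<star>\<^bsub>ten A\<^esub> b = pure A x (s \<otimes>\<^bsub>S\<^esub> b)"
  by (simp add: pure_def ract_coset[OF assms])

lemma ract_additive:
  assumes A: "right_module R A" and b: "b \<in> carrier S"
  shows "additive_map (ten A) (ten A) (\<lambda>X. X \<star>\<^bsub>ten A\<^esub> b)"
proof (rule additive_mapI)
  interpret S: ring S by (rule S)
  let ?g = "\<lambda>(x, s). frag_of (x, s \<otimes>\<^bsub>S\<^esub> b)"
  fix X assume "X \<in> carrier (ten A)"
  then obtain c where c: "c \<in> carrier (frags A)" "X = coset A c" by (auto simp: ten_carrier)
  have "Poly_Mapping.keys (frag_extend ?g c) \<subseteq> carrier A \<times> carrier S"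
    by (rule order_trans[OF keys_frag_extend]) (use c(1) b in \<open>auto split: if_splits\<close>)
  then show "X \<star>\<^bsub>ten A\<^esub> b \<in> carrier (ten A)" by (simp add: c(2) ract_coset[OF A b] ten_carrier)
next
  fix X Y assume "X \<in> carrier (ten A)" "Y \<in> carrier (ten A)"
  then obtain c d where "X = coset A c" "Y = coset A d" by (auto simp: ten_carrier)
  then show "(X \<oplus>\<^bsub>ten A\<^esub> Y) \<star>\<^bsub>ten A\<^esub> b = X \<star>\<^bsub>ten A\<^esub> b \<oplus>\<^bsub>ten A\<^esub> Y \<star>\<^bsub>ten A\<^esub> b"
    by (simp add: ten_add[OF A] ract_coset[OF A b] frag_extend_add)
qed

text \<open>The axioms for sums, products and the unit of S are equalities between additive maps, so
  they only have to be checked on pure tensors.\<close>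

lemma ten_module:
  assumes A: "right_module R A"
  shows "right_module S (ten A)"
proof -
  interpret S: ring S by (rule S)
  interpret T: abelian_group "ten A" by (rule ten_abelian_group[OF A])
  note ra = ract_additive[OF A]
  have add: "additive_map (ten A) (ten A) (\<lambda>X. f X \<oplus>\<^bsub>ten A\<^esub> g X)"
    if "additive_map (ten A) (ten A) f" "additive_map (ten A) (ten A) g" for f g
    by (rule additive_mapI) (simp_all add: additive_closed[OF that(1)] additive_closed[OF that(2)]
        additive_add[OF that(1)] additive_add[OF that(2)] T.a_ac)
  have id: "additive_map (ten A) (ten A) (\<lambda>X. X)" by (simp add: additive_map_def)
  note pe = additive_eq_on_pure[OF A T.abelian_group_axioms]
  show ?thesis
  proof (rule right_moduleI)
    show "\<exists>y\<in>carrier (ten A). y \<oplus>\<^bsub>ten A\<^esub> x = \<zero>\<^bsub>ten A\<^esub>" if "x \<in> carrier (ten A)" for x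
      using that by (intro bexI[of _ "\<ominus>\<^bsub>ten A\<^esub> x"]) (auto simp: T.l_neg)
    show "X \<star>\<^bsub>ten A\<^esub> a \<in> carrier (ten A)" if "X \<in> carrier (ten A)" "a \<in> carrier S" for X a
      using additive_closed[OF ra] that by blast
    show "(X \<oplus>\<^bsub>ten A\<^esub> Y) \<star>\<^bsub>ten A\<^esub> a = X \<star>\<^bsub>ten A\<^esub> a \<oplus>\<^bsub>ten A\<^esub> Y \<star>\<^bsub>ten A\<^esub> a"
      if "X \<in> carrier (ten A)" "Y \<in> carrier (ten A)" "a \<in> carrier S" for X Y a
      using additive_add[OF ra] that by blast
    show "X \<star>\<^bsub>ten A\<^esub> (a \<oplus>\<^bsub>S\<^esub> b) = X \<star>\<^bsub>ten A\<^esub> a \<oplus>\<^bsub>ten A\<^esub> X \<star>\<^bsub>ten A\<^esub> b"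
      if X: "X \<in> carrier (ten A)" and ab: "a \<in> carrier S" "b \<in> carrier S" for X a b
      by (rule pe[OF ra[OF S.a_closed[OF ab]] add[OF ra[OF ab(1)] ra[OF ab(2)]] _ X])
        (use ab in \<open>simp add: ract_pure[OF A] S.r_distr pure_relations(2)[OF A]\<close>)
    show "X \<star>\<^bsub>ten A\<^esub> (a \<otimes>\<^bsub>S\<^esub> b) = X \<star>\<^bsub>ten A\<^esub> a \<star>\<^bsub>ten A\<^esub> b"
      if X: "X \<in> carrier (ten A)" and ab: "a \<in> carrier S" "b \<in> carrier S" for X a b
      by (rule pe[OF ra[OF S.m_closed[OF ab]] additive_comp[OF ra[OF ab(1)] ra[OF ab(2)]] _ X])
        (use ab in \<open>simp add: ract_pure[OF A] S.m_assoc\<close>)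
    show "X \<star>\<^bsub>ten A\<^esub> \<one>\<^bsub>S\<^esub> = X" if X: "X \<in> carrier (ten A)" for X
      by (rule pe[OF ra[OF S.one_closed] id _ X]) (simp add: ract_pure[OF A])
  qed (auto simp: S T.a_ac)
qed

lemma additive_hom:
  assumes A: "right_module R A" and X: "right_module S X" and f: "additive_map (ten A) X f"
    and pure: "\<And>x s b. x \<in> carrier A \<Longrightarrow> s \<in> carrier S \<Longrightarrow> b \<in> carrier S \<Longrightarrow>
      f (pure A x (s \<otimes>\<^bsub>S\<^esub> b)) = f (pure A x s) \<star>\<^bsub>X\<^esub> b"
  shows "f \<in> rmod_hom S (ten A) X"
proof -
  interpret X: right_module S X by fact
  have act: "additive_map X X (\<lambda>x. x \<star>\<^bsub>X\<^esub> b)" if "b \<in> carrier S" for b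
    by (rule additive_mapI) (use that X.ract_closed X.ract_add_left in auto)
  show ?thesis
  proof (rule rmod_homI)
    show "f (x \<star>\<^bsub>ten A\<^esub> b) = f x \<star>\<^bsub>X\<^esub> b" if x: "x \<in> carrier (ten A)" and b: "b \<in> carrier S" for x b
      by (rule additive_eq_on_pure[OF A X.M.abelian_group_axioms additive_comp[OF ract_additive[OF A b] f]
            additive_comp[OF f act[OF b]] _ x]) (use b pure in \<open>simp add: ract_pure[OF A b]\<close>)
  qed (use f in \<open>auto simp: additive_map_def\<close>)
qed

lemma hom_additive: "f \<in> rmod_hom S X Y \<Longrightarrow> additive_map X Y f"
  by (simp add: rmod_hom_def additive_map_def Pi_iff)

lemma canonical_hom:
  assumes A: "right_module R A"
  shows "(\<lambda>x. pure A x \<one>\<^bsub>S\<^esub>) \<in> rmod_hom R A (restrict_scalars \<phi> (ten A))"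
proof -
  interpret S: ring S by (rule S)
  show ?thesis
    by (rule rmod_homI)
      (auto simp: restrict_scalars_simps pure_closed pure_relations[OF A] ract_pure[OF A] \<phi>_closed)
qed

lemma canonical_map_eq: "canonical_map R A S \<phi> x = pure A x \<one>\<^bsub>S\<^esub>"
  by (simp add: canonical_map_def pure_def coset_def)

lemma ten_adjoint:
  assumes A: "right_module R A" and X: "right_module S X" and c: "c \<in> rmod_hom R A (restrict_scalars \<phi> X)"
  shows "\<exists>\<Theta>\<in>rmod_hom S (ten A) X. \<forall>x\<in>carrier A. \<forall>s\<in>carrier S. \<Theta> (pure A x s) = c x \<star>\<^bsub>X\<^esub> s"
proof -
  interpret X: right_module S X by fact
  interpret S: ring S by (rule S)
  have cl: "c x \<in> carrier X" if "x \<in> carrier A" for x using hom_closed[OF c that] by (simp add: restrict_scalars_simps)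
  have "\<exists>\<Theta>. additive_map (ten A) X \<Theta> \<and> (\<forall>x\<in>carrier A. \<forall>s\<in>carrier S. \<Theta> (pure A x s) = c x \<star>\<^bsub>X\<^esub> s)"
    by (rule ten_universal[OF A X.M.abelian_group_axioms])
      (use cl hom_add[OF c] hom_act[OF c] in
        \<open>auto simp: X.ract_closed X.ract_add_left X.ract_add_right X.ract_assoc restrict_scalars_simps \<phi>_closed\<close>)
  then obtain \<Theta> where \<Theta>: "additive_map (ten A) X \<Theta>" "\<forall>x\<in>carrier A. \<forall>s\<in>carrier S. \<Theta> (pure A x s) = c x \<star>\<^bsub>X\<^esub> s"
    by blast
  have "\<Theta> \<in> rmod_hom S (ten A) X"
    by (rule additive_hom[OF A X \<Theta>(1)]) (use \<Theta>(2) cl in \<open>simp add: X.ract_assoc\<close>)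
  then show ?thesis using \<Theta>(2) by blast
qed

lemma tensor_map_coset:
  assumes A: "right_module R A" and B: "right_module R B" and f: "f \<in> rmod_hom R A B"
  shows "tensor_map R B S \<phi> f (coset A c) = coset B (frag_extend (\<lambda>(x, s). frag_of (f x, s)) c)"
proof -
  interpret S: ring S by (rule S)
  let ?g = "\<lambda>(x, s :: 's). frag_of (f x, s)"
  have "tensor_map R B S \<phi> f (coset A c) = (\<Union>c\<in>coset A c. coset B (frag_extend ?g c))"
    by (simp add: tensor_map_def coset_def)
  also have "\<dots> = coset B (frag_extend ?g c)"
  proof (rule coset_extend[OF A B])
    show "?g (x, s) \<in> carrier (frags B)" if "x \<in> carrier A" "s \<in> carrier S" for x s
      using that hom_closed[OF f] by simp
    fix r assume r: "r \<in> tensor_relators R A S \<phi>"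
    have "frag_extend ?g r \<in> tensor_relators R B S \<phi>"
      using r
    proof (rule relatorE)
      fix x y s assume *: "r = frag_of (x \<oplus>\<^bsub>A\<^esub> y, s) - frag_of (x, s) - frag_of (y, s)"
        "x \<in> carrier A" "y \<in> carrier A" "s \<in> carrier S"
      have "frag_extend ?g r = frag_of (f x \<oplus>\<^bsub>B\<^esub> f y, s) - frag_of (f x, s) - frag_of (f y, s)"
        using * by (simp add: *(1) frag_extend_diff hom_add[OF f])
      then show "frag_extend ?g r \<in> tensor_relators R B S \<phi>" using * hom_closed[OF f] by (simp only: relatorI)
    next
      fix x s t assume *: "r = frag_of (x, s \<oplus>\<^bsub>S\<^esub> t) - frag_of (x, s) - frag_of (x, t)"
        "x \<in> carrier A" "s \<in> carrier S" "t \<in> carrier S"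
      have "frag_extend ?g r = frag_of (f x, s \<oplus>\<^bsub>S\<^esub> t) - frag_of (f x, s) - frag_of (f x, t)"
        by (simp add: *(1) frag_extend_diff)
      then show "frag_extend ?g r \<in> tensor_relators R B S \<phi>" using * hom_closed[OF f] by (simp only: relatorI)
    next
      fix x a s assume *: "r = frag_of (x \<star>\<^bsub>A\<^esub> a, s) - frag_of (x, \<phi> a \<otimes>\<^bsub>S\<^esub> s)"
        "x \<in> carrier A" "a \<in> carrier R" "s \<in> carrier S"
      have "frag_extend ?g r = frag_of (f x \<star>\<^bsub>B\<^esub> a, s) - frag_of (f x, \<phi> a \<otimes>\<^bsub>S\<^esub> s)"
        using * by (simp add: *(1) frag_extend_diff hom_act[OF f])
      then show "frag_extend ?g r \<in> tensor_relators R B S \<phi>" using * hom_closed[OF f] by (simp only: relatorI)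
    qed
    then show "frag_extend ?g r \<in> rels B" using rels_facts(5)[OF B] by blast
  qed
  finally show ?thesis .
qed

lemma tensor_map_pure:
  assumes "right_module R A" "right_module R B" "f \<in> rmod_hom R A B"
  shows "tensor_map R B S \<phi> f (pure A x s) = pure B (f x) s"
  by (simp add: pure_def tensor_map_coset[OF assms])

lemma tensor_map_hom:
  assumes A: "right_module R A" and B: "right_module R B" and f: "f \<in> rmod_hom R A B"
  shows "tensor_map R B S \<phi> f \<in> rmod_hom S (ten A) (ten B)"
proof (rule additive_hom[OF A ten_module[OF B]])
  let ?g = "\<lambda>(x, s :: 's). frag_of (f x, s)"
  show "additive_map (ten A) (ten B) (tensor_map R B S \<phi> f)"
  proof (rule additive_mapI)
    fix X assume "X \<in> carrier (ten A)"
    then obtain c where c: "c \<in> carrier (frags A)" "X = coset A c" by (auto simp: ten_carrier)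
    have "Poly_Mapping.keys (frag_extend ?g c) \<subseteq> carrier B \<times> carrier S"
      by (rule order_trans[OF keys_frag_extend]) (use c(1) hom_closed[OF f] in \<open>auto split: if_splits\<close>)
    then show "tensor_map R B S \<phi> f X \<in> carrier (ten B)"
      by (simp add: c(2) tensor_map_coset[OF A B f] ten_carrier)
  next
    fix X Y assume "X \<in> carrier (ten A)" "Y \<in> carrier (ten A)"
    then obtain c d where "X = coset A c" "Y = coset A d" by (auto simp: ten_carrier)
    then show "tensor_map R B S \<phi> f (X \<oplus>\<^bsub>ten A\<^esub> Y) = tensor_map R B S \<phi> f X \<oplus>\<^bsub>ten B\<^esub> tensor_map R B S \<phi> f Y"
      by (simp add: ten_add[OF A] ten_add[OF B] tensor_map_coset[OF A B f] frag_extend_add)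
  qed
qed (simp add: tensor_map_pure[OF A B f] ract_pure[OF B])

end

section \<open>Universal localisation and local modules\<close>

text \<open>\<open>P\<close> is a summand of a free module that may have infinite rank. Only the
  finitely many coordinates that occur in generators of \<open>P\<close> are nonzero on
  \<open>P\<close>, and these are the functionals.\<close>

lemma dual_basis:
  fixes P :: "('r, 'p, 'z) rmod_scheme"
  assumes P: "fg_projective_rmod R P"
  shows "\<exists>(I :: 'p set) u \<alpha>. finite I \<and> (\<forall>x\<in>I. u x \<in> carrier P) \<and>
    (\<forall>x\<in>I. \<alpha> x \<in> rmod_hom R P (regular_rmod R)) \<and>
    (\<forall>p\<in>carrier P. (\<Oplus>\<^bsub>P\<^esub>x\<in>I. u x \<star>\<^bsub>P\<^esub> \<alpha> x p) = p)"
proof -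
  interpret P: right_module R P using P by (simp add: fg_projective_rmod_def projective_rmod_def)
  interpret R1: right_module R "regular_rmod R" by (rule regular_rmod_module[OF P.R.ring_axioms])
  obtain X :: "'p set" and i r where i: "i \<in> rmod_hom R P (free_rmod R X)"
    and r: "r \<in> rmod_hom R (free_rmod R X) P" and ri: "\<forall>x\<in>carrier P. r (i x) = x"
    using P unfolding fg_projective_rmod_def projective_rmod_def by blast
  obtain G where G: "finite G" "G \<subseteq> carrier P" "carrier P = rspan R P G"
    using P by (auto simp: fg_projective_rmod_def fin_gen_def)
  define I where "I = (\<Union>g\<in>G. {y. i g y \<noteq> \<zero>\<^bsub>R\<^esub>})"
  have ig: "i g \<in> carrier (free_rmod R X)" if "g \<in> carrier P" for g by (rule hom_closed[OF i that])
  have I: "finite I" "I \<subseteq> X" using G(1,2) ig by (auto simp: I_def free_rmod_simps subset_iff)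
  have \<alpha>: "(\<lambda>p. i p x) \<in> rmod_hom R P (regular_rmod R)" for x by (rule hom_comp[OF i coord_hom])
  have van: "i p y = \<zero>\<^bsub>R\<^esub>" if y: "y \<notin> I" and p: "p \<in> carrier P" for y p
  proof -
    let ?V = "{p \<in> carrier P. i p y = \<zero>\<^bsub>regular_rmod R\<^esub>}"
    have V: "rsubmodule R P ?V" by (rule rsubmodule_kernel[OF P.right_module_axioms R1.right_module_axioms \<alpha>])
    have "G \<subseteq> ?V" using y G(2) by (auto simp: I_def regular_rmod_simps)
    then have "rspan R P G \<subseteq> ?V" by (rule P.rspan_least[OF V])
    then have "p \<in> ?V" using p G(3) by (rule_tac subsetD) simp_all
    then show ?thesis by (simp add: regular_rmod_simps)
  qed
  have "(\<Oplus>\<^bsub>P\<^esub>x\<in>I. r (unit_vec R x) \<star>\<^bsub>P\<^esub> i p x) = p" if p: "p \<in> carrier P" for p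
    using free_expand[OF P.right_module_axioms r ig[OF p] I van[OF _ p]] ri p by simp
  moreover have "r (unit_vec R x) \<in> carrier P" if "x \<in> I" for x
    using that I(2) by (intro hom_closed[OF r] unit_vec_closed[OF P.R.ring_axioms]) auto
  ultimately show ?thesis
    using I(1) \<alpha> by (intro exI[of _ I] exI[of _ "\<lambda>x. r (unit_vec R x)"] exI[of _ "\<lambda>x p. i p x"]) blast
qed

text \<open>\<open>finsum\<close> looks only at carrier, zero and addition, which the two records
  share.\<close>

lemma finsum_restrict_regular: "finsum (restrict_scalars \<phi> (regular_rmod S)) = finsum S"
  by (simp add: finsum_def finprod_def restrict_scalars_def regular_rmod_def fun_eq_iff)

lemma finsum_regular: "finsum (regular_rmod S) = finsum S"
  by (simp add: finsum_def finprod_def regular_rmod_def fun_eq_iff)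

lemma rmod_hom_finsum:
  assumes A: "right_module R A" and X: "right_module R X" and h: "\<And>i. i \<in> I \<Longrightarrow> h i \<in> rmod_hom R A X"
  shows "(\<lambda>a. \<Oplus>\<^bsub>X\<^esub>i\<in>I. h i a) \<in> rmod_hom R A X"
proof -
  interpret A: right_module R A by fact
  interpret X: right_module R X by fact
  have ha: "additive_map A X (h i)" if "i \<in> I" for i
    using h[OF that] by (simp add: additive_map_def hom_closed hom_add)
  have s: "additive_map A X (\<lambda>a. \<Oplus>\<^bsub>X\<^esub>i\<in>I. h i a)"
    by (rule additive_map_finsum[OF X.M.abelian_group_axioms ha]) auto
  show ?thesis
  proof (rule rmod_homI)
    fix a r assume a: "a \<in> carrier A" and r: "r \<in> carrier R"
    have act: "additive_map X X (\<lambda>x. x \<star>\<^bsub>X\<^esub> r)"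
      by (rule additive_mapI) (use r X.ract_closed X.ract_add_left in auto)
    have "(\<Oplus>\<^bsub>X\<^esub>i\<in>I. h i a) \<star>\<^bsub>X\<^esub> r = (\<Oplus>\<^bsub>X\<^esub>i\<in>I. h i a \<star>\<^bsub>X\<^esub> r)"
      by (rule additive_finsum[OF X.M.abelian_group_axioms X.M.abelian_group_axioms act]) (rule hom_closed[OF h a])
    also have "\<dots> = (\<Oplus>\<^bsub>X\<^esub>i\<in>I. h i (a \<star>\<^bsub>A\<^esub> r))"
      using hom_act[OF h a r] hom_closed[OF h A.ract_closed[OF a r]] by (intro X.M.finsum_cong') auto
    finally show "(\<Oplus>\<^bsub>X\<^esub>i\<in>I. h i (a \<star>\<^bsub>A\<^esub> r)) = (\<Oplus>\<^bsub>X\<^esub>i\<in>I. h i a) \<star>\<^bsub>X\<^esub> r" by simp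
  qed (use s in \<open>auto simp: additive_map_def\<close>)
qed

context scalars
begin

lemma regular_module: "right_module S (regular_rmod S)"
  by (rule regular_rmod_module[OF S])

lemma functional_hom:
  "\<gamma> \<in> rmod_hom R A (regular_rmod R) \<Longrightarrow> (\<lambda>x. \<phi> (\<gamma> x)) \<in> rmod_hom R A (restrict_scalars \<phi> (regular_rmod S))"
  using hom_closed[of \<gamma> R A "regular_rmod R"]
  by (intro rmod_homI)
    (auto simp: restrict_scalars_simps regular_rmod_simps \<phi>_closed \<phi>_add \<phi>_mult hom_add hom_act)

lemma pure_additive_left:
  "right_module R A \<Longrightarrow> s \<in> carrier S \<Longrightarrow> additive_map A (ten A) (\<lambda>x. pure A x s)"
  by (rule additive_mapI) (auto simp: pure_closed pure_relations)

lemma pure_additive_right: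
  "right_module R A \<Longrightarrow> x \<in> carrier A \<Longrightarrow> additive_map (regular_rmod S) (ten A) (\<lambda>s. pure A x s)"
  by (rule additive_mapI) (auto simp: pure_closed pure_relations regular_rmod_simps)

lemma pure_expand:
  assumes A: "right_module R A" and u: "\<forall>x\<in>I. u x \<in> carrier A"
    and \<alpha>: "\<forall>x\<in>I. \<alpha> x \<in> rmod_hom R A (regular_rmod R)"
    and basis: "\<forall>p\<in>carrier A. (\<Oplus>\<^bsub>A\<^esub>x\<in>I. u x \<star>\<^bsub>A\<^esub> \<alpha> x p) = p"
    and p: "p \<in> carrier A" and s: "s \<in> carrier S"
  shows "(\<Oplus>\<^bsub>ten A\<^esub>x\<in>I. pure A (u x) (\<phi> (\<alpha> x p) \<otimes>\<^bsub>S\<^esub> s)) = pure A p s"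
proof -
  interpret A: right_module R A by fact
  interpret T: abelian_group "ten A" by (rule ten_abelian_group[OF A])
  have c: "\<alpha> x p \<in> carrier R" "u x \<star>\<^bsub>A\<^esub> \<alpha> x p \<in> carrier A" if "x \<in> I" for x
    using hom_closed[of "\<alpha> x" R A "regular_rmod R" p] \<alpha> u that p by (auto simp: regular_rmod_simps A.ract_closed)
  have "pure A p s = pure A (\<Oplus>\<^bsub>A\<^esub>x\<in>I. u x \<star>\<^bsub>A\<^esub> \<alpha> x p) s" using basis p by simp
  also have "\<dots> = (\<Oplus>\<^bsub>ten A\<^esub>x\<in>I. pure A (u x \<star>\<^bsub>A\<^esub> \<alpha> x p) s)"
    by (rule additive_finsum[OF A.M.abelian_group_axioms T.abelian_group_axioms pure_additive_left[OF A s]]) (rule c)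
  also have "\<dots> = (\<Oplus>\<^bsub>ten A\<^esub>x\<in>I. pure A (u x) (\<phi> (\<alpha> x p) \<otimes>\<^bsub>S\<^esub> s))"
    using c u s \<phi>_closed pure_relations(3)[OF A] pure_closed[OF c(2) s]
    by (intro T.finsum_cong') (auto simp: pure_relations(3)[OF A, symmetric])
  finally show ?thesis by simp
qed

end

section \<open>Inverting the presentations versus being local\<close>

locale placed_scalars = hereditary_placed R E + scalars R S \<phi>
  for R :: "('r, 'k) ring_scheme" and E :: "('r, 'r univ) rmod set"
    and S :: "('s, 'l) ring_scheme" and \<phi> :: "'r \<Rightarrow> 's"
begin

text \<open>By adjunction, R-maps from P or Q to \<open>X\<close> come from S-maps on the tensor
  products, and these correspond when f \<otimes> S is bijective. The two claims are existence and
  uniqueness of extensions along \<open>f\<close>.\<close>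

lemma bij_tensor_extend:
  assumes P: "right_module R P" and Q: "right_module R Q" and f: "f \<in> rmod_hom R P Q"
    and bij: "bij_betw (tensor_map R Q S \<phi> f) (carrier (ten P)) (carrier (ten Q))"
    and X: "right_module S X"
  shows "c \<in> rmod_hom R P (restrict_scalars \<phi> X)
      \<Longrightarrow> \<exists>e\<in>rmod_hom R Q (restrict_scalars \<phi> X). \<forall>p\<in>carrier P. e (f p) = c p"
    and "\<lbrakk>u \<in> rmod_hom R Q (restrict_scalars \<phi> X); \<forall>p\<in>carrier P. u (f p) = \<zero>\<^bsub>X\<^esub>; q \<in> carrier Q\<rbrakk>
      \<Longrightarrow> u q = \<zero>\<^bsub>X\<^esub>"
proof -
  let ?t = "tensor_map R Q S \<phi> f" and ?v = "inv_into (carrier (ten P)) (tensor_map R Q S \<phi> f)"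
  interpret S: ring S by (rule S)
  interpret X: right_module S X by fact
  have t: "?t \<in> rmod_hom S (ten P) (ten Q)" by (rule tensor_map_hom[OF P Q f])
  have v: "?v \<in> rmod_hom S (ten Q) (ten P)" by (rule inverse_hom[OF ten_module[OF P] t bij])
  {
    assume c: "c \<in> rmod_hom R P (restrict_scalars \<phi> X)"
    obtain \<Theta> where \<Theta>: "\<Theta> \<in> rmod_hom S (ten P) X" "\<forall>x\<in>carrier P. \<forall>s\<in>carrier S. \<Theta> (pure P x s) = c x \<star>\<^bsub>X\<^esub> s"
      using ten_adjoint[OF P X c] by blast
    have e: "(\<lambda>q. \<Theta> (?v (pure Q q \<one>\<^bsub>S\<^esub>))) \<in> rmod_hom R Q (restrict_scalars \<phi> X)"
      by (rule hom_comp[OF canonical_hom[OF Q] hom_comp[OF restrict_hom[OF v] restrict_hom[OF \<Theta>(1)]]])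
    show "\<exists>e\<in>rmod_hom R Q (restrict_scalars \<phi> X). \<forall>p\<in>carrier P. e (f p) = c p"
    proof (rule bexI[OF _ e], rule ballI)
      fix p assume p: "p \<in> carrier P"
      have "?v (pure Q (f p) \<one>\<^bsub>S\<^esub>) = ?v (?t (pure P p \<one>\<^bsub>S\<^esub>))" by (simp add: tensor_map_pure[OF P Q f])
      also have "\<dots> = pure P p \<one>\<^bsub>S\<^esub>" using bij pure_closed[OF p S.one_closed] by (simp add: bij_betw_def)
      finally show "\<Theta> (?v (pure Q (f p) \<one>\<^bsub>S\<^esub>)) = c p"
        using \<Theta>(2) p hom_closed[OF c p] by (simp add: X.ract_one restrict_scalars_simps)
    qed
  next
    assume u: "u \<in> rmod_hom R Q (restrict_scalars \<phi> X)" "\<forall>p\<in>carrier P. u (f p) = \<zero>\<^bsub>X\<^esub>" and q: "q \<in> carrier Q"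
    obtain \<Theta> where \<Theta>: "\<Theta> \<in> rmod_hom S (ten Q) X" "\<forall>x\<in>carrier Q. \<forall>s\<in>carrier S. \<Theta> (pure Q x s) = u x \<star>\<^bsub>X\<^esub> s"
      using ten_adjoint[OF Q X u(1)] by blast
    have z: "\<Theta> (?t Z) = \<zero>\<^bsub>X\<^esub>" if Z: "Z \<in> carrier (ten P)" for Z
    proof (rule additive_eq_on_pure[OF P X.M.abelian_group_axioms hom_additive[OF hom_comp[OF t \<Theta>(1)]] _ _ Z])
      show "additive_map (ten P) X (\<lambda>_. \<zero>\<^bsub>X\<^esub>)" by (simp add: additive_map_def)
      show "\<Theta> (?t (pure P x s)) = \<zero>\<^bsub>X\<^esub>" if "x \<in> carrier P" "s \<in> carrier S" for x s
        using that \<Theta>(2) u(2) hom_closed[OF f] by (simp add: tensor_map_pure[OF P Q f] X.zero_ract)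
    qed
    have "pure Q q \<one>\<^bsub>S\<^esub> \<in> ?t ` carrier (ten P)" using bij pure_closed[OF q S.one_closed] by (simp add: bij_betw_def)
    then have "\<Theta> (pure Q q \<one>\<^bsub>S\<^esub>) = \<zero>\<^bsub>X\<^esub>" using z by auto
    then show "u q = \<zero>\<^bsub>X\<^esub>" using \<Theta>(2) q hom_closed[OF u(1) q] by (simp add: X.ract_one restrict_scalars_simps)
  }
qed

text \<open>Extensions exist by \<open>bij_tensor_extend\<close>. For torsion-freeness, a map from
  an object is pulled back to R^n, where it vanishes on the kernel of the presentation and therefore
  everywhere; \<open>standard_presentation\<close> puts the presentation into the form that
  \<open>inverts\<close> covers.\<close>

lemma inverts_local:
  assumes inv: "inverts R E S \<phi>" and X: "right_module S X"
  shows "local_module R E (restrict_scalars \<phi> X)"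
  unfolding local_module_def
proof (intro conjI ballI allI impI)
  have Xm: "right_module R (restrict_scalars \<phi> X)" by (rule restrict_module[OF X])
  have bij: "bij_betw (tensor_map R Q S \<phi> f) (carrier (ten P)) (carrier (ten Q))"
    if "A \<in> E" "fg_projective_rmod R P" "fg_projective_rmod R Q" "short_exact R P f Q g A"
    for A and P Q :: "('r, 'r univ) rmod" and f g
    using inv that unfolding inverts_def by blast
  show "torsion_free R E (restrict_scalars \<phi> X)"
  proof (rule torsion_freeI[OF Xm])
    fix A h a assume A: "A \<in> E" and h: "h \<in> rmod_hom R A (restrict_scalars \<phi> X)" and a: "a \<in> carrier A"
    obtain n :: nat and p where p: "p \<in> rmod_hom R (free_rmod R {..<n}) A"
      "p ` carrier (free_rmod R {..<n}) = carrier A"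
      "fin_gen R (free_rmod R {..<n}) (a_kernel (free_rmod R {..<n}) A p)"
      using object_fp[OF A] unfolding fin_presented_def by blast
    note std = standard_presentation[OF object_module[OF A] p(1,2) refl p(3)]
    let ?P = "singleton_rmod (sub (free_rmod R {..<n}) (a_kernel (free_rmod R {..<n}) A p))"
      and ?Q = "singleton_rmod (free_rmod R {..<n})" and ?g = "\<lambda>x. p (the_elem x)"
    have m: "right_module R ?P" "right_module R ?Q" using std(1,2) by (simp_all add: fg_projective_rmod_def projective_rmod_def)
    have g: "(\<lambda>x. x) \<in> rmod_hom R ?P ?Q" "?g \<in> rmod_hom R ?Q A" "?g ` carrier ?Q = carrier A"
      "(\<lambda>x. x) ` carrier ?P = {x \<in> carrier ?Q. ?g x = \<zero>\<^bsub>A\<^esub>}"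
      using std(3) by (simp_all add: short_exact_def a_kernel_eq)
    have h0: "h \<zero>\<^bsub>A\<^esub> = \<zero>\<^bsub>X\<^esub>"
      using hom_zero[OF right_module_abelian_group[OF object_module[OF A]] right_module_abelian_group[OF Xm] h]
      by (simp add: restrict_scalars_simps)
    have "a \<in> ?g ` carrier ?Q" unfolding g(3) by (rule a)
    then obtain q where q: "a = ?g q" "q \<in> carrier ?Q" by (elim imageE)
    have "h (?g x) = \<zero>\<^bsub>X\<^esub>" if "x \<in> carrier ?P" for x
    proof -
      have "x \<in> (\<lambda>x. x) ` carrier ?P" using that by simp
      then have "?g x = \<zero>\<^bsub>A\<^esub>" unfolding g(4) by simp
      then show ?thesis using h0 by simp
    qed
    then have "h (?g q) = \<zero>\<^bsub>X\<^esub>"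
      by (intro bij_tensor_extend(2)[OF m g(1) bij[OF A std] X hom_comp[OF g(2) h] _ q(2)] ballI)
    then show "h a = \<zero>\<^bsub>restrict_scalars \<phi> X\<^esub>" using q(1) by (simp add: restrict_scalars_simps)
  qed
  fix A and P Q :: "('r, 'r univ) rmod" and f g c
  assume A: "A \<in> E" and conj: "fg_projective_rmod R P \<and> fg_projective_rmod R Q \<and> short_exact R P f Q g A"
    and c: "c \<in> rmod_hom R P (restrict_scalars \<phi> X)"
  have m: "right_module R P" "right_module R Q" "f \<in> rmod_hom R P Q"
    using conj by (simp_all add: fg_projective_rmod_def projective_rmod_def short_exact_def)
  show "\<exists>e\<in>rmod_hom R Q (restrict_scalars \<phi> X). \<forall>p\<in>carrier P. e (f p) = c p"
    by (rule bij_tensor_extend(1)[OF m bij X c]) (use A conj in auto)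
qed

text \<open>Conversely \<open>f \<otimes> S\<close> is invertible as soon as its \<open>S\<close>-dual is: an inverse is assembled from a dual
  basis of \<open>P\<close> whose functionals have been extended along \<open>f\<close>.\<close>

lemma local_inverts:
  assumes loc: "local_module R E (restrict_scalars \<phi> (regular_rmod S))"
  shows "inverts R E S \<phi>"
  unfolding inverts_def
proof (intro ballI allI impI)
  fix A and P Q :: "('r, 'r univ) rmod" and f g
  assume A: "A \<in> E" and conj: "fg_projective_rmod R P \<and> fg_projective_rmod R Q \<and> short_exact R P f Q g A"
  have Pf: "fg_projective_rmod R P" and Qf: "fg_projective_rmod R Q" and ex: "short_exact R P f Q g A"
    using conj by auto
  interpret P: right_module R P using Pf by (simp add: fg_projective_rmod_def projective_rmod_def)
  interpret Q: right_module R Q using Qf by (simp add: fg_projective_rmod_def projective_rmod_def)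
  interpret S: ring S by (rule S)
  interpret S1: right_module S "regular_rmod S" by (rule regular_module)
  let ?SR = "restrict_scalars \<phi> (regular_rmod S)"
  interpret SR: right_module R ?SR by (rule restrict_module[OF regular_module])
  note Pm = P.right_module_axioms and Qm = Q.right_module_axioms
  interpret TP: abelian_group "ten P" by (rule ten_abelian_group[OF Pm])
  interpret TQ: abelian_group "ten Q" by (rule ten_abelian_group[OF Qm])
  have f: "f \<in> rmod_hom R P Q" using ex by (simp add: short_exact_def)
  have Qq: "quot_in R E Q (f ` carrier P)" by (rule short_exact_quot_in[OF A Qm ex])
  obtain I u \<alpha> where I: "finite (I :: 'r univ set)" "\<forall>x\<in>I. u x \<in> carrier P"
    "\<forall>x\<in>I. \<alpha> x \<in> rmod_hom R P (regular_rmod R)" "\<forall>p\<in>carrier P. (\<Oplus>\<^bsub>P\<^esub>x\<in>I. u x \<star>\<^bsub>P\<^esub> \<alpha> x p) = p"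
    using dual_basis[OF Pf] by (elim exE conjE) (rule that)
  obtain J v \<beta> where J: "finite (J :: 'r univ set)" "\<forall>x\<in>J. v x \<in> carrier Q"
    "\<forall>x\<in>J. \<beta> x \<in> rmod_hom R Q (regular_rmod R)" "\<forall>p\<in>carrier Q. (\<Oplus>\<^bsub>Q\<^esub>x\<in>J. v x \<star>\<^bsub>Q\<^esub> \<beta> x p) = p"
    using dual_basis[OF Qf] by (elim exE conjE) (rule that)
  let ?t = "tensor_map R Q S \<phi> f"
  have t: "?t \<in> rmod_hom S (ten P) (ten Q)" by (rule tensor_map_hom[OF Pm Qm f])
  \<comment> \<open>\<open>d x\<close> extends to Q the functional of P obtained from
    \<open>\<alpha> x\<close> and \<open>\<phi>\<close>; \<open>D x\<close> below is the S-linear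
    map it induces on the tensor product.\<close>
  have "\<exists>e\<in>rmod_hom R Q ?SR. \<forall>p\<in>carrier P. e (f p) = \<phi> (\<alpha> x p)" if "x \<in> I" for x
    using I(3) that by (intro local_module_extend[OF loc A Pf Qf ex] functional_hom) blast
  then obtain d where d: "\<And>x. x \<in> I \<Longrightarrow> d x \<in> rmod_hom R Q ?SR"
    "\<And>x p. x \<in> I \<Longrightarrow> p \<in> carrier P \<Longrightarrow> d x (f p) = \<phi> (\<alpha> x p)" by metis
  have dS: "d x q \<in> carrier S" if "x \<in> I" "q \<in> carrier Q" for x q
    using hom_closed[OF d(1)[OF that(1)] that(2)] by (simp add: restrict_scalars_simps regular_rmod_simps)
  have "\<exists>\<Theta>\<in>rmod_hom S (ten Q) (regular_rmod S). \<forall>q\<in>carrier Q. \<forall>s\<in>carrier S. \<Theta> (pure Q q s) = d x q \<otimes>\<^bsub>S\<^esub> s" if "x \<in> I" for x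
    using ten_adjoint[OF Qm regular_module d(1)[OF that]] by (simp add: regular_rmod_simps)
  then obtain D where D: "\<And>x. x \<in> I \<Longrightarrow> D x \<in> rmod_hom S (ten Q) (regular_rmod S)"
    "\<And>x q s. x \<in> I \<Longrightarrow> q \<in> carrier Q \<Longrightarrow> s \<in> carrier S \<Longrightarrow> D x (pure Q q s) = d x q \<otimes>\<^bsub>S\<^esub> s" by metis
  have "\<exists>\<Theta>\<in>rmod_hom S (ten Q) (regular_rmod S). \<forall>q\<in>carrier Q. \<forall>s\<in>carrier S. \<Theta> (pure Q q s) = \<phi> (\<beta> y q) \<otimes>\<^bsub>S\<^esub> s" if "y \<in> J" for y
    using ten_adjoint[OF Qm regular_module functional_hom, of "\<beta> y"] J(3) that by (simp add: regular_rmod_simps)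
  then obtain B where B: "\<And>y. y \<in> J \<Longrightarrow> B y \<in> rmod_hom S (ten Q) (regular_rmod S)"
    "\<And>y q s. y \<in> J \<Longrightarrow> q \<in> carrier Q \<Longrightarrow> s \<in> carrier S \<Longrightarrow> B y (pure Q q s) = \<phi> (\<beta> y q) \<otimes>\<^bsub>S\<^esub> s" by metis
  have DS: "D x z \<in> carrier S" if "x \<in> I" "z \<in> carrier (ten Q)" for x z
    using hom_closed[OF D(1)[OF that(1)] that(2)] by (simp add: regular_rmod_simps)
  have BS: "B x z \<in> carrier S" if "x \<in> J" "z \<in> carrier (ten Q)" for x z
    using hom_closed[OF B(1)[OF that(1)] that(2)] by (simp add: regular_rmod_simps)
  \<comment> \<open>An inverse of f \<otimes> S can only be this one: an element of P \<otimes> S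
    expands in the dual basis of P, and its coordinates are read off by \<open>D\<close> from its
    image in Q \<otimes> S.\<close>
  define G where "G z = (\<Oplus>\<^bsub>ten P\<^esub>x\<in>I. pure P (u x) (D x z))" for z
  have Gadd: "additive_map (ten Q) (ten P) G"
    unfolding G_def
  proof (rule additive_map_finsum[OF TP.abelian_group_axioms])
    fix x assume x: "x \<in> I"
    show "additive_map (ten Q) (ten P) (\<lambda>z. pure P (u x) (D x z))"
      using I(2) x by (intro additive_comp[OF hom_additive[OF D(1)] pure_additive_right[OF Pm]]) auto
  qed auto
  have Gt: "G (?t z) = z" if z: "z \<in> carrier (ten P)" for z
  proof (rule additive_eq_on_pure[OF Pm TP.abelian_group_axioms additive_comp[OF hom_additive[OF t] Gadd] _ _ z])
    show "additive_map (ten P) (ten P) (\<lambda>z. z)" by (simp add: additive_map_def)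
    fix p s assume p: "p \<in> carrier P" and s: "s \<in> carrier S"
    have fp: "f p \<in> carrier Q" by (rule hom_closed[OF f p])
    have c: "\<phi> (\<alpha> x p) \<otimes>\<^bsub>S\<^esub> s \<in> carrier S" if "x \<in> I" for x
      using hom_closed[of "\<alpha> x" R P "regular_rmod R" p] I(3) that p s by (auto simp: regular_rmod_simps \<phi>_closed)
    have "G (?t (pure P p s)) = (\<Oplus>\<^bsub>ten P\<^esub>x\<in>I. pure P (u x) (\<phi> (\<alpha> x p) \<otimes>\<^bsub>S\<^esub> s))"
      unfolding G_def tensor_map_pure[OF Pm Qm f]
      using D(2)[OF _ fp s] d(2)[OF _ p] c I(2) pure_closed[of _ P] by (intro TP.finsum_cong') auto
    also have "\<dots> = pure P p s" by (rule pure_expand[OF Pm I(2-4) p s])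
    finally show "G (?t (pure P p s)) = pure P p s" .
  qed
  have Q_expand: "(\<Oplus>\<^bsub>ten Q\<^esub>y\<in>J. pure Q (v y) (B y z)) = z" if z: "z \<in> carrier (ten Q)" for z
  proof (rule additive_eq_on_pure[OF Qm TQ.abelian_group_axioms _ _ _ z])
    show "additive_map (ten Q) (ten Q) (\<lambda>z. \<Oplus>\<^bsub>ten Q\<^esub>y\<in>J. pure Q (v y) (B y z))"
    proof (rule additive_map_finsum[OF TQ.abelian_group_axioms])
      fix y assume y: "y \<in> J"
      show "additive_map (ten Q) (ten Q) (\<lambda>z. pure Q (v y) (B y z))"
        using J(2) y by (intro additive_comp[OF hom_additive[OF B(1)] pure_additive_right[OF Qm]]) auto
    qed auto
    show "additive_map (ten Q) (ten Q) (\<lambda>z. z)" by (simp add: additive_map_def)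
    fix q s assume q: "q \<in> carrier Q" and s: "s \<in> carrier S"
    have c: "\<phi> (\<beta> x q) \<otimes>\<^bsub>S\<^esub> s \<in> carrier S" if "x \<in> J" for x
      using hom_closed[of "\<beta> x" R Q "regular_rmod R" q] J(3) that q s by (auto simp: regular_rmod_simps \<phi>_closed)
    have "(\<Oplus>\<^bsub>ten Q\<^esub>y\<in>J. pure Q (v y) (B y (pure Q q s))) = (\<Oplus>\<^bsub>ten Q\<^esub>y\<in>J. pure Q (v y) (\<phi> (\<beta> y q) \<otimes>\<^bsub>S\<^esub> s))"
      using B(2)[OF _ q s] c J(2) pure_closed[of _ Q] by (intro TQ.finsum_cong') auto
    also have "\<dots> = pure Q q s" by (rule pure_expand[OF Qm J(2-4) q s])
    finally show "(\<Oplus>\<^bsub>ten Q\<^esub>y\<in>J. pure Q (v y) (B y (pure Q q s))) = pure Q q s" .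
  qed
  have tG: "additive_map (ten Q) (ten Q) (\<lambda>z. ?t (G z))" by (rule additive_comp[OF Gadd hom_additive[OF t]])
  \<comment> \<open>The identity \<open>?t (G z) = z\<close> is tested through the functionals of Q,
    which determine an element by \<open>Q_expand\<close>.\<close>
  have BtG: "B y (?t (G z)) = B y z" if y: "y \<in> J" and z: "z \<in> carrier (ten Q)" for y z
  proof (rule additive_eq_on_pure[OF Qm S1.M.abelian_group_axioms additive_comp[OF tG hom_additive[OF B(1)[OF y]]]
        hom_additive[OF B(1)[OF y]] _ z])
    fix q s assume q: "q \<in> carrier Q" and s: "s \<in> carrier S"
    have fu: "f (u x) \<in> carrier Q" if "x \<in> I" for x using I(2) that hom_closed[OF f] by simp
    have \<beta>y: "\<beta> y \<in> rmod_hom R Q (regular_rmod R)" using J(3) y by simp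
    have b: "\<phi> (\<beta> y (f (u x))) \<in> carrier S" if "x \<in> I" for x
      using hom_closed[OF \<beta>y fu[OF that]] by (simp add: regular_rmod_simps \<phi>_closed)
    \<comment> \<open>As a function of q this is an R-linear map from Q to S that agrees with \<phi>
      (\<beta> y q) on f(P), by the dual basis of P. Since S is torsion-free over R, the two agree
      on all of Q.\<close>
    define w where "w q = (\<Oplus>\<^bsub>?SR\<^esub>x\<in>I. \<phi> (\<beta> y (f (u x))) \<otimes>\<^bsub>S\<^esub> d x q)" for q
    have lmult: "(\<lambda>z. s0 \<otimes>\<^bsub>S\<^esub> z) \<in> rmod_hom R ?SR ?SR" if "s0 \<in> carrier S" for s0
      by (rule rmod_homI) (use that in \<open>auto simp: restrict_scalars_simps regular_rmod_simps S.r_distr S.m_assoc \<phi>_closed\<close>)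
    have wh: "w \<in> rmod_hom R Q ?SR"
      unfolding w_def using hom_comp[OF d(1) lmult[OF b]] by (intro rmod_hom_finsum[OF Qm SR.right_module_axioms])
    have \<beta>f: "(\<lambda>p. \<phi> (\<beta> y (f p))) \<in> rmod_hom R P ?SR" by (rule hom_comp[OF f functional_hom[OF \<beta>y]])
    have \<beta>fA: "additive_map P ?SR (\<lambda>p. \<phi> (\<beta> y (f p)))"
      by (rule additive_mapI) (rule hom_closed[OF \<beta>f] hom_add[OF \<beta>f]; assumption)+
    have "w q = \<phi> (\<beta> y q)"
    proof (rule torsion_free_extension_unique[OF local_module_torsion_free[OF loc] Qq wh functional_hom[OF \<beta>y] _ q])
      fix q' assume "q' \<in> f ` carrier P"
      then obtain p where p: "q' = f p" "p \<in> carrier P" by (elim imageE)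
      have ap: "\<alpha> x p \<in> carrier R" "u x \<in> carrier P" if "x \<in> I" for x
        using hom_closed[of "\<alpha> x" R P "regular_rmod R" p] I(2,3) that p(2) by (auto simp: regular_rmod_simps)
      have e: "\<phi> (\<beta> y (f (u x))) \<otimes>\<^bsub>S\<^esub> d x (f p) = \<phi> (\<beta> y (f (u x \<star>\<^bsub>P\<^esub> \<alpha> x p)))" if "x \<in> I" for x
        using hom_act[OF \<beta>f ap(2)[OF that] ap(1)[OF that]] d(2)[OF that p(2)] by (simp add: restrict_scalars_simps regular_rmod_simps)
      have "w (f p) = (\<Oplus>\<^bsub>?SR\<^esub>x\<in>I. \<phi> (\<beta> y (f (u x \<star>\<^bsub>P\<^esub> \<alpha> x p))))"
        unfolding w_def using e hom_closed[OF \<beta>f P.ract_closed] ap by (intro SR.M.finsum_cong') auto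
      also have "\<dots> = \<phi> (\<beta> y (f (\<Oplus>\<^bsub>P\<^esub>x\<in>I. u x \<star>\<^bsub>P\<^esub> \<alpha> x p)))"
        by (rule additive_finsum[OF P.M.abelian_group_axioms SR.M.abelian_group_axioms \<beta>fA, symmetric])
          (rule P.ract_closed[OF ap(2,1)])
      also have "\<dots> = \<phi> (\<beta> y (f p))" using I(4) p(2) by simp
      finally show "w q' = \<phi> (\<beta> y q')" using p(1) by simp
    qed
    then have w: "(\<Oplus>\<^bsub>S\<^esub>x\<in>I. \<phi> (\<beta> y (f (u x))) \<otimes>\<^bsub>S\<^esub> d x q) = \<phi> (\<beta> y q)"
      by (simp add: w_def finsum_restrict_regular)
    have ds: "d x q \<otimes>\<^bsub>S\<^esub> s \<in> carrier S" if "x \<in> I" for x using dS[OF that q] s by simp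
    have "G (pure Q q s) = (\<Oplus>\<^bsub>ten P\<^esub>x\<in>I. pure P (u x) (d x q \<otimes>\<^bsub>S\<^esub> s))"
      unfolding G_def using D(2)[OF _ q s] ds I(2) pure_closed[of _ P] by (intro TP.finsum_cong') auto
    then have "?t (G (pure Q q s)) = (\<Oplus>\<^bsub>ten Q\<^esub>x\<in>I. ?t (pure P (u x) (d x q \<otimes>\<^bsub>S\<^esub> s)))"
      using ds I(2) pure_closed[of _ P]
      by (simp add: additive_finsum[OF TP.abelian_group_axioms TQ.abelian_group_axioms hom_additive[OF t]])
    also have "\<dots> = (\<Oplus>\<^bsub>ten Q\<^esub>x\<in>I. pure Q (f (u x)) (d x q \<otimes>\<^bsub>S\<^esub> s))"
      by (simp add: tensor_map_pure[OF Pm Qm f])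
    finally have "B y (?t (G (pure Q q s))) = (\<Oplus>\<^bsub>regular_rmod S\<^esub>x\<in>I. B y (pure Q (f (u x)) (d x q \<otimes>\<^bsub>S\<^esub> s)))"
      using ds fu pure_closed[of _ Q]
      by (simp add: additive_finsum[OF TQ.abelian_group_axioms S1.M.abelian_group_axioms hom_additive[OF B(1)[OF y]]])
    also have "\<dots> = (\<Oplus>\<^bsub>S\<^esub>x\<in>I. B y (pure Q (f (u x)) (d x q \<otimes>\<^bsub>S\<^esub> s)))" by (simp add: finsum_regular)
    also have "\<dots> = (\<Oplus>\<^bsub>S\<^esub>x\<in>I. (\<phi> (\<beta> y (f (u x))) \<otimes>\<^bsub>S\<^esub> d x q) \<otimes>\<^bsub>S\<^esub> s)"
      using B(2)[OF y fu ds] b dS[OF _ q] s by (intro S.finsum_cong') (auto simp: S.m_assoc)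
    also have "\<dots> = (\<Oplus>\<^bsub>S\<^esub>x\<in>I. \<phi> (\<beta> y (f (u x))) \<otimes>\<^bsub>S\<^esub> d x q) \<otimes>\<^bsub>S\<^esub> s"
      using b dS[OF _ q] s I(1) by (intro S.finsum_ldistr[symmetric]) auto
    also have "\<dots> = B y (pure Q q s)" using w B(2)[OF y q s] by simp
    finally show "B y (?t (G (pure Q q s))) = B y (pure Q q s)" .
  qed
  have tGz: "?t (G z) = z" if z: "z \<in> carrier (ten Q)" for z
  proof -
    have "?t (G z) = (\<Oplus>\<^bsub>ten Q\<^esub>y\<in>J. pure Q (v y) (B y (?t (G z))))"
      by (rule Q_expand[symmetric]) (rule additive_closed[OF tG z])
    also have "\<dots> = (\<Oplus>\<^bsub>ten Q\<^esub>y\<in>J. pure Q (v y) (B y z))"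
      using BtG[OF _ z] J(2) BS[OF _ z] pure_closed[of _ Q] by (intro TQ.finsum_cong') auto
    also have "\<dots> = z" by (rule Q_expand[OF z])
    finally show ?thesis .
  qed
  show "bij_betw ?t (carrier (ten P)) (carrier (ten Q))"
    by (rule bij_betw_byWitness[where f' = G])
      (use Gt tGz hom_closed[OF t] additive_closed[OF Gadd] in auto)
qed

end

lemma image_ring_ops:
  "carrier (image_ring f R) = f ` carrier R"
  "monoid.mult (image_ring f R) = (\<lambda>a b. f (inv_into (carrier R) f a \<otimes>\<^bsub>R\<^esub> inv_into (carrier R) f b))"
  "one (image_ring f R) = f \<one>\<^bsub>R\<^esub>" "\<zero>\<^bsub>image_ring f R\<^esub> = f \<zero>\<^bsub>R\<^esub>"
  "add (image_ring f R) = (\<lambda>a b. f (inv_into (carrier R) f a \<oplus>\<^bsub>R\<^esub> inv_into (carrier R) f b))"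
  by (auto simp: image_ring_def image_group_def monoid.defs)

text \<open>The test rings in the definition of a universal localisation are only given up to a choice of
  type; a ring of arbitrary type is moved there along an injection.\<close>

lemma (in placed_scalars) inverts_image_ring:
  assumes loc: "local_module R E (restrict_scalars \<phi> (regular_rmod S))" and inj: "inj_on e (carrier S)"
  shows "ring (image_ring e S)" "(\<lambda>a. e (\<phi> a)) \<in> ring_hom R (image_ring e S)"
    "inverts R E (image_ring e S) (\<lambda>a. e (\<phi> a))"
proof -
  interpret S: ring S by (rule S)
  let ?T = "image_ring e S" and ?\<psi> = "\<lambda>a. e (\<phi> a)"
  have inv: "inv_into (carrier S) e (e x) = x" if "x \<in> carrier S" for x using inj that by simp
  show T: "ring ?T" by (rule S.inj_imp_image_ring_is_ring[OF inj])
  show \<psi>: "?\<psi> \<in> ring_hom R ?T"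
    by (rule ring_hom_memI) (auto simp: image_ring_ops inv \<phi>_closed \<phi>_mult \<phi>_add \<phi>_one)
  interpret T: placed_scalars R E ?T ?\<psi>
    by (intro placed_scalars.intro hereditary_placed_axioms scalars.intro base_ring T \<psi>)
  have "local_module R E (restrict_scalars ?\<psi> (regular_rmod ?T))"
  proof (rule local_module_iso[OF loc _ _ T.restrict_module[OF T.regular_module]])
    show "e \<in> rmod_hom R (restrict_scalars \<phi> (regular_rmod S)) (restrict_scalars ?\<psi> (regular_rmod ?T))"
      by (rule rmod_homI) (auto simp: restrict_scalars_simps regular_rmod_simps image_ring_ops inv \<phi>_closed)
    show "bij_betw e (carrier (restrict_scalars \<phi> (regular_rmod S))) (carrier (restrict_scalars ?\<psi> (regular_rmod ?T)))"
      using inj by (auto simp: restrict_scalars_simps regular_rmod_simps image_ring_ops bij_betw_def)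
  qed
  then show "inverts R E ?T ?\<psi>" by (rule T.local_inverts)
qed

section \<open>Endomorphism rings and the universal property\<close>

definition endo_ring :: "('r, 'l, 'y) rmod_scheme \<Rightarrow> ('l \<Rightarrow> 'l) ring"
  \<comment> \<open>endomorphisms act from the right, so \<open>h k\<close> means \<open>h\<close> first\<close>
  where "endo_ring L =
    \<lparr>carrier = {h \<in> extensional (carrier L). additive_map L L h},
     monoid.mult = (\<lambda>h k. restrict (\<lambda>x. k (h x)) (carrier L)), one = restrict (\<lambda>x. x) (carrier L),
     ring.zero = restrict (\<lambda>_. \<zero>\<^bsub>L\<^esub>) (carrier L),
     add = (\<lambda>h k. restrict (\<lambda>x. h x \<oplus>\<^bsub>L\<^esub> k x) (carrier L))\<rparr>"

definition act_map :: "('r, 'l, 'y) rmod_scheme \<Rightarrow> 'r \<Rightarrow> 'l \<Rightarrow> 'l"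
  where "act_map L a = restrict (\<lambda>x. x \<star>\<^bsub>L\<^esub> a) (carrier L)"

lemma endo_ring_simps:
  "\<one>\<^bsub>endo_ring L\<^esub> = restrict (\<lambda>x. x) (carrier L)"
  "\<zero>\<^bsub>endo_ring L\<^esub> = restrict (\<lambda>_. \<zero>\<^bsub>L\<^esub>) (carrier L)"
  "h \<otimes>\<^bsub>endo_ring L\<^esub> k = restrict (\<lambda>x. k (h x)) (carrier L)"
  "h \<oplus>\<^bsub>endo_ring L\<^esub> k = restrict (\<lambda>x. h x \<oplus>\<^bsub>L\<^esub> k x) (carrier L)"
  by (simp_all add: endo_ring_def)

lemma endo_carrier: "h \<in> carrier (endo_ring L) \<longleftrightarrow> h \<in> extensional (carrier L) \<and> additive_map L L h"
  by (simp add: endo_ring_def)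

lemma endo_closed: "h \<in> carrier (endo_ring L) \<Longrightarrow> x \<in> carrier L \<Longrightarrow> h x \<in> carrier L"
  by (simp add: endo_carrier additive_map_def)

lemma endo_add: "h \<in> carrier (endo_ring L) \<Longrightarrow> x \<in> carrier L \<Longrightarrow> y \<in> carrier L \<Longrightarrow> h (x \<oplus>\<^bsub>L\<^esub> y) = h x \<oplus>\<^bsub>L\<^esub> h y"
  by (simp add: endo_carrier additive_map_def)

lemma endo_eqI:
  "h \<in> extensional (carrier L) \<Longrightarrow> k \<in> extensional (carrier L) \<Longrightarrow> (\<And>x. x \<in> carrier L \<Longrightarrow> h x = k x) \<Longrightarrow> h = k"
  by (rule extensionalityI)

lemma endo_restrictI:
  assumes "abelian_group L" "\<And>x. x \<in> carrier L \<Longrightarrow> f x \<in> carrier L"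
    "\<And>x y. x \<in> carrier L \<Longrightarrow> y \<in> carrier L \<Longrightarrow> f (x \<oplus>\<^bsub>L\<^esub> y) = f x \<oplus>\<^bsub>L\<^esub> f y"
  shows "restrict f (carrier L) \<in> carrier (endo_ring L)"
proof -
  interpret L: abelian_group L by fact
  show ?thesis using assms by (simp add: endo_carrier additive_map_def)
qed

lemma endo_ring:
  assumes L: "abelian_group L"
  shows "ring (endo_ring L)"
proof -
  interpret L: abelian_group L by fact
  note cl = endo_closed[of _ L] and ad = endo_add[of _ L] and r = endo_restrictI[OF L]
  have add: "h \<oplus>\<^bsub>endo_ring L\<^esub> k \<in> carrier (endo_ring L)" if "h \<in> carrier (endo_ring L)" "k \<in> carrier (endo_ring L)" for h k
    unfolding endo_ring_simps by (rule r) (simp_all add: cl[OF that(1)] cl[OF that(2)] ad[OF that(1)] ad[OF that(2)] L.a_ac)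
  have mult: "h \<otimes>\<^bsub>endo_ring L\<^esub> k \<in> carrier (endo_ring L)" if "h \<in> carrier (endo_ring L)" "k \<in> carrier (endo_ring L)" for h k
    unfolding endo_ring_simps by (rule r) (simp_all add: cl[OF that(1)] cl[OF that(2)] ad[OF that(1)] ad[OF that(2)])
  have ext: "h = k" if "h \<in> carrier (endo_ring L)" "k \<in> carrier (endo_ring L)" "\<And>x. x \<in> carrier L \<Longrightarrow> h x = k x" for h k
    using that by (intro endo_eqI[of h L k]) (simp_all add: endo_carrier)
  have one: "\<one>\<^bsub>endo_ring L\<^esub> \<in> carrier (endo_ring L)" and zero: "\<zero>\<^bsub>endo_ring L\<^esub> \<in> carrier (endo_ring L)"
    unfolding endo_ring_simps by (rule r; simp)+
  show ?thesis
  proof (rule ringI)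
    show "abelian_group (endo_ring L)"
    proof (rule abelian_groupI)
      fix h assume h: "h \<in> carrier (endo_ring L)"
      have i: "restrict (\<lambda>x. \<ominus>\<^bsub>L\<^esub> h x) (carrier L) \<in> carrier (endo_ring L)"
        by (rule r) (simp_all add: cl[OF h] ad[OF h] L.minus_add)
      show "\<exists>k\<in>carrier (endo_ring L). k \<oplus>\<^bsub>endo_ring L\<^esub> h = \<zero>\<^bsub>endo_ring L\<^esub>"
        by (rule bexI[OF _ i], rule ext[OF add[OF i h] zero]) (simp add: endo_ring_simps L.l_neg cl[OF h])
      show "\<zero>\<^bsub>endo_ring L\<^esub> \<oplus>\<^bsub>endo_ring L\<^esub> h = h"
        by (rule ext[OF add[OF zero h] h]) (simp add: endo_ring_simps cl[OF h])
    next
      fix h k l assume h: "h \<in> carrier (endo_ring L)" "k \<in> carrier (endo_ring L)" "l \<in> carrier (endo_ring L)"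
      show "h \<oplus>\<^bsub>endo_ring L\<^esub> k \<oplus>\<^bsub>endo_ring L\<^esub> l = h \<oplus>\<^bsub>endo_ring L\<^esub> (k \<oplus>\<^bsub>endo_ring L\<^esub> l)"
        by (rule ext[OF add[OF add[OF h(1,2)] h(3)] add[OF h(1) add[OF h(2,3)]]])
          (simp add: endo_ring_simps cl[OF h(1)] cl[OF h(2)] cl[OF h(3)] L.a_assoc)
    next
      fix h k assume h: "h \<in> carrier (endo_ring L)" "k \<in> carrier (endo_ring L)"
      show "h \<oplus>\<^bsub>endo_ring L\<^esub> k = k \<oplus>\<^bsub>endo_ring L\<^esub> h"
        by (rule ext[OF add[OF h] add[OF h(2,1)]]) (simp add: endo_ring_simps cl[OF h(1)] cl[OF h(2)] L.a_comm)
    qed (rule add zero; assumption)+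
    show "monoid (endo_ring L)"
    proof (rule monoidI)
      fix h k l assume h: "h \<in> carrier (endo_ring L)" "k \<in> carrier (endo_ring L)" "l \<in> carrier (endo_ring L)"
      show "h \<otimes>\<^bsub>endo_ring L\<^esub> k \<otimes>\<^bsub>endo_ring L\<^esub> l = h \<otimes>\<^bsub>endo_ring L\<^esub> (k \<otimes>\<^bsub>endo_ring L\<^esub> l)"
        by (rule ext[OF mult[OF mult[OF h(1,2)] h(3)] mult[OF h(1) mult[OF h(2,3)]]])
          (simp add: endo_ring_simps cl[OF h(1)])
    next
      fix h assume h: "h \<in> carrier (endo_ring L)"
      show "\<one>\<^bsub>endo_ring L\<^esub> \<otimes>\<^bsub>endo_ring L\<^esub> h = h" "h \<otimes>\<^bsub>endo_ring L\<^esub> \<one>\<^bsub>endo_ring L\<^esub> = h"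
        by (rule ext[OF mult[OF one h] h], simp add: endo_ring_simps)
          (rule ext[OF mult[OF h one] h], simp add: endo_ring_simps cl[OF h])
    qed (rule mult one; assumption)+
    fix h k l assume h: "h \<in> carrier (endo_ring L)" "k \<in> carrier (endo_ring L)" "l \<in> carrier (endo_ring L)"
    show "(h \<oplus>\<^bsub>endo_ring L\<^esub> k) \<otimes>\<^bsub>endo_ring L\<^esub> l = h \<otimes>\<^bsub>endo_ring L\<^esub> l \<oplus>\<^bsub>endo_ring L\<^esub> k \<otimes>\<^bsub>endo_ring L\<^esub> l"
      by (rule ext[OF mult[OF add[OF h(1,2)] h(3)] add[OF mult[OF h(1,3)] mult[OF h(2,3)]]])
        (simp add: endo_ring_simps cl[OF h(1)] cl[OF h(2)] ad[OF h(3)])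
    show "l \<otimes>\<^bsub>endo_ring L\<^esub> (h \<oplus>\<^bsub>endo_ring L\<^esub> k) = l \<otimes>\<^bsub>endo_ring L\<^esub> h \<oplus>\<^bsub>endo_ring L\<^esub> l \<otimes>\<^bsub>endo_ring L\<^esub> k"
      by (rule ext[OF mult[OF h(3) add[OF h(1,2)]] add[OF mult[OF h(3,1)] mult[OF h(3,2)]]])
        (simp add: endo_ring_simps cl[OF h(3)])
  qed
qed

text \<open>This is a homomorphism and not an antihomomorphism, because a product in
  \<open>endo_ring\<close> applies its left factor first.\<close>

lemma act_map_ring_hom:
  assumes L: "right_module R L"
  shows "act_map L \<in> ring_hom R (endo_ring L)"
proof -
  interpret L: right_module R L by fact
  have c: "act_map L a \<in> carrier (endo_ring L)" if "a \<in> carrier R" for a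
    unfolding act_map_def by (rule endo_restrictI[OF L.M.abelian_group_axioms]) (simp_all add: that L.ract_closed L.ract_add_left)
  show ?thesis
    by (rule ring_hom_memI)
      (use c in \<open>auto simp: act_map_def endo_ring_simps L.ract_closed L.ract_assoc L.ract_add_right L.ract_one fun_eq_iff restrict_def\<close>)
qed

context hereditary_placed
begin

text \<open>Evaluation at each x in \<open>L\<close> reduces torsion-freeness and extension to
  \<open>L\<close>. The extensions chosen for the various x fit together to one endomorphism for
  every q: \<open>e (x + y)\<close> and the sum of \<open>e x\<close> and \<open>e y\<close> agree
  on f(P), hence on Q.\<close>

lemma endo_ring_local:
  assumes L: "local_module R E L"
  shows "local_module R E (restrict_scalars (act_map L) (regular_rmod (endo_ring L)))" (is "local_module R E ?W")
proof -
  note tf = local_module_torsion_free[OF L]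
  interpret L: right_module R L by (rule torsion_free_module[OF tf])
  interpret EL: scalars R "endo_ring L" "act_map L"
    by (intro scalars.intro base_ring endo_ring L.M.abelian_group_axioms act_map_ring_hom L.right_module_axioms)
  have Wm: "right_module R ?W" by (rule EL.restrict_module[OF EL.regular_module])
  have W: "carrier ?W = carrier (endo_ring L)" "\<zero>\<^bsub>?W\<^esub> = restrict (\<lambda>_. \<zero>\<^bsub>L\<^esub>) (carrier L)"
    by (simp_all add: restrict_scalars_simps regular_rmod_simps endo_ring_simps)
  have Wadd: "h \<oplus>\<^bsub>?W\<^esub> k = restrict (\<lambda>x. h x \<oplus>\<^bsub>L\<^esub> k x) (carrier L)"
    and Wact: "h \<star>\<^bsub>?W\<^esub> a = restrict (\<lambda>x. act_map L a (h x)) (carrier L)" for h k a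
    by (simp_all add: restrict_scalars_simps regular_rmod_simps endo_ring_simps)
  have ev: "(\<lambda>h. h x) \<in> rmod_hom R ?W L" if x: "x \<in> carrier L" for x
    by (rule rmod_homI) (use x endo_closed[OF _ x] in \<open>auto simp: W Wadd Wact act_map_def\<close>)
  have ext: "h = k" if "h \<in> carrier (endo_ring L)" "k \<in> carrier (endo_ring L)" "\<And>x. x \<in> carrier L \<Longrightarrow> h x = k x" for h k
    using that by (intro endo_eqI[of h L k]) (simp_all add: endo_carrier)
  show ?thesis
    unfolding local_module_def
  proof (intro conjI ballI allI impI)
    show "torsion_free R E ?W"
    proof (rule torsion_freeI[OF Wm])
      fix A h a assume A: "A \<in> E" and h: "h \<in> rmod_hom R A ?W" and a: "a \<in> carrier A"
      show "h a = \<zero>\<^bsub>?W\<^esub>"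
      proof (rule ext)
        show "h a \<in> carrier (endo_ring L)" using hom_closed[OF h a] by (simp add: W)
        show "\<zero>\<^bsub>?W\<^esub> \<in> carrier (endo_ring L)"
          unfolding W(1)[symmetric] by (rule abelian_monoid.zero_closed[OF abelian_group.axioms(1)[OF right_module_abelian_group[OF Wm]]])
        show "h a x = \<zero>\<^bsub>?W\<^esub> x" if x: "x \<in> carrier L" for x
          using torsion_freeD[OF tf A hom_comp[OF h ev[OF x]] a] x by (simp add: W)
      qed
    qed
    fix A and P Q :: "('r, 'r univ) rmod" and f g c
    assume A: "A \<in> E" and conj: "fg_projective_rmod R P \<and> fg_projective_rmod R Q \<and> short_exact R P f Q g A"
      and c: "c \<in> rmod_hom R P ?W"
    have Pf: "fg_projective_rmod R P" and Qf: "fg_projective_rmod R Q" and se: "short_exact R P f Q g A"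
      using conj by auto
    have Qm: "right_module R Q" using Qf by (simp add: fg_projective_rmod_def projective_rmod_def)
    have f: "f \<in> rmod_hom R P Q" using se by (simp add: short_exact_def)
    have Qq: "quot_in R E Q (f ` carrier P)" by (rule short_exact_quot_in[OF A Qm se])
    have "\<exists>e\<in>rmod_hom R Q L. \<forall>p\<in>carrier P. e (f p) = c p x" if "x \<in> carrier L" for x
      by (rule local_module_extend[OF L A Pf Qf se hom_comp[OF c ev[OF that]]])
    then obtain e where e: "\<And>x. x \<in> carrier L \<Longrightarrow> e x \<in> rmod_hom R Q L"
      "\<And>x p. x \<in> carrier L \<Longrightarrow> p \<in> carrier P \<Longrightarrow> e x (f p) = c p x" by metis
    have cE: "c p \<in> carrier (endo_ring L)" if "p \<in> carrier P" for p using hom_closed[OF c that] by (simp add: W)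
    have e_add: "e (x \<oplus>\<^bsub>L\<^esub> y) q = e x q \<oplus>\<^bsub>L\<^esub> e y q"
      if x: "x \<in> carrier L" and y: "y \<in> carrier L" and q: "q \<in> carrier Q" for x y q
    proof (rule torsion_free_extension_unique[OF tf Qq e(1)[OF L.M.a_closed[OF x y]] L.hom_plus[OF e(1)[OF x] e(1)[OF y]] _ q])
      fix z assume "z \<in> f ` carrier P"
      then obtain p where p: "z = f p" "p \<in> carrier P" by (elim imageE)
      show "e (x \<oplus>\<^bsub>L\<^esub> y) z = e x z \<oplus>\<^bsub>L\<^esub> e y z"
        unfolding p(1) e(2)[OF L.M.a_closed[OF x y] p(2)] e(2)[OF x p(2)] e(2)[OF y p(2)] by (rule endo_add[OF cE[OF p(2)] x y])
    qed
    define G where "G q = restrict (\<lambda>x. e x q) (carrier L)" for q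
    have GE: "G q \<in> carrier (endo_ring L)" if "q \<in> carrier Q" for q
      unfolding G_def by (rule endo_restrictI[OF L.M.abelian_group_axioms]) (simp_all add: that e_add hom_closed[OF e(1)])
    have "G \<in> rmod_hom R Q ?W"
    proof (rule rmod_homI)
      show "G q \<in> carrier ?W" if "q \<in> carrier Q" for q using GE[OF that] by (simp add: W)
      show "G (q \<oplus>\<^bsub>Q\<^esub> q') = G q \<oplus>\<^bsub>?W\<^esub> G q'" if "q \<in> carrier Q" "q' \<in> carrier Q" for q q'
        unfolding Wadd G_def by (rule restrict_ext) (simp add: hom_add[OF e(1)] that)
      show "G (q \<star>\<^bsub>Q\<^esub> a) = G q \<star>\<^bsub>?W\<^esub> a" if "q \<in> carrier Q" "a \<in> carrier R" for q a
        unfolding Wact G_def by (rule restrict_ext) (simp add: hom_act[OF e(1)] that act_map_def hom_closed[OF e(1)])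
    qed
    moreover have "G (f p) = c p" if p: "p \<in> carrier P" for p
      by (rule ext[OF GE[OF hom_closed[OF f p]] cE[OF p]]) (simp add: G_def e(2) p)
    ultimately show "\<exists>e\<in>rmod_hom R Q ?W. \<forall>p\<in>carrier P. e (f p) = c p" by blast
  qed
qed

end

text \<open>An endomorphism is coded by its graph, a pair of sequences being interleaved into a
  single one. A set of sequences is an element of \<open>'r univ\<close>; this is why hulls are
  sought with sequences as elements.\<close>

lemma endo_ring_embeds:
  fixes L :: "('r, nat \<Rightarrow> 'r, 'y) rmod_scheme"
  shows "\<exists>enc :: ((nat \<Rightarrow> 'r) \<Rightarrow> nat \<Rightarrow> 'r) \<Rightarrow> 'r univ. inj_on enc (carrier (endo_ring L))"
proof -
  define c :: "(nat \<Rightarrow> 'r) \<Rightarrow> (nat \<Rightarrow> 'r) \<Rightarrow> nat \<Rightarrow> 'r"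
    where "c v w n = (if even n then v (n div 2) else w (n div 2))" for v w n
  have c: "v = v' \<and> w = w'" if "c v w = c v' w'" for v w v' w'
  proof -
    have "v n = v' n" "w n = w' n" for n
      using fun_cong[OF that, of "2 * n"] fun_cong[OF that, of "2 * n + 1"] by (simp_all add: c_def)
    then show ?thesis by auto
  qed
  have "inj_on (\<lambda>h. (\<lambda>x. c x (h x)) ` carrier L) (carrier (endo_ring L))"
  proof (rule inj_onI)
    fix h k assume h: "h \<in> carrier (endo_ring L)" and k: "k \<in> carrier (endo_ring L)"
      and eq: "(\<lambda>x. c x (h x)) ` carrier L = (\<lambda>x. c x (k x)) ` carrier L"
    show "h = k"
    proof (rule endo_eqI)
      fix x assume "x \<in> carrier L"
      then have "c x (h x) \<in> (\<lambda>x. c x (k x)) ` carrier L" unfolding eq[symmetric] by (rule imageI)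
      then obtain y where "c x (h x) = c y (k y)" by (elim imageE)
      then show "h x = k x" using c by blast
    qed (use h k in \<open>simp_all add: endo_carrier\<close>)
  qed
  then show ?thesis by blast
qed

context placed_scalars
begin

text \<open>Locality makes S' a test ring, so universality gives a ring map from S to S' over R.
  Followed by the inclusion it is an endomorphism of S over R, hence the identity by uniqueness, and
  S lies in S'. As test rings have a prescribed type, both rings are replaced by their copies under
  \<open>Inl\<close>.\<close>

lemma localisation_generated:
  assumes uni: "universal_localisation R E S \<phi>" and S': "ring (S\<lparr>carrier := S'\<rparr>)" "S' \<subseteq> carrier S"
    and im: "\<phi> ` carrier R \<subseteq> S'" and loc: "local_module R E (restrict_scalars \<phi> (regular_rmod (S\<lparr>carrier := S'\<rparr>)))"
  shows "carrier S \<subseteq> S'"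
proof
  interpret S: ring S by (rule S)
  interpret V: placed_scalars R E "S\<lparr>carrier := S'\<rparr>" \<phi>
    by (intro placed_scalars.intro hereditary_placed_axioms scalars.intro base_ring S'(1) ring_hom_memI)
      (use im in \<open>auto simp: \<phi>_mult \<phi>_add \<phi>_one\<close>)
  let ?i = "Inl :: 's \<Rightarrow> 's + 'r univ"
  let ?T = "image_ring ?i (S\<lparr>carrier := S'\<rparr>)" and ?U = "image_ring ?i S" and ?\<psi> = "\<lambda>a. ?i (\<phi> a)"
  have inv: "inverts R E S \<phi>" using uni by (simp add: universal_localisation_def)
  note T = V.inverts_image_ring[OF loc, of ?i, simplified]
  note U = inverts_image_ring[OF inverts_local[OF inv regular_module], of ?i, simplified]
  have u: "\<exists>\<chi>\<in>ring_hom S T. (\<forall>a\<in>carrier R. \<chi> (\<phi> a) = \<psi> a) \<and>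
        (\<forall>\<chi>'\<in>ring_hom S T. (\<forall>a\<in>carrier R. \<chi>' (\<phi> a) = \<psi> a) \<longrightarrow> (\<forall>s\<in>carrier S. \<chi>' s = \<chi> s))"
    if "ring T" "\<psi> \<in> ring_hom R T" "inverts R E T \<psi>" for T :: "('s + 'r univ) ring" and \<psi>
    using uni that unfolding universal_localisation_def by blast
  obtain \<chi> where \<chi>: "\<chi> \<in> ring_hom S ?T" "\<forall>a\<in>carrier R. \<chi> (\<phi> a) = ?\<psi> a"
    using u[OF T] by blast
  have inv1: "inv_into S' ?i (?i x) = x" if "x \<in> S'" for x using that by simp
  have inv2: "inv_into (carrier S) ?i (?i x) = x" if "x \<in> carrier S" for x using that by simp
  have \<chi>S: "\<exists>x\<in>S'. \<chi> s = ?i x" if "s \<in> carrier S" for s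
    using ring_hom_closed[OF \<chi>(1) that] by (auto simp: image_ring_ops)
  have \<chi>U: "\<chi> \<in> ring_hom S ?U"
  proof (rule ring_hom_memI)
    show "\<chi> s \<in> carrier ?U" if "s \<in> carrier S" for s using \<chi>S[OF that] S'(2) by (auto simp: image_ring_ops)
    show "\<chi> (s \<otimes>\<^bsub>S\<^esub> t) = \<chi> s \<otimes>\<^bsub>?U\<^esub> \<chi> t" "\<chi> (s \<oplus>\<^bsub>S\<^esub> t) = \<chi> s \<oplus>\<^bsub>?U\<^esub> \<chi> t"
      if st: "s \<in> carrier S" "t \<in> carrier S" for s t
    proof -
      obtain x y where xy: "x \<in> S'" "\<chi> s = ?i x" "y \<in> S'" "\<chi> t = ?i y" using \<chi>S[OF st(1)] \<chi>S[OF st(2)] by blast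
      have xS: "x \<in> carrier S" "y \<in> carrier S" using S'(2) xy by auto
      show "\<chi> (s \<otimes>\<^bsub>S\<^esub> t) = \<chi> s \<otimes>\<^bsub>?U\<^esub> \<chi> t" "\<chi> (s \<oplus>\<^bsub>S\<^esub> t) = \<chi> s \<oplus>\<^bsub>?U\<^esub> \<chi> t"
        using ring_hom_mult[OF \<chi>(1) st] ring_hom_add[OF \<chi>(1) st]
        by (simp_all add: xy(2,4) image_ring_ops inv1[OF xy(1)] inv1[OF xy(3)] inv2[OF xS(1)] inv2[OF xS(2)])
    qed
    show "\<chi> \<one>\<^bsub>S\<^esub> = \<one>\<^bsub>?U\<^esub>" using ring_hom_one[OF \<chi>(1)] by (simp add: image_ring_ops)
  qed
  have iU: "?i \<in> ring_hom S ?U" by (rule ring_hom_memI) (auto simp: image_ring_ops)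
  fix s assume s: "s \<in> carrier S"
  obtain \<chi>0 where "\<forall>\<chi>'\<in>ring_hom S ?U. (\<forall>a\<in>carrier R. \<chi>' (\<phi> a) = ?\<psi> a) \<longrightarrow> (\<forall>s\<in>carrier S. \<chi>' s = \<chi>0 s)"
    using u[OF U] by blast
  then have "\<chi> s = ?i s" using \<chi>U iU \<chi>(2) s by metis
  then show "s \<in> S'" using \<chi>S[OF s] by auto
qed

text \<open>A local module is acted upon by the localisation: its endomorphism ring receives a map from it.\<close>

lemma localisation_acts:
  fixes L :: "('r, nat \<Rightarrow> 'r) rmod"
  assumes uni: "universal_localisation R E S \<phi>" and L: "local_module R E L"
  shows "\<exists>X :: ('s, nat \<Rightarrow> 'r) rmod. right_module S X \<and> carrier X = carrier L \<and> add X = add L \<and> \<zero>\<^bsub>X\<^esub> = \<zero>\<^bsub>L\<^esub> \<and>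
    (\<forall>x\<in>carrier L. \<forall>a\<in>carrier R. x \<star>\<^bsub>X\<^esub> \<phi> a = x \<star>\<^bsub>L\<^esub> a)"
proof -
  interpret S: ring S by (rule S)
  interpret L: right_module R L by (rule torsion_free_module[OF local_module_torsion_free[OF L]])
  let ?EL = "endo_ring L"
  interpret EL: placed_scalars R E ?EL "act_map L"
    by (intro placed_scalars.intro hereditary_placed_axioms scalars.intro base_ring endo_ring
        L.M.abelian_group_axioms act_map_ring_hom L.right_module_axioms)
  obtain enc :: "((nat \<Rightarrow> 'r) \<Rightarrow> nat \<Rightarrow> 'r) \<Rightarrow> 'r univ" where enc: "inj_on enc (carrier ?EL)"
    using endo_ring_embeds by blast
  \<comment> \<open>The summand \<open>'r univ\<close> of the test type receives the coded
    endomorphisms.\<close>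
  define e :: "((nat \<Rightarrow> 'r) \<Rightarrow> nat \<Rightarrow> 'r) \<Rightarrow> 's + 'r univ" where "e h = Inr (enc h)" for h
  have e: "inj_on e (carrier ?EL)" using enc by (auto simp: e_def inj_on_def)
  let ?T = "image_ring e ?EL"
  have "\<exists>\<chi>\<in>ring_hom S ?T. \<forall>a\<in>carrier R. \<chi> (\<phi> a) = e (act_map L a)"
    using uni EL.inverts_image_ring[OF endo_ring_local[OF L] e] unfolding universal_localisation_def by blast
  then obtain \<chi> where \<chi>: "\<chi> \<in> ring_hom S ?T" "\<And>a. a \<in> carrier R \<Longrightarrow> \<chi> (\<phi> a) = e (act_map L a)" by blast
  define h where "h s = inv_into (carrier ?EL) e (\<chi> s)" for s
  have inv: "inv_into (carrier ?EL) e (e x) = x" if "x \<in> carrier ?EL" for x using e that by simp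
  have c: "\<chi> s \<in> e ` carrier ?EL" if "s \<in> carrier S" for s
    using ring_hom_closed[OF \<chi>(1) that] by (simp add: image_ring_ops)
  have h: "h s \<in> carrier ?EL" if "s \<in> carrier S" for s unfolding h_def by (rule inv_into_into[OF c[OF that]])
  have EL: "ring ?EL" by (rule EL.S)
  interpret ELr: ring ?EL by (rule EL)
  have h_ops: "h (s \<otimes>\<^bsub>S\<^esub> t) = h s \<otimes>\<^bsub>?EL\<^esub> h t" "h (s \<oplus>\<^bsub>S\<^esub> t) = h s \<oplus>\<^bsub>?EL\<^esub> h t"
    if st: "s \<in> carrier S" "t \<in> carrier S" for s t
    using inv[OF ELr.m_closed[OF h[OF st(1)] h[OF st(2)]]] inv[OF ELr.a_closed[OF h[OF st(1)] h[OF st(2)]]]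
      ring_hom_mult[OF \<chi>(1) st] ring_hom_add[OF \<chi>(1) st]
    by (simp_all add: h_def image_ring_ops)
  have h_one: "h \<one>\<^bsub>S\<^esub> = \<one>\<^bsub>?EL\<^esub>"
    using ring_hom_one[OF \<chi>(1)] inv[OF ELr.one_closed] by (simp add: h_def image_ring_ops)
  have h_\<phi>: "h (\<phi> a) = act_map L a" if "a \<in> carrier R" for a
    using \<chi>(2)[OF that] inv[OF EL.\<phi>_closed[OF that]] by (simp add: h_def)
  define X :: "('s, nat \<Rightarrow> 'r) rmod" where "X =
    \<lparr>carrier = carrier L, monoid.mult = (\<lambda>_ _. undefined), one = undefined,
     ring.zero = \<zero>\<^bsub>L\<^esub>, add = add L, ract = (\<lambda>x s. h s x)\<rparr>"
  have Xs: "carrier X = carrier L" "\<zero>\<^bsub>X\<^esub> = \<zero>\<^bsub>L\<^esub>" "add X = add L" "x \<star>\<^bsub>X\<^esub> s = h s x" for x s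
    by (simp_all add: X_def)
  have "right_module S X"
  proof (rule right_moduleI)
    show "\<exists>y\<in>carrier X. y \<oplus>\<^bsub>X\<^esub> x = \<zero>\<^bsub>X\<^esub>" if "x \<in> carrier X" for x
      using that by (intro bexI[of _ "\<ominus>\<^bsub>L\<^esub> x"]) (auto simp: Xs L.M.l_neg)
    show "ring S" by (rule S)
  qed (auto simp: Xs L.M.a_ac endo_closed[OF h] endo_add[OF h] h_ops h_one endo_ring_simps)
  moreover have "x \<star>\<^bsub>X\<^esub> \<phi> a = x \<star>\<^bsub>L\<^esub> a" if "x \<in> carrier L" "a \<in> carrier R" for x a
    using that by (simp add: Xs h_\<phi> act_map_def)
  ultimately show ?thesis using Xs by blast
qed

end

section \<open>The directed union\<close>

text \<open>Isomorphism theorem: (N + G(Y)) / N is the quotient of \<open>Y\<close> by the preimage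
  of \<open>N\<close>. The surjection onto the object sends z + G y to q y.\<close>

lemma (in well_placed) quot_in_sum:
  assumes X: "right_module R X" and N: "rsubmodule R X N" and G: "G \<in> rmod_hom R Y X"
    and Y: "quot_in R E Y {y \<in> carrier Y. G y \<in> N}"
  shows "rsubmodule R X {z \<oplus>\<^bsub>X\<^esub> G y | z y. z \<in> N \<and> y \<in> carrier Y}" (is "rsubmodule R X ?V")
    and "quot_in R E (sub X {z \<oplus>\<^bsub>X\<^esub> G y | z y. z \<in> N \<and> y \<in> carrier Y}) N"
proof -
  interpret X: right_module R X by (rule X)
  interpret Y: right_module R Y by (rule quot_in_module[OF Y])
  interpret N: right_module R "sub X N" by (rule X.right_module_sub[OF N])
  obtain C q where C: "C \<in> E" "right_module R C" and q: "q \<in> rmod_hom R Y C" "q ` carrier Y = carrier C"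
    and ker: "{y \<in> carrier Y. G y \<in> N} = {y \<in> carrier Y. q y = \<zero>\<^bsub>C\<^esub>}"
    using quot_inD[OF Y] by (elim exE conjE) (rule that)
  interpret C: right_module R C by (rule C(2))
  let ?B = "rmod_prod (sub X N) Y" and ?p = "\<lambda>w. fst w \<oplus>\<^bsub>X\<^esub> G (snd w)"
  have B: "right_module R ?B" by (rule rmod_prod_module[OF N.right_module_axioms Y.right_module_axioms])
  have Nc: "\<And>z. z \<in> N \<Longrightarrow> z \<in> carrier X" by (rule rsubmoduleD(5)[OF N])
  have incl: "(\<lambda>x. x) \<in> rmod_hom R (sub X N) X" by (rule hom_sub_dom[OF X.hom_id rsubmoduleD(1)[OF N]])
  have p: "?p \<in> rmod_hom R ?B X" by (rule hom_copair[OF X incl G])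
  have V: "?V = ?p ` carrier ?B" unfolding rmod_prod_simps sub_simps image_def by force
  show Vs: "rsubmodule R X ?V" unfolding V by (rule rsubmodule_image_carrier[OF B X p])
  interpret V: right_module R "sub X ?V" by (rule X.right_module_sub[OF Vs])
  have pV: "?p \<in> rmod_hom R ?B (sub X ?V)" by (rule hom_sub_cod[OF p]) (simp only: V)
  have kp: "q (snd w) = \<zero>\<^bsub>C\<^esub>" if w: "w \<in> carrier ?B" and z: "?p w = \<zero>\<^bsub>sub X ?V\<^esub>" for w
  proof -
    have wN: "fst w \<in> N" "snd w \<in> carrier Y" using w by (auto simp: rmod_prod_simps)
    have c: "fst w \<in> carrier X" "G (snd w) \<in> carrier X" using Nc[OF wN(1)] hom_closed[OF G wN(2)] by auto
    have "G (snd w) \<oplus>\<^bsub>X\<^esub> fst w = \<zero>\<^bsub>X\<^esub>" using z c by (simp add: X.M.a_comm)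
    then have "G (snd w) = \<ominus>\<^bsub>X\<^esub> fst w" using X.M.minus_equality c by simp
    then have "G (snd w) \<in> N" using X.rsubmodule_a_inv[OF N wN(1)] by simp
    then have "snd w \<in> {y \<in> carrier Y. G y \<in> N}" using wN(2) by simp
    then show ?thesis unfolding ker by simp
  qed
  obtain g where g: "g \<in> rmod_hom R (sub X ?V) C" "\<forall>w\<in>carrier ?B. g (?p w) = q (snd w)"
    using hom_factor[OF B V.right_module_axioms C(2) pV _ hom_comp[OF hom_snd q(1)] kp] V by auto
  have gp: "g (z \<oplus>\<^bsub>X\<^esub> G y) = q y" if "z \<in> N" "y \<in> carrier Y" for z y
    using g(2) that by (auto simp: rmod_prod_simps)
  have "g ` carrier (sub X ?V) = carrier C"
  proof
    show "g ` carrier (sub X ?V) \<subseteq> carrier C" using hom_closed[OF g(1)] by (rule image_subsetI)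
    show "carrier C \<subseteq> g ` carrier (sub X ?V)"
    proof
      fix a assume "a \<in> carrier C"
      then have "a \<in> q ` carrier Y" using q(2) by simp
      then obtain y where y: "a = q y" "y \<in> carrier Y" by (elim imageE)
      have v: "\<zero>\<^bsub>X\<^esub> \<oplus>\<^bsub>X\<^esub> G y \<in> carrier (sub X ?V)" unfolding sub_simps using rsubmoduleD(2)[OF N] y(2) by blast
      then show "a \<in> g ` carrier (sub X ?V)"
        using imageI[of _ _ g, OF v] unfolding gp[OF rsubmoduleD(2)[OF N] y(2)] y(1) by (simp only:)
    qed
  qed
  moreover have "N = {v \<in> carrier (sub X ?V). g v = \<zero>\<^bsub>C\<^esub>}"
  proof (intro equalityI subsetI)
    fix z assume z: "z \<in> N"
    have z0: "z \<oplus>\<^bsub>X\<^esub> G \<zero>\<^bsub>Y\<^esub> = z"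
      using hom_zero[OF Y.M.abelian_group_axioms X.M.abelian_group_axioms G] Nc[OF z] by simp
    have "z \<oplus>\<^bsub>X\<^esub> G \<zero>\<^bsub>Y\<^esub> \<in> ?V" using z Y.M.zero_closed by blast
    then have "z \<in> ?V" unfolding z0 .
    moreover have "g z = \<zero>\<^bsub>C\<^esub>"
      using gp[OF z Y.M.zero_closed] hom_zero[OF Y.M.abelian_group_axioms C.M.abelian_group_axioms q(1)] unfolding z0 by simp
    ultimately show "z \<in> {v \<in> carrier (sub X ?V). g v = \<zero>\<^bsub>C\<^esub>}" by simp
  next
    fix v assume "v \<in> {v \<in> carrier (sub X ?V). g v = \<zero>\<^bsub>C\<^esub>}"
    then have v: "v \<in> ?V" "g v = \<zero>\<^bsub>C\<^esub>" unfolding sub_simps by auto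
    obtain z y where zy: "v = z \<oplus>\<^bsub>X\<^esub> G y" "z \<in> N" "y \<in> carrier Y" using v(1) by blast
    have "y \<in> {y \<in> carrier Y. q y = \<zero>\<^bsub>C\<^esub>}" using gp[OF zy(2,3)] v(2) zy by simp
    then have "G y \<in> N" unfolding ker[symmetric] by simp
    then show "v \<in> N" unfolding zy(1) by (rule rsubmoduleD(3)[OF N zy(2)])
  qed
  ultimately show "quot_in R E (sub X ?V) N"
    unfolding quot_in_def using V.right_module_axioms C(1) g(1) by blast
qed

text \<open>A local module \<open>X\<close> over \<open>M\<close> that maps to a hull of \<open>M\<close>. The map need not be injective, but on
  submodules torsion modulo \<open>M\<close> it is, because both modules are torsion-free.\<close>

locale hull_map = hereditary_placed R E
  for R :: "('r, 'k) ring_scheme" and E :: "('r, 'r univ) rmod set" +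
  fixes X :: "('r, 'x, 'y) rmod_scheme" and M :: "('r, 'm, 'z) rmod_scheme" and \<iota> :: "'m \<Rightarrow> 'x"
    and L :: "('r, 'l, 'w) rmod_scheme" and \<kappa> :: "'m \<Rightarrow> 'l" and \<Theta> :: "'x \<Rightarrow> 'l"
  assumes local_X: "local_module R E X" and M: "right_module R M"
    and \<iota>: "\<iota> \<in> rmod_hom R M X" "inj_on \<iota> (carrier M)" and hull: "hull_of M L \<kappa>"
    and \<Theta>: "\<Theta> \<in> rmod_hom R X L" "\<And>x. x \<in> carrier M \<Longrightarrow> \<Theta> (\<iota> x) = \<kappa> x"
begin

abbreviation base :: "'x set" where "base \<equiv> \<iota> ` carrier M"

text \<open>These are the submodules M_t of the claim, with \<open>M\<close> identified with its
  image \<open>base\<close>.\<close>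

definition layers :: "'x set set"
  where "layers = {N. rsubmodule R X N \<and> base \<subseteq> N \<and> quot_in R E (sub X N) base}"

lemma X: "right_module R X"
  by (rule torsion_free_module[OF local_module_torsion_free[OF local_X]])

lemma base: "rsubmodule R X base"
  by (rule rsubmodule_image_carrier[OF M X \<iota>(1)])

lemma layersD:
  assumes "N \<in> layers"
  shows "rsubmodule R X N" "base \<subseteq> N" "quot_in R E (sub X N) base"
  using assms by (simp_all add: layers_def)

lemma bij_inverse:
  assumes "j \<in> rmod_hom R M Z" "inj_on j (carrier M)" "right_module R Z" "h \<in> rmod_hom R A Z"
    "\<And>a. a \<in> carrier A \<Longrightarrow> h a \<in> j ` carrier M"
  shows "(\<lambda>a. inv_into (carrier M) j (h a)) \<in> rmod_hom R A M"
proof -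
  have j: "j \<in> rmod_hom R M (sub Z (j ` carrier M))" by (rule hom_sub_cod[OF assms(1)]) simp
  have "inv_into (carrier M) j \<in> rmod_hom R (sub Z (j ` carrier M)) M"
    by (rule inverse_hom[OF M j]) (use assms(2) in \<open>simp add: bij_betw_def\<close>)
  moreover have "h \<in> rmod_hom R A (sub Z (j ` carrier M))"
    by (rule hom_sub_cod[OF assms(4)]) (use assms(5) in blast)
  ultimately show ?thesis by (rule hom_comp[rotated])
qed

text \<open>The preimage of \<open>base\<close> under \<open>G\<close> equals the preimage D of
  \<kappa>(M) under the composite of \<open>G\<close> and \<open>\<Theta>\<close>. It is contained
  in D since \<open>\<Theta>\<close> extends \<kappa>. On D, both \<open>G\<close> and the map
  through \<open>b\<close> and \<iota> go to the torsion-free \<open>X\<close> and agree on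
  \<open>Y0\<close>; as D / Y0 is in \<open>E\<close>, they are equal. Finally Y / D is in
  \<open>E\<close>, so base + G(Y) is a layer.\<close>

lemma layer_containing:
  assumes Y: "quot_in R E Y Y0" and G: "G \<in> rmod_hom R Y X" and G0: "\<And>y. y \<in> Y0 \<Longrightarrow> G y \<in> base"
  shows "\<exists>V\<in>layers. \<forall>y\<in>carrier Y. G y \<in> V"
proof -
  interpret X: right_module R X by (rule X)
  interpret Y: right_module R Y by (rule quot_in_module[OF Y])
  have Y0: "rsubmodule R Y Y0" by (rule quot_in_rsubmodule[OF Y])
  have \<kappa>: "\<kappa> \<in> rmod_hom R M L" "inj_on \<kappa> (carrier M)" and Ll: "local_module R E L" using hull by (auto simp: hull_of_def)
  note Lm = torsion_free_module[OF local_module_torsion_free[OF Ll]]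
  define c where "c y = inv_into (carrier M) \<iota> (G y)" for y
  have c: "c \<in> rmod_hom R (sub Y Y0) M"
    unfolding c_def by (rule bij_inverse[OF \<iota> X hom_sub_dom[OF G rsubmoduleD(1)[OF Y0]]]) (use G0 in simp)
  have \<iota>c: "\<iota> (c y) = G y" "c y \<in> carrier M" if "G y \<in> base" for y
    unfolding c_def using that by (rule f_inv_into_f, rule inv_into_into)
  have H: "(\<lambda>y. \<Theta> (G y)) \<in> rmod_hom R Y L" by (rule hom_comp[OF G \<Theta>(1)])
  have H0: "\<Theta> (G y) = \<kappa> (c y)" if "y \<in> Y0" for y
    using \<Theta>(2)[OF \<iota>c(2)[OF G0[OF that]]] \<iota>c(1)[OF G0[OF that]] by simp
  let ?D = "{y \<in> carrier Y. \<Theta> (G y) \<in> \<kappa> ` carrier M}"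
  note D = hull_preimage[OF hull M Y c H H0]
  have Ds: "rsubmodule R Y ?D" by (rule quot_in_rsubmodule[OF D(2)])
  define b where "b y = inv_into (carrier M) \<kappa> (\<Theta> (G y))" for y
  have b: "b \<in> rmod_hom R (sub Y ?D) M"
    unfolding b_def by (rule bij_inverse[OF \<kappa> Lm hom_sub_dom[OF H rsubmoduleD(1)[OF Ds]]]) simp
  have bc: "b y = c y" if "y \<in> Y0" for y
    unfolding b_def H0[OF that] by (rule inv_into_f_f[OF \<kappa>(2) \<iota>c(2)[OF G0[OF that]]])
  have G_eq: "G y = \<iota> (b y)" if y: "y \<in> ?D" for y
  proof (rule torsion_free_extension_unique[OF local_module_torsion_free[OF local_X] D(1)
        hom_sub_dom[OF G rsubmoduleD(1)[OF Ds]] hom_comp[OF b \<iota>(1)]])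
    show "G z = \<iota> (b z)" if "z \<in> Y0" for z unfolding bc[OF that] by (rule \<iota>c(1)[OF G0[OF that], symmetric])
    show "y \<in> carrier (sub Y ?D)" unfolding sub_simps by (rule y)
  qed
  have "?D = {y \<in> carrier Y. G y \<in> base}"
  proof (intro equalityI subsetI)
    fix y assume y: "y \<in> ?D"
    have "b y \<in> carrier M" using hom_closed[OF b] y unfolding sub_simps by blast
    then show "y \<in> {y \<in> carrier Y. G y \<in> base}" using G_eq[OF y] y by simp
  next
    fix y assume "y \<in> {y \<in> carrier Y. G y \<in> base}"
    then have y: "y \<in> carrier Y" "G y \<in> base" by auto
    have "\<Theta> (G y) = \<kappa> (c y)" using \<Theta>(2)[OF \<iota>c(2)[OF y(2)]] \<iota>c(1)[OF y(2)] by simp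
    then show "y \<in> ?D" using y(1) \<iota>c(2)[OF y(2)] by simp
  qed
  then have q: "quot_in R E Y {y \<in> carrier Y. G y \<in> base}" using D(2) by simp
  let ?V = "{z \<oplus>\<^bsub>X\<^esub> G y | z y. z \<in> base \<and> y \<in> carrier Y}"
  note V = quot_in_sum[OF X base G q]
  have "z \<in> ?V" if "z \<in> base" for z
  proof -
    have "z \<oplus>\<^bsub>X\<^esub> G \<zero>\<^bsub>Y\<^esub> = z"
      using hom_zero[OF Y.M.abelian_group_axioms X.M.abelian_group_axioms G] rsubmoduleD(5)[OF base that] by simp
    then show ?thesis using that Y.M.zero_closed by (metis (mono_tags, lifting) mem_Collect_eq)
  qed
  then have "?V \<in> layers" unfolding layers_def using V by blast
  moreover have "G y \<in> ?V" if "y \<in> carrier Y" for y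
  proof -
    have "\<zero>\<^bsub>X\<^esub> \<oplus>\<^bsub>X\<^esub> G y = G y" using hom_closed[OF G that] by simp
    then show ?thesis using rsubmoduleD(2)[OF base] that by (metis (mono_tags, lifting) mem_Collect_eq)
  qed
  ultimately show ?thesis by blast
qed

lemma base_layer: "base \<in> layers"
  using base quot_in_carrier[OF right_module.right_module_sub[OF X base]] by (simp add: layers_def)

text \<open>\<open>layer_containing\<close> is applied to addition on the product of the two
  layers.\<close>

lemma layers_directed:
  assumes N: "N1 \<in> layers" "N2 \<in> layers"
  shows "\<exists>V\<in>layers. N1 \<subseteq> V \<and> N2 \<subseteq> V"
proof -
  interpret X: right_module R X by (rule X)
  note n = layersD[OF N(1)] layersD[OF N(2)]
  have incl: "(\<lambda>x. x) \<in> rmod_hom R (sub X K) X" if "rsubmodule R X K" for K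
    by (rule hom_sub_dom[OF X.hom_id rsubmoduleD(1)[OF that]])
  note G = hom_copair[OF X incl[OF n(1)] incl[OF n(4)]]
  have "fst w \<oplus>\<^bsub>X\<^esub> snd w \<in> base" if "w \<in> base \<times> base" for w
    using that rsubmoduleD(3)[OF base, of "fst w" "snd w"] unfolding mem_Times_iff by simp
  then obtain V where V: "V \<in> layers" "\<forall>w\<in>carrier (rmod_prod (sub X N1) (sub X N2)). fst w \<oplus>\<^bsub>X\<^esub> snd w \<in> V"
    using layer_containing[OF quot_in_prod[OF n(3,6)] G] by blast
  have "x \<in> V" if "x \<in> N1" for x
    using bspec[OF V(2), of "(x, \<zero>\<^bsub>X\<^esub>)"] that rsubmoduleD(2)[OF n(4)] rsubmoduleD(5)[OF n(1) that]
    by (simp add: rmod_prod_simps)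
  moreover have "x \<in> V" if "x \<in> N2" for x
    using bspec[OF V(2), of "(\<zero>\<^bsub>X\<^esub>, x)"] that rsubmoduleD(2)[OF n(1)] rsubmoduleD(5)[OF n(4) that]
    by (simp add: rmod_prod_simps)
  ultimately show ?thesis using V(1) by blast
qed

lemma layers_finite:
  "finite B \<Longrightarrow> B \<subseteq> \<Union>layers \<Longrightarrow> \<exists>V\<in>layers. B \<subseteq> V"
proof (induction B rule: finite_induct)
  case empty
  show ?case using base_layer by blast
next
  case (insert x B)
  have "B \<subseteq> \<Union>layers" "x \<in> \<Union>layers" using insert.prems by simp_all
  obtain V where V: "V \<in> layers" "B \<subseteq> V" using insert.IH[OF \<open>B \<subseteq> \<Union>layers\<close>] by (elim bexE) (rule that)
  obtain N where N: "N \<in> layers" "x \<in> N" using \<open>x \<in> \<Union>layers\<close> by (elim UnionE)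
  obtain W where W: "W \<in> layers" "V \<subseteq> W" "N \<subseteq> W" using layers_directed[OF V(1) N(1)] by blast
  have "insert x B \<subseteq> W" using subset_trans[OF V(2) W(2)] subsetD[OF W(3) N(2)] by simp
  then show ?case using W(1) by (rule rev_bexI[rotated])
qed

lemma rsubmodule_union: "rsubmodule R X (\<Union>layers)"
proof -
  interpret X: right_module R X by (rule X)
  show ?thesis
  proof (rule X.rsubmoduleI)
    show "\<Union>layers \<subseteq> carrier X" by (intro Union_least) (rule rsubmoduleD(1)[OF layersD(1)])
    show "\<zero>\<^bsub>X\<^esub> \<in> \<Union>layers" using base_layer rsubmoduleD(2)[OF base] by (rule UnionI)
    show "x \<star>\<^bsub>X\<^esub> a \<in> \<Union>layers" if x: "x \<in> \<Union>layers" and a: "a \<in> carrier R" for x a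
    proof -
      obtain N where N: "N \<in> layers" "x \<in> N" using x by (elim UnionE)
      show ?thesis using N(1) rsubmoduleD(4)[OF layersD(1)[OF N(1)] N(2) a] by (rule UnionI)
    qed
    show "x \<oplus>\<^bsub>X\<^esub> y \<in> \<Union>layers" if "x \<in> \<Union>layers" "y \<in> \<Union>layers" for x y
    proof -
      obtain V where V: "V \<in> layers" "{x, y} \<subseteq> V" using layers_finite[of "{x, y}"] \<open>x \<in> \<Union>layers\<close> \<open>y \<in> \<Union>layers\<close> by auto
      have "x \<in> V" "y \<in> V" using V(2) by simp_all
      show ?thesis using V(1) rsubmoduleD(3)[OF layersD(1)[OF V(1)] \<open>x \<in> V\<close> \<open>y \<in> V\<close>] by (rule UnionI)
    qed
  qed
qed

text \<open>A map from the finitely generated P to the union lands in one layer N. It extends to Q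
  with values in \<open>X\<close>; \<open>layer_containing\<close>, applied to the pushout of N
  modulo \<open>base\<close> with Q along P, then puts these values into a single layer.\<close>

lemma local_union: "local_module R E (sub X (\<Union>layers))"
  unfolding local_module_def
proof (intro conjI ballI allI impI)
  interpret X: right_module R X by (rule X)
  note tf = local_module_torsion_free[OF local_X] and U = rsubmodule_union
  have incl: "(\<lambda>x. x) \<in> rmod_hom R (sub X K) X" if "rsubmodule R X K" for K
    by (rule hom_sub_dom[OF X.hom_id rsubmoduleD(1)[OF that]])
  show "torsion_free R E (sub X (\<Union>layers))"
    by (rule torsion_free_embed[OF tf X.right_module_sub[OF U] incl[OF U]]) simp
  fix A and P Q :: "('r, 'r univ) rmod" and f g c
  assume A: "A \<in> E" and conj: "fg_projective_rmod R P \<and> fg_projective_rmod R Q \<and> short_exact R P f Q g A"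
    and c: "c \<in> rmod_hom R P (sub X (\<Union>layers))"
  have Pf: "fg_projective_rmod R P" and Qf: "fg_projective_rmod R Q" and se: "short_exact R P f Q g A"
    using conj by auto
  have Qm: "right_module R Q" using Qf by (simp add: fg_projective_rmod_def projective_rmod_def)
  have Pm: "right_module R P" using Pf by (simp add: fg_projective_rmod_def projective_rmod_def)
  interpret Q: right_module R Q by (rule Qm)
  have Qq: "quot_in R E Q (f ` carrier P)" by (rule short_exact_quot_in[OF A Qm se])
  have cX: "c \<in> rmod_hom R P X" by (rule hom_sub_incl[OF c rsubmoduleD(1)[OF U]])
  obtain B where B: "finite B" "B \<subseteq> carrier P" "carrier P = rspan R P B"
    using Pf by (auto simp: fg_projective_rmod_def fin_gen_def)
  have "c b \<in> \<Union>layers" if "b \<in> B" for b using hom_closed[OF c subsetD[OF B(2) that]] unfolding sub_simps .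
  then obtain N where N: "N \<in> layers" "c ` B \<subseteq> N" using layers_finite[of "c ` B"] B(1) by auto
  note n = layersD[OF N(1)]
  interpret N: right_module R "sub X N" by (rule X.right_module_sub[OF n(1)])
  have "rspan R P B \<subseteq> {p \<in> carrier P. c p \<in> N}"
    by (rule right_module.rspan_least[OF Pm rsubmodule_vimage[OF Pm X cX n(1)]]) (use B(2) N(2) in auto)
  then have cN: "c p \<in> N" if "p \<in> carrier P" for p using that unfolding B(3)[symmetric] by auto
  obtain e where e: "e \<in> rmod_hom R Q X" "\<forall>p\<in>carrier P. e (f p) = c p"
    using local_module_extend[OF local_X A Pf Qf se cX] by (elim bexE) (rule that)
  have eN: "e \<in> rmod_hom R (sub Q (f ` carrier P)) (sub X N)"
    by (rule hom_sub_cod[OF hom_sub_dom[OF e(1) rsubmoduleD(1)[OF quot_in_rsubmodule[OF Qq]]]]) (use e(2) cN in auto)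
  have "\<exists>V\<in>layers. \<forall>w\<in>carrier (rmod_prod (sub X N) Q). fst w \<oplus>\<^bsub>X\<^esub> e (snd w) \<in> V"
    by (rule layer_containing[OF quot_in_pushout[OF n(3) Qq eN] hom_copair[OF X incl[OF n(1)] e(1)]]) simp
  then obtain V where V: "V \<in> layers" "\<forall>w\<in>carrier (rmod_prod (sub X N) Q). fst w \<oplus>\<^bsub>X\<^esub> e (snd w) \<in> V"
    by (elim bexE) (rule that)
  have eV: "e q \<in> \<Union>layers" if "q \<in> carrier Q" for q
  proof (rule UnionI[OF V(1)])
    show "e q \<in> V" using bspec[OF V(2), of "(\<zero>\<^bsub>X\<^esub>, q)"] that rsubmoduleD(2)[OF n(1)] hom_closed[OF e(1) that]
      by (simp add: rmod_prod_simps)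
  qed
  have "e \<in> rmod_hom R Q (sub X (\<Union>layers))" by (rule hom_sub_cod[OF e(1)]) (rule image_subsetI[OF eV])
  with e(2) show "\<exists>e\<in>rmod_hom R Q (sub X (\<Union>layers)). \<forall>p\<in>carrier P. e (f p) = c p" by (rule bexI)
qed

end

section \<open>The canonical map\<close>

context placed_scalars
begin

text \<open>\<open>localisation_acts\<close> makes \<open>L\<close> an S-module, so
  \<open>\<kappa>\<close> factors through M \<otimes> S by adjunction.\<close>

lemma canonical_lift:
  fixes L :: "('r, nat \<Rightarrow> 'r) rmod"
  assumes uni: "universal_localisation R E S \<phi>" and M: "right_module R M"
    and L: "local_module R E L" and \<kappa>: "\<kappa> \<in> rmod_hom R M L"
  shows "\<exists>\<Theta>\<in>rmod_hom R (restrict_scalars \<phi> (ten M)) L. \<forall>x\<in>carrier M. \<Theta> (pure M x \<one>\<^bsub>S\<^esub>) = \<kappa> x"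
proof -
  interpret S: ring S by (rule S)
  obtain X :: "('s, nat \<Rightarrow> 'r) rmod" where X: "right_module S X" "carrier X = carrier L" "add X = add L"
    "\<forall>x\<in>carrier L. \<forall>a\<in>carrier R. x \<star>\<^bsub>X\<^esub> \<phi> a = x \<star>\<^bsub>L\<^esub> a"
    using localisation_acts[OF uni L] by (elim exE conjE) (rule that)
  interpret X: right_module S X by (rule X(1))
  have "\<kappa> \<in> rmod_hom R M (restrict_scalars \<phi> X)"
    by (rule rmod_homI) (use \<kappa> X(2-4) in \<open>simp_all add: restrict_scalars_simps hom_closed hom_add hom_act\<close>)
  then obtain \<Theta> where \<Theta>: "\<Theta> \<in> rmod_hom S (ten M) X" "\<forall>x\<in>carrier M. \<forall>s\<in>carrier S. \<Theta> (pure M x s) = \<kappa> x \<star>\<^bsub>X\<^esub> s"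
    using ten_adjoint[OF M X(1)] by blast
  have "\<Theta> \<in> rmod_hom R (restrict_scalars \<phi> (ten M)) L"
    by (rule rmod_homI)
      (use hom_closed[OF \<Theta>(1)] hom_add[OF \<Theta>(1)] hom_act[OF \<Theta>(1)] X(2-4) in \<open>simp_all add: restrict_scalars_simps \<phi>_closed\<close>)
  moreover have "\<Theta> (pure M x \<one>\<^bsub>S\<^esub>) = \<kappa> x" if x: "x \<in> carrier M" for x
    using \<Theta>(2) x X.ract_one[of "\<kappa> x"] hom_closed[OF \<kappa> x] X(2) by simp
  ultimately show ?thesis by blast
qed

text \<open>The torsion part T dies in M \<otimes> S, which is local and so torsion-free. Conversely
  M / T embeds in a hull \<open>L\<close>, and the map from M to \<open>L\<close> factors through M
  \<otimes> S; an element that dies there is zero in M / T.\<close>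

lemma canonical_kernel:
  fixes M :: "('r, 'm, 'z) rmod_scheme"
  assumes uni: "universal_localisation R E S \<phi>" and M: "right_module R M"
    and small: "carrier M \<lesssim> (UNIV :: (nat \<Rightarrow> 'r) set)"
  shows "{x \<in> carrier M. pure M x \<one>\<^bsub>S\<^esub> = \<zero>\<^bsub>ten M\<^esub>} = torsion_part R E M"
proof (intro equalityI subsetI)
  interpret M: right_module R M by (rule M)
  let ?T = "torsion_part R E M" and ?X = "restrict_scalars \<phi> (ten M)"
  have inv: "inverts R E S \<phi>" using uni by (simp add: universal_localisation_def)
  note T = rsubmodule_torsion_part[OF M]
  note Xl = inverts_local[OF inv ten_module[OF M]]
  {
    fix x assume x: "x \<in> ?T"
    show "x \<in> {x \<in> carrier M. pure M x \<one>\<^bsub>S\<^esub> = \<zero>\<^bsub>ten M\<^esub>}"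
      using torsion_part_least[OF local_module_torsion_free[OF Xl] M canonical_hom[OF M] x] rsubmoduleD(5)[OF T x]
      by (simp add: restrict_scalars_simps)
  next
    fix x assume "x \<in> {x \<in> carrier M. pure M x \<one>\<^bsub>S\<^esub> = \<zero>\<^bsub>ten M\<^esub>}"
    then have x: "x \<in> carrier M" "pure M x \<one>\<^bsub>S\<^esub> = \<zero>\<^bsub>ten M\<^esub>" by auto
    let ?Q = "rquot M ?T" and ?c = "a_r_coset M ?T"
    note r = M.rquot_facts[OF T]
    have "carrier ?Q \<lesssim> (UNIV :: (nat \<Rightarrow> 'r) set)"
      unfolding r(3)[symmetric] by (rule lepoll_trans[OF image_lepoll small])
    then obtain L :: "('r, nat \<Rightarrow> 'r) rmod" and \<kappa> where h: "hull_of ?Q L \<kappa>"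
      using hull_exists[OF torsion_free_rquot_torsion_part[OF M]] by blast
    have L: "local_module R E L" and \<kappa>: "\<kappa> \<in> rmod_hom R ?Q L" "inj_on \<kappa> (carrier ?Q)"
      using h by (auto simp: hull_of_def)
    note Lm = torsion_free_module[OF local_module_torsion_free[OF L]]
    obtain \<Theta> where \<Theta>: "\<Theta> \<in> rmod_hom R ?X L" "\<forall>x\<in>carrier M. \<Theta> (pure M x \<one>\<^bsub>S\<^esub>) = \<kappa> (?c x)"
      using canonical_lift[OF uni M L hom_comp[OF r(2) \<kappa>(1)]] by (elim bexE) (rule that)
    have "\<kappa> (?c x) = \<Theta> \<zero>\<^bsub>ten M\<^esub>" using bspec[OF \<Theta>(2) x(1)] unfolding x(2) by (rule sym)
    also have "\<dots> = \<zero>\<^bsub>L\<^esub>"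
      using hom_zero[OF right_module_abelian_group[OF torsion_free_module[OF local_module_torsion_free[OF Xl]]]
          right_module_abelian_group[OF Lm] \<Theta>(1)] by (simp add: restrict_scalars_simps)
    finally have "?c x = \<zero>\<^bsub>?Q\<^esub>"
      using \<kappa>(2) hom_closed[OF r(2) x(1)] unfolding hom_inj_iff[OF r(1) Lm \<kappa>(1)] by blast
    then show "x \<in> ?T" using r(4)[OF x(1)] by simp
  }
qed

text \<open>The elements of \<open>S\<close> that preserve a local submodule form a local subring, hence all of \<open>S\<close>.\<close>

lemma local_submodule_stable:
  assumes uni: "universal_localisation R E S \<phi>" and X: "right_module S X"
    and U: "rsubmodule R (restrict_scalars \<phi> X) U" and loc: "local_module R E (sub (restrict_scalars \<phi> X) U)"
    and x: "x \<in> U" and s: "s \<in> carrier S"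
  shows "x \<star>\<^bsub>X\<^esub> s \<in> U"
proof -
  interpret S: ring S by (rule S)
  interpret X: right_module S X by (rule X)
  let ?X = "restrict_scalars \<phi> X" and ?W = "restrict_scalars \<phi> (regular_rmod S)"
  have Xm: "right_module R ?X" by (rule restrict_module[OF X])
  interpret XR: right_module R ?X by (rule Xm)
  have inv: "inverts R E S \<phi>" using uni by (simp add: universal_localisation_def)
  note tf = local_module_torsion_free[OF inverts_local[OF inv X]]
  note W = inverts_local[OF inv regular_module]
  have Uc: "x \<in> carrier X" if "x \<in> U" for x using rsubmoduleD(5)[OF U that] by (simp add: restrict_scalars_simps)
  have Ua: "x \<oplus>\<^bsub>X\<^esub> y \<in> U" if "x \<in> U" "y \<in> U" for x y
    using rsubmoduleD(3)[OF U that] by (simp add: restrict_scalars_simps)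
  have Uact: "x \<star>\<^bsub>X\<^esub> \<phi> a \<in> U" if "x \<in> U" "a \<in> carrier R" for x a
    using rsubmoduleD(4)[OF U that] by (simp add: restrict_scalars_simps)
  \<comment> \<open>Negation in \<open>X\<close> and in its restriction to R belongs to two records
    with the same addition; uniqueness of inverses identifies the two.\<close>
  have Um: "\<ominus>\<^bsub>X\<^esub> x \<in> U" if "x \<in> U" for x
    using Uact[OF that, of "\<ominus>\<^bsub>R\<^esub> \<one>\<^bsub>R\<^esub>"] XR.ract_minus_one[of x] XR.rsubmodule_a_inv[OF U that]
      X.M.minus_equality[of _ x] XR.M.l_neg[of x] XR.M.a_inv_closed[of x] Uc[OF that]
    by (simp add: restrict_scalars_simps)
  define S' where "S' = {s \<in> carrier S. \<forall>x\<in>U. x \<star>\<^bsub>X\<^esub> s \<in> U}"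
  have "subring S' S"
  proof (rule S.subringI)
    fix h assume h: "h \<in> S'"
    have "x \<star>\<^bsub>X\<^esub> (\<ominus>\<^bsub>S\<^esub> h) \<in> U" if "x \<in> U" for x
    proof -
      have "x \<star>\<^bsub>X\<^esub> (\<ominus>\<^bsub>S\<^esub> h) \<oplus>\<^bsub>X\<^esub> x \<star>\<^bsub>X\<^esub> h = \<zero>\<^bsub>X\<^esub>"
        using X.ract_add_right[of x "\<ominus>\<^bsub>S\<^esub> h" h] h Uc[OF that] by (simp add: S'_def S.l_neg X.ract_zero)
      then have "x \<star>\<^bsub>X\<^esub> (\<ominus>\<^bsub>S\<^esub> h) = \<ominus>\<^bsub>X\<^esub> (x \<star>\<^bsub>X\<^esub> h)"
        using X.M.minus_equality X.ract_closed Uc[OF that] h by (simp add: S'_def)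
      then show ?thesis using Um h that by (simp add: S'_def)
    qed
    then show "\<ominus>\<^bsub>S\<^esub> h \<in> S'" using h by (simp add: S'_def)
  next
    fix h k assume "h \<in> S'" "k \<in> S'"
    then show "h \<otimes>\<^bsub>S\<^esub> k \<in> S'" "h \<oplus>\<^bsub>S\<^esub> k \<in> S'"
      using Uc Ua by (simp_all add: S'_def X.ract_assoc X.ract_add_right)
  qed (use Uc in \<open>auto simp: S'_def X.ract_one\<close>)
  then have S': "ring (S\<lparr>carrier := S'\<rparr>)" by (rule S.subring_is_ring)
  have im: "\<phi> ` carrier R \<subseteq> S'" using Uact \<phi>_closed by (auto simp: S'_def)
  interpret V: scalars R "S\<lparr>carrier := S'\<rparr>" \<phi>
    by (intro scalars.intro base_ring S' ring_hom_memI) (use im in \<open>auto simp: \<phi>_mult \<phi>_add \<phi>_one\<close>)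
  let ?W' = "restrict_scalars \<phi> (regular_rmod (S\<lparr>carrier := S'\<rparr>))"
  have W'm: "right_module R ?W'" by (rule V.restrict_module[OF V.regular_module])
  have incl: "(\<lambda>s. s) \<in> rmod_hom R ?W' ?W"
    by (rule rmod_homI) (auto simp: restrict_scalars_simps regular_rmod_simps S'_def)
  have "local_module R E ?W'"
    unfolding local_module_def
  proof (intro conjI ballI allI impI)
    show "torsion_free R E ?W'"
      by (rule torsion_free_embed[OF local_module_torsion_free[OF W] W'm incl]) (simp add: restrict_scalars_simps regular_rmod_simps)
    fix A and P Q :: "('r, 'r univ) rmod" and f g c
    assume A: "A \<in> E" and conj: "fg_projective_rmod R P \<and> fg_projective_rmod R Q \<and> short_exact R P f Q g A"
      and c: "c \<in> rmod_hom R P ?W'"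
    have Pf: "fg_projective_rmod R P" and Qf: "fg_projective_rmod R Q" and se: "short_exact R P f Q g A"
      using conj by auto
    have Qm: "right_module R Q" using Qf by (simp add: fg_projective_rmod_def projective_rmod_def)
    have Qq: "quot_in R E Q (f ` carrier P)" by (rule short_exact_quot_in[OF A Qm se])
    obtain e where e: "e \<in> rmod_hom R Q ?W" "\<forall>p\<in>carrier P. e (f p) = c p"
      using local_module_extend[OF W A Pf Qf se hom_comp[OF c incl]] by (elim bexE) (rule that)
    have eS: "e q \<in> carrier S" if "q \<in> carrier Q" for q
      using hom_closed[OF e(1) that] by (simp add: restrict_scalars_simps regular_rmod_simps)
    have cS: "c p \<in> S'" if "p \<in> carrier P" for p
      using hom_closed[OF c that] by (simp add: restrict_scalars_simps regular_rmod_simps)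
    have act: "(\<lambda>s. x \<star>\<^bsub>X\<^esub> s) \<in> rmod_hom R ?W ?X" if "x \<in> carrier X" for x
      by (rule rmod_homI) (use that in \<open>auto simp: restrict_scalars_simps regular_rmod_simps \<phi>_closed X.ract_closed X.ract_add_right X.ract_assoc\<close>)
    \<comment> \<open>So far \<open>e\<close> is only known to take values in S. The products of x
      with these values extend p to x c(p) from P to Q inside \<open>X\<close>; by uniqueness they
      equal the extension \<open>d\<close> with values in the local module \<open>U\<close>. Hence e
      q preserves \<open>U\<close>.\<close>
    have "x \<star>\<^bsub>X\<^esub> e q \<in> U" if x: "x \<in> U" and q: "q \<in> carrier Q" for x q
    proof -
      have xe: "(\<lambda>q. x \<star>\<^bsub>X\<^esub> e q) \<in> rmod_hom R Q ?X" by (rule hom_comp[OF e(1) act[OF Uc[OF x]]])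
      have xc: "(\<lambda>p. x \<star>\<^bsub>X\<^esub> c p) \<in> rmod_hom R P (sub ?X U)"
        by (rule hom_sub_cod[OF hom_comp[OF hom_comp[OF c incl] act[OF Uc[OF x]]]]) (use cS x in \<open>auto simp: S'_def\<close>)
      obtain d where d: "d \<in> rmod_hom R Q (sub ?X U)" "\<forall>p\<in>carrier P. d (f p) = x \<star>\<^bsub>X\<^esub> c p"
        using local_module_extend[OF loc A Pf Qf se xc] by (elim bexE) (rule that)
      have "x \<star>\<^bsub>X\<^esub> e q = d q"
        by (rule torsion_free_extension_unique[OF tf Qq xe hom_sub_incl[OF d(1) rsubmoduleD(1)[OF U]] _ q])
          (use e(2) d(2) in auto)
      then show ?thesis using hom_closed[OF d(1) q] by simp
    qed
    then have "e q \<in> S'" if "q \<in> carrier Q" for q using eS[OF that] that by (simp add: S'_def)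
    then have "e \<in> rmod_hom R Q ?W'"
      by (intro rmod_homI) (use hom_add[OF e(1)] hom_act[OF e(1)] in \<open>simp_all add: restrict_scalars_simps regular_rmod_simps\<close>)
    with e(2) show "\<exists>e\<in>rmod_hom R Q ?W'. \<forall>p\<in>carrier P. e (f p) = c p" by (rule bexI)
  qed
  then have "carrier S \<subseteq> S'"
    by (intro localisation_generated[OF uni S' _ im]) (auto simp: S'_def)
  then show ?thesis using s x by (auto simp: S'_def)
qed

text \<open>Injectivity of M to M \<otimes> S makes \<open>M\<close> torsion-free, so a hull exists
  and the layers inside M \<otimes> S are available. Their union is local, hence stable under S; it
  contains every x \<otimes> 1 and therefore all of M \<otimes> S.\<close>

lemma canonical_union:
  fixes M :: "('r, 'm, 'z) rmod_scheme"
  assumes uni: "universal_localisation R E S \<phi>" and M: "right_module R M"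
    and small: "carrier M \<lesssim> (UNIV :: (nat \<Rightarrow> 'r) set)" and inj: "inj_on (\<lambda>x. pure M x \<one>\<^bsub>S\<^esub>) (carrier M)"
  shows "\<exists>\<F>. directed_union \<F> (carrier (ten M)) \<and>
    (\<forall>N\<in>\<F>. rsubmodule R (restrict_scalars \<phi> (ten M)) N \<and> (\<lambda>x. pure M x \<one>\<^bsub>S\<^esub>) ` carrier M \<subseteq> N \<and>
      quot_in R E (sub (restrict_scalars \<phi> (ten M)) N) ((\<lambda>x. pure M x \<one>\<^bsub>S\<^esub>) ` carrier M))"
proof -
  interpret S: ring S by (rule S)
  let ?X = "restrict_scalars \<phi> (ten M)" and ?\<iota> = "\<lambda>x. pure M x \<one>\<^bsub>S\<^esub>"
  have inv: "inverts R E S \<phi>" using uni by (simp add: universal_localisation_def)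
  note Xl = inverts_local[OF inv ten_module[OF M]] and \<iota> = canonical_hom[OF M]
  note Xm = torsion_free_module[OF local_module_torsion_free[OF Xl]]
  interpret X: right_module R ?X by (rule Xm)
  have tf: "torsion_free R E M"
    by (rule torsion_free_embed[OF local_module_torsion_free[OF Xl] M \<iota>])
      (use inj in \<open>unfold hom_inj_iff[OF M Xm \<iota>], blast\<close>)
  obtain L :: "('r, nat \<Rightarrow> 'r) rmod" and \<kappa> where h: "hull_of M L \<kappa>" using hull_exists[OF tf small] by blast
  have L: "local_module R E L" and \<kappa>: "\<kappa> \<in> rmod_hom R M L" using h by (auto simp: hull_of_def)
  obtain \<Theta> where \<Theta>: "\<Theta> \<in> rmod_hom R ?X L" "\<forall>x\<in>carrier M. \<Theta> (?\<iota> x) = \<kappa> x"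
    using canonical_lift[OF uni M L \<kappa>] by (elim bexE) (rule that)
  interpret H: hull_map R E ?X M ?\<iota> L \<kappa> \<Theta>
    by (intro hull_map.intro hull_map_axioms.intro hereditary_placed_axioms Xl M \<iota> inj h \<Theta>(1)) (use \<Theta>(2) in simp)
  let ?U = "\<Union>H.layers"
  note U = H.rsubmodule_union
  have pU: "pure M x s \<in> ?U" if x: "x \<in> carrier M" and s: "s \<in> carrier S" for x s
  proof -
    have "?\<iota> x \<in> ?U" using H.base_layer imageI[OF x] by (rule UnionI)
    then have "?\<iota> x \<star>\<^bsub>ten M\<^esub> s \<in> ?U"
      using s by (rule local_submodule_stable[OF uni ten_module[OF M] U H.local_union])
    then show ?thesis using s by (simp add: ract_pure[OF M])
  qed
  have "carrier (ten M) \<subseteq> ?U"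
  proof
    fix Z assume Z: "Z \<in> carrier (ten M)"
    note r = X.rquot_facts[OF U]
    interpret Q: right_module R "rquot ?X ?U" by (rule r(1))
    \<comment> \<open>Membership in \<open>?U\<close> is rephrased as vanishing in the quotient, so
      that it only has to be checked on pure tensors.\<close>
    have "a_r_coset ?X ?U Z = \<zero>\<^bsub>rquot ?X ?U\<^esub>"
    proof (rule additive_eq_on_pure[OF M Q.M.abelian_group_axioms _ _ _ Z])
      show "additive_map (ten M) (rquot ?X ?U) (a_r_coset ?X ?U)"
        using hom_closed[OF r(2)] hom_add[OF r(2)] by (simp add: additive_map_def restrict_scalars_simps)
      show "additive_map (ten M) (rquot ?X ?U) (\<lambda>_. \<zero>\<^bsub>rquot ?X ?U\<^esub>)" by (simp add: additive_map_def)
      show "a_r_coset ?X ?U (pure M x s) = \<zero>\<^bsub>rquot ?X ?U\<^esub>" if "x \<in> carrier M" "s \<in> carrier S" for x s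
        using r(4)[of "pure M x s"] pU[OF that] pure_closed[OF that] by (simp add: restrict_scalars_simps)
    qed
    then show "Z \<in> ?U" using r(4)[of Z] Z by (simp add: restrict_scalars_simps)
  qed
  moreover have "?U \<subseteq> carrier (ten M)" using rsubmoduleD(1)[OF U] by (simp add: restrict_scalars_simps)
  ultimately have "?U = carrier (ten M)" by (rule equalityI[rotated])
  moreover have "H.layers \<noteq> {}" using H.base_layer by auto
  ultimately have "directed_union H.layers (carrier (ten M))"
    unfolding directed_union_def using H.layers_directed by blast
  then show ?thesis using H.layersD by blast
qed

end

theorem theorem2p6:
  fixes R :: "('r, 'k) ring_scheme"
    and E :: "('r, 'r univ) rmod set"
    and S :: "('s, 'l) ring_scheme"
    and \<phi> :: "'r \<Rightarrow> 's"
    and M :: "('r, 'm, 'z) rmod_scheme"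
  defines "MS \<equiv> restrict_scalars \<phi> (tensor R M S \<phi>)"
    and "\<iota> \<equiv> canonical_map R M S \<phi>"
  assumes "hereditary_ring R"
    and "well_placed R E"
    and "\<And>A. A \<in> E \<Longrightarrow> carrier A \<noteq> {\<zero>\<^bsub>A\<^esub>} \<Longrightarrow> hom_dim_one R A"
    and "universal_localisation R E S \<phi>"
    and "fin_presented R M"
  shows "fin_gen R M (a_kernel M MS \<iota>) \<and>
    (inj_on \<iota> (carrier M) \<longrightarrow>
      (\<exists>\<F>. directed_union \<F> (carrier MS) \<and>
        (\<forall>N\<in>\<F>. rsubmodule R MS N \<and> \<iota> ` carrier M \<subseteq> N \<and>
          belongs_to R E (rquot (MS\<lparr>carrier := N\<rparr>) (\<iota> ` carrier M)))))"
proof -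
  have R: "right_hereditary R" using assms(3) by (simp add: hereditary_ring_def)
  interpret H: hereditary_placed R E
    by (intro hereditary_placed.intro hereditary_placed_axioms.intro assms(4,5) R)
  interpret L: placed_scalars R E S \<phi>
    using assms(6) by (intro placed_scalars.intro scalars.intro H.hereditary_placed_axioms H.base_ring)
      (simp_all add: universal_localisation_def)
  have M: "right_module R M" using assms(7) by (simp add: fin_presented_def)
  \<comment> \<open>Finite presentation bounds the size of \<open>M\<close>, whatever its element
    type; the construction of hulls depends on this bound.\<close>
  note small = fin_presented_lepoll[OF assms(7)]
  have \<iota>: "\<iota> = (\<lambda>x. L.pure M x \<one>\<^bsub>S\<^esub>)" by (simp add: fun_eq_iff \<iota>_def L.canonical_map_eq)
  have "a_kernel M MS \<iota> = torsion_part R E M"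
    using L.canonical_kernel[OF assms(6) M small] by (simp add: a_kernel_eq \<iota> MS_def restrict_scalars_simps)
  then have "fin_gen R M (a_kernel M MS \<iota>)" using H.fin_gen_torsion_part[OF assms(7)] by simp
  moreover have "\<exists>\<F>. directed_union \<F> (carrier MS) \<and>
        (\<forall>N\<in>\<F>. rsubmodule R MS N \<and> \<iota> ` carrier M \<subseteq> N \<and>
          belongs_to R E (rquot (MS\<lparr>carrier := N\<rparr>) (\<iota> ` carrier M)))" if inj: "inj_on \<iota> (carrier M)"
  proof -
    have MS: "carrier MS = carrier (L.ten M)" by (simp add: MS_def restrict_scalars_simps)
    obtain \<F> where \<F>: "directed_union \<F> (carrier MS)"
      "\<forall>N\<in>\<F>. rsubmodule R MS N \<and> \<iota> ` carrier M \<subseteq> N \<and> quot_in R E (sub MS N) (\<iota> ` carrier M)"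
      using L.canonical_union[OF assms(6) M small inj[unfolded \<iota>], folded MS_def \<iota> MS] by (elim exE conjE) (rule that)
    then show ?thesis using H.quot_in_belongs_to by blast
  qed
  ultimately show ?thesis by blast
qed

end
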